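(* Let $K/K_0$ be a PAC extension. Then $K^{\mathrm{ab}}=K_0^{\mathrm{ab}}K$.
   Context: A field extension $K/K_0$ (not necessarily algebraic) is called a PAC extension if for every absolutely irreducible variety $V$ of dimension $r\geq 1$ defined over $K$ and every separable dominating rational map $\nu\colon V\to\mathbb{A}^r$ defined over $K$ there exists $a\in V(K)$ for which $\nu(a)\in K_0^r$. $K^{\mathrm{ab}}$ denotes the maximal abelian (Galois) extension of $K$; the separable closure of $K_0$ is taken inside the separable closure of $K$. *)

theory Defs
  imports
    "HOL-Algebra.Algebraic_Closure_Type"
    "HOL-Algebra.Generated_Fields"
    "HOL-Library.Poly_Mapping"
    "HOL-Library.FuncSet"
begin

text \<open>
  All fields under consideration are subsets of one algebraically closed field, the type
  \<open>'a::alg_closed_field\<close>, viewed as a ring of HOL-Algebra so that its notions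
  (\<open>subfield\<close>, \<open>generate_field\<close>, \<open>ring_iso\<close>, \<open>ideal\<close>) apply.
  In particular separable closures and abelian extensions of subfields live inside this type.
\<close>

abbreviation ambient :: "'a::alg_closed_field ring" where
  "ambient \<equiv> ring_of_type_algebra"

definition adjoin :: "'a::alg_closed_field set \<Rightarrow> 'a set \<Rightarrow> 'a set" where
  "adjoin K S = generate_field ambient (K \<union> S)"

subsection \<open>Algebraic, separable and Galois extensions\<close>

definition polys_over :: "'a::alg_closed_field set \<Rightarrow> 'a poly set" where
  "polys_over K = {f. \<forall>i. poly.coeff f i \<in> K}"

definition irreducible_over :: "'a::alg_closed_field set \<Rightarrow> 'a poly \<Rightarrow> bool" where
  "irreducible_over K f \<longleftrightarrow> f \<in> polys_over K \<and> degree f > 0 \<and>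
     (\<forall>g\<in>polys_over K. \<forall>h\<in>polys_over K. f = g * h \<longrightarrow> degree g = 0 \<or> degree h = 0)"

definition algebraic_ext :: "'a::alg_closed_field set \<Rightarrow> 'a set \<Rightarrow> bool" where
  "algebraic_ext K L \<longleftrightarrow> (\<forall>x\<in>L. \<exists>f\<in>polys_over K. f \<noteq> 0 \<and> poly f x = 0)"

text \<open>
  An irreducible polynomial is separable if it has no multiple root in the algebraically closed
  field \<open>'a\<close>, which is what \<open>rsquarefree\<close> says.
\<close>

definition separable_algebraic_ext :: "'a::alg_closed_field set \<Rightarrow> 'a set \<Rightarrow> bool" where
  "separable_algebraic_ext K L \<longleftrightarrow>
     (\<forall>x\<in>L. \<exists>f. irreducible_over K f \<and> poly f x = 0 \<and> rsquarefree f)"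

text \<open>A polynomial splits in \<open>L\<close> iff all its roots in \<open>'a\<close> lie in \<open>L\<close>.\<close>

definition normal_ext :: "'a::alg_closed_field set \<Rightarrow> 'a set \<Rightarrow> bool" where
  "normal_ext K L \<longleftrightarrow> algebraic_ext K L \<and>
     (\<forall>f. irreducible_over K f \<and> (\<exists>x\<in>L. poly f x = 0) \<longrightarrow> (\<forall>x. poly f x = 0 \<longrightarrow> x \<in> L))"

definition galois_ext :: "'a::alg_closed_field set \<Rightarrow> 'a set \<Rightarrow> bool" where
  "galois_ext K L \<longleftrightarrow> subfield K ambient \<and> subfield L ambient \<and> K \<subseteq> L \<and>
     separable_algebraic_ext K L \<and> normal_ext K L"

text \<open>Automorphisms are total functions here; only their values on \<open>L\<close> are meaningful.\<close>

definition galois_group :: "'a::alg_closed_field set \<Rightarrow> 'a set \<Rightarrow> ('a \<Rightarrow> 'a) set" where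
  "galois_group K L =
     {\<sigma> \<in> ring_iso (ambient\<lparr>carrier := L\<rparr>) (ambient\<lparr>carrier := L\<rparr>). \<forall>x\<in>K. \<sigma> x = x}"

definition abelian_ext :: "'a::alg_closed_field set \<Rightarrow> 'a set \<Rightarrow> bool" where
  "abelian_ext K L \<longleftrightarrow> galois_ext K L \<and>
     (\<forall>\<sigma>\<in>galois_group K L. \<forall>\<tau>\<in>galois_group K L. \<forall>x\<in>L. \<sigma> (\<tau> x) = \<tau> (\<sigma> x))"

definition max_abelian_ext :: "'a::alg_closed_field set \<Rightarrow> 'a set" where
  "max_abelian_ext K = adjoin K (\<Union>{L. abelian_ext K L})"

subsection \<open>Polynomials in several variables\<close>

text \<open>
  The polynomial ring in the variables \<open>X\<^sub>0, X\<^sub>1, \<dots>\<close>; a monomial is a finitely supported exponent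
  function. \<open>mpolys n A\<close> consists of the polynomials in \<open>X\<^sub>0, \<dots>, X\<^bsub>n-1\<^esub>\<close> with coefficients in \<open>A\<close>
  (where \<open>0 \<in> A\<close>).
\<close>

type_synonym 'a mpoly = "(nat \<Rightarrow>\<^sub>0 nat) \<Rightarrow>\<^sub>0 'a"

definition mpolys :: "nat \<Rightarrow> 'a::zero set \<Rightarrow> 'a mpoly set" where
  "mpolys n A =
     {p. (\<forall>m. Poly_Mapping.lookup p m \<in> A) \<and>
         (\<forall>m\<in>Poly_Mapping.keys p. Poly_Mapping.keys m \<subseteq> {..<n})}"

definition meval :: "'a::comm_semiring_1 mpoly \<Rightarrow> (nat \<Rightarrow> 'a) \<Rightarrow> 'a" where
  "meval p x =
     (\<Sum>m\<in>Poly_Mapping.keys p.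
        Poly_Mapping.lookup p m * (\<Prod>i\<in>Poly_Mapping.keys m. x i ^ Poly_Mapping.lookup m i))"

subsection \<open>Transcendence degree\<close>

definition alg_independent :: "'a::alg_closed_field set \<Rightarrow> nat \<Rightarrow> (nat \<Rightarrow> 'a) \<Rightarrow> bool" where
  "alg_independent K r t \<longleftrightarrow> (\<forall>p\<in>mpolys r K. meval p t = 0 \<longrightarrow> p = 0)"

definition has_trdeg :: "'a::alg_closed_field set \<Rightarrow> 'a set \<Rightarrow> nat \<Rightarrow> bool" where
  "has_trdeg K F r \<longleftrightarrow>
     (\<exists>t. t ` {..<r} \<subseteq> F \<and> alg_independent K r t \<and> algebraic_ext (adjoin K (t ` {..<r})) F)"

text \<open>
  The ambient algebraically closed field has infinite transcendence degree over \<open>K\<close>, i.e. it is a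
  universal domain over \<open>K\<close> in the sense of Weil. This is only a choice of an ambient field: every
  field extension embeds into one of this kind (the algebraic closure of the field of rational
  functions over \<open>K\<close> in infinitely many variables). It guarantees that varieties over \<open>K\<close> have
  generic points.
\<close>

definition universal_domain_over :: "'a::alg_closed_field set \<Rightarrow> bool" where
  "universal_domain_over K \<longleftrightarrow> (\<forall>r. \<exists>t. alg_independent K r t)"

subsection \<open>Affine varieties\<close>

definition affine_space :: "nat \<Rightarrow> 'a set \<Rightarrow> (nat \<Rightarrow> 'a) set" where
  "affine_space n A = {..<n} \<rightarrow>\<^sub>E A"

definition zero_locus :: "nat \<Rightarrow> 'a::alg_closed_field mpoly set \<Rightarrow> (nat \<Rightarrow> 'a) set" where
  "zero_locus n S = {x \<in> affine_space n UNIV. \<forall>p\<in>S. meval p x = 0}"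

definition vanishing_ideal :: "nat \<Rightarrow> (nat \<Rightarrow> 'a::alg_closed_field) set \<Rightarrow> 'a mpoly set" where
  "vanishing_ideal n V = {p \<in> mpolys n UNIV. \<forall>x\<in>V. meval p x = 0}"

definition zariski_closed :: "nat \<Rightarrow> (nat \<Rightarrow> 'a::alg_closed_field) set \<Rightarrow> bool" where
  "zariski_closed n V \<longleftrightarrow> (\<exists>S\<subseteq>mpolys n UNIV. V = zero_locus n S)"

definition zariski_dense :: "nat \<Rightarrow> (nat \<Rightarrow> 'a::alg_closed_field) set \<Rightarrow> bool" where
  "zariski_dense n S \<longleftrightarrow> S \<subseteq> affine_space n UNIV \<and>
     (\<forall>Z. zariski_closed n Z \<and> S \<subseteq> Z \<longrightarrow> Z = affine_space n UNIV)"

text \<open>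
  Irreducibility is meant in the Zariski topology over the algebraically closed field \<open>'a\<close>, hence
  is absolute irreducibility.
\<close>

definition abs_irreducible :: "nat \<Rightarrow> (nat \<Rightarrow> 'a::alg_closed_field) set \<Rightarrow> bool" where
  "abs_irreducible n V \<longleftrightarrow> V \<noteq> {} \<and>
     (\<forall>A B. zariski_closed n A \<and> zariski_closed n B \<and> V = A \<union> B \<longrightarrow> V = A \<or> V = B)"

text \<open>
  \<open>V\<close> is defined over \<open>K\<close> if its ideal over \<open>'a\<close> is generated by polynomials over \<open>K\<close>. For
  imperfect \<open>K\<close> this is stronger than being the zero locus of polynomials over \<open>K\<close>.
\<close>

definition defined_over ::
  "'a::alg_closed_field set \<Rightarrow> nat \<Rightarrow> (nat \<Rightarrow> 'a) set \<Rightarrow> bool" where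
  "defined_over K n V \<longleftrightarrow>
     vanishing_ideal n V =
       genideal (ring_of_type_algebra\<lparr>carrier := mpolys n UNIV\<rparr>)
         (vanishing_ideal n V \<inter> mpolys n K)"

definition abs_irreducible_variety ::
  "'a::alg_closed_field set \<Rightarrow> nat \<Rightarrow> (nat \<Rightarrow> 'a) set \<Rightarrow> bool" where
  "abs_irreducible_variety K n V \<longleftrightarrow>
     zariski_closed n V \<and> abs_irreducible n V \<and> defined_over K n V"

text \<open>
  The function field \<open>K(V)\<close> is realised as \<open>K(x)\<close> for a generic point \<open>x\<close> of \<open>V\<close> over \<open>K\<close>, i.e.
  for a point \<open>x\<close> of \<open>V\<close> that specialises to all points of \<open>V\<close>. Different generic points give
  \<open>K\<close>-isomorphic fields.
\<close>

definition generic_point ::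
  "'a::alg_closed_field set \<Rightarrow> nat \<Rightarrow> (nat \<Rightarrow> 'a) set \<Rightarrow> (nat \<Rightarrow> 'a) \<Rightarrow> bool" where
  "generic_point K n V x \<longleftrightarrow> x \<in> V \<and>
     (\<forall>p\<in>mpolys n K. meval p x = 0 \<longrightarrow> (\<forall>y\<in>V. meval p y = 0))"

definition function_field ::
  "'a::alg_closed_field set \<Rightarrow> nat \<Rightarrow> (nat \<Rightarrow> 'a) \<Rightarrow> 'a set" where
  "function_field K n x = adjoin K (x ` {..<n})"

subsection \<open>Rational maps to affine space\<close>

text \<open>
  Let \<open>x\<close> be a generic point of \<open>V\<close> over \<open>K\<close>. A rational map from \<open>V\<close> to affine \<open>r\<close>-space defined
  over \<open>K\<close> is an \<open>r\<close>-tuple \<open>\<nu>\<close> of elements of \<open>K(x)\<close>. It is defined at the point \<open>a\<close> of \<open>V\<close>, with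
  value \<open>b\<close>, if each \<open>\<nu> i\<close> can be written as \<open>p(x)/q(x)\<close> with \<open>q(a) \<noteq> 0\<close> and then
  \<open>b i = p(a)/q(a)\<close>. Note that \<open>q(a) \<noteq> 0\<close> entails \<open>q(x) \<noteq> 0\<close>.
\<close>

definition rational_map_value ::
  "'a::alg_closed_field set \<Rightarrow> nat \<Rightarrow> nat \<Rightarrow> (nat \<Rightarrow> 'a) \<Rightarrow> (nat \<Rightarrow> 'a) \<Rightarrow>
     (nat \<Rightarrow> 'a) \<Rightarrow> (nat \<Rightarrow> 'a) \<Rightarrow> bool" where
  "rational_map_value K n r x \<nu> a b \<longleftrightarrow>
     (\<forall>i<r. \<exists>p\<in>mpolys n K. \<exists>q\<in>mpolys n K.
        meval q a \<noteq> 0 \<and> \<nu> i = meval p x / meval q x \<and> b i = meval p a / meval q a)"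

definition dominating ::
  "'a::alg_closed_field set \<Rightarrow> nat \<Rightarrow> nat \<Rightarrow> (nat \<Rightarrow> 'a) set \<Rightarrow> (nat \<Rightarrow> 'a) \<Rightarrow>
     (nat \<Rightarrow> 'a) \<Rightarrow> bool" where
  "dominating K n r V x \<nu> \<longleftrightarrow>
     zariski_dense r {b \<in> affine_space r UNIV. \<exists>a\<in>V. rational_map_value K n r x \<nu> a b}"

text \<open>
  A dominating rational map \<open>\<nu>\<close> is separable if \<open>K(V)/K(\<nu>)\<close> is a separable extension. It is only
  used when \<open>V\<close> has dimension \<open>r\<close>; then \<open>K(V)/K(\<nu>)\<close> is algebraic, and separability has its
  algebraic meaning.
\<close>

definition separable_map ::
  "'a::alg_closed_field set \<Rightarrow> nat \<Rightarrow> nat \<Rightarrow> (nat \<Rightarrow> 'a) \<Rightarrow> (nat \<Rightarrow> 'a) \<Rightarrow> bool" where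
  "separable_map K n r x \<nu> \<longleftrightarrow>
     separable_algebraic_ext (adjoin K (\<nu> ` {..<r})) (function_field K n x)"

subsection \<open>PAC extensions\<close>

text \<open>
  The dimension of \<open>V\<close> is the transcendence degree of \<open>K(V)\<close> over \<open>K\<close>. The definition is meaningful
  if the ambient field is a universal domain over \<open>K\<close>, so that every \<open>V\<close> has a generic point.
\<close>

definition PAC_extension :: "'a::alg_closed_field set \<Rightarrow> 'a set \<Rightarrow> bool" where
  "PAC_extension K0 K \<longleftrightarrow>
     subfield K0 ambient \<and> subfield K ambient \<and> K0 \<subseteq> K \<and>
     (\<forall>n r V x \<nu>.
        r \<ge> 1 \<and>
        abs_irreducible_variety K n V \<and>
        generic_point K n V x \<and>
        has_trdeg K (function_field K n x) r \<and>
        \<nu> \<in> affine_space r (function_field K n x) \<and>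
        dominating K n r V x \<nu> \<and>
        separable_map K n r x \<nu>
        \<longrightarrow> (\<exists>a \<in> V \<inter> affine_space n K. \<exists>b \<in> affine_space r K0.
              rational_map_value K n r x \<nu> a b))"

end

theory Submission
  imports Defs Complex_Main "HOL-Number_Theory.Cong"
begin

text \<open>
  Decomposing an abelian extension of \<open>K\<close>, it suffices to treat an element \<open>\<theta>\<close> whose conjugates over
  \<open>K\<close> are permuted cyclically by some \<open>\<sigma>\<close>, with \<open>l\<^sup>a\<close> a period, \<open>l\<close> prime. There is a generic family of
  abelian extensions with enough cyclic ones of degree \<open>l\<^sup>a\<close>: a separable cover of affine \<open>r\<close>-space over
  the prime field whose total space is rational. Twisting it by \<open>K(\<theta>)\<close> gives a variety over \<open>K\<close>
  which still covers affine \<open>r\<close>-space. A \<open>K\<close>-point of the twist over a point of \<open>K0\<^sup>r\<close>, provided by the PAC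
  property, says that \<open>\<theta>\<close> lies in the compositum of \<open>K\<close> and the specialized extension, which is abelian
  over \<open>K0\<close>.

  If \<open>l\<close> is the characteristic \<open>p\<close>, the cover is the Lang map \<open>y \<mapsto> frob(y) / y\<close> on truncated
  power series with constant term 1. Otherwise it adjoins an \<open>n\<close>-th root of
  \<open>\<Prod> b\<^sub>k\<^bsup>e(k)\<^esup>\<close>, where \<open>n = l\<^sup>a\<close>, \<open>k e(k) \<equiv> 1\<close> modulo \<open>n\<close>, and \<open>b\<^sub>k\<close> are the conjugates of a generic element
  of the algebra generated by an \<open>n\<close>-th root of unity.
\<close>

subsection \<open>Subfields\<close>

text \<open>The theorem asks only for abelian extensions, so the specialized field may be
  \<open>K0(\<zeta>, z)\<close> with a radical \<open>z\<close>. It is abelian because the exponents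
  \<open>e(k)\<close>, inverse to \<open>k\<close>, make \<open>\<zeta> \<mapsto> \<zeta>^d\<close>
  act on the radicand as the \<open>d\<close>-th power up to \<open>n\<close>-th powers. Rationality
  of the total space is what makes the PAC property applicable: over a Galois extension of
  \<open>K\<close> the twist is again parametrized by an open part of affine space, hence absolutely
  irreducible, and its conjugates differ by a change of parameters, so its equations descend to
  \<open>K\<close>. In characteristic \<open>p\<close> truncated power series replace Witt vectors:
  with constant term 1 over the prime field they form an abelian group, in which
  \<open>1 + T\<close> has any prescribed power of \<open>p\<close> as order for a suitable
  truncation.\<close>

definition is_subfield :: "'a::field set \<Rightarrow> bool" where
  "is_subfield F \<longleftrightarrow> 0 \<in> F \<and> 1 \<in> F \<and> (\<forall>x\<in>F. \<forall>y\<in>F. x + y \<in> F \<and> x * y \<in> F) \<and>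
     (\<forall>x\<in>F. - x \<in> F \<and> inverse x \<in> F)"

lemma is_subfieldI:
  assumes "1 \<in> F" "\<And>x y. x \<in> F \<Longrightarrow> y \<in> F \<Longrightarrow> x + y \<in> F"
    "\<And>x y. x \<in> F \<Longrightarrow> y \<in> F \<Longrightarrow> x * y \<in> F" "\<And>x. x \<in> F \<Longrightarrow> - x \<in> F"
    "\<And>x. x \<in> F \<Longrightarrow> x \<noteq> 0 \<Longrightarrow> inverse x \<in> F"
  shows "is_subfield F"
proof -
  have "1 + - 1 \<in> F" using assms by blast
  then have "0 \<in> F" by simp
  then show ?thesis unfolding is_subfield_def using assms
    by (metis inverse_zero)
qed

context
  fixes F :: "'a::field set"
  assumes F: "is_subfield F"
begin

lemma sf_0 [simp]: "0 \<in> F" and sf_1 [simp]: "1 \<in> F"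
  using F by (auto simp: is_subfield_def)

lemma sf_add: "x \<in> F \<Longrightarrow> y \<in> F \<Longrightarrow> x + y \<in> F"
  and sf_mult: "x \<in> F \<Longrightarrow> y \<in> F \<Longrightarrow> x * y \<in> F"
  and sf_uminus: "x \<in> F \<Longrightarrow> - x \<in> F"
  and sf_inverse: "x \<in> F \<Longrightarrow> inverse x \<in> F"
  using F by (auto simp: is_subfield_def)

lemma sf_diff: "x \<in> F \<Longrightarrow> y \<in> F \<Longrightarrow> x - y \<in> F"
  using sf_add[of x "- y"] sf_uminus by simp

lemma sf_divide: "x \<in> F \<Longrightarrow> y \<in> F \<Longrightarrow> x / y \<in> F"
  by (simp add: divide_inverse sf_mult sf_inverse)

lemma sf_power: "x \<in> F \<Longrightarrow> x ^ n \<in> F"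
  by (induction n) (auto intro: sf_mult)

lemma sf_sum: "(\<And>i. i \<in> I \<Longrightarrow> f i \<in> F) \<Longrightarrow> sum f I \<in> F"
  by (induction I rule: infinite_finite_induct) (auto intro: sf_add)

lemma sf_prod: "(\<And>i. i \<in> I \<Longrightarrow> f i \<in> F) \<Longrightarrow> prod f I \<in> F"
  by (induction I rule: infinite_finite_induct) (auto intro: sf_mult)

lemma sf_of_nat: "of_nat n \<in> F"
  by (induction n) (auto intro: sf_add)

end

lemmas sf_intros = sf_0 sf_1 sf_add sf_mult sf_uminus sf_inverse sf_diff sf_divide sf_power sf_sum
  sf_prod sf_of_nat

lemma is_subfield_Int: "is_subfield F \<Longrightarrow> is_subfield G \<Longrightarrow> is_subfield (F \<inter> G)"
  by (intro is_subfieldI) (simp_all add: sf_intros)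

lemma ambient_simps [simp]:
  "carrier (ambient :: 'a::alg_closed_field ring) = UNIV"
  "monoid.mult (ambient :: 'a ring) x y = x * y"
  "ring.add (ambient :: 'a ring) x y = x + y"
  "monoid.one (ambient :: 'a ring) = 1"
  "ring.zero (ambient :: 'a ring) = 0"
  by (simp_all add: ring_of_type_algebra_def)

lemma field_ambient: "field (ambient :: 'a::alg_closed_field ring)"
  by rule

lemma ambient_a_inv [simp]: "a_inv (ambient :: 'a::alg_closed_field ring) x = - x"
proof -
  interpret field "ambient :: 'a ring" by (rule field_ambient)
  show ?thesis by (rule minus_equality) auto
qed

lemma ambient_m_inv [simp]:
  "x \<noteq> 0 \<Longrightarrow> m_inv (ambient :: 'a::alg_closed_field ring) x = inverse x"
proof -
  assume "x \<noteq> 0"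
  interpret field "ambient :: 'a ring" by (rule field_ambient)
  show ?thesis by (rule comm_inv_char) (use \<open>x \<noteq> 0\<close> in auto)
qed

lemma subfield_ambient_iff: "subfield F ambient \<longleftrightarrow> is_subfield (F :: 'a::alg_closed_field set)"
proof
  interpret field "ambient :: 'a ring" by (rule field_ambient)
  {
    assume "subfield F ambient"
    note sr = subfieldE(1)[OF this] and F = this
    show "is_subfield F"
    proof (rule is_subfieldI)
      fix x assume "x \<in> F" "x \<noteq> 0"
      then have "m_inv ambient x \<in> F" using subfield_m_inv(1)[OF F, of x] by auto
      then show "inverse x \<in> F" using \<open>x \<noteq> 0\<close> by simp
    qed (use subringE[OF sr] in auto)
  }
  assume "is_subfield F"
  then show "subfield F ambient"
    by (intro subfieldI' subringI) (auto intro: sf_intros)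
qed

lemma
  fixes K S :: "'a::alg_closed_field set"
  shows is_subfield_adjoin [simp]: "is_subfield (adjoin K S)"
    and adjoin_base: "K \<subseteq> adjoin K S"
    and adjoin_gen: "S \<subseteq> adjoin K S"
proof -
  interpret field "ambient :: 'a ring" by (rule field_ambient)
  show "is_subfield (adjoin K S)" unfolding adjoin_def
    by (subst subfield_ambient_iff[symmetric], rule generate_field_is_subfield) auto
  show "K \<subseteq> adjoin K S" "S \<subseteq> adjoin K S" unfolding adjoin_def by (auto intro: generate_field.incl)
qed

lemma adjoin_minimal:
  fixes E :: "'a::alg_closed_field set"
  assumes "is_subfield E" "K \<subseteq> E" "S \<subseteq> E"
  shows "adjoin K S \<subseteq> E"
proof -
  interpret field "ambient :: 'a ring" by (rule field_ambient)
  show ?thesis unfolding adjoin_def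
    using assms by (intro generate_field_min_subfield1) (simp_all only: subfield_ambient_iff ambient_simps Un_subset_iff subset_UNIV simp_thms)
qed

lemma adjoin_mono: "K \<subseteq> K' \<Longrightarrow> S \<subseteq> S' \<Longrightarrow> adjoin K S \<subseteq> adjoin K' S'"
  using adjoin_base[of K' S'] adjoin_gen[of S' K'] by (intro adjoin_minimal) auto

lemma adjoin_insert: "adjoin K (insert s S) = adjoin (adjoin K S) {s}"
proof
  show "adjoin K (insert s S) \<subseteq> adjoin (adjoin K S) {s}"
    using adjoin_base[of K S] adjoin_gen[of S K] adjoin_base[of "adjoin K S" "{s}"] adjoin_gen[of "{s}" "adjoin K S"]
    by (intro adjoin_minimal) auto
  show "adjoin (adjoin K S) {s} \<subseteq> adjoin K (insert s S)"
    using adjoin_base[of K "insert s S"] adjoin_gen[of "insert s S" K]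
    by (intro adjoin_minimal is_subfield_adjoin) auto
qed

lemma adjoin_empty: "is_subfield K \<Longrightarrow> adjoin K {} = K"
  using adjoin_minimal[of K K "{}"] adjoin_base[of K "{}"] by auto

subsection \<open>Polynomials over a subfield\<close>

context
  fixes F :: "'a::alg_closed_field set"
  assumes F: "is_subfield F"
begin

lemma polys_over_0 [simp]: "0 \<in> polys_over F" and polys_over_1 [simp]: "1 \<in> polys_over F"
  using F by (auto simp: polys_over_def intro: sf_intros)

lemma polys_over_pCons: "a \<in> F \<Longrightarrow> p \<in> polys_over F \<Longrightarrow> pCons a p \<in> polys_over F"
  by (auto simp: polys_over_def coeff_pCons split: nat.splits)

lemma polys_over_monom: "a \<in> F \<Longrightarrow> Polynomial.monom a n \<in> polys_over F"
  using F by (auto simp: polys_over_def intro: sf_intros)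

lemma polys_over_add: "p \<in> polys_over F \<Longrightarrow> q \<in> polys_over F \<Longrightarrow> p + q \<in> polys_over F"
  and polys_over_diff: "p \<in> polys_over F \<Longrightarrow> q \<in> polys_over F \<Longrightarrow> p - q \<in> polys_over F"
  and polys_over_uminus: "p \<in> polys_over F \<Longrightarrow> - p \<in> polys_over F"
  and polys_over_smult: "a \<in> F \<Longrightarrow> p \<in> polys_over F \<Longrightarrow> Polynomial.smult a p \<in> polys_over F"
  and polys_over_mult: "p \<in> polys_over F \<Longrightarrow> q \<in> polys_over F \<Longrightarrow> p * q \<in> polys_over F"
  and polys_over_pderiv: "p \<in> polys_over F \<Longrightarrow> pderiv p \<in> polys_over F"
  using F by (auto simp: polys_over_def coeff_mult coeff_pderiv intro!: sf_intros sf_of_nat[OF F, of "Suc _", simplified])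

lemma polys_over_prod: "(\<And>i. i \<in> I \<Longrightarrow> f i \<in> polys_over F) \<Longrightarrow> prod f I \<in> polys_over F"
  by (induction I rule: infinite_finite_induct) (auto intro: polys_over_mult)

lemma poly_in_subfield: "p \<in> polys_over F \<Longrightarrow> x \<in> F \<Longrightarrow> poly p x \<in> F"
  unfolding poly_altdef using F by (auto simp: polys_over_def intro!: sf_intros)

text \<open>Cancelling leading terms one at a time keeps the coefficients of quotient and remainder
  inside \<open>F\<close>; the minimal polynomials over \<open>F\<close> rest on this.\<close>

lemma division_over:
  assumes "f \<in> polys_over F" "f \<noteq> 0" "g \<in> polys_over F"
  shows "\<exists>q\<in>polys_over F. \<exists>r\<in>polys_over F. g = q * f + r \<and> (r = 0 \<or> Polynomial.degree r < Polynomial.degree f)"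
  using assms(3)
proof (induction "Polynomial.degree g" arbitrary: g rule: less_induct)
  case less
  show ?case
  proof (cases "g = 0 \<or> Polynomial.degree g < Polynomial.degree f")
    case True
    then show ?thesis using less(2) by (intro bexI[of _ 0] bexI[of _ g]) auto
  next
    case False
    define c where "c = Polynomial.lead_coeff g / Polynomial.lead_coeff f"
    define q where "q = Polynomial.monom c (Polynomial.degree g - Polynomial.degree f)"
    have cF: "c \<in> F" using less(2) assms(1) F by (auto simp: c_def polys_over_def intro: sf_intros)
    have q: "q \<in> polys_over F" unfolding q_def by (rule polys_over_monom[OF cF])
    have c0: "c \<noteq> 0" using False assms(2) by (auto simp: c_def)
    have dq: "Polynomial.degree (q * f) = Polynomial.degree g"
      using False c0 assms(2) by (subst degree_mult_eq) (auto simp: q_def degree_monom_eq)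
    have lc: "Polynomial.lead_coeff (q * f) = Polynomial.lead_coeff g"
    proof -
      have "Polynomial.lead_coeff (q * f) = c * Polynomial.lead_coeff f"
        unfolding lead_coeff_mult by (simp add: q_def degree_monom_eq c0)
      then show ?thesis using assms(2) by (simp add: c_def)
    qed
    define g' where "g' = g - q * f"
    have g': "g' \<in> polys_over F" unfolding g'_def
      by (intro polys_over_diff polys_over_mult q assms less)
    have "g' = 0 \<or> Polynomial.degree g' < Polynomial.degree g"
    proof (cases "Polynomial.degree g = 0")
      case True
      then have "Polynomial.degree g' = 0" using dq unfolding g'_def
        by (metis degree_diff_le le_zero_eq order_refl)
      moreover have "poly.coeff g' 0 = 0" unfolding g'_def using lc dq True by simp
      ultimately show ?thesis by (metis leading_coeff_0_iff)
    next
      case False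
      have "Polynomial.degree g' \<le> Polynomial.degree g" unfolding g'_def
        using dq by (simp add: degree_diff_le)
      moreover have "poly.coeff g' (Polynomial.degree g) = 0" unfolding g'_def using lc dq by simp
      ultimately show ?thesis by (metis eq_zero_or_degree_less)
    qed
    then show ?thesis
    proof
      assume "g' = 0"
      then show ?thesis using q by (intro bexI[of _ q] bexI[of _ 0]) (auto simp: g'_def)
    next
      assume "Polynomial.degree g' < Polynomial.degree g"
      from less(1)[OF this g'] obtain q' r where *: "q'\<in>polys_over F" "r\<in>polys_over F" "g' = q' * f + r" "r = 0 \<or> Polynomial.degree r < Polynomial.degree f"
        by blast
      then have "g = (q + q') * f + r" by (simp add: g'_def algebra_simps)
      then show ?thesis using * q polys_over_add by blast
    qed
  qed
qed

end

lemma polys_over_mono: "F \<subseteq> G \<Longrightarrow> polys_over F \<subseteq> polys_over G"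
  by (auto simp: polys_over_def)

text \<open>Stated as generation of the ideal of polynomials over \<open>F\<close> vanishing at
  \<open>x\<close>, the form in which it is used; minimality of the degree follows.\<close>

definition is_minpoly :: "'a::alg_closed_field set \<Rightarrow> 'a \<Rightarrow> 'a poly \<Rightarrow> bool" where
  "is_minpoly F x m \<longleftrightarrow> m \<in> polys_over F \<and> Polynomial.lead_coeff m = 1 \<and> poly m x = 0 \<and>
     (\<forall>g\<in>polys_over F. poly g x = 0 \<longrightarrow> (\<exists>q\<in>polys_over F. g = q * m))"

definition algebraic_over :: "'a::alg_closed_field set \<Rightarrow> 'a \<Rightarrow> bool" where
  "algebraic_over F x \<longleftrightarrow> (\<exists>f\<in>polys_over F. f \<noteq> 0 \<and> poly f x = 0)"

lemma is_minpoly_degree_pos: "is_minpoly F x m \<Longrightarrow> Polynomial.degree m > 0"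
proof (rule ccontr)
  assume m: "is_minpoly F x m" "\<not> Polynomial.degree m > 0"
  then obtain c where "m = [:c:]" by (auto elim: degree_eq_zeroE)
  then show False using m by (auto simp: is_minpoly_def)
qed

lemma is_minpoly_nz: "is_minpoly F x m \<Longrightarrow> m \<noteq> 0"
  by (auto simp: is_minpoly_def)

lemma minpoly_exists:
  assumes F: "is_subfield F" and x: "algebraic_over F x"
  shows "\<exists>m. is_minpoly F x m"
proof -
  let ?P = "\<lambda>f. f \<in> polys_over F \<and> f \<noteq> 0 \<and> poly f x = 0"
  define d where "d = (LEAST d. \<exists>f. ?P f \<and> Polynomial.degree f = d)"
  have "\<exists>f. ?P f \<and> Polynomial.degree f = d"
    unfolding d_def by (rule LeastI_ex) (use x in \<open>auto simp: algebraic_over_def\<close>)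
  then obtain f where f: "?P f" "Polynomial.degree f = d" by blast
  have least: "\<And>g. ?P g \<Longrightarrow> d \<le> Polynomial.degree g" unfolding d_def by (rule Least_le) blast
  define m where "m = Polynomial.smult (inverse (Polynomial.lead_coeff f)) f"
  have mF: "m \<in> polys_over F" unfolding m_def
    by (intro polys_over_smult F sf_inverse) (use f in \<open>auto simp: polys_over_def\<close>)
  have m: "?P m" "Polynomial.degree m = d" "Polynomial.lead_coeff m = 1"
    using f mF by (auto simp: m_def)
  have "\<exists>q\<in>polys_over F. g = q * m" if g: "g \<in> polys_over F" "poly g x = 0" for g
  proof -
    obtain q r where qr: "q\<in>polys_over F" "r\<in>polys_over F" "g = q * m + r" "r = 0 \<or> Polynomial.degree r < Polynomial.degree m"
      using division_over[OF F mF _ g(1)] m by blast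
    then have "poly r x = 0" using g(2) m by simp
    then have "r = 0" using least[of r] qr(2,4) m(2) by fastforce
    then show ?thesis using qr by auto
  qed
  then show ?thesis using m by (auto simp: is_minpoly_def)
qed

lemma is_minpoly_irreducible:
  assumes F: "is_subfield F" and m: "is_minpoly F x m"
  shows "irreducible_over F m"
  unfolding irreducible_over_def
proof (intro conjI ballI impI)
  show "m \<in> polys_over F" "0 < Polynomial.degree m"
    using m is_minpoly_degree_pos by (auto simp: is_minpoly_def)
  fix g h assume gh: "g \<in> polys_over F" "h \<in> polys_over F" "m = g * h"
  then have "poly g x = 0 \<or> poly h x = 0" and nz: "g \<noteq> 0" "h \<noteq> 0"
    using m is_minpoly_nz[OF m] by (auto simp: is_minpoly_def)
  moreover have deg: "Polynomial.degree m = Polynomial.degree g + Polynomial.degree h"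
    using nz gh by (simp add: degree_mult_eq)
  moreover have "Polynomial.degree m \<le> Polynomial.degree k"
    if "k \<in> polys_over F" "k \<noteq> 0" "poly k x = 0" for k
  proof -
    obtain q where "k = q * m" using m \<open>k \<in> polys_over F\<close> \<open>poly k x = 0\<close> by (auto simp: is_minpoly_def)
    then show ?thesis using \<open>k \<noteq> 0\<close> by (auto simp: degree_mult_eq)
  qed
  ultimately show "Polynomial.degree g = 0 \<or> Polynomial.degree h = 0" using gh nz
    by fastforce
qed

lemma irreducible_over_minpoly:
  assumes F: "is_subfield F" and f: "irreducible_over F f" and "poly f x = 0"
  shows "\<exists>m c. is_minpoly F x m \<and> c \<in> F \<and> c \<noteq> 0 \<and> f = Polynomial.smult c m"
proof -
  have fF: "f \<in> polys_over F" "f \<noteq> 0" using f by (auto simp: irreducible_over_def)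
  obtain m where m: "is_minpoly F x m" using minpoly_exists[OF F, of x] fF assms by (auto simp: algebraic_over_def)
  obtain q where q: "q \<in> polys_over F" "f = q * m" using m fF assms by (auto simp: is_minpoly_def)
  have "Polynomial.degree q = 0"
    using f q m is_minpoly_degree_pos[OF m] unfolding irreducible_over_def is_minpoly_def by fastforce
  then obtain c where c: "q = [:c:]" by (auto elim: degree_eq_zeroE)
  have "c \<in> F" using q c unfolding polys_over_def by (auto dest: spec[of _ 0])
  then show ?thesis using m q c fF by (intro exI[of _ m] exI[of _ c]) auto
qed

lemma adjoin_singleton:
  fixes F :: "'a::alg_closed_field set"
  assumes F: "is_subfield F" and x: "algebraic_over F x"
  shows "adjoin F {x} = {poly p x | p. p \<in> polys_over F}"
proof
  obtain m where m: "is_minpoly F x m" using minpoly_exists[OF F x] by blast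
  let ?E = "{poly p x | p. p \<in> polys_over F}"
  show "?E \<subseteq> adjoin F {x}"
    using adjoin_base[of F "{x}"] adjoin_gen[of "{x}" F]
    by (auto intro!: poly_in_subfield simp: subset_eq polys_over_def)
  have "is_subfield ?E"
  proof (rule is_subfieldI, goal_cases)
    case 1 show ?case using F by (auto intro!: exI[of _ 1])
  next
    case (2 a b) then show ?case using F by (force intro!: polys_over_add simp flip: poly_add)
  next
    case (3 a b) then show ?case using F by (force intro!: polys_over_mult simp flip: poly_mult)
  next
    case (4 a) then obtain p where "p \<in> polys_over F" "a = poly p x" by blast
    then have "- a = poly (- p) x" "- p \<in> polys_over F"
      using F by (auto intro!: polys_over_uminus)
    then show ?case by blast
  next
    case (5 a)
    then obtain p where p: "p \<in> polys_over F" "a = poly p x" by blast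
    have mF: "m \<in> polys_over F" and mx: "poly m x = 0" using m by (auto simp: is_minpoly_def)
    have min: "r = 0" if "r \<in> polys_over F" "poly r x = 0" "Polynomial.degree r < Polynomial.degree m" for r
      using m that unfolding is_minpoly_def
      by (metis degree_mult_eq le_add2 mult_zero_left mult_zero_right not_le)
    \<comment> \<open>Euclidean recursion: dividing \<open>m\<close> by \<open>p\<close> leaves
      \<open>r\<close> with r(x) = -q(x) p(x), nonzero and of smaller degree, so an inverse of r(x)
      yields one of p(x).\<close>
    have inv: "\<exists>q\<in>polys_over F. poly q x * poly p x = 1"
      if "p \<in> polys_over F" "poly p x \<noteq> 0" "Polynomial.degree p < Polynomial.degree m" for p
      using that
    proof (induction "Polynomial.degree p" arbitrary: p rule: less_induct)
      case less
      show ?case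
      proof (cases "Polynomial.degree p = 0")
        case True
        then obtain c where c: "p = [:c:]" by (auto elim: degree_eq_zeroE)
        then have "c \<in> F" "c \<noteq> 0" using less by (auto simp: polys_over_def dest: spec[of _ 0])
        then show ?thesis using c F by (intro bexI[of _ "[:inverse c:]"]) (auto intro!: polys_over_pCons sf_intros)
      next
        case False
        then have p0: "p \<noteq> 0" by auto
        obtain q r where qr: "q\<in>polys_over F" "r\<in>polys_over F" "m = q * p + r" "r = 0 \<or> Polynomial.degree r < Polynomial.degree p"
          using division_over[OF F less(2) p0 mF] by blast
        have "r \<noteq> 0"
        proof
          assume "r = 0"
          then have "m = q * p" using qr by simp
          then have "Polynomial.degree q = 0"
            using is_minpoly_irreducible[OF F m] False qr less by (auto simp: irreducible_over_def)
          moreover have "q \<noteq> 0" using \<open>m = q * p\<close> is_minpoly_nz[OF m] by auto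
          ultimately have "Polynomial.degree m = Polynomial.degree p"
            using \<open>m = q * p\<close> p0 by (simp add: degree_mult_eq)
          then show False using less by simp
        qed
        then have dr: "Polynomial.degree r < Polynomial.degree p" using qr by simp
        then have "poly r x \<noteq> 0" using min[of r] qr \<open>r \<noteq> 0\<close> less by auto
        then obtain s where s: "s\<in>polys_over F" "poly s x * poly r x = 1"
          using less(1)[OF dr qr(2)] dr less(4) by auto
        have "poly r x = - poly q x * poly p x" using mx qr(3) by (simp add: eq_neg_iff_add_eq_0 add.commute)
        then have "poly (- (s * q)) x * poly p x = 1" using s by (simp add: algebra_simps)
        moreover have "- (s * q) \<in> polys_over F"
          using F s qr by (auto intro!: polys_over_uminus polys_over_mult)
        ultimately show ?thesis by blast
      qed
    qed
    obtain q r where qr: "q\<in>polys_over F" "r\<in>polys_over F" "p = q * m + r" "r = 0 \<or> Polynomial.degree r < Polynomial.degree m"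
      using division_over[OF F mF is_minpoly_nz[OF m] p(1)] by blast
    then have "poly r x = a" using mx p by simp
    then obtain s where s: "s \<in> polys_over F" "poly s x * a = 1" using inv[of r] qr 5 by auto
    then have "inverse a = poly s x" by (metis inverse_unique mult.commute)
    then show ?case using s by blast
  qed
  moreover have "F \<subseteq> ?E" 
  proof
    fix c assume "c \<in> F"
    then show "c \<in> ?E" using F by (intro CollectI exI[of _ "[:c:]"]) (auto intro: polys_over_pCons)
  qed
  moreover have "x \<in> ?E" using F by (intro CollectI exI[of _ "[:0,1:]"]) (auto intro!: polys_over_pCons sf_intros)
  ultimately show "adjoin F {x} \<subseteq> ?E" by (intro adjoin_minimal) auto
qed

subsection \<open>Linear algebra over a subfield\<close>

text \<open>Meant for finite \<open>B\<close>: over an infinite \<open>B\<close> every sum is 0 and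
  the set shrinks to zero.\<close>

definition spanned :: "'a::field set \<Rightarrow> 'a set \<Rightarrow> 'a set" where
  "spanned F B = {\<Sum>b\<in>B. c b * b | c. \<forall>b\<in>B. c b \<in> F}"

context
  fixes F :: "'a::field set"
  assumes F: "is_subfield F"
begin

lemma spanned_0 [simp]: "0 \<in> spanned F B"
  unfolding spanned_def using F by (intro CollectI exI[of _ "\<lambda>_. 0"]) auto

lemma spanned_add: "x \<in> spanned F B \<Longrightarrow> y \<in> spanned F B \<Longrightarrow> x + y \<in> spanned F B"
proof -
  assume "x \<in> spanned F B" "y \<in> spanned F B"
  then obtain c d where "\<forall>b\<in>B. c b \<in> F" "\<forall>b\<in>B. d b \<in> F" "x = (\<Sum>b\<in>B. c b * b)" "y = (\<Sum>b\<in>B. d b * b)"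
    unfolding spanned_def by blast
  then show ?thesis unfolding spanned_def using F
    by (intro CollectI exI[of _ "\<lambda>b. c b + d b"]) (auto simp: sum.distrib ring_distribs sf_add)
qed

lemma spanned_scale: "a \<in> F \<Longrightarrow> x \<in> spanned F B \<Longrightarrow> a * x \<in> spanned F B"
proof -
  assume a: "a \<in> F" and "x \<in> spanned F B"
  then obtain c where "\<forall>b\<in>B. c b \<in> F" "x = (\<Sum>b\<in>B. c b * b)"
    unfolding spanned_def by blast
  then show ?thesis unfolding spanned_def using F a
    by (intro CollectI exI[of _ "\<lambda>b. a * c b"]) (auto simp: sum_distrib_left mult_ac sf_mult)
qed

lemma spanned_sum: "(\<And>i. i \<in> I \<Longrightarrow> f i \<in> spanned F B) \<Longrightarrow> sum f I \<in> spanned F B"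
  by (induction I rule: infinite_finite_induct) (auto intro: spanned_add)

lemma spanned_superset: "finite B \<Longrightarrow> B \<subseteq> spanned F B"
proof
  fix x assume "finite B" "x \<in> B"
  then have "(\<Sum>b\<in>B. (if b = x then 1 else 0) * b) = x"
    by (simp add: if_distrib[of "\<lambda>c. c * _"] cong: if_cong)
  then show "x \<in> spanned F B" unfolding spanned_def using F
    by (intro CollectI exI[of _ "\<lambda>b. if b = x then 1 else 0"]) auto
qed

lemma spanned_min:
  assumes "B \<subseteq> spanned F C" shows "spanned F B \<subseteq> spanned F C"
proof
  fix x assume "x \<in> spanned F B"
  then obtain c where "\<forall>b\<in>B. c b \<in> F" "x = (\<Sum>b\<in>B. c b * b)" unfolding spanned_def by blast
  then show "x \<in> spanned F C" using assms by (auto intro!: spanned_sum spanned_scale)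
qed

lemma linear_dependence:
  assumes "finite B" "finite I" "card B < card I" "\<And>i. i \<in> I \<Longrightarrow> v i \<in> spanned F B"
  shows "\<exists>c. (\<forall>i\<in>I. c i \<in> F) \<and> (\<exists>i\<in>I. c i \<noteq> 0) \<and> (\<Sum>i\<in>I. c i * v i) = 0"
  using assms
proof (induction B arbitrary: I v rule: finite_induct)
  case empty
  then obtain i where "i \<in> I" by fastforce
  moreover have "v i = 0" if "i \<in> I" for i using empty(3)[OF that] by (auto simp: spanned_def)
  ultimately show ?case using F by (intro exI[of _ "\<lambda>_. 1"]) auto
next
  case (insert b B)
  have "\<exists>a w. a \<in> F \<and> w \<in> spanned F B \<and> v i = a * b + w" if "i \<in> I" for i
  proof -
    obtain c where "\<forall>x\<in>insert b B. c x \<in> F" "v i = (\<Sum>x\<in>insert b B. c x * x)"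
      using insert(6)[OF \<open>i \<in> I\<close>] unfolding spanned_def by blast
    then show ?thesis using insert(1,2)
      by (intro exI[of _ "c b"] exI[of _ "\<Sum>x\<in>B. c x * x"]) (auto simp: spanned_def)
  qed
  then obtain a w where aw: "\<And>i. i \<in> I \<Longrightarrow> a i \<in> F \<and> w i \<in> spanned F B \<and> v i = a i * b + w i"
    by metis
  show ?case
  proof (cases "\<forall>i\<in>I. a i = 0")
    case True
    then show ?thesis using insert(3)[of I v] insert aw by (simp add: card_insert_if)
  next
    case False
    then obtain j where j: "j \<in> I" "a j \<noteq> 0" by blast
    \<comment> \<open>Elimination with the pivot \<open>v j\<close>: the multiples of
      \<open>b\<close> cancel, so these vectors lie in the span of the smaller set
      \<open>B\<close>.\<close>
    define v' where "v' i = v i - (a i / a j) * v j" for i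
    have "v' i \<in> spanned F B" if "i \<in> I - {j}" for i
    proof -
      have "v' i = w i + (- (a i / a j)) * w j"
        using aw[of i] aw[of j] that j unfolding v'_def by (simp add: field_simps)
      also have "\<dots> \<in> spanned F B" using aw[of i] aw[of j] that j F
        by (intro spanned_add spanned_scale) (auto intro!: sf_uminus sf_divide)
      finally show ?thesis .
    qed
    moreover have "card B < card (I - {j})" using insert j by simp
    ultimately obtain c where c: "\<forall>i\<in>I - {j}. c i \<in> F" "\<exists>i\<in>I - {j}. c i \<noteq> 0" "(\<Sum>i\<in>I - {j}. c i * v' i) = 0"
      using insert(3)[of "I - {j}" v'] insert(4) by auto
    define d where "d i = (if i = j then - (\<Sum>i\<in>I - {j}. c i * (a i / a j)) else c i)" for i
    have "(\<Sum>i\<in>I. d i * v i) = d j * v j + (\<Sum>i\<in>I - {j}. c i * v i)"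
      by (subst sum.remove[OF insert(4) j(1)]) (auto simp: d_def)
    also have "\<dots> = (\<Sum>i\<in>I - {j}. c i * v' i)"
      by (simp add: d_def v'_def right_diff_distrib sum_subtractf sum_distrib_left sum_distrib_right mult_ac)
    finally have "(\<Sum>i\<in>I. d i * v i) = 0" using c by simp
    moreover have "\<forall>i\<in>I. d i \<in> F" using c aw j F
      by (auto simp: d_def intro!: sf_uminus sf_sum sf_mult sf_divide)
    moreover have "\<exists>i\<in>I. d i \<noteq> 0" using c by (auto simp: d_def)
    ultimately show ?thesis by blast
  qed
qed

text \<open>The elements of \<open>C\<close> are taken in one by one, each enlarging the family
  exactly if it lies outside the span so far. Expanding coefficients from a large field along such a
  family breaks one relation into several with coefficients in \<open>F\<close>.\<close>

lemma independent_representation: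
  assumes "finite C"
  shows "\<exists>(k::nat) \<gamma>. (\<forall>f. (\<forall>t<k. f t \<in> F) \<and> (\<Sum>t<k. f t * \<gamma> t) = 0 \<longrightarrow> (\<forall>t<k. f t = 0)) \<and>
           (\<forall>x\<in>C. \<exists>f. (\<forall>t<k. f t \<in> F) \<and> x = (\<Sum>t<k. f t * \<gamma> t))"
  using assms
proof (induction C rule: finite_induct)
  case empty
  then show ?case by (intro exI[of _ 0]) auto
next
  case (insert y C)
  from insert.IH obtain k :: nat and \<gamma> where
    "(\<forall>f. (\<forall>t<k. f t \<in> F) \<and> (\<Sum>t<k. f t * \<gamma> t) = 0 \<longrightarrow> (\<forall>t<k. f t = 0)) \<and>
       (\<forall>x\<in>C. \<exists>f. (\<forall>t<k. f t \<in> F) \<and> x = (\<Sum>t<k. f t * \<gamma> t))" by (elim exE)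
  then have ind: "\<And>f. (\<forall>t<k. f t \<in> F) \<Longrightarrow> (\<Sum>t<k. f t * \<gamma> t) = 0 \<Longrightarrow> (\<forall>t<k. f t = 0)" and
    rep: "\<And>x. x \<in> C \<Longrightarrow> \<exists>f. (\<forall>t<k. f t \<in> F) \<and> x = (\<Sum>t<k. f t * \<gamma> t)"
    by (simp_all del: All_less_Suc)
  show ?case
  proof (cases "\<exists>f. (\<forall>t<k. f t \<in> F) \<and> y = (\<Sum>t<k. f t * \<gamma> t)")
    case True
    then show ?thesis using ind rep by (intro exI[of _ k] exI[of _ \<gamma>]) auto
  next
    case False
    define \<delta> where "\<delta> = \<gamma>(k := y)"
    have sum_\<delta>: "(\<Sum>t<Suc k. f t * \<delta> t) = (\<Sum>t<k. f t * \<gamma> t) + f k * y" for f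
      by (simp add: \<delta>_def)
    have "\<forall>t<Suc k. f t = 0" if f: "\<forall>t<Suc k. f t \<in> F" "(\<Sum>t<Suc k. f t * \<delta> t) = 0" for f
    proof -
      have "f k = 0"
      proof (rule ccontr)
        assume fk: "f k \<noteq> 0"
        have "f k * y = - (\<Sum>t<k. f t * \<gamma> t)" using f(2) unfolding sum_\<delta> by (metis add.commute eq_neg_iff_add_eq_0)
        then have "y = - (\<Sum>t<k. f t * \<gamma> t) / f k" using fk by (simp add: field_simps)
        also have "\<dots> = (\<Sum>t<k. (- (f t / f k)) * \<gamma> t)" by (simp add: sum_divide_distrib sum_negf)
        finally have y: "y = (\<Sum>t<k. (- (f t / f k)) * \<gamma> t)" .
        have "\<forall>t<k. - (f t / f k) \<in> F" using f F by (auto intro!: sf_uminus sf_divide)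
        with y have "\<exists>f. (\<forall>t<k. f t \<in> F) \<and> y = (\<Sum>t<k. f t * \<gamma> t)"
          by (intro exI[of _ "\<lambda>t. - (f t / f k)"] conjI)
        with False show False by contradiction
      qed
      have "\<forall>t<k. f t \<in> F" using f(1) less_SucI by blast
      moreover have "(\<Sum>t<k. f t * \<gamma> t) = 0" using f(2) \<open>f k = 0\<close> by (simp only: sum_\<delta> mult_zero_left add_0_right)
      ultimately have "\<forall>t<k. f t = 0" by (rule ind)
      then show ?thesis using \<open>f k = 0\<close> less_Suc_eq by metis
    qed
    moreover have "\<exists>f. (\<forall>t<Suc k. f t \<in> F) \<and> x = (\<Sum>t<Suc k. f t * \<delta> t)" if x: "x \<in> insert y C" for x
    proof (cases "x = y")
      case True
      then show ?thesis using F unfolding sum_\<delta>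
        by (intro exI[of _ "\<lambda>t. if t = k then 1 else 0"] conjI allI impI) auto
    next
      case False
      then obtain f where "\<forall>t<k. f t \<in> F" "x = (\<Sum>t<k. f t * \<gamma> t)" using rep x by blast
      then show ?thesis using F unfolding sum_\<delta>
        by (intro exI[of _ "f(k := 0)"] conjI allI impI) auto
    qed
    ultimately have "(\<forall>f. (\<forall>t<Suc k. f t \<in> F) \<and> (\<Sum>t<Suc k. f t * \<delta> t) = 0 \<longrightarrow> (\<forall>t<Suc k. f t = 0)) \<and>
       (\<forall>x\<in>insert y C. \<exists>f. (\<forall>t<Suc k. f t \<in> F) \<and> x = (\<Sum>t<Suc k. f t * \<delta> t))" by blast
    then show ?thesis by (intro exI[of _ "Suc k"] exI[of _ \<delta>])
  qed
qed

end

subsection \<open>Algebraic elements\<close>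

context
  fixes F :: "'a::alg_closed_field set"
  assumes F: "is_subfield F"
begin

text \<open>One generator at a time: division by its minimal polynomial shows that the products of
  the previous spanning set with the powers \<open>s ^ i\<close> below the degree suffice.\<close>

lemma adjoin_algebraic_spanned:
  assumes "finite S" "\<And>s. s \<in> S \<Longrightarrow> algebraic_over F s"
  shows "\<exists>B. finite B \<and> adjoin F S \<subseteq> spanned F B"
  using assms
proof (induction S rule: finite_induct)
  case empty
  have "F \<subseteq> spanned F {1}"
  proof
    fix c assume "c \<in> F"
    then show "c \<in> spanned F {1}" unfolding spanned_def by (intro CollectI exI[of _ "\<lambda>_. c"]) auto
  qed
  then show ?case using adjoin_empty[OF F] by auto
next
  case (insert s S)
  then obtain B where B: "finite B" "adjoin F S \<subseteq> spanned F B" by auto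
  let ?G = "adjoin F S"
  have G: "is_subfield ?G" "F \<subseteq> ?G" by (simp_all add: adjoin_base)
  have "algebraic_over ?G s" using insert(4)[of s] polys_over_mono[OF G(2)]
    unfolding algebraic_over_def by auto
  then obtain m where m: "is_minpoly ?G s m" using minpoly_exists G by blast
  let ?d = "Polynomial.degree m"
  define C where "C = (\<lambda>(b, i). b * s ^ i) ` (B \<times> {..<?d})"
  have finC: "finite C" unfolding C_def using B by auto
  have "adjoin F (insert s S) \<subseteq> spanned F C"
  proof
    fix x assume "x \<in> adjoin F (insert s S)"
    then obtain p where p: "p \<in> polys_over ?G" "x = poly p s"
      unfolding adjoin_insert[of F s S] adjoin_singleton[OF G(1) \<open>algebraic_over ?G s\<close>] by blast
    obtain q r where qr: "r\<in>polys_over ?G" "p = q * m + r" "r = 0 \<or> Polynomial.degree r < ?d"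
      using division_over[OF G(1) _ is_minpoly_nz[OF m] p(1)] m unfolding is_minpoly_def by blast
    have "?d > 0" by (rule is_minpoly_degree_pos[OF m])
    then have deg: "Polynomial.degree r < ?d" using qr by auto
    have "x = poly r s" using p qr m by (simp add: is_minpoly_def)
    also have "\<dots> = (\<Sum>i\<le>Polynomial.degree r. poly.coeff r i * s ^ i)" by (rule poly_altdef)
    also have "\<dots> \<in> spanned F C"
    proof (rule spanned_sum[OF F])
      fix i assume "i \<in> {..Polynomial.degree r}"
      then have i: "i < ?d" using deg by auto
      have "poly.coeff r i \<in> spanned F B" using qr(1) B unfolding polys_over_def by auto
      then obtain c where c: "\<forall>b\<in>B. c b \<in> F" "poly.coeff r i = (\<Sum>b\<in>B. c b * b)"
        unfolding spanned_def by blast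
      have "poly.coeff r i * s ^ i = (\<Sum>b\<in>B. c b * (b * s ^ i))"
        by (simp add: c sum_distrib_left sum_distrib_right mult_ac)
      also have "\<dots> \<in> spanned F C"
      proof (rule spanned_sum[OF F], rule spanned_scale[OF F])
        fix b assume "b \<in> B"
        then have "b * s ^ i \<in> C" using i by (auto simp: C_def)
        then show "b * s ^ i \<in> spanned F C" using spanned_superset[OF F finC] by auto
      qed (use c in auto)
      finally show "poly.coeff r i * s ^ i \<in> spanned F C" .
    qed
    finally show "x \<in> spanned F C" .
  qed
  then show ?case using finC by blast
qed

text \<open>The \<open>card B + 1\<close> powers of \<open>x\<close> with exponents up to
  \<open>card B\<close> are linearly dependent.\<close>

lemma spanned_algebraic:
  assumes "finite B" "E \<subseteq> spanned F B" "is_subfield E" "x \<in> E"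
  shows "algebraic_over F x"
proof -
  have "x ^ i \<in> spanned F B" for i using assms sf_power[OF assms(3,4), of i] by auto
  then obtain c where c: "\<forall>i\<in>{..card B}. c i \<in> F" "\<exists>i\<in>{..card B}. c i \<noteq> 0" "(\<Sum>i\<le>card B. c i * x ^ i) = 0"
    using linear_dependence[OF F assms(1), of "{..card B}" "\<lambda>i. x ^ i"] by auto
  define f where "f = (\<Sum>i\<le>card B. Polynomial.monom (c i) i)"
  have coeff: "poly.coeff f i = (if i \<le> card B then c i else 0)" for i
    by (simp add: f_def coeff_sum)
  have "f \<in> polys_over F" using c F by (auto simp: polys_over_def coeff)
  moreover have "f \<noteq> 0"
  proof
    assume "f = 0" then show False using c(2) coeff by (metis atMost_iff coeff_0)
  qed
  moreover have "poly f x = 0" using c(3) by (simp add: f_def poly_sum poly_monom)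
  ultimately show ?thesis by (auto simp: algebraic_over_def)
qed

lemma algebraic_over_adjoin:
  assumes "finite S" "\<And>s. s \<in> S \<Longrightarrow> algebraic_over F s" "x \<in> adjoin F S"
  shows "algebraic_over F x"
  using adjoin_algebraic_spanned[OF assms(1,2)] spanned_algebraic[OF _ _ is_subfield_adjoin assms(3)]
  by blast

text \<open>Passes from an arbitrary field \<open>G\<close> to a finitely generated one, so that
  finite spanning sets can be used in the proofs of transitivity.\<close>

lemma poly_over_finite_coeffs:
  assumes "f \<in> polys_over G" shows "\<exists>C. finite C \<and> C \<subseteq> G \<and> f \<in> polys_over (adjoin F C)"
proof (intro exI conjI)
  let ?C = "poly.coeff f ` {..Polynomial.degree f}"
  show "finite ?C" by simp
  show "?C \<subseteq> G" using assms by (auto simp: polys_over_def)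
  have "poly.coeff f i \<in> adjoin F ?C" for i
  proof (cases "i \<le> Polynomial.degree f")
    case True then show ?thesis using adjoin_gen[of ?C F] by auto
  next
    case False then show ?thesis by (simp add: coeff_eq_0)
  qed
  then show "f \<in> polys_over (adjoin F ?C)" by (auto simp: polys_over_def)
qed

end

lemma spanned_trans:
  assumes F: "is_subfield F" and "finite B" "finite C" and G: "G \<subseteq> spanned F B"
  shows "spanned G C \<subseteq> spanned F ((\<lambda>(b, c). b * c) ` (B \<times> C))"
proof
  let ?D = "(\<lambda>(b, c). b * c) ` (B \<times> C)"
  fix x assume "x \<in> spanned G C"
  then obtain d where d: "\<forall>c\<in>C. d c \<in> G" "x = (\<Sum>c\<in>C. d c * c)" unfolding spanned_def by blast
  have "d c * c \<in> spanned F ?D" if c: "c \<in> C" for c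
  proof -
    obtain e where e: "\<forall>b\<in>B. e b \<in> F" "d c = (\<Sum>b\<in>B. e b * b)"
      using d G c unfolding spanned_def by blast
    have "d c * c = (\<Sum>b\<in>B. e b * (b * c))" by (simp add: e sum_distrib_left sum_distrib_right mult_ac)
    also have "\<dots> \<in> spanned F ?D"
    proof (rule spanned_sum[OF F], rule spanned_scale[OF F])
      fix b assume "b \<in> B"
      then have "b * c \<in> ?D" using c by auto
      then show "b * c \<in> spanned F ?D" using spanned_superset[OF F, of ?D] assms by auto
    qed (use e in auto)
    finally show ?thesis .
  qed
  then show "x \<in> spanned F ?D" unfolding d by (intro spanned_sum[OF F]) auto
qed

lemma algebraic_over_trans:
  assumes F: "is_subfield F" and "algebraic_over G x" "\<And>y. y \<in> G \<Longrightarrow> algebraic_over F y"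
  shows "algebraic_over F x"
proof -
  obtain f where f: "f \<in> polys_over G" "f \<noteq> 0" "poly f x = 0" using assms by (auto simp: algebraic_over_def)
  obtain C where C: "finite C" "C \<subseteq> G" "f \<in> polys_over (adjoin F C)" using poly_over_finite_coeffs[OF F f(1)] by blast
  let ?G = "adjoin F C"
  obtain B where B: "finite B" "?G \<subseteq> spanned F B" using adjoin_algebraic_spanned[OF F C(1)] C assms by blast
  have "algebraic_over ?G x" using f C by (auto simp: algebraic_over_def)
  then obtain D where D: "finite D" "adjoin ?G {x} \<subseteq> spanned ?G D"
    using adjoin_algebraic_spanned[of ?G "{x}"] by auto
  have "adjoin ?G {x} \<subseteq> spanned F ((\<lambda>(b, c). b * c) ` (B \<times> D))"
    using D spanned_trans[OF F B(1) D(1) B(2)] by blast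
  then show ?thesis using B D adjoin_gen[of "{x}" ?G]
    by (intro spanned_algebraic[OF F _ _ is_subfield_adjoin]) auto
qed

lemma algebraic_over_mono: "algebraic_over F x \<Longrightarrow> F \<subseteq> G \<Longrightarrow> algebraic_over G x"
  unfolding algebraic_over_def using polys_over_mono[of F G] by blast

subsection \<open>Separable elements\<close>

text \<open>No irreducibility is asked of \<open>f\<close>, only that \<open>x\<close> is a simple
  root; this makes the passage to larger fields immediate. \<open>separable_over_iff\<close> gives
  the agreement with the notion through irreducible polynomials.\<close>

definition separable_over :: "'a::alg_closed_field set \<Rightarrow> 'a \<Rightarrow> bool" where
  "separable_over F x \<longleftrightarrow> (\<exists>f\<in>polys_over F. poly f x = 0 \<and> poly (pderiv f) x \<noteq> 0)"

lemma separable_imp_algebraic: "separable_over F x \<Longrightarrow> algebraic_over F x"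
  unfolding separable_over_def algebraic_over_def by (metis pderiv_0 poly_0)

lemma separable_over_mono: "separable_over F x \<Longrightarrow> F \<subseteq> G \<Longrightarrow> separable_over G x"
  unfolding separable_over_def using polys_over_mono[of F G] by blast

lemma separable_over_self: "is_subfield F \<Longrightarrow> x \<in> F \<Longrightarrow> separable_over F x"
  unfolding separable_over_def
  by (intro bexI[of _ "[:- x, 1:]"]) (auto intro!: polys_over_pCons sf_intros simp: pderiv_pCons)

lemma separable_over_minpoly:
  assumes "separable_over F x" "is_minpoly F x m"
  shows "poly (pderiv m) x \<noteq> 0"
proof -
  obtain f where f: "f \<in> polys_over F" "poly f x = 0" "poly (pderiv f) x \<noteq> 0"
    using assms by (auto simp: separable_over_def)
  then obtain q where "f = q * m" using assms by (auto simp: is_minpoly_def)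
  then show ?thesis using f assms by (auto simp: pderiv_mult is_minpoly_def)
qed

text \<open>The derivative has smaller degree than \<open>m\<close> and would be divisible by
  it.\<close>

lemma is_minpoly_pderiv:
  assumes "is_subfield F" "is_minpoly F x m" "poly (pderiv m) x = 0"
  shows "pderiv m = 0"
proof (rule ccontr)
  assume nz: "pderiv m \<noteq> 0"
  have "pderiv m \<in> polys_over F" using assms by (auto simp: is_minpoly_def intro: polys_over_pderiv)
  then obtain q where "pderiv m = q * m" using assms by (auto simp: is_minpoly_def)
  then have "Polynomial.degree m \<le> Polynomial.degree (pderiv m)" using nz by (auto simp: degree_mult_eq)
  moreover have deg: "Polynomial.degree (pderiv m) \<le> Polynomial.degree m - 1"
    by (rule degree_le) (auto simp: coeff_pderiv intro: coeff_eq_0)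
  ultimately show False using is_minpoly_degree_pos[OF assms(2)] deg by linarith
qed

lemma rsquarefreeI:
  fixes f :: "'a::idom poly"
  assumes "f \<noteq> 0" "\<And>a. poly f a = 0 \<Longrightarrow> poly (pderiv f) a \<noteq> 0"
  shows "rsquarefree f"
  unfolding rsquarefree_def
proof (intro conjI allI assms(1))
  fix a
  have False if "Polynomial.order a f \<ge> 2"
  proof -
    have "[:-a, 1:] ^ 2 dvd f" using that order_1[of a f] by (meson dvd_trans le_imp_power_dvd)
    then obtain g where "f = [:-a, 1:] * ([:-a, 1:] * g)" by (metis dvdE mult.assoc power2_eq_square)
    then have "poly f a = 0 \<and> poly (pderiv f) a = 0" by (simp only: pderiv_mult) simp
    then show False using assms(2) by blast
  qed
  then show "Polynomial.order a f = 0 \<or> Polynomial.order a f = 1" by force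
qed

lemma rsquarefree_imp_pderiv:
  fixes f :: "'a::idom poly"
  assumes "rsquarefree f" "poly f a = 0"
  shows "poly (pderiv f) a \<noteq> 0"
proof
  assume *: "poly (pderiv f) a = 0"
  obtain g where g: "f = [:-a, 1:] * g" using assms(2) by (auto simp: poly_eq_0_iff_dvd)
  have "pderiv f = g + [:-a, 1:] * pderiv g" unfolding g pderiv_mult by (simp add: pderiv_pCons)
  then have "poly g a = 0" using * by simp
  then obtain h where "g = [:-a, 1:] * h" by (auto simp: poly_eq_0_iff_dvd)
  then have "[:-a, 1:] ^ 2 dvd f" unfolding g by (metis dvd_triv_left mult.assoc power2_eq_square)
  then have "2 \<le> Polynomial.order a f" using assms(1) by (auto simp: order_divides rsquarefree_def)
  then show False using assms(1) unfolding rsquarefree_def by (metis one_le_numeral le_antisym numeral_le_one_iff semiring_norm(69) not_numeral_le_zero)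
qed

text \<open>Every root \<open>a\<close> of the irreducible \<open>m\<close> has \<open>m\<close> as
  its minimal polynomial up to a constant. A double root would therefore force
  \<open>pderiv m = 0\<close>, against the simplicity of the root \<open>x\<close>.\<close>

lemma separable_over_iff:
  assumes F: "is_subfield F"
  shows "separable_over F x \<longleftrightarrow> (\<exists>f. irreducible_over F f \<and> poly f x = 0 \<and> rsquarefree f)"
proof
  assume x: "separable_over F x"
  then obtain m where m: "is_minpoly F x m" using minpoly_exists[OF F] separable_imp_algebraic by blast
  have irr: "irreducible_over F m" by (rule is_minpoly_irreducible[OF F m])
  have m0: "m \<noteq> 0" by (rule is_minpoly_nz[OF m])
  have mF: "m \<in> polys_over F" using m by (simp add: is_minpoly_def)
  have "rsquarefree m"
  proof (rule rsquarefreeI[OF m0], rule notI)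
    fix a assume a: "poly m a = 0" "poly (pderiv m) a = 0"
    obtain m' c where m': "is_minpoly F a m'" "m = Polynomial.smult c m'" "c \<noteq> 0"
      using irreducible_over_minpoly[OF F irr a(1)] by blast
    then have "poly (pderiv m') a = 0" using a by (simp add: pderiv_smult)
    then have "pderiv m' = 0" by (rule is_minpoly_pderiv[OF F m'(1)])
    then have "pderiv m = 0" by (simp add: m' pderiv_smult)
    then show False using separable_over_minpoly[OF x m] by simp
  qed
  then show "\<exists>f. irreducible_over F f \<and> poly f x = 0 \<and> rsquarefree f" using irr m by (auto simp: is_minpoly_def)
next
  assume "\<exists>f. irreducible_over F f \<and> poly f x = 0 \<and> rsquarefree f"
  then show "separable_over F x" using rsquarefree_imp_pderiv by (auto simp: separable_over_def irreducible_over_def)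
qed

lemma separable_algebraic_ext_iff:
  assumes "is_subfield F" shows "separable_algebraic_ext F L \<longleftrightarrow> (\<forall>x\<in>L. separable_over F x)"
  by (simp add: separable_algebraic_ext_def separable_over_iff[OF assms])

lemma minpoly_pderiv_0_imp_CHAR_dvd:
  assumes "pderiv (m :: 'a::alg_closed_field poly) = 0" "poly.coeff m i \<noteq> 0"
  shows "CHAR('a) dvd i"
proof (cases i)
  case (Suc j)
  then have "of_nat i * poly.coeff m i = 0" using coeff_pderiv[of m j] assms(1) by simp
  then show ?thesis using assms(2) by (simp add: of_nat_eq_0_iff_char_dvd)
qed simp

lemma algebraic_imp_separable_CHAR_0:
  assumes F: "is_subfield F" and x: "algebraic_over F (x::'a::alg_closed_field)" and "CHAR('a) = 0"
  shows "separable_over F x"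
proof -
  obtain m where m: "is_minpoly F x m" using minpoly_exists[OF F x] by blast
  have "poly (pderiv m) x \<noteq> 0"
  proof
    assume "poly (pderiv m) x = 0"
    then have "pderiv m = 0" by (rule is_minpoly_pderiv[OF F m])
    then have "CHAR('a) dvd Polynomial.degree m"
      by (rule minpoly_pderiv_0_imp_CHAR_dvd) (use is_minpoly_nz[OF m] in simp)
    moreover have deg: "Polynomial.degree (pderiv m) \<le> Polynomial.degree m - 1"
    by (rule degree_le) (auto simp: coeff_pderiv intro: coeff_eq_0)
  ultimately show False using is_minpoly_degree_pos[OF m] assms by simp
  qed
  then show ?thesis using m by (auto simp: separable_over_def is_minpoly_def)
qed

text \<open>
  If \<open>E = F E\<^sup>p\<close>, then \<open>p\<close>-th powers of a minimal spanning family of \<open>E\<close> are linearly independent over \<open>F\<close>,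
  so a relation \<open>\<Sum> a\<^sub>j x\<^bsup>pj\<^esup> = 0\<close> comes from a relation of smaller degree.
\<close>

lemma separable_adjoin_CHAR:
  fixes F :: "'a::alg_closed_field set"
  defines "p \<equiv> CHAR('a)"
  assumes F: "is_subfield F" and p: "p > 0"
    and S: "finite S" "\<And>s. s \<in> S \<Longrightarrow> algebraic_over F s" "S \<subseteq> adjoin F ((\<lambda>s. s ^ p) ` S)"
    and x: "x \<in> adjoin F S"
  shows "separable_over F x"
proof -
  have prime: "prime CHAR('a)" using p prime_CHAR_semidom by (simp add: p_def)
  note frob = freshmans_dream_sum[OF prime, of p, unfolded p_def, OF refl, folded p_def]
  define E where "E = adjoin F S"
  have E: "is_subfield E" "F \<subseteq> E" "S \<subseteq> E" by (simp_all add: E_def adjoin_base adjoin_gen)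
  have ex: "\<exists>B. finite B \<and> E \<subseteq> spanned F B" unfolding E_def by (rule adjoin_algebraic_spanned[OF F S(1,2)])
  \<comment> \<open>The least size of a spanning set stands in for the degree of \<open>E\<close>
    over \<open>F\<close>.\<close>
  define n where "n = (LEAST n. \<exists>B. finite B \<and> E \<subseteq> spanned F B \<and> card B = n)"
  have "\<exists>B. finite B \<and> E \<subseteq> spanned F B \<and> card B = n"
    unfolding n_def by (rule LeastI_ex) (use ex in blast)
  then obtain B where B: "finite B" "E \<subseteq> spanned F B" "card B = n" by blast
  have least: "n \<le> card C" if "finite C" "E \<subseteq> spanned F C" for C
    unfolding n_def by (rule Least_le) (use that in blast)
  define P where "P = (\<lambda>b. b ^ p) ` B"
  have pow: "v ^ p \<in> spanned F P" if v: "v \<in> E" for v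
  proof -
    obtain c where c: "\<forall>b\<in>B. c b \<in> F" "v = (\<Sum>b\<in>B. c b * b)" using v B(2) unfolding spanned_def by blast
    have "v ^ p = (\<Sum>b\<in>B. c b ^ p * b ^ p)" by (simp add: c frob power_mult_distrib)
    also have "\<dots> \<in> spanned F P"
    proof (rule spanned_sum[OF F], rule spanned_scale[OF F])
      fix b assume "b \<in> B"
      then show "b ^ p \<in> spanned F P" using spanned_superset[OF F, of P] B by (auto simp: P_def)
    qed (use c F in \<open>auto intro: sf_power\<close>)
    finally show ?thesis .
  qed
  \<comment> \<open>\<open>W\<close> is the compositum \<open>F E^p\<close>. It is a field
    containing \<open>F\<close> and the \<open>p\<close>-th powers of \<open>S\<close>, hence
    \<open>S\<close> by hypothesis, hence all of \<open>E\<close>.\<close>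
  define W where "W = {y. \<exists>V. finite V \<and> V \<subseteq> E \<and> y \<in> spanned F ((\<lambda>v. v ^ p) ` V)}"
  have WE: "W \<subseteq> E"
  proof
    fix y assume "y \<in> W"
    then obtain V where V: "V \<subseteq> E" "y \<in> spanned F ((\<lambda>v. v ^ p) ` V)" by (auto simp: W_def)
    then obtain c where "\<forall>b\<in>(\<lambda>v. v ^ p) ` V. c b \<in> F" "y = (\<Sum>b\<in>(\<lambda>v. v ^ p) ` V. c b * b)"
      unfolding spanned_def by blast
    then show "y \<in> E" using V E by (auto intro!: sf_sum[OF E(1)] sf_mult[OF E(1)] sf_power[OF E(1)])
  qed
  have mono: "y \<in> spanned F ((\<lambda>v. v ^ p) ` V')" if "y \<in> spanned F ((\<lambda>v. v ^ p) ` V)" "V \<subseteq> V'" "finite V'" for y V V'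
    using that spanned_min[OF F, of "(\<lambda>v. v ^ p) ` V" "(\<lambda>v. v ^ p) ` V'"] spanned_superset[OF F, of "(\<lambda>v. v ^ p) ` V'"]
    by blast
  have Wpow: "v ^ p \<in> W" if "v \<in> E" for v
    using that spanned_superset[OF F, of "{v ^ p}"] unfolding W_def by (intro CollectI exI[of _ "{v}"]) auto
  have Wscale: "a * y \<in> W" if "a \<in> F" "y \<in> W" for a y
    using that spanned_scale[OF F] unfolding W_def by blast
  have Wadd: "y + z \<in> W" if yz: "y \<in> W" "z \<in> W" for y z
  proof -
    obtain V V' where "finite V" "V \<subseteq> E" "y \<in> spanned F ((\<lambda>v. v ^ p) ` V)" "finite V'" "V' \<subseteq> E" "z \<in> spanned F ((\<lambda>v. v ^ p) ` V')"
      using yz unfolding W_def by blast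
    then show ?thesis unfolding W_def
      by (intro CollectI exI[of _ "V \<union> V'"]) (auto intro!: spanned_add[OF F] intro: mono)
  qed
  have W0: "0 \<in> W" unfolding W_def using F by (intro CollectI exI[of _ "{}"]) auto
  have Wsum: "sum f I \<in> W" if "\<And>i. i \<in> I \<Longrightarrow> f i \<in> W" for f :: "'a \<Rightarrow> 'a" and I
    using that by (induction I rule: infinite_finite_induct) (auto intro: W0 Wadd)
  have Wpmult: "v ^ p * y \<in> W" if vy: "v \<in> E" "y \<in> W" for v y
  proof -
    obtain V c where V: "V \<subseteq> E" "\<forall>b\<in>(\<lambda>v. v ^ p) ` V. c b \<in> F" "y = (\<Sum>b\<in>(\<lambda>v. v ^ p) ` V. c b * b)"
      using vy unfolding W_def spanned_def by blast
    have "v ^ p * y = (\<Sum>b\<in>(\<lambda>v. v ^ p) ` V. c b * (v ^ p * b))" by (simp add: V sum_distrib_left mult_ac)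
    also have "\<dots> \<in> W"
    proof (rule Wsum, rule Wscale)
      fix b assume b: "b \<in> (\<lambda>v. v ^ p) ` V"
      then show "c b \<in> F" using V by blast
      obtain u where "u \<in> V" "b = u ^ p" using b by blast
      then show "v ^ p * b \<in> W" using Wpow[of "v * u"] vy V E by (auto simp: power_mult_distrib intro: sf_mult)
    qed
    finally show ?thesis .
  qed
  have Wmult: "y * z \<in> W" if yz: "y \<in> W" "z \<in> W" for y z
  proof -
    obtain V c where V: "V \<subseteq> E" "\<forall>b\<in>(\<lambda>v. v ^ p) ` V. c b \<in> F" "y = (\<Sum>b\<in>(\<lambda>v. v ^ p) ` V. c b * b)"
      using yz unfolding W_def spanned_def by blast
    have "y * z = (\<Sum>b\<in>(\<lambda>v. v ^ p) ` V. c b * (b * z))" by (simp add: V sum_distrib_left sum_distrib_right mult_ac)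
    also have "\<dots> \<in> W" using V yz by (auto intro!: Wsum Wscale Wpmult)
    finally show ?thesis .
  qed
  have W1: "1 \<in> W" using Wpow[of 1] E by simp
  have "F \<subseteq> W" using Wscale[OF _ W1] by auto
  moreover have "is_subfield W"
  proof (rule is_subfieldI[OF W1 Wadd Wmult])
    fix y assume y: "y \<in> W"
    show "- y \<in> W" using Wscale[of "-1" y] y F by (auto intro: sf_intros)
    assume "y \<noteq> 0"
    \<comment> \<open>An inverse is written as the \<open>p\<close>-th power of
      \<open>inverse y\<close> times \<open>y ^ (p - 1)\<close>: the first factor is a
      \<open>p\<close>-th power from \<open>E\<close>, the second lies in \<open>W\<close>.\<close>
    have "p = Suc (p - 1)" using p by simp
    then have "y ^ p = y * y ^ (p - 1)" by (metis power_Suc)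
    then have eq: "inverse y ^ p * y ^ (p - 1) = inverse y"
      using \<open>y \<noteq> 0\<close> by (simp add: power_inverse field_simps)
    have "y ^ k \<in> W" for k using y by (induction k) (auto intro: W1 Wmult)
    moreover have "inverse y \<in> E" using y WE E by (auto intro: sf_inverse)
    ultimately have "inverse y ^ p * y ^ (p - 1) \<in> W" by (intro Wpmult)
    then show "inverse y \<in> W" by (simp only: eq)
  qed
  moreover have "(\<lambda>s. s ^ p) ` S \<subseteq> W" using Wpow E by auto
  ultimately have "adjoin F ((\<lambda>s. s ^ p) ` S) \<subseteq> W" by (intro adjoin_minimal)
  then have "E \<subseteq> W" unfolding E_def using S(3) \<open>F \<subseteq> W\<close> \<open>is_subfield W\<close> by (intro adjoin_minimal) auto
  have EP: "E \<subseteq> spanned F P"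
  proof
    fix y assume "y \<in> E"
    then obtain V where "V \<subseteq> E" "y \<in> spanned F ((\<lambda>v. v ^ p) ` V)" using \<open>E \<subseteq> W\<close> unfolding W_def by blast
    then show "y \<in> spanned F P" using spanned_min[OF F, of "(\<lambda>v. v ^ p) ` V" P] pow by blast
  qed
  have "finite P" using B by (simp add: P_def)
  have "card P = card B" using least[OF \<open>finite P\<close> EP] B card_image_le[OF B(1), of "\<lambda>b. b ^ p"] by (simp add: P_def)
  then have inj: "inj_on (\<lambda>b. b ^ p) B" using B by (simp add: P_def inj_on_iff_eq_card)
  \<comment> \<open>A nontrivial relation would allow one \<open>p\<close>-th power to be dropped
    from the spanning set \<open>P\<close>, against the minimality of \<open>n\<close>.\<close>
  have indep: "c b0 = 0" if c: "\<forall>b\<in>B. c b \<in> F" "(\<Sum>b\<in>B. c b * b ^ p) = 0" and b0: "b0 \<in> B" for c b0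
  proof (rule ccontr)
    assume nz: "c b0 \<noteq> 0"
    let ?Q = "P - {b0 ^ p}"
    have "c b0 * b0 ^ p + (\<Sum>b\<in>B - {b0}. c b * b ^ p) = 0"
      using c(2) sum.remove[OF B(1) b0, of "\<lambda>b. c b * b ^ p"] by simp
    then have "c b0 * b0 ^ p = - (\<Sum>b\<in>B - {b0}. c b * b ^ p)" by (rule eq_neg_iff_add_eq_0[THEN iffD2])
    then have "b0 ^ p = - (\<Sum>b\<in>B - {b0}. c b * b ^ p) / c b0" using nz by (simp add: field_simps)
    also have "\<dots> = (\<Sum>b\<in>B - {b0}. (- (c b / c b0)) * b ^ p)" by (simp add: sum_divide_distrib sum_negf)
    also have "\<dots> \<in> spanned F ?Q"
    proof (rule spanned_sum[OF F], rule spanned_scale[OF F])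
      fix b assume b: "b \<in> B - {b0}"
      then have "b ^ p \<noteq> b0 ^ p" using inj b0 by (auto simp: inj_on_def)
      then have "b ^ p \<in> ?Q" using b by (auto simp: P_def)
      then show "b ^ p \<in> spanned F ?Q" using spanned_superset[OF F, of ?Q] \<open>finite P\<close> by auto
      show "- (c b / c b0) \<in> F" using c b0 b F by (auto intro!: sf_uminus sf_divide)
    qed
    finally have "b0 ^ p \<in> spanned F ?Q" .
    then have "P \<subseteq> spanned F ?Q" using spanned_superset[OF F, of ?Q] \<open>finite P\<close> by auto
    then have "E \<subseteq> spanned F ?Q" using EP spanned_min[OF F, of P ?Q] by blast
    then have "n \<le> card ?Q" using \<open>finite P\<close> by (intro least) auto
    moreover have "card ?Q < card P" using \<open>finite P\<close> b0 by (intro psubset_card_mono) (auto simp: P_def)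
    ultimately show False using \<open>card P = card B\<close> B by simp
  qed
  have alg: "algebraic_over F x" by (rule algebraic_over_adjoin[OF F S(1,2) x])
  obtain m where m: "is_minpoly F x m" using minpoly_exists[OF F alg] by blast
  have mF: "m \<in> polys_over F" using m by (simp add: is_minpoly_def)
  have "poly (pderiv m) x \<noteq> 0"
  proof
    assume "poly (pderiv m) x = 0"
    then have pd: "pderiv m = 0" by (rule is_minpoly_pderiv[OF F m])
    note dvd = minpoly_pderiv_0_imp_CHAR_dvd[OF pd, folded p_def]
    have "p dvd Polynomial.degree m" using dvd is_minpoly_nz[OF m] by simp
    then obtain N where N: "Polynomial.degree m = p * N" by blast
    define a where "a j = poly.coeff m (p * j)" for j
    have "(0::'a) = poly m x" using m by (simp add: is_minpoly_def)
    also have "\<dots> = (\<Sum>i\<le>p * N. poly.coeff m i * x ^ i)" by (simp add: poly_altdef N)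
    also have "\<dots> = (\<Sum>i\<in>(\<lambda>j. p * j) ` {..N}. poly.coeff m i * x ^ i)"
    proof (rule sum.mono_neutral_right)
      show "\<forall>i\<in>{..p * N} - (\<lambda>j. p * j) ` {..N}. poly.coeff m i * x ^ i = 0"
      proof
        fix i assume i: "i \<in> {..p * N} - (\<lambda>j. p * j) ` {..N}"
        have "\<not> p dvd i"
        proof
          assume "p dvd i"
          then obtain j where "i = p * j" by blast
          then show False using i p by auto
        qed
        then show "poly.coeff m i * x ^ i = 0" using dvd[of i] by auto
      qed
    qed (use p in auto)
    also have "\<dots> = (\<Sum>j\<le>N. a j * x ^ (p * j))"
      using p by (subst sum.reindex) (auto simp: inj_on_def a_def)
    finally have sum0: "(\<Sum>j\<le>N. a j * x ^ (p * j)) = 0" by simp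
    \<comment> \<open>These roots exist in the ambient field but need not lie in \<open>F\<close>,
      so the relation for \<open>x\<close> obtained by extracting \<open>p\<close>-th roots still
      has to be brought down to \<open>F\<close>.\<close>
    have "\<exists>c. c ^ p = a j" for j using nth_root_exists[of p "a j"] p by blast
    then obtain c where c: "\<And>j. c j ^ p = a j" by metis
    have "(\<Sum>j\<le>N. c j * x ^ j) ^ p = (\<Sum>j\<le>N. a j * x ^ (p * j))"
      by (simp add: frob power_mult_distrib c flip: power_mult) (simp add: mult.commute)
    then have c0: "(\<Sum>j\<le>N. c j * x ^ j) = 0" using sum0 p by simp
    have "x ^ j \<in> spanned F B" for j using B sf_power[OF is_subfield_adjoin x, of j] by (auto simp: E_def)
    then have "\<exists>M. (\<forall>b\<in>B. M b \<in> F) \<and> x ^ j = (\<Sum>b\<in>B. M b * b)" for j unfolding spanned_def by blast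
    then obtain M where M: "\<And>j b. b \<in> B \<Longrightarrow> M j b \<in> F" "\<And>j. x ^ j = (\<Sum>b\<in>B. M j b * b)" by metis
    have rel: "(\<Sum>j\<le>N. c j * M j b) = 0" if b: "b \<in> B" for b
    proof -
      have "(\<Sum>b\<in>B. (\<Sum>j\<le>N. c j * M j b) * b) = (\<Sum>j\<le>N. c j * x ^ j)"
        unfolding M(2) sum_distrib_right sum_distrib_left by (subst sum.swap) (simp add: mult_ac)
      then have "(\<Sum>b\<in>B. (\<Sum>j\<le>N. c j * M j b) * b) ^ p = 0" using c0 p by simp
      then have "(\<Sum>b\<in>B. (\<Sum>j\<le>N. a j * M j b ^ p) * b ^ p) = 0"
        by (simp add: frob power_mult_distrib c)
      moreover have "\<forall>b\<in>B. (\<Sum>j\<le>N. a j * M j b ^ p) \<in> F"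
        using mF M F by (auto simp: a_def polys_over_def intro!: sf_sum sf_mult sf_power)
      ultimately have "(\<Sum>j\<le>N. a j * M j b ^ p) = 0" using indep[of "\<lambda>b. \<Sum>j\<le>N. a j * M j b ^ p" b] b by blast
      then have "(\<Sum>j\<le>N. c j * M j b) ^ p = 0" by (simp add: frob power_mult_distrib c)
      then show ?thesis using p by simp
    qed
    \<comment> \<open>Components of the \<open>c j\<close> along a family independent over
      \<open>F\<close>. A component in which \<open>c N\<close> has a nonzero entry gives a relation
      over \<open>F\<close> of degree at most \<open>N\<close>, less than the degree
      \<open>p * N\<close> of \<open>m\<close>.\<close>
    from independent_representation[OF F finite_imageI[OF finite_atMost], of c N] obtain k :: nat and \<gamma> where
      "(\<forall>f. (\<forall>t<k. f t \<in> F) \<and> (\<Sum>t<k. f t * \<gamma> t) = 0 \<longrightarrow> (\<forall>t<k. f t = 0)) \<and>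
       (\<forall>x\<in>c ` {..N}. \<exists>f. (\<forall>t<k. f t \<in> F) \<and> x = (\<Sum>t<k. f t * \<gamma> t))"
      by (elim exE)
    then have ind: "\<And>f. (\<forall>t<k. f t \<in> F) \<Longrightarrow> (\<Sum>t<k. f t * \<gamma> t) = 0 \<Longrightarrow> (\<forall>t<k. f t = 0)"
      and "\<And>j. j \<le> N \<Longrightarrow> \<exists>f. (\<forall>t<k. f t \<in> F) \<and> c j = (\<Sum>t<k. f t * \<gamma> t)"
      by auto
    then have "\<forall>j. \<exists>f. j \<le> N \<longrightarrow> (\<forall>t<k. f t \<in> F) \<and> c j = (\<Sum>t<k. f t * \<gamma> t)" by blast
    from choice[OF this] obtain f where
      rep: "\<And>j. j \<le> N \<Longrightarrow> (\<forall>t<k. f j t \<in> F) \<and> c j = (\<Sum>t<k. f j t * \<gamma> t)" by blast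
    have cN: "c N \<noteq> 0"
    proof
      assume "c N = 0"
      then have "a N = 0" using c[of N] p by (metis zero_power)
      then show False using is_minpoly_nz[OF m] by (simp add: a_def flip: N)
    qed
    have "\<exists>t<k. f N t \<noteq> 0"
    proof (rule ccontr)
      assume "\<not> (\<exists>t<k. f N t \<noteq> 0)"
      then have "(\<Sum>t<k. f N t * \<gamma> t) = 0" by (intro sum.neutral) simp
      then show False using cN rep[of N] by simp
    qed
    then obtain t where t: "t < k" "f N t \<noteq> 0" by blast
    have rel': "(\<Sum>j\<le>N. f j t * M j b) = 0" if b: "b \<in> B" for b
    proof -
      have "(\<Sum>t<k. (\<Sum>j\<le>N. f j t * M j b) * \<gamma> t) = (\<Sum>j\<le>N. (\<Sum>t<k. f j t * \<gamma> t) * M j b)"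
        unfolding sum_distrib_right by (subst sum.swap) (simp add: mult_ac)
      also have "\<dots> = (\<Sum>j\<le>N. c j * M j b)" using rep by simp
      finally have "(\<Sum>t<k. (\<Sum>j\<le>N. f j t * M j b) * \<gamma> t) = 0" using rel[OF b] by simp
      moreover have "\<forall>t<k. (\<Sum>j\<le>N. f j t * M j b) \<in> F" using rep M b F by (auto intro!: sf_sum sf_mult)
      ultimately show ?thesis using ind[of "\<lambda>t. \<Sum>j\<le>N. f j t * M j b"] t by blast
    qed
    have "(\<Sum>j\<le>N. f j t * x ^ j) = (\<Sum>b\<in>B. (\<Sum>j\<le>N. f j t * M j b) * b)"
      unfolding M(2) sum_distrib_right sum_distrib_left by (subst sum.swap) (simp add: mult_ac)
    also have "\<dots> = 0" using rel' by simp
    finally have root: "(\<Sum>j\<le>N. f j t * x ^ j) = 0" .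
    define g where "g = (\<Sum>j\<le>N. Polynomial.monom (f j t) j)"
    have coeff: "poly.coeff g i = (if i \<le> N then f i t else 0)" for i by (simp add: g_def coeff_sum)
    have "g \<in> polys_over F" using rep t F by (auto simp: polys_over_def coeff)
    moreover have "poly g x = 0" using root by (simp add: g_def poly_sum poly_monom)
    ultimately obtain q where q: "g = q * m" using m by (auto simp: is_minpoly_def)
    have "g \<noteq> 0" using coeff[of N] t by auto
    then have "Polynomial.degree m \<le> Polynomial.degree g" using q by (auto simp: degree_mult_eq)
    moreover have "Polynomial.degree g \<le> N" by (rule degree_le) (simp add: coeff)
    moreover have "p \<ge> 2" using prime_ge_2_nat[OF prime] by (simp add: p_def)
    moreover have "N > 0" using is_minpoly_degree_pos[OF m] N by (cases N) auto
    moreover from calculation(3,4) have "1 * N < p * N" by (intro mult_strict_right_mono) auto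
    ultimately show False using N by linarith
  qed
  then show ?thesis using m by (auto simp: separable_over_def is_minpoly_def)
qed

text \<open>Over \<open>F(s^p)\<close> the polynomial \<open>X^p - s^p\<close> is the
  \<open>p\<close>-th power of \<open>X - s\<close>. The minimal polynomial of \<open>s\<close>
  divides it, so \<open>s\<close> is its only root, and a simple one by separability; hence it is
  linear.\<close>

lemma separable_in_adjoin_power:
  fixes F :: "'a::alg_closed_field set"
  assumes F: "is_subfield F" and p: "CHAR('a) > 0" and s: "separable_over F s"
  shows "s \<in> adjoin F {s ^ CHAR('a)}"
proof -
  let ?p = "CHAR('a)"
  let ?G = "adjoin F {s ^ ?p}"
  have prime: "prime ?p" by (rule prime_CHAR_semidom[OF p])
  have G: "is_subfield ?G" "F \<subseteq> ?G" "s ^ ?p \<in> ?G" using adjoin_gen[of "{s ^ ?p}" F] by (simp_all add: adjoin_base)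
  have sG: "separable_over ?G s" by (rule separable_over_mono[OF s G(2)])
  obtain m where m: "is_minpoly ?G s m" using minpoly_exists[OF G(1)] separable_imp_algebraic[OF sG] by blast
  have pd: "poly (pderiv m) s \<noteq> 0" by (rule separable_over_minpoly[OF sG m])
  obtain g where g: "m = [:-s, 1:] * g" using m by (auto simp: is_minpoly_def poly_eq_0_iff_dvd)
  have gs: "poly g s \<noteq> 0" using pd unfolding g pderiv_mult by (simp add: pderiv_pCons)
  define f where "f = Polynomial.monom 1 ?p - [:s ^ ?p:]"
  have "f \<in> polys_over ?G" unfolding f_def
    using G by (intro polys_over_diff polys_over_monom polys_over_pCons) auto
  moreover have "poly f s = 0" by (simp add: f_def poly_monom)
  ultimately obtain q where q: "f = q * m" using m by (auto simp: is_minpoly_def)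
  have root: "a = s" if "poly m a = 0" for a
  proof -
    have "poly f a = 0" using q that by simp
    then have "a ^ ?p = s ^ ?p" by (simp add: f_def poly_monom)
    then have "(a - s) ^ ?p = 0"
      using freshmans_dream[OF prime refl, of "a - s" s] by simp
    then show ?thesis by simp
  qed
  have "Polynomial.degree g = 0"
  proof (rule ccontr)
    assume "Polynomial.degree g \<noteq> 0"
    then obtain a where a: "poly g a = 0" using alg_closed_imp_poly_has_root[of g] by auto
    then have "a = s" using root[of a] g by simp
    then show False using a gs by simp
  qed
  then obtain c where "g = [:c:]" by (auto elim: degree_eq_zeroE)
  then have m': "m = [:- (s * c), c:]" using g by simp
  have "c \<noteq> 0" using \<open>g = [:c:]\<close> gs by auto
  then have "c = 1" using m m' by (simp add: is_minpoly_def)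
  then have "- s \<in> ?G" using m m' unfolding is_minpoly_def polys_over_def by (auto dest: spec[of _ 0])
  then show ?thesis using sf_uminus[OF G(1)] by fastforce
qed

text \<open>In positive characteristic each generator lies in the field generated by its own
  \<open>p\<close>-th power, so \<open>separable_adjoin_CHAR\<close> applies.\<close>

lemma separable_over_adjoin_finite:
  fixes F :: "'a::alg_closed_field set"
  assumes F: "is_subfield F" and S: "finite S" "\<And>s. s \<in> S \<Longrightarrow> separable_over F s" and x: "x \<in> adjoin F S"
  shows "separable_over F x"
proof (cases "CHAR('a) = 0")
  case True
  have "algebraic_over F x" using S separable_imp_algebraic by (intro algebraic_over_adjoin[OF F S(1) _ x]) blast
  then show ?thesis using algebraic_imp_separable_CHAR_0[OF F _ True] by blast
next
  case False
  let ?P = "(\<lambda>s. s ^ CHAR('a)) ` S"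
  have "S \<subseteq> adjoin F ?P"
  proof
    fix s assume s: "s \<in> S"
    then have "s \<in> adjoin F {s ^ CHAR('a)}" using S False by (intro separable_in_adjoin_power[OF F]) auto
    then show "s \<in> adjoin F ?P" using adjoin_mono[of F F "{s ^ CHAR('a)}" ?P] s by auto
  qed
  then show ?thesis using False S separable_imp_algebraic
    by (intro separable_adjoin_CHAR[OF F _ S(1) _ _ x]) auto
qed

lemma is_subfield_separable:
  fixes F :: "'a::alg_closed_field set"
  assumes F: "is_subfield F" shows "is_subfield {x. separable_over F x}"
proof (rule is_subfieldI, goal_cases)
  case 1 show ?case using separable_over_self[OF F] F by simp
next
  case (2 x y)
  have "x + y \<in> adjoin F {x, y}" using adjoin_gen[of "{x,y}" F] by (intro sf_add) auto
  then show ?case using 2 separable_over_adjoin_finite[OF F, of "{x, y}"] by auto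
next
  case (3 x y)
  have "x * y \<in> adjoin F {x, y}" using adjoin_gen[of "{x,y}" F] by (intro sf_mult) auto
  then show ?case using 3 separable_over_adjoin_finite[OF F, of "{x, y}"] by auto
next
  case (4 x)
  have "- x \<in> adjoin F {x}" using adjoin_gen[of "{x}" F] by (intro sf_uminus) auto
  then show ?case using 4 separable_over_adjoin_finite[OF F, of "{x}"] by auto
next
  case (5 x)
  have "inverse x \<in> adjoin F {x}" using adjoin_gen[of "{x}" F] by (intro sf_inverse) auto
  then show ?case using 5 separable_over_adjoin_finite[OF F, of "{x}"] by auto
qed

lemma separable_over_adjoin:
  assumes F: "is_subfield F" and S: "\<And>s. s \<in> S \<Longrightarrow> separable_over F s" and x: "x \<in> adjoin F S"
  shows "separable_over F x"
proof -
  have "adjoin F S \<subseteq> {x. separable_over F x}"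
    using S separable_over_self[OF F] by (intro adjoin_minimal is_subfield_separable F) auto
  then show ?thesis using x by blast
qed

text \<open>In characteristic \<open>p\<close>, let \<open>C\<close> be the finitely many
  coefficients of a polynomial for \<open>x\<close>. These, and then \<open>x\<close> itself, can be
  recovered from \<open>p\<close>-th powers, so \<open>insert x C\<close> satisfies the hypothesis
  of \<open>separable_adjoin_CHAR\<close>.\<close>

lemma separable_over_trans:
  fixes F :: "'a::alg_closed_field set"
  assumes F: "is_subfield F" and x: "separable_over G x" and G: "\<And>y. y \<in> G \<Longrightarrow> separable_over F y"
  shows "separable_over F x"
proof (cases "CHAR('a) = 0")
  case True
  have "algebraic_over F x" using separable_imp_algebraic[OF x] separable_imp_algebraic[OF G]
    by (rule algebraic_over_trans[OF F])
  then show ?thesis using algebraic_imp_separable_CHAR_0[OF F _ True] by blast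
next
  case False
  let ?p = "CHAR('a)"
  obtain f where f: "f \<in> polys_over G" "poly f x = 0" "poly (pderiv f) x \<noteq> 0" using x by (auto simp: separable_over_def)
  obtain C where C: "finite C" "C \<subseteq> G" "f \<in> polys_over (adjoin F C)" using poly_over_finite_coeffs[OF F f(1)] by blast
  have "separable_over (adjoin F C) x" using f C by (auto simp: separable_over_def)
  then have xin: "x \<in> adjoin (adjoin F C) {x ^ ?p}" using False by (intro separable_in_adjoin_power) auto
  define S where "S = insert x C"
  let ?H = "adjoin F ((\<lambda>s. s ^ ?p) ` S)"
  have "C \<subseteq> ?H"
  proof
    fix s assume s: "s \<in> C"
    then have "s \<in> adjoin F {s ^ ?p}" using C G False by (intro separable_in_adjoin_power[OF F]) auto
    then show "s \<in> ?H" using adjoin_mono[of F F "{s ^ ?p}" "(\<lambda>s. s ^ ?p) ` S"] s by (auto simp: S_def)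
  qed
  then have "adjoin F C \<subseteq> ?H" using adjoin_base[of F] by (intro adjoin_minimal) auto
  moreover have "x ^ ?p \<in> ?H" using adjoin_gen[of "(\<lambda>s. s ^ ?p) ` S" F] by (auto simp: S_def)
  ultimately have "adjoin (adjoin F C) {x ^ ?p} \<subseteq> ?H" by (rule_tac adjoin_minimal) simp_all
  then have "S \<subseteq> ?H" using xin \<open>C \<subseteq> ?H\<close> by (auto simp: S_def)
  moreover have "algebraic_over F s" if "s \<in> S" for s
    using that C G separable_imp_algebraic[OF x] separable_imp_algebraic
      algebraic_over_trans[OF F, of G x] by (auto simp: S_def)
  moreover have "x \<in> adjoin F S" using adjoin_gen[of S F] by (auto simp: S_def)
  ultimately show ?thesis using False C by (intro separable_adjoin_CHAR[OF F, of S]) (auto simp: S_def)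
qed

lemma separable_root:
  fixes F :: "'a::alg_closed_field set"
  assumes F: "is_subfield F" and "of_nat n \<noteq> (0::'a)" "z ^ n \<in> F"
  shows "separable_over F z"
proof (cases "z = 0")
  case True
  then show ?thesis using separable_over_self[OF F] F by simp
next
  case False
  let ?f = "Polynomial.monom 1 n - [:z ^ n:]"
  have "?f \<in> polys_over F" using assms by (intro polys_over_diff polys_over_monom polys_over_pCons F) auto
  moreover have "poly ?f z = 0" by (simp add: poly_monom)
  moreover have "poly (pderiv ?f) z \<noteq> 0"
    using assms False by (simp add: pderiv_diff pderiv_monom pderiv_pCons poly_monom)
  ultimately show ?thesis unfolding separable_over_def by blast
qed

subsection \<open>Embeddings\<close>

text \<open>The target is the whole algebraically closed field, so that extensions to algebraic
  elements always exist; values outside \<open>E\<close> carry no meaning.\<close>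

definition embedding :: "'a::alg_closed_field set \<Rightarrow> 'a set \<Rightarrow> ('a \<Rightarrow> 'a) \<Rightarrow> bool" where
  "embedding K E \<tau> \<longleftrightarrow> (\<forall>x\<in>E. \<forall>y\<in>E. \<tau> (x + y) = \<tau> x + \<tau> y \<and> \<tau> (x * y) = \<tau> x * \<tau> y) \<and>
     \<tau> 1 = 1 \<and> (\<forall>x\<in>K. \<tau> x = x)"

context
  fixes K E :: "'a::alg_closed_field set" and \<tau>
  assumes E: "is_subfield E" and \<tau>: "embedding K E \<tau>"
begin

lemma emb_add: "x \<in> E \<Longrightarrow> y \<in> E \<Longrightarrow> \<tau> (x + y) = \<tau> x + \<tau> y"
  and emb_mult: "x \<in> E \<Longrightarrow> y \<in> E \<Longrightarrow> \<tau> (x * y) = \<tau> x * \<tau> y"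
  and emb_1: "\<tau> 1 = 1"
  and emb_fix: "x \<in> K \<Longrightarrow> \<tau> x = x"
  using \<tau> by (auto simp: embedding_def)

lemma emb_0: "\<tau> 0 = 0"
  using emb_add[of 0 0] E by (simp only: sf_0 add_0_right add_cancel_right_right)

lemma emb_uminus: "x \<in> E \<Longrightarrow> \<tau> (- x) = - \<tau> x"
  using emb_add[of x "- x"] E emb_0 by (simp add: sf_uminus eq_neg_iff_add_eq_0 add.commute)

lemma emb_diff: "x \<in> E \<Longrightarrow> y \<in> E \<Longrightarrow> \<tau> (x - y) = \<tau> x - \<tau> y"
  using emb_add[of x "- y"] E by (simp add: sf_uminus emb_uminus)

lemma emb_inverse: "x \<in> E \<Longrightarrow> \<tau> (inverse x) = inverse (\<tau> x)"
proof (cases "x = 0")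
  case False
  assume "x \<in> E"
  then have "\<tau> (inverse x) * \<tau> x = 1" using emb_mult[of "inverse x" x] False E by (simp add: sf_inverse emb_1)
  then show ?thesis by (metis inverse_unique mult.commute)
qed (simp add: emb_0)

lemma emb_eq_0: "x \<in> E \<Longrightarrow> \<tau> x = 0 \<longleftrightarrow> x = 0"
  using emb_mult[of "inverse x" x] E emb_0 emb_1 by (cases "x = 0") (auto simp: sf_inverse)

lemma emb_inj: "x \<in> E \<Longrightarrow> y \<in> E \<Longrightarrow> \<tau> x = \<tau> y \<longleftrightarrow> x = y"
  using emb_eq_0[of "x - y"] emb_diff[of x y] E by (auto simp: sf_diff)

lemma emb_power: "x \<in> E \<Longrightarrow> \<tau> (x ^ n) = \<tau> x ^ n"
  by (induction n) (use E in \<open>auto simp: emb_1 emb_mult sf_power\<close>)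

lemma emb_divide: "x \<in> E \<Longrightarrow> y \<in> E \<Longrightarrow> \<tau> (x / y) = \<tau> x / \<tau> y"
  using E by (simp add: divide_inverse emb_mult emb_inverse sf_inverse)

lemma emb_of_nat: "\<tau> (of_nat n) = of_nat n"
  by (induction n) (use E in \<open>auto simp: emb_0 emb_1 emb_add sf_of_nat\<close>)

lemma emb_sum: "(\<And>i. i \<in> I \<Longrightarrow> f i \<in> E) \<Longrightarrow> \<tau> (sum f I) = (\<Sum>i\<in>I. \<tau> (f i))"
  by (induction I rule: infinite_finite_induct) (use E in \<open>auto simp: emb_0 emb_add sf_sum\<close>)

lemma emb_prod: "(\<And>i. i \<in> I \<Longrightarrow> f i \<in> E) \<Longrightarrow> \<tau> (prod f I) = (\<Prod>i\<in>I. \<tau> (f i))"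
  by (induction I rule: infinite_finite_induct) (use E in \<open>auto simp: emb_1 emb_mult sf_prod\<close>)

lemma emb_poly:
  assumes "p \<in> polys_over E" "x \<in> E"
  shows "\<tau> (poly p x) = poly (map_poly \<tau> p) (\<tau> x)"
proof -
  have deg: "Polynomial.degree (map_poly \<tau> p) \<le> Polynomial.degree p" by (rule degree_le) (simp add: coeff_map_poly emb_0 coeff_eq_0)
  have cm: "\<tau> (poly.coeff p i) = poly.coeff (map_poly \<tau> p) i" for i by (simp add: coeff_map_poly emb_0)
  have "\<tau> (poly p x) = (\<Sum>i\<le>Polynomial.degree p. \<tau> (poly.coeff p i) * \<tau> x ^ i)"
    using assms E by (simp add: poly_altdef emb_sum polys_over_def sf_mult sf_power emb_mult emb_power)
  also have "\<dots> = (\<Sum>i\<le>Polynomial.degree (map_poly \<tau> p). \<tau> (poly.coeff p i) * \<tau> x ^ i)"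
    by (rule sum.mono_neutral_right) (use deg in \<open>auto simp: cm coeff_eq_0\<close>)
  also have "\<dots> = poly (map_poly \<tau> p) (\<tau> x)" by (simp add: poly_altdef coeff_map_poly emb_0)
  finally show ?thesis .
qed

lemma emb_map_poly_add: "p \<in> polys_over E \<Longrightarrow> q \<in> polys_over E \<Longrightarrow> map_poly \<tau> (p + q) = map_poly \<tau> p + map_poly \<tau> q"
  by (rule poly_eqI) (simp add: coeff_map_poly emb_0 emb_add polys_over_def)

lemma emb_map_poly_diff: "p \<in> polys_over E \<Longrightarrow> q \<in> polys_over E \<Longrightarrow> map_poly \<tau> (p - q) = map_poly \<tau> p - map_poly \<tau> q"
  by (rule poly_eqI) (simp add: coeff_map_poly emb_0 emb_diff polys_over_def)

lemma emb_map_poly_mult: "p \<in> polys_over E \<Longrightarrow> q \<in> polys_over E \<Longrightarrow> map_poly \<tau> (p * q) = map_poly \<tau> p * map_poly \<tau> q"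
  by (rule poly_eqI) (use E in \<open>simp add: coeff_map_poly emb_0 coeff_mult emb_sum emb_mult polys_over_def sf_mult\<close>)

lemma emb_map_poly_fix: "p \<in> polys_over K \<Longrightarrow> map_poly \<tau> p = p"
  by (rule poly_eqI) (simp add: coeff_map_poly emb_0 emb_fix polys_over_def)

lemma emb_root: "p \<in> polys_over K \<Longrightarrow> K \<subseteq> E \<Longrightarrow> x \<in> E \<Longrightarrow> poly p x = 0 \<Longrightarrow> poly p (\<tau> x) = 0"
  using emb_poly[of p x] polys_over_mono[of K E] by (auto simp: emb_map_poly_fix emb_0)

lemma embedding_image_adjoin:
  assumes "adjoin F S \<subseteq> E" "is_subfield G" "\<And>x. x \<in> F \<Longrightarrow> \<tau> x \<in> G" "\<And>x. x \<in> S \<Longrightarrow> \<tau> x \<in> G" "x \<in> adjoin F S"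
  shows "\<tau> x \<in> G"
proof -
  have "adjoin F S \<subseteq> {x\<in>E. \<tau> x \<in> G}"
  proof (rule adjoin_minimal)
    show "is_subfield {x\<in>E. \<tau> x \<in> G}"
      by (rule is_subfieldI)
        (use E assms(2) in \<open>auto simp: emb_1 emb_add emb_mult emb_uminus emb_inverse intro: sf_intros\<close>)
  qed (use assms adjoin_base[of F S] adjoin_gen[of S F] in auto)
  then show ?thesis using assms(5) by blast
qed

end

lemma embeddings_agree_adjoin:
  assumes E: "is_subfield E" and \<sigma>: "embedding K E \<sigma>" and \<tau>: "embedding K E \<tau>" and sub: "adjoin F S \<subseteq> E"
    and "\<And>x. x \<in> F \<Longrightarrow> \<sigma> x = \<tau> x" "\<And>x. x \<in> S \<Longrightarrow> \<sigma> x = \<tau> x" "x \<in> adjoin F S"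
  shows "\<sigma> x = \<tau> x"
proof -
  have "adjoin F S \<subseteq> {x\<in>E. \<sigma> x = \<tau> x}"
  proof (rule adjoin_minimal)
    show "is_subfield {x\<in>E. \<sigma> x = \<tau> x}"
      by (rule is_subfieldI)
        (use E in \<open>auto simp: emb_1[OF E \<sigma>] emb_1[OF E \<tau>] emb_add[OF E \<sigma>] emb_add[OF E \<tau>]
          emb_mult[OF E \<sigma>] emb_mult[OF E \<tau>] emb_uminus[OF E \<sigma>] emb_uminus[OF E \<tau>]
          emb_inverse[OF E \<sigma>] emb_inverse[OF E \<tau>] intro: sf_intros\<close>)
  qed (use assms adjoin_base[of F S] adjoin_gen[of S F] in auto)
  then show ?thesis using assms by blast
qed

lemma embedding_id: "embedding K E (\<lambda>x. x)"
  by (simp add: embedding_def)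

lemma embedding_comp:
  assumes "embedding K E \<sigma>" "embedding K L \<tau>" "\<And>x. x \<in> E \<Longrightarrow> \<sigma> x \<in> L"
  shows "embedding K E (\<lambda>x. \<tau> (\<sigma> x))"
  using assms by (auto simp: embedding_def)

lemma embedding_extend_simple:
  fixes E :: "'a::alg_closed_field set"
  assumes E: "is_subfield E" and \<tau>: "embedding K E \<tau>" and m: "is_minpoly E x m"
    and y: "poly (map_poly \<tau> m) y = 0" and KE: "K \<subseteq> E"
  shows "\<exists>\<tau>'. embedding K (adjoin E {x}) \<tau>' \<and> (\<forall>z\<in>E. \<tau>' z = \<tau> z) \<and> \<tau>' x = y"
proof -
  have mE: "m \<in> polys_over E" "poly m x = 0" using m by (auto simp: is_minpoly_def)
  have alg: "algebraic_over E x" using m is_minpoly_nz[OF m] by (auto simp: algebraic_over_def is_minpoly_def)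
  \<comment> \<open>The value at \<open>z\<close> is read off from an arbitrary polynomial
    representing \<open>z\<close>; two choices differ by a multiple of \<open>m\<close>, whose image
    under \<open>\<tau>\<close> vanishes at \<open>y\<close>.\<close>
  define \<tau>' where "\<tau>' z = poly (map_poly \<tau> (SOME p. p \<in> polys_over E \<and> poly p x = z)) y" for z
  have val: "\<tau>' (poly p x) = poly (map_poly \<tau> p) y" if p: "p \<in> polys_over E" for p
  proof -
    define q where "q = (SOME q. q \<in> polys_over E \<and> poly q x = poly p x)"
    have q: "q \<in> polys_over E" "poly q x = poly p x"
      unfolding q_def using someI_ex[of "\<lambda>q. q \<in> polys_over E \<and> poly q x = poly p x"] p by auto
    have "p - q \<in> polys_over E" "poly (p - q) x = 0" using p q by (auto intro: polys_over_diff[OF E])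
    then obtain r where r: "r \<in> polys_over E" "p - q = r * m" using m by (auto simp: is_minpoly_def)
    have "poly (map_poly \<tau> (p - q)) y = 0" by (simp add: r emb_map_poly_mult[OF E \<tau> r(1) mE(1)] y)
    then have "poly (map_poly \<tau> p) y = poly (map_poly \<tau> q) y" by (simp add: emb_map_poly_diff[OF E \<tau> p q(1)])
    then show ?thesis by (simp add: \<tau>'_def q_def)
  qed
  have base: "\<tau>' z = \<tau> z" if "z \<in> E" for z
    using val[of "[:z:]"] that E by (simp add: polys_over_pCons map_poly_pCons emb_0[OF E \<tau>])
  have "embedding K (adjoin E {x}) \<tau>'"
    unfolding embedding_def
  proof (intro conjI ballI)
    fix a b assume "a \<in> adjoin E {x}" "b \<in> adjoin E {x}"
    then obtain p q where pq: "p \<in> polys_over E" "a = poly p x" "q \<in> polys_over E" "b = poly q x"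
      unfolding adjoin_singleton[OF E alg] by blast
    show "\<tau>' (a + b) = \<tau>' a + \<tau>' b" using val[OF polys_over_add[OF E pq(1,3)]] pq
      by (simp add: val emb_map_poly_add[OF E \<tau>])
    show "\<tau>' (a * b) = \<tau>' a * \<tau>' b" using val[OF polys_over_mult[OF E pq(1,3)]] pq
      by (simp add: val emb_map_poly_mult[OF E \<tau>])
  next
    show "\<tau>' 1 = 1" using base[of 1] E emb_1[OF E \<tau>] by simp
    show "\<tau>' z = z" if "z \<in> K" for z using base[of z] that KE emb_fix[OF E \<tau>] by auto
  qed
  moreover have "\<tau>' x = y"
    using val[of "[:0, 1:]"] E by (simp add: polys_over_pCons map_poly_pCons emb_0[OF E \<tau>] emb_1[OF E \<tau>])
  ultimately show ?thesis using base by blast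
qed

lemma embedding_extend:
  fixes E L :: "'a::alg_closed_field set"
  assumes E: "is_subfield E" and L: "is_subfield L" and EL: "E \<subseteq> L"
    and alg: "\<And>x. x \<in> L \<Longrightarrow> algebraic_over E x" and \<tau>: "embedding K E \<tau>" and KE: "K \<subseteq> E"
  shows "\<exists>\<tau>'. embedding K L \<tau>' \<and> (\<forall>z\<in>E. \<tau>' z = \<tau> z)"
proof -
  define good where "good M \<sigma> \<longleftrightarrow> is_subfield M \<and> E \<subseteq> M \<and> M \<subseteq> L \<and> embedding K M \<sigma> \<and> (\<forall>z\<in>E. \<sigma> z = \<tau> z)" for M \<sigma>
  \<comment> \<open>Partial extensions are compared through their graphs: extension becomes
    inclusion, and the meaningless values outside \<open>M\<close> disappear.\<close>
  define graph where "graph M \<sigma> = (\<lambda>x. (x, \<sigma> x)) ` M" for M and \<sigma> :: "'a \<Rightarrow> 'a"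
  define A where "A = {graph M \<sigma> | M \<sigma>. good M \<sigma>}"
  have "\<exists>G\<in>A. \<forall>U\<in>A. G \<subseteq> U \<longrightarrow> U = G"
  proof (rule subset_Zorn_nonempty)
    show "A \<noteq> {}" using E EL \<tau> unfolding A_def good_def by blast
  next
    fix C assume C: "C \<noteq> {}" "subset.chain A C"
    then have CA: "C \<subseteq> A" by (auto simp: subset.chain_def)
    have lin: "U \<subseteq> Y \<or> Y \<subseteq> U" if "U \<in> C" "Y \<in> C" for U Y
      using C(2) that by (auto simp: subset_chain_def)
    have fn: "v = w" if vw: "(x, v) \<in> \<Union>C" "(x, w) \<in> \<Union>C" for x v w
    proof -
      obtain U Y where XY: "U \<in> C" "Y \<in> C" "(x, v) \<in> U" "(x, w) \<in> Y" using vw by blast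
      then obtain Z where "Z \<in> C" "(x, v) \<in> Z" "(x, w) \<in> Z" using lin[of U Y] by blast
      then obtain M \<sigma> where "(x, v) \<in> graph M \<sigma>" "(x, w) \<in> graph M \<sigma>" using CA unfolding A_def by blast
      then show ?thesis by (auto simp: graph_def)
    qed
    define M where "M = Domain (\<Union>C)"
    define \<sigma> where "\<sigma> x = (THE v. (x, v) \<in> \<Union>C)" for x
    have \<sigma>: "\<sigma> x = v" if "(x, v) \<in> \<Union>C" for x v unfolding \<sigma>_def using that fn by (intro the_equality)
    have piece: "\<exists>N \<rho>. graph N \<rho> \<in> C \<and> good N \<rho> \<and> x \<in> N \<and> y \<in> N \<and> N \<subseteq> M \<and> (\<forall>z\<in>N. \<sigma> z = \<rho> z)"
      if xy: "x \<in> M" "y \<in> M" for x y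
    proof -
      obtain v w U Y where "U \<in> C" "Y \<in> C" "(x, v) \<in> U" "(y, w) \<in> Y" using xy unfolding M_def by blast
      then obtain Z where Z: "Z \<in> C" "(x, v) \<in> Z" "(y, w) \<in> Z" using lin[of U Y] by blast
      then obtain N \<rho> where N: "Z = graph N \<rho>" "good N \<rho>" using CA unfolding A_def by blast
      have in_C: "(z, \<rho> z) \<in> \<Union>C" if "z \<in> N" for z using that Z N by (auto simp: graph_def)
      then have "N \<subseteq> M" unfolding M_def by blast
      moreover have "\<forall>z\<in>N. \<sigma> z = \<rho> z" using in_C \<sigma> by blast
      moreover have "x \<in> N" "y \<in> N" using Z N by (auto simp: graph_def)
      ultimately show ?thesis using Z N by blast
    qed
    obtain U where "U \<in> C" using C by blast
    then obtain N0 \<rho>0 where N0: "U = graph N0 \<rho>0" "good N0 \<rho>0" using CA unfolding A_def by blast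
    have in_C0: "(z, \<rho>0 z) \<in> \<Union>C" if "z \<in> N0" for z using that \<open>U \<in> C\<close> N0 by (auto simp: graph_def)
    then have N0M: "N0 \<subseteq> M" unfolding M_def by blast
    have EM: "E \<subseteq> M" using N0 N0M unfolding good_def by blast
    have agree0: "\<forall>z\<in>E. \<sigma> z = \<tau> z" using in_C0 \<sigma> N0 unfolding good_def by (metis subsetD)
    have sf: "is_subfield M"
    proof (rule is_subfieldI)
      show "1 \<in> M" using EM E sf_1 by blast
      fix x y assume "x \<in> M" "y \<in> M"
      then obtain N \<rho> where "good N \<rho>" "x \<in> N" "y \<in> N" "N \<subseteq> M" using piece by blast
      then show "x + y \<in> M" "x * y \<in> M" unfolding good_def by (auto intro: sf_add sf_mult)
    next
      fix x assume "x \<in> M"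
      then obtain N \<rho> where "good N \<rho>" "x \<in> N" "N \<subseteq> M" using piece[of x x] by blast
      then show "- x \<in> M" "inverse x \<in> M" unfolding good_def by (auto intro: sf_uminus sf_inverse)
    qed
    have MsubL: "M \<subseteq> L"
    proof
      fix x assume "x \<in> M"
      then obtain N \<rho> where "good N \<rho>" "x \<in> N" using piece[of x x] by blast
      then show "x \<in> L" unfolding good_def by blast
    qed
    have "embedding K M \<sigma>"
      unfolding embedding_def
    proof (intro conjI ballI)
      fix x y assume "x \<in> M" "y \<in> M"
      then obtain N \<rho> where N: "good N \<rho>" "x \<in> N" "y \<in> N" "\<forall>z\<in>N. \<sigma> z = \<rho> z" using piece by blast
      then have N': "is_subfield N" "embedding K N \<rho>" unfolding good_def by auto
      show "\<sigma> (x + y) = \<sigma> x + \<sigma> y" "\<sigma> (x * y) = \<sigma> x * \<sigma> y"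
        using N emb_add[OF N' N(2,3)] emb_mult[OF N' N(2,3)] sf_add[OF N'(1) N(2,3)] sf_mult[OF N'(1) N(2,3)] by auto
    next
      show "\<sigma> 1 = 1" using agree0 E emb_1[OF E \<tau>] by simp
      show "\<sigma> z = z" if "z \<in> K" for z using agree0 that KE emb_fix[OF E \<tau>] by auto
    qed
    then have "good M \<sigma>" unfolding good_def using sf EM MsubL agree0 by blast
    moreover have "\<Union>C = graph M \<sigma>"
    proof
      show "\<Union>C \<subseteq> graph M \<sigma>"
      proof
        fix a assume a: "a \<in> \<Union>C"
        obtain x v where "a = (x, v)" by (cases a)
        then show "a \<in> graph M \<sigma>" using a \<sigma>[of x v] unfolding graph_def M_def by (intro image_eqI[of _ _ x]) auto
      qed
      show "graph M \<sigma> \<subseteq> \<Union>C"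
        unfolding graph_def M_def using \<sigma> by auto
    qed
    ultimately show "\<Union>C \<in> A" unfolding A_def by blast
  qed
  then obtain U0 where U0: "U0 \<in> A" "\<forall>U\<in>A. U0 \<subseteq> U \<longrightarrow> U = U0" by (elim bexE)
  from U0(1) obtain M \<sigma> where M: "good M \<sigma>" "U0 = graph M \<sigma>" unfolding A_def by (elim CollectE exE conjE)
  have max: "U = graph M \<sigma>" if "U \<in> A" "graph M \<sigma> \<subseteq> U" for U
    using U0(2) that unfolding M(2) by simp
  have M': "is_subfield M" "E \<subseteq> M" "M \<subseteq> L" "embedding K M \<sigma>" "\<forall>z\<in>E. \<sigma> z = \<tau> z" using M(1) unfolding good_def by simp_all
  have "L \<subseteq> M"
  proof (rule ccontr)
    assume "\<not> L \<subseteq> M"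
    then obtain x where x: "x \<in> L" "x \<notin> M" by blast
    have "algebraic_over M x" using alg[OF x(1)] M'(2) by (rule algebraic_over_mono)
    then obtain m where m: "is_minpoly M x m" using minpoly_exists[OF M'(1)] by blast
    have "poly.coeff (map_poly \<sigma> m) (Polynomial.degree m) = 1"
      using m emb_1[OF M'(1,4)] by (simp add: coeff_map_poly emb_0[OF M'(1,4)] is_minpoly_def)
    then have "Polynomial.degree m \<le> Polynomial.degree (map_poly \<sigma> m)" by (intro le_degree) simp
    then obtain y where y: "poly (map_poly \<sigma> m) y = 0"
      using alg_closed_imp_poly_has_root[of "map_poly \<sigma> m"] is_minpoly_degree_pos[OF m] by auto
    obtain \<sigma>' where \<sigma>': "embedding K (adjoin M {x}) \<sigma>'" "\<forall>z\<in>M. \<sigma>' z = \<sigma> z"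
      using embedding_extend_simple[OF M'(1,4) m y] KE M' by blast
    have "adjoin M {x} \<subseteq> L" using M' x L by (intro adjoin_minimal) auto
    moreover have MM: "M \<subseteq> adjoin M {x}" by (rule adjoin_base)
    ultimately have "good (adjoin M {x}) \<sigma>'" unfolding good_def using \<sigma>' M' by auto
    then have "graph (adjoin M {x}) \<sigma>' \<in> A" unfolding A_def by blast
    moreover have "graph M \<sigma> \<subseteq> graph (adjoin M {x}) \<sigma>'" unfolding graph_def using \<sigma>' MM by force
    ultimately have "graph (adjoin M {x}) \<sigma>' = graph M \<sigma>" by (rule max)
    moreover have dom: "fst ` graph N \<rho> = N" for N \<rho> by (simp add: graph_def image_image)
    ultimately have "adjoin M {x} = M" using dom[of "adjoin M {x}" \<sigma>'] dom[of M \<sigma>] by simp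
    then show False using adjoin_gen[of "{x}" M] x by blast
  qed
  then show ?thesis using M' by (metis subset_antisym)
qed

subsection \<open>Galois extensions\<close>

lemma conjugate_embedding:
  fixes F L :: "'a::alg_closed_field set"
  assumes F: "is_subfield F" and L: "is_subfield L" and FL: "F \<subseteq> L"
    and alg: "\<And>x. x \<in> L \<Longrightarrow> algebraic_over F x"
    and x: "x \<in> L" and m: "is_minpoly F x m" and y: "poly m y = 0"
  shows "\<exists>\<tau>. embedding F L \<tau> \<and> \<tau> x = y"
proof -
  have "map_poly (\<lambda>x. x) m = m" by (rule map_poly_idI) simp
  then obtain \<tau> where \<tau>: "embedding F (adjoin F {x}) \<tau>" "\<tau> x = y"
    using embedding_extend_simple[OF F embedding_id[of F F] m, of y] y by auto
  have sub: "adjoin F {x} \<subseteq> L" using FL x by (rule_tac adjoin_minimal[OF L]) auto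
  have "algebraic_over (adjoin F {x}) z" if "z \<in> L" for z
    using alg[OF that] adjoin_base by (rule algebraic_over_mono)
  then obtain \<tau>' where "embedding F L \<tau>'" "\<forall>z\<in>adjoin F {x}. \<tau>' z = \<tau> z"
    using embedding_extend[OF is_subfield_adjoin L sub _ \<tau>(1) adjoin_base] by blast
  moreover have "x \<in> adjoin F {x}" using adjoin_gen by blast
  ultimately show ?thesis using \<tau> by auto
qed

lemma galois_extD:
  assumes "galois_ext K L"
  shows "is_subfield K" "is_subfield L" "K \<subseteq> L"
    and "\<And>x. x \<in> L \<Longrightarrow> separable_over K x" "\<And>x. x \<in> L \<Longrightarrow> algebraic_over K x"
    and "\<And>x m y. x \<in> L \<Longrightarrow> is_minpoly K x m \<Longrightarrow> poly m y = 0 \<Longrightarrow> y \<in> L"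
proof -
  show K: "is_subfield K" and "is_subfield L" "K \<subseteq> L" using assms by (auto simp: galois_ext_def subfield_ambient_iff)
  show sep: "\<And>x. x \<in> L \<Longrightarrow> separable_over K x"
    using assms by (simp add: galois_ext_def separable_algebraic_ext_iff[OF K])
  then show "\<And>x. x \<in> L \<Longrightarrow> algebraic_over K x" using separable_imp_algebraic by blast
  show "y \<in> L" if "x \<in> L" "is_minpoly K x m" "poly m y = 0" for x m y
  proof -
    have "irreducible_over K m" "poly m x = 0" using that is_minpoly_irreducible[OF K] by (auto simp: is_minpoly_def)
    then show ?thesis using assms that unfolding galois_ext_def normal_ext_def by blast
  qed
qed

lemma galois_embedding_image:
  assumes L: "galois_ext K L" and \<tau>: "embedding K L \<tau>" and x: "x \<in> L"
  shows "\<tau> x \<in> L"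
proof -
  note D = galois_extD[OF L]
  obtain m where m: "is_minpoly K x m" using minpoly_exists[OF D(1) D(5)[OF x]] by blast
  then have "poly m (\<tau> x) = 0" using emb_root[OF D(2) \<tau> _ D(3) x] by (auto simp: is_minpoly_def)
  then show ?thesis using D(6)[OF x m] by blast
qed

lemma galois_group_embedding: "\<tau> \<in> galois_group K L \<Longrightarrow> embedding K L \<tau>"
  by (auto simp: galois_group_def ring_iso_def ring_hom_def embedding_def)

text \<open>An embedding of a Galois extension into the ambient field permutes the finite set of
  roots of each minimal polynomial, which makes it surjective onto \<open>L\<close>.\<close>

lemma galois_group_iff:
  assumes L: "galois_ext K L"
  shows "\<tau> \<in> galois_group K L \<longleftrightarrow> embedding K L \<tau>"
proof
  assume \<tau>: "embedding K L \<tau>"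
  note D = galois_extD[OF L]
  have inj: "inj_on \<tau> L" using emb_inj[OF D(2) \<tau>] by (auto simp: inj_on_def)
  have im: "\<tau> ` L \<subseteq> L" using galois_embedding_image[OF L \<tau>] by blast
  have "x \<in> \<tau> ` L" if x: "x \<in> L" for x
  proof -
    obtain m where m: "is_minpoly K x m" using minpoly_exists[OF D(1) D(5)[OF x]] by blast
    let ?R = "{y. poly m y = 0}"
    have RL: "?R \<subseteq> L" using D(6)[OF x m] by blast
    have fin: "finite ?R" using poly_roots_finite[OF is_minpoly_nz[OF m]] .
    have "\<tau> ` ?R \<subseteq> ?R" using emb_root[OF D(2) \<tau> _ D(3)] m RL by (auto simp: is_minpoly_def)
    moreover have "inj_on \<tau> ?R" using inj RL by (rule inj_on_subset)
    ultimately have "\<tau> ` ?R = ?R" using fin by (simp add: endo_inj_surj)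
    then have "x \<in> \<tau> ` ?R" using m by (auto simp: is_minpoly_def)
    then show ?thesis using RL by blast
  qed
  then have "bij_betw \<tau> L L" using inj im by (auto simp: bij_betw_def)
  then show "\<tau> \<in> galois_group K L"
    using \<tau> im by (auto simp: galois_group_def ring_iso_def ring_hom_def embedding_def)
qed (rule galois_group_embedding)

text \<open>Since \<open>x\<close> is separable over \<open>F\<close> and outside \<open>F\<close>,
  its minimal polynomial over \<open>F\<close> has a second root, to which an embedding fixing
  \<open>F\<close> moves \<open>x\<close>.\<close>

lemma galois_fixed:
  assumes L: "galois_ext K L" and F: "is_subfield F" "K \<subseteq> F" "F \<subseteq> L" and x: "x \<in> L" "x \<notin> F"
  shows "\<exists>\<tau>\<in>galois_group K L. (\<forall>y\<in>F. \<tau> y = y) \<and> \<tau> x \<noteq> x"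
proof -
  note D = galois_extD[OF L]
  have sep: "separable_over F x" by (rule separable_over_mono[OF D(4)[OF x(1)] F(2)])
  obtain m where m: "is_minpoly F x m" using minpoly_exists[OF F(1) separable_imp_algebraic[OF sep]] by blast
  have pd: "poly (pderiv m) x \<noteq> 0" by (rule separable_over_minpoly[OF sep m])
  obtain g where g: "m = [:-x, 1:] * g" using m by (auto simp: is_minpoly_def poly_eq_0_iff_dvd)
  have gx: "poly g x \<noteq> 0" using pd unfolding g pderiv_mult by (simp add: pderiv_pCons)
  have "Polynomial.degree g \<noteq> 0"
  proof
    assume "Polynomial.degree g = 0"
    then obtain c where c: "g = [:c:]" by (auto elim: degree_eq_zeroE)
    then have m': "m = [:- (x * c), c:]" using g by simp
    have "c \<noteq> 0" using c gx by auto
    then have "c = 1" using m m' by (simp add: is_minpoly_def)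
    then have "- x \<in> F" using m m' unfolding is_minpoly_def polys_over_def by (auto dest: spec[of _ 0])
    then show False using sf_uminus[OF F(1)] x by fastforce
  qed
  then obtain y where y: "poly g y = 0" using alg_closed_imp_poly_has_root[of g] by auto
  have alg: "\<And>z. z \<in> L \<Longrightarrow> algebraic_over F z" using algebraic_over_mono[OF D(5) F(2)] .
  have "poly m y = 0" using y g by simp
  then obtain \<tau> where \<tau>: "embedding F L \<tau>" "\<tau> x = y"
    using conjugate_embedding[OF F(1) D(2) F(3) alg x(1) m] by blast
  then have "embedding K L \<tau>" using F(2) by (auto simp: embedding_def)
  moreover have "y \<noteq> x" using y gx by auto
  ultimately show ?thesis using \<tau> by (auto simp: galois_group_iff[OF L] embedding_def)
qed

text \<open>Conjugate elements are related by an embedding of the whole field, and an embedding that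
  keeps the generators inside keeps everything inside; this gives normality.\<close>

lemma galois_extI:
  assumes K: "is_subfield K" and Z: "\<And>z. z \<in> Z \<Longrightarrow> separable_over K z"
    and emb: "\<And>\<tau> z. embedding K (adjoin K Z) \<tau> \<Longrightarrow> z \<in> Z \<Longrightarrow> \<tau> z \<in> adjoin K Z"
  shows "galois_ext K (adjoin K Z)"
proof -
  let ?E = "adjoin K Z"
  have sep: "separable_over K x" if "x \<in> ?E" for x using separable_over_adjoin[OF K Z that] .
  then have alg: "algebraic_over K x" if "x \<in> ?E" for x using that separable_imp_algebraic by blast
  have E: "is_subfield ?E" "K \<subseteq> ?E" by (simp_all add: adjoin_base)
  have "y \<in> ?E" if f: "irreducible_over K f" "x \<in> ?E" "poly f x = 0" "poly f y = 0" for f x y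
  proof -
    obtain m c where m: "is_minpoly K x m" "f = Polynomial.smult c m" "c \<noteq> 0"
      using irreducible_over_minpoly[OF K f(1,3)] by blast
    then obtain \<tau> where \<tau>: "embedding K ?E \<tau>" "\<tau> x = y"
      using conjugate_embedding[OF K E alg f(2) m(1), of y] f(4) by auto
    have "\<tau> x \<in> ?E" using embedding_image_adjoin[OF E(1) \<tau>(1) subset_refl E(1) _ _ f(2)] emb[OF \<tau>(1)] emb_fix[OF E(1) \<tau>(1)] E
      by auto
    then show ?thesis using \<tau> by simp
  qed
  then show ?thesis
    unfolding galois_ext_def normal_ext_def algebraic_ext_def subfield_ambient_iff separable_algebraic_ext_iff[OF K]
    using K E sep alg unfolding algebraic_over_def by blast
qed

lemma abelian_extI:
  assumes K: "is_subfield K" and Z: "\<And>z. z \<in> Z \<Longrightarrow> separable_over K z"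
    and emb: "\<And>\<tau> z. embedding K (adjoin K Z) \<tau> \<Longrightarrow> z \<in> Z \<Longrightarrow> \<tau> z \<in> adjoin K Z"
    and comm: "\<And>\<sigma> \<tau> z. embedding K (adjoin K Z) \<sigma> \<Longrightarrow> embedding K (adjoin K Z) \<tau> \<Longrightarrow> z \<in> Z \<Longrightarrow> \<sigma> (\<tau> z) = \<tau> (\<sigma> z)"
  shows "abelian_ext K (adjoin K Z)"
  unfolding abelian_ext_def
proof (intro conjI ballI)
  let ?E = "adjoin K Z"
  show gal: "galois_ext K ?E" by (rule galois_extI[OF K]) (fact Z, fact emb)
  fix \<sigma> \<tau> x assume "\<sigma> \<in> galois_group K ?E" "\<tau> \<in> galois_group K ?E" and x: "x \<in> ?E"
  then have \<sigma>: "embedding K ?E \<sigma>" and \<tau>: "embedding K ?E \<tau>" by (auto intro: galois_group_embedding)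
  have E: "is_subfield ?E" by simp
  show "\<sigma> (\<tau> x) = \<tau> (\<sigma> x)"
  proof (rule embeddings_agree_adjoin[OF E _ _ subset_refl _ _ x])
    show "embedding K ?E (\<lambda>x. \<sigma> (\<tau> x))" "embedding K ?E (\<lambda>x. \<tau> (\<sigma> x))"
      using embedding_comp[OF \<tau> \<sigma>] embedding_comp[OF \<sigma> \<tau>] galois_embedding_image[OF gal \<sigma>] galois_embedding_image[OF gal \<tau>] by blast+
  qed (use comm[OF \<sigma> \<tau>] emb_fix[OF E \<sigma>] emb_fix[OF E \<tau>] in auto)
qed

lemma abelian_ext_subset_max: "abelian_ext K L \<Longrightarrow> L \<subseteq> max_abelian_ext K"
  unfolding max_abelian_ext_def using adjoin_gen[of "\<Union>{L. abelian_ext K L}" K] by blast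

lemma is_subfield_max_abelian_ext: "is_subfield (max_abelian_ext K)"
  by (simp add: max_abelian_ext_def)

lemma subset_max_abelian_ext: "K \<subseteq> max_abelian_ext K"
  by (simp add: max_abelian_ext_def adjoin_base)

lemma embedding_mono: "embedding K E \<tau> \<Longrightarrow> K' \<subseteq> K \<Longrightarrow> E' \<subseteq> E \<Longrightarrow> embedding K' E' \<tau>"
  unfolding embedding_def by (meson subsetD)

text \<open>An embedding of the compositum over \<open>K\<close> is determined by its restriction to
  \<open>L\<close>, which lies in the abelian Galois group of \<open>L\<close> over
  \<open>K0\<close>.\<close>

lemma abelian_ext_base_change:
  assumes K: "is_subfield K" and K0K: "K0 \<subseteq> K" and L: "abelian_ext K0 L"
  shows "abelian_ext K (adjoin K L)"
proof -
  have gal: "galois_ext K0 L" using L by (simp add: abelian_ext_def)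
  note D = galois_extD[OF gal]
  let ?E = "adjoin K L"
  have LE: "L \<subseteq> ?E" by (rule adjoin_gen)
  have restr: "embedding K0 L \<tau>" if "embedding K ?E \<tau>" for \<tau>
    using that K0K LE by (rule embedding_mono)
  show ?thesis
  proof (rule abelian_extI[OF K])
    show "separable_over K z" if "z \<in> L" for z using D(4)[OF that] K0K by (rule separable_over_mono)
    show "\<tau> z \<in> ?E" if "embedding K ?E \<tau>" "z \<in> L" for \<tau> z
      using galois_embedding_image[OF gal restr[OF that(1)] that(2)] LE by blast
    show "\<sigma> (\<tau> z) = \<tau> (\<sigma> z)" if "embedding K ?E \<sigma>" "embedding K ?E \<tau>" "z \<in> L" for \<sigma> \<tau> z
      using L restr[OF that(1)] restr[OF that(2)] that(3) galois_group_iff[OF gal] unfolding abelian_ext_def by blast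
  qed
qed

lemma adjoin_max_abelian_ext_subset:
  assumes K: "is_subfield K" and K0K: "K0 \<subseteq> K"
  shows "adjoin (max_abelian_ext K0) K \<subseteq> max_abelian_ext K"
proof (rule adjoin_minimal[OF is_subfield_max_abelian_ext _ subset_max_abelian_ext])
  have "L \<subseteq> max_abelian_ext K" if "abelian_ext K0 L" for L
    using abelian_ext_subset_max[OF abelian_ext_base_change[OF K K0K that]] adjoin_gen[of L K] by blast
  then show "max_abelian_ext K0 \<subseteq> max_abelian_ext K"
    unfolding max_abelian_ext_def[of K0] using K0K subset_max_abelian_ext[of K]
    by (rule_tac adjoin_minimal[OF is_subfield_max_abelian_ext]) auto
qed

subsection \<open>Reduction to cyclic extensions of prime power degree\<close>

context
  fixes K E :: "'a::alg_closed_field set" and \<tau>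
  assumes E: "is_subfield E" and \<tau>: "embedding K E \<tau>"
begin

lemma emb_map_poly_prod:
  assumes "\<And>i. i \<in> I \<Longrightarrow> f i \<in> polys_over E"
  shows "map_poly \<tau> (prod f I) = (\<Prod>i\<in>I. map_poly \<tau> (f i))"
  using assms
proof (induction I rule: infinite_finite_induct)
  case (insert i I)
  then show ?case by (simp add: emb_map_poly_mult[OF E \<tau>] polys_over_prod[OF E])
qed (simp_all add: emb_1[OF E \<tau>])

lemma root_product_fixed:
  assumes "finite B" "B \<subseteq> E" "\<tau> ` B \<subseteq> B"
  shows "map_poly \<tau> (\<Prod>b\<in>B. [:-b, 1:]) = (\<Prod>b\<in>B. [:-b, 1:])"
proof -
  have inj: "inj_on \<tau> B" using emb_inj[OF E \<tau>] assms(2) by (auto simp: inj_on_def)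
  have "map_poly \<tau> (\<Prod>b\<in>B. [:-b, 1:]) = (\<Prod>b\<in>B. map_poly \<tau> [:-b, 1:])"
    by (rule emb_map_poly_prod) (use assms E in \<open>auto intro!: polys_over_pCons sf_uminus\<close>)
  also have "\<dots> = (\<Prod>b\<in>B. [:- \<tau> b, 1:])"
    by (rule prod.cong) (use assms E in \<open>auto simp: map_poly_pCons emb_0[OF E \<tau>] emb_1[OF E \<tau>] emb_uminus[OF E \<tau>]\<close>)
  also have "\<dots> = (\<Prod>b\<in>\<tau> ` B. [:- b, 1:])" using inj by (simp add: prod.reindex)
  also have "\<tau> ` B = B" using assms inj by (simp add: endo_inj_surj)
  finally show ?thesis .
qed

end

lemma root_product_polys_over:
  assumes "is_subfield E" "B \<subseteq> E" shows "(\<Prod>b\<in>B. [:-b, 1:]) \<in> polys_over E"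
  using assms by (auto intro!: polys_over_prod polys_over_pCons sf_uminus)

text \<open>Every element returns after at most \<open>card R\<close> steps, and that number divides
  the factorial; one exponent thus serves all points and all automorphisms.\<close>

lemma inj_on_finite_periodic:
  assumes "finite R" "inj_on f R" "f ` R \<subseteq> R" "\<rho> \<in> R"
  shows "(f ^^ fact (card R)) \<rho> = \<rho>"
proof -
  have mem: "(f ^^ i) \<rho> \<in> R" for i using assms by (induction i) auto
  have "\<not> inj_on (\<lambda>i. (f ^^ i) \<rho>) {..card R}"
  proof
    assume "inj_on (\<lambda>i. (f ^^ i) \<rho>) {..card R}"
    then have "card {..card R} \<le> card R" using mem assms(1) by (intro card_inj_on_le) auto
    then show False by simp
  qed
  then obtain i j where "i \<le> card R" "j \<le> card R" "i \<noteq> j" "(f ^^ i) \<rho> = (f ^^ j) \<rho>"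
    by (auto simp: inj_on_def)
  then obtain i j where ij: "i < j" "j \<le> card R" "(f ^^ i) \<rho> = (f ^^ j) \<rho>"
    by (metis linorder_neq_iff)
  have "i \<le> j \<Longrightarrow> (f ^^ i) \<rho> = (f ^^ j) \<rho> \<Longrightarrow> (f ^^ (j - i)) \<rho> = \<rho>" for i j
  proof (induction i arbitrary: j)
    case (Suc i)
    then obtain j' where j': "j = Suc j'" by (cases j) auto
    then have "(f ^^ i) \<rho> = (f ^^ j') \<rho>" using Suc.prems mem[of i] mem[of j'] assms(2) by (auto simp: inj_on_def)
    then show ?case using Suc j' by simp
  qed simp
  then have k: "(f ^^ (j - i)) \<rho> = \<rho>" using ij by simp
  have "(f ^^ ((j - i) * c)) \<rho> = \<rho>" for c
    by (induction c) (simp_all add: k funpow_add)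
  moreover have "j - i dvd fact (card R)" using ij by (intro dvd_fact) auto
  ultimately show ?thesis by auto
qed

lemma sum_cyclic_shift:
  fixes g :: "nat \<Rightarrow> 'b::comm_monoid_add"
  assumes "g n = g 0" shows "(\<Sum>i<n. g (Suc i)) = (\<Sum>i<n. g i)"
proof (cases n)
  case (Suc m)
  have "(\<Sum>i<n. g (Suc i)) = (\<Sum>i<m. g (Suc i)) + g n" by (simp add: Suc)
  also have "\<dots> = (\<Sum>i<Suc m. g i)" unfolding assms by (simp only: sum.lessThan_Suc_shift add.commute)
  also have "\<dots> = (\<Sum>i<n. g i)" by (simp add: Suc)
  finally show ?thesis .
qed simp

lemma sum_powers_root_of_unity:
  fixes w :: "'b::field"
  assumes "w ^ n = 1" "w \<noteq> 1" shows "(\<Sum>j<n. w ^ j) = 0"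
  using geometric_sum[OF assms(2), of n] assms(1) by simp

text \<open>The Galois group may be infinite and is never decomposed. If some
  \<open>\<theta>\<close> lies outside \<open>\<Omega>\<close>, an automorphism fixing
  \<open>\<Omega> \<inter> L\<close> moves it, and complex functions on the finite orbit of
  \<open>\<theta>\<close> supply a character that detects this automorphism. A suitable power of the
  character has values of order a power of a prime \<open>l\<close>; the elements fixed by its
  kernel are handled by \<open>cyc\<close>.\<close>

lemma abelian_reduction:
  fixes K L \<Omega> :: "'a::alg_closed_field set"
  assumes L: "abelian_ext K L" and \<Omega>: "is_subfield \<Omega>" "K \<subseteq> \<Omega>"
    and cyc: "\<And>\<sigma> (l::nat) a x. prime l \<Longrightarrow> \<sigma> \<in> galois_group K L \<Longrightarrow> x \<in> L \<Longrightarrow> (\<sigma> ^^ (l ^ a)) x = x \<Longrightarrow>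
      (\<forall>\<tau>\<in>galois_group K L. \<exists>i. \<tau> x = (\<sigma> ^^ i) x) \<Longrightarrow> x \<in> \<Omega>"
  shows "L \<subseteq> \<Omega>"
proof
  fix \<theta> assume \<theta>: "\<theta> \<in> L"
  show "\<theta> \<in> \<Omega>"
  proof (rule ccontr)
    assume "\<theta> \<notin> \<Omega>"
    let ?G = "galois_group K L"
    have gal: "galois_ext K L" using L by (simp add: abelian_ext_def)
    note D = galois_extD[OF gal]
    have comm: "\<sigma> (\<tau> x) = \<tau> (\<sigma> x)" if "\<sigma> \<in> ?G" "\<tau> \<in> ?G" "x \<in> L" for \<sigma> \<tau> x
      using L that by (simp add: abelian_ext_def)
    have emb: "embedding K L \<tau>" if "\<tau> \<in> ?G" for \<tau> using that by (rule galois_group_embedding)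
    have im: "\<tau> x \<in> L" if "\<tau> \<in> ?G" "x \<in> L" for \<tau> x using galois_embedding_image[OF gal emb[OF that(1)] that(2)] .
    have comp: "(\<lambda>x. \<sigma> (\<tau> x)) \<in> ?G" if "\<sigma> \<in> ?G" "\<tau> \<in> ?G" for \<sigma> \<tau>
      using embedding_comp[OF emb[OF that(2)] emb[OF that(1)]] im that by (simp add: galois_group_iff[OF gal])
    have id: "(\<lambda>x. x) \<in> ?G" by (simp add: galois_group_iff[OF gal] embedding_id)
    have pow: "(\<tau> ^^ i) \<in> ?G" if "\<tau> \<in> ?G" for \<tau> i
    proof (induction i)
      case 0 show ?case using id by (simp add: id_def)
    next
      case (Suc i) show ?case using comp[OF that Suc] by (simp add: comp_def)
    qed
    obtain \<tau>0 where \<tau>0: "\<tau>0 \<in> ?G" "\<And>y. y \<in> \<Omega> \<inter> L \<Longrightarrow> \<tau>0 y = y" "\<tau>0 \<theta> \<noteq> \<theta>"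
      using galois_fixed[OF gal is_subfield_Int[OF \<Omega>(1) D(2)] _ _ \<theta>] \<Omega>(2) D(3) \<open>\<theta> \<notin> \<Omega>\<close> by blast
    define R where "R = (\<lambda>\<tau>. \<tau> \<theta>) ` ?G"
    have RL: "R \<subseteq> L" using im \<theta> by (auto simp: R_def)
    have \<theta>R: "\<theta> \<in> R" using id by (force simp: R_def)
    obtain m where m: "is_minpoly K \<theta> m" using minpoly_exists[OF D(1) D(5)[OF \<theta>]] by blast
    have "R \<subseteq> {y. poly m y = 0}"
      using emb_root[OF D(2) emb _ D(3) \<theta>] m by (auto simp: R_def is_minpoly_def)
    then have finR: "finite R" using poly_roots_finite[OF is_minpoly_nz[OF m]] by (rule finite_subset)
    have GR: "\<tau> ` R \<subseteq> R" if "\<tau> \<in> ?G" for \<tau> using comp[OF that] by (force simp: R_def)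
    define n where "n = (fact (card R) :: nat)"
    have n: "n > 0" by (simp add: n_def)
    have per: "(\<tau> ^^ n) \<rho> = \<rho>" if \<tau>: "\<tau> \<in> ?G" and \<rho>: "\<rho> \<in> R" for \<tau> \<rho>
    proof -
      have "inj_on \<tau> R" using emb_inj[OF D(2) emb[OF \<tau>]] RL unfolding inj_on_def by blast
      then show ?thesis unfolding n_def by (rule inj_on_finite_periodic[OF finR _ GR[OF \<tau>] \<rho>])
    qed
    \<comment> \<open>Only finitely many permutations of the finite orbit \<open>R\<close> occur;
      \<open>T0\<close> represents them.\<close>
    obtain T0 where T0: "T0 \<subseteq> ?G" "finite T0" "(\<lambda>\<tau>. restrict \<tau> R) ` ?G = (\<lambda>\<tau>. restrict \<tau> R) ` T0"
    proof -
      have "(\<lambda>\<tau>. restrict \<tau> R) ` ?G \<subseteq> R \<rightarrow>\<^sub>E R" using GR by fastforce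
      then have "finite ((\<lambda>\<tau>. restrict \<tau> R) ` ?G)" using finR finite_PiE[of R "\<lambda>_. R"] finite_subset by blast
      then show ?thesis using finite_subset_image[OF _ subset_refl] that by metis
    qed
    \<comment> \<open>Simultaneous eigenfunctions of \<open>T\<close> in the permutation
      representation on \<open>R\<close>.\<close>
    define eig where "eig T h \<longleftrightarrow> (\<forall>a\<in>T. \<exists>c. \<forall>\<rho>\<in>R. h (a \<rho>) = c * h \<rho>)" for T and h :: "'a \<Rightarrow> complex"
    define w where "w = cis (2 * pi / n)"
    have wpow: "w ^ j = cis (2 * pi * j / n)" for j by (simp add: w_def DeMoivre mult_ac)
    have wn: "w ^ n = 1" using n by (simp add: wpow)
    have w1: "w ^ i \<noteq> 1" if "0 < i" "i < n" for i
      using bij_betw_roots_unity[OF n] that n wpow unfolding bij_betw_def inj_on_def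
      by (metis (no_types, lifting) lessThan_iff mult_zero_right of_nat_0 power_0 less_irrefl)
    \<comment> \<open>Commuting operators of finite order over the complex numbers are
      simultaneously diagonalizable: if \<open>\<tau>0\<close> fixed all joint eigenfunctions, it
      would fix all functions. The induction drops one operator at a time.\<close>
    have descend: "(\<forall>h :: 'a \<Rightarrow> complex. \<forall>\<rho>\<in>R. h (\<tau>0 \<rho>) = h \<rho>)"
      if "finite T" "T \<subseteq> ?G" "\<And>h. eig T h \<Longrightarrow> \<forall>\<rho>\<in>R. h (\<tau>0 \<rho>) = h \<rho>" for T
      using that
    proof (induction T rule: finite_induct)
      case empty
      then show ?case by (simp add: eig_def)
    next
      case (insert a T)
      have a: "a \<in> ?G" using insert by simp
      have apow: "(a ^^ i) \<rho> \<in> R" if "\<rho> \<in> R" for i \<rho> using GR[OF pow[OF a]] that by blast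
      show ?case
      proof (rule insert.IH)
        show "T \<subseteq> ?G" using insert by simp
        fix h assume h: "eig T h"
        \<comment> \<open>Up to the factor \<open>n\<close>, the projection of \<open>h\<close> to
          the eigenspace of \<open>a\<close> with eigenvalue \<open>inverse (w ^ j)\<close>. As
          \<open>a\<close> commutes with \<open>T\<close>, the other eigenvalue equations survive;
          the projections add up to \<open>n h\<close>.\<close>
        define hj where "hj j \<rho> = (\<Sum>i<n. w ^ (j * i) * h ((a ^^ i) \<rho>))" for j \<rho>
        have "eig (insert a T) (hj j)" for j
          unfolding eig_def
        proof
          fix b assume b: "b \<in> insert a T"
          show "\<exists>c. \<forall>\<rho>\<in>R. hj j (b \<rho>) = c * hj j \<rho>"
          proof (cases "b = a")
            case True
            have "hj j (a \<rho>) = inverse (w ^ j) * hj j \<rho>" if \<rho>: "\<rho> \<in> R" for \<rho>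
            proof -
              let ?g = "\<lambda>i. w ^ (j * i) * h ((a ^^ i) \<rho>)"
              have "w ^ j * hj j (a \<rho>) = (\<Sum>i<n. ?g (Suc i))"
                unfolding hj_def sum_distrib_left by (intro sum.cong) (auto simp: power_add funpow_swap1 mult_ac)
              also have "\<dots> = (\<Sum>i<n. ?g i)"
                by (rule sum_cyclic_shift) (use per[OF a \<rho>] wn in \<open>simp add: power_mult power_mult[of w n j, symmetric] mult.commute[of j n]\<close>)
              finally have "w ^ j * hj j (a \<rho>) = hj j \<rho>" by (simp add: hj_def)
              moreover have "w ^ j \<noteq> 0" by (simp add: w_def)
              ultimately show ?thesis by (simp add: field_simps)
            qed
            then show ?thesis using True by blast
          next
            case False
            then have bT: "b \<in> T" "b \<in> ?G" using b insert by auto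
            then obtain c where c: "\<forall>\<rho>\<in>R. h (b \<rho>) = c * h \<rho>" using h by (auto simp: eig_def)
            have "hj j (b \<rho>) = c * hj j \<rho>" if \<rho>: "\<rho> \<in> R" for \<rho>
            proof -
              have "h ((a ^^ i) (b \<rho>)) = c * h ((a ^^ i) \<rho>)" for i
                using comm[OF pow[OF a, of i] bT(2)] \<rho> RL c apow[OF \<rho>] by auto
              then show ?thesis by (simp add: hj_def sum_distrib_left mult_ac)
            qed
            then show ?thesis by blast
          qed
        qed
        then have inv: "\<forall>\<rho>\<in>R. hj j (\<tau>0 \<rho>) = hj j \<rho>" for j using insert.prems(2) by blast
        have tot: "(\<Sum>j<n. hj j \<rho>) = of_nat n * h \<rho>" for \<rho>
        proof -
          have "(\<Sum>j<n. hj j \<rho>) = (\<Sum>i<n. (\<Sum>j<n. (w ^ i) ^ j) * h ((a ^^ i) \<rho>))"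
            unfolding hj_def sum_distrib_right by (subst sum.swap) (simp add: mult.commute flip: power_mult)
          also have "\<dots> = (\<Sum>i<n. if i = 0 then of_nat n * h \<rho> else 0)"
          proof (rule sum.cong)
            fix i assume i: "i \<in> {..<n}"
            show "(\<Sum>j<n. (w ^ i) ^ j) * h ((a ^^ i) \<rho>) = (if i = 0 then of_nat n * h \<rho> else 0)"
            proof (cases "i = 0")
              case False
              have "(w ^ i) ^ n = 1" using wn by (metis mult.commute power_mult power_one)
              then have "(\<Sum>j<n. (w ^ i) ^ j) = 0" using w1[of i] i False by (intro sum_powers_root_of_unity) auto
              then show ?thesis using False by simp
            qed simp
          qed simp
          finally show ?thesis using n by simp
        qed
        show "\<forall>\<rho>\<in>R. h (\<tau>0 \<rho>) = h \<rho>"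
        proof
          fix \<rho> assume "\<rho> \<in> R"
          then have "of_nat n * h (\<tau>0 \<rho>) = of_nat n * h \<rho>" using inv by (simp flip: tot)
          then show "h (\<tau>0 \<rho>) = h \<rho>" using n by simp
        qed
      qed
    qed
    have "\<not> (\<forall>h::'a \<Rightarrow> complex. \<forall>\<rho>\<in>R. h (\<tau>0 \<rho>) = h \<rho>)"
    proof
      assume "\<forall>h::'a \<Rightarrow> complex. \<forall>\<rho>\<in>R. h (\<tau>0 \<rho>) = h \<rho>"
      then have "(if \<tau>0 \<theta> = \<theta> then 1 else (0::complex)) = (if \<theta> = \<theta> then 1 else 0)"
        using \<theta>R by (elim allE[of _ "\<lambda>x. if x = \<theta> then 1 else 0"]) blast
      then show False using \<tau>0 by simp
    qed
    then obtain h where h: "eig T0 h" "\<not> (\<forall>\<rho>\<in>R. h (\<tau>0 \<rho>) = h \<rho>)" using descend[OF T0(2,1)] by blast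
    have eigG: "\<exists>c. \<forall>\<rho>\<in>R. h (\<tau> \<rho>) = c * h \<rho>" if \<tau>: "\<tau> \<in> ?G" for \<tau>
    proof -
      obtain b where b: "b \<in> T0" "restrict \<tau> R = restrict b R" using T0(3) \<tau> by blast
      then have "\<tau> \<rho> = b \<rho>" if "\<rho> \<in> R" for \<rho> using that by (metis restrict_apply')
      then show ?thesis using h(1) b(1) unfolding eig_def by (metis (no_types, lifting))
    qed
    have h\<theta>: "h \<theta> \<noteq> 0"
    proof
      assume h0: "h \<theta> = 0"
      have "h \<rho> = 0" if \<rho>: "\<rho> \<in> R" for \<rho>
      proof -
        obtain \<tau> where \<tau>: "\<tau> \<in> ?G" "\<rho> = \<tau> \<theta>" using \<rho> unfolding R_def by blast
        then show ?thesis using eigG[OF \<tau>(1)] \<theta>R h0 by force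
      qed
      then show False using h(2) GR[OF \<tau>0(1)] by (metis imageI subsetD)
    qed
    define lam where "lam \<tau> = h (\<tau> \<theta>) / h \<theta>" for \<tau>
    have lam: "h (\<tau> \<rho>) = lam \<tau> * h \<rho>" if "\<tau> \<in> ?G" "\<rho> \<in> R" for \<tau> \<rho>
    proof -
      obtain c where "\<forall>\<rho>\<in>R. h (\<tau> \<rho>) = c * h \<rho>" using eigG[OF \<open>\<tau> \<in> ?G\<close>] by blast
      then show ?thesis using that \<theta>R h\<theta> by (simp add: lam_def)
    qed
    have lam_comp: "lam (\<lambda>x. \<sigma> (\<tau> x)) = lam \<sigma> * lam \<tau>" if "\<sigma> \<in> ?G" "\<tau> \<in> ?G" for \<sigma> \<tau>
      using lam[OF that(1), of "\<tau> \<theta>"] GR[OF that(2)] \<theta>R h\<theta> by (auto simp: lam_def[of "\<lambda>x. \<sigma> (\<tau> x)"] lam_def[of \<tau>])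
    have lam_pow: "lam (\<tau> ^^ i) = lam \<tau> ^ i" if "\<tau> \<in> ?G" for \<tau> i
    proof (induction i)
      case 0 show ?case using h\<theta> by (simp add: lam_def)
    next
      case (Suc i) show ?case using lam_comp[OF that pow[OF that, of i]] Suc by (simp add: comp_def)
    qed
    have lam_n: "lam \<tau> ^ n = 1" if "\<tau> \<in> ?G" for \<tau>
      using lam_pow[OF that, of n] per[OF that \<theta>R] h\<theta> by (simp add: lam_def[of "\<tau> ^^ n"])
    have lam0: "lam \<tau>0 \<noteq> 1" using h(2) lam[OF \<tau>0(1)] by auto
    \<comment> \<open>A prime \<open>l\<close> dividing the order of \<open>lam \<tau>0\<close> is
      chosen; raising to the prime-to-\<open>l\<close> part \<open>n'\<close> of \<open>n\<close>
      then leaves a nontrivial value.\<close>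
    obtain l a n' where ln: "prime (l::nat)" "n = l ^ a * n'" "lam \<tau>0 ^ n' \<noteq> 1"
    proof -
      define d where "d = (LEAST d. d > 0 \<and> lam \<tau>0 ^ d = 1)"
      have d: "d > 0" "lam \<tau>0 ^ d = 1"
        using LeastI[of "\<lambda>d. d > 0 \<and> lam \<tau>0 ^ d = 1" n] n lam_n[OF \<tau>0(1)] by (auto simp: d_def)
      have ddvd: "d dvd k" if "lam \<tau>0 ^ k = 1" for k
      proof -
        have "lam \<tau>0 ^ (k mod d) = 1"
        proof -
          have "lam \<tau>0 ^ k = (lam \<tau>0 ^ d) ^ (k div d) * lam \<tau>0 ^ (k mod d)"
            by (simp flip: power_mult power_add)
          then show ?thesis using that d by simp
        qed
        then have "\<not> k mod d > 0" using Least_le[of "\<lambda>d. d > 0 \<and> lam \<tau>0 ^ d = 1" "k mod d"] d(1) mod_less_divisor[OF d(1), of k]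
          unfolding d_def by linarith
        then show ?thesis by auto
      qed
      have "d \<noteq> 1" using d lam0 by auto
      then obtain l where l: "prime l" "l dvd d" using prime_factor_nat by blast
      have "\<not> is_unit l" using l by (auto dest: prime_gt_1_nat)
      then obtain n' where n': "n = l ^ multiplicity l n * n'" "\<not> l dvd n'"
        using multiplicity_decompose'[of n l] n by auto
      have "lam \<tau>0 ^ n' \<noteq> 1" using ddvd[of n'] l n' by (metis dvd_trans)
      then show ?thesis using that[of l "multiplicity l n" n'] l n' by blast
    qed
    define q where "q = l ^ a"
    have q: "q > 0" using ln(1) by (simp add: q_def prime_gt_0_nat)
    define mu where "mu \<tau> = lam \<tau> ^ n'" for \<tau>
    have mu_comp: "mu (\<lambda>x. \<sigma> (\<tau> x)) = mu \<sigma> * mu \<tau>" if "\<sigma> \<in> ?G" "\<tau> \<in> ?G" for \<sigma> \<tau>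
      using lam_comp[OF that] by (simp add: mu_def power_mult_distrib)
    have mu_pow: "mu (\<tau> ^^ i) = mu \<tau> ^ i" if "\<tau> \<in> ?G" for \<tau> i
      using lam_pow[OF that] by (simp add: mu_def flip: power_mult) (simp add: mult.commute)
    have mu_q: "mu \<tau> ^ q = 1" if "\<tau> \<in> ?G" for \<tau>
      using lam_n[OF that] ln(2) by (simp add: mu_def q_def mult.commute flip: power_mult)
    define v where "v = cis (2 * pi / q)"
    have vpow: "v ^ j = cis (2 * pi * j / q)" for j by (simp add: v_def DeMoivre mult_ac)
    have vq: "v ^ q = 1" using q by (simp add: vpow)
    have mu_v: "\<exists>k. mu \<tau> = v ^ k" if "\<tau> \<in> ?G" for \<tau>
    proof -
      have "mu \<tau> \<in> {z. z ^ q = 1}" using mu_q[OF that] by simp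
      also have "\<dots> = (\<lambda>k. cis (2 * pi * k / q)) ` {..<q}" using bij_betw_roots_unity[OF q] by (simp add: bij_betw_def)
      finally show ?thesis by (auto simp: vpow)
    qed
    \<comment> \<open>The least positive exponent that occurs gives a generator of the cyclic image
      of \<open>mu\<close>, by division with remainder. Under \<open>mu\<close>, the iterate
      \<open>\<sigma> ^^ (q - 1)\<close> acts as the inverse of \<open>\<sigma>\<close>.\<close>
    define k0 where "k0 = (LEAST k. k > 0 \<and> (\<exists>\<tau>\<in>?G. mu \<tau> = v ^ k))"
    have "q > 0 \<and> (\<exists>\<tau>\<in>?G. mu \<tau> = v ^ q)" using q vq id mu_pow[OF id, of 0] by (force simp: id_def)
    then have "k0 > 0 \<and> (\<exists>\<tau>\<in>?G. mu \<tau> = v ^ k0)" unfolding k0_def by (rule LeastI)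
    then obtain \<sigma> where k0: "k0 > 0" and \<sigma>: "\<sigma> \<in> ?G" "mu \<sigma> = v ^ k0" by blast
    have gen: "\<exists>i. mu \<tau> = mu \<sigma> ^ i" if \<tau>: "\<tau> \<in> ?G" for \<tau>
    proof -
      obtain k where k: "mu \<tau> = v ^ k" using mu_v[OF \<tau>] by blast
      define i where "i = k div k0"
      have kk: "k = k0 * i + k mod k0" by (simp add: i_def)
      have "mu (\<lambda>x. \<tau> ((\<sigma> ^^ (i * (q - 1))) x)) = v ^ k * (v ^ k0) ^ (i * (q - 1))"
        using mu_comp[OF \<tau> pow[OF \<sigma>(1)]] mu_pow[OF \<sigma>(1)] \<sigma>(2) k by simp
      also have "\<dots> = v ^ (k mod k0 + q * (k0 * i))"
      proof -
        have "k + k0 * (i * (q - 1)) = k mod k0 + k0 * i * (1 + (q - 1))"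
          using kk by (simp only: distrib_left mult.assoc mult_1_right)
        also have "\<dots> = k mod k0 + q * (k0 * i)" using q by (simp add: mult_ac)
        finally show ?thesis by (simp flip: power_mult power_add)
      qed
      also have "\<dots> = v ^ (k mod k0)" by (simp add: power_add power_mult vq)
      finally have mem: "mu (\<lambda>x. \<tau> ((\<sigma> ^^ (i * (q - 1))) x)) = v ^ (k mod k0)" .
      have "\<not> k mod k0 > 0"
      proof
        assume "k mod k0 > 0"
        then have "k0 \<le> k mod k0" unfolding k0_def[of] using mem comp[OF \<tau> pow[OF \<sigma>(1)]]
          by (intro Least_le) (auto simp: k0_def[symmetric])
        then show False using mod_less_divisor[OF k0, of k] by linarith
      qed
      then have "k = k0 * i" using kk by simp
      then show ?thesis using k \<sigma>(2) by (auto simp: power_mult)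
    qed
    \<comment> \<open>On elements fixed by the kernel of \<open>mu\<close> the group acts through
      powers of \<open>\<sigma>\<close>, and \<open>\<sigma> ^^ q\<close> acts trivially; these are
      the hypotheses of \<open>cyc\<close>.\<close>
    have fixed_in_\<Omega>: "x \<in> \<Omega>" if x: "x \<in> L" and fixd: "\<And>\<tau>. \<tau> \<in> ?G \<Longrightarrow> mu \<tau> = 1 \<Longrightarrow> \<tau> x = x" for x
    proof (rule cyc[OF ln(1) \<sigma>(1) x])
      have qpow: "(\<sigma> ^^ (i * q)) x = x" for i
        using fixd[OF pow[OF \<sigma>(1), of "i * q"]] mu_pow[OF \<sigma>(1)] mu_q[OF \<sigma>(1)] by (simp add: mult.commute[of i] power_mult)
      show "(\<sigma> ^^ (l ^ a)) x = x" using qpow[of 1] by (simp add: q_def)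
      show "\<forall>\<tau>\<in>?G. \<exists>i. \<tau> x = (\<sigma> ^^ i) x"
      proof
        fix \<tau> assume \<tau>: "\<tau> \<in> ?G"
        obtain i where i: "mu \<tau> = mu \<sigma> ^ i" using gen[OF \<tau>] by blast
        have "mu (\<lambda>x. (\<sigma> ^^ (i * (q - 1))) (\<tau> x)) = mu \<sigma> ^ (i * (q - 1) + i)"
          using mu_comp[OF pow[OF \<sigma>(1)] \<tau>] mu_pow[OF \<sigma>(1)] i by (simp add: power_add)
        also have "i * (q - 1) + i = q * i" using q by (cases q) auto
        also have "mu \<sigma> ^ (q * i) = 1" using mu_q[OF \<sigma>(1)] by (simp add: power_mult)
        finally have "(\<sigma> ^^ (i * (q - 1))) (\<tau> x) = x" using fixd comp[OF pow[OF \<sigma>(1)] \<tau>] by blast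
        then have "(\<sigma> ^^ i) x = (\<sigma> ^^ (i + i * (q - 1))) (\<tau> x)" by (simp add: funpow_add)
        also have "i + i * (q - 1) = i * q" using q by (cases q) auto
        also have "(\<sigma> ^^ (i * q)) (\<tau> x) = \<tau> x" using comm[OF pow[OF \<sigma>(1)] \<tau> x] qpow by simp
        finally show "\<exists>i. \<tau> x = (\<sigma> ^^ i) x" by metis
      qed
    qed
    \<comment> \<open>The orbit of \<open>\<theta>\<close> under the kernel of \<open>mu\<close>.
      The polynomial with these roots has coefficients in \<open>\<Omega>\<close>, so
      \<open>\<tau>0\<close> fixes it and must map \<open>\<theta>\<close> into
      \<open>B\<close>.\<close>
    define B where "B = {\<tau> \<theta> | \<tau>. \<tau> \<in> ?G \<and> mu \<tau> = 1}"
    have BR: "B \<subseteq> R" by (auto simp: B_def R_def)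
    then have B: "finite B" "B \<subseteq> L" using finR RL finite_subset by auto
    have \<theta>B: "\<theta> \<in> B" using id mu_pow[OF id, of 0] unfolding B_def by (force simp: id_def)
    define f where "f = (\<Prod>b\<in>B. [:-b, 1:])"
    have fL: "f \<in> polys_over L" unfolding f_def by (rule root_product_polys_over[OF D(2) B(2)])
    have "poly.coeff f i \<in> \<Omega>" for i
    proof (rule fixed_in_\<Omega>)
      show "poly.coeff f i \<in> L" using fL by (auto simp: polys_over_def)
      fix \<tau> assume \<tau>: "\<tau> \<in> ?G" "mu \<tau> = 1"
      have "\<tau> ` B \<subseteq> B"
      proof
        fix y assume "y \<in> \<tau> ` B"
        then obtain \<rho> where "\<rho> \<in> ?G" "mu \<rho> = 1" "y = \<tau> (\<rho> \<theta>)" unfolding B_def by blast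
        then show "y \<in> B" using comp[OF \<tau>(1)] mu_comp[OF \<tau>(1)] \<tau>(2) unfolding B_def
          by (intro CollectI exI[of _ "\<lambda>x. \<tau> (\<rho> x)"]) auto
      qed
      then have "map_poly \<tau> f = f" unfolding f_def by (rule root_product_fixed[OF D(2) emb[OF \<tau>(1)] B])
      then show "\<tau> (poly.coeff f i) = poly.coeff f i"
        using coeff_map_poly[of \<tau> f i] emb_0[OF D(2) emb[OF \<tau>(1)]] by simp
    qed
    then have "\<tau>0 (poly.coeff f i) = poly.coeff f i" for i using \<tau>0(2) fL by (simp add: polys_over_def)
    then have "map_poly \<tau>0 f = f"
      by (intro poly_eqI) (simp add: coeff_map_poly emb_0[OF D(2) emb[OF \<tau>0(1)]])
    moreover have "poly f \<theta> = 0" unfolding f_def poly_prod using \<theta>B B(1) by (intro prod_zero) auto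
    ultimately have "poly f (\<tau>0 \<theta>) = 0"
      using emb_poly[OF D(2) emb[OF \<tau>0(1)] fL \<theta>] emb_0[OF D(2) emb[OF \<tau>0(1)]] by simp
    then have "\<tau>0 \<theta> \<in> B" unfolding f_def poly_prod using B(1) by auto
    then obtain \<tau> where "\<tau>0 \<theta> = \<tau> \<theta>" "mu \<tau> = 1" unfolding B_def by blast
    \<comment> \<open>\<open>mu\<close> depends on an automorphism only through its value at
      \<open>\<theta>\<close>.\<close>
    then have "mu \<tau>0 = 1" by (simp add: mu_def lam_def)
    then show False using ln(3) by (simp add: mu_def)
  qed
qed

subsection \<open>Polynomials in several variables\<close>

abbreviation "mlookup \<equiv> Poly_Mapping.lookup"
abbreviation "mkeys \<equiv> Poly_Mapping.keys"
abbreviation "msingle \<equiv> Poly_Mapping.single"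

definition monomial :: "(nat \<Rightarrow>\<^sub>0 nat) \<Rightarrow> (nat \<Rightarrow> 'a::comm_semiring_1) \<Rightarrow> 'a" where
  "monomial m x = (\<Prod>i\<in>mkeys m. x i ^ mlookup m i)"

lemma monomial_superset: "finite S \<Longrightarrow> mkeys m \<subseteq> S \<Longrightarrow> monomial m x = (\<Prod>i\<in>S. x i ^ mlookup m i)"
  unfolding monomial_def by (rule prod.mono_neutral_left) (auto simp: in_keys_iff)

lemma monomial_0 [simp]: "monomial 0 x = 1"
  by (simp add: monomial_def)

lemma keys_add_subset: "mkeys m \<subseteq> S \<Longrightarrow> mkeys m' \<subseteq> S \<Longrightarrow> mkeys (m + m') \<subseteq> S" for m m' :: "nat \<Rightarrow>\<^sub>0 nat"
  by (rule subset_trans[OF Poly_Mapping.keys_add]) simp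

lemma monomial_add: "monomial (m + m') x = monomial m x * monomial m' x"
proof -
  let ?S = "mkeys m \<union> mkeys m'"
  have "mkeys (m + m') \<subseteq> ?S" by (rule Poly_Mapping.keys_add)
  then show ?thesis
    by (simp add: monomial_superset[of ?S] lookup_add power_add prod.distrib)
qed

lemma meval_superset:
  "finite M \<Longrightarrow> mkeys p \<subseteq> M \<Longrightarrow> meval p x = (\<Sum>m\<in>M. mlookup p m * monomial m x)"
  unfolding meval_def monomial_def by (rule sum.mono_neutral_left) (auto simp: in_keys_iff)

lemma meval_0 [simp]: "meval 0 x = 0"
  by (simp add: meval_def)

lemma meval_add: "meval (p + q) x = meval p x + meval q x"
proof -
  let ?M = "mkeys p \<union> mkeys q"
  have "mkeys (p + q) \<subseteq> ?M" by (rule Poly_Mapping.keys_add)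
  then show ?thesis
    by (simp add: meval_superset[of ?M] lookup_add distrib_right sum.distrib)
qed

lemma meval_uminus: "meval (- p) x = - meval (p :: 'a::comm_ring_1 mpoly) x"
  by (simp add: meval_superset[of "mkeys p"] sum_negf)

lemma meval_diff: "meval (p - q) x = meval p x - meval (q :: 'a::comm_ring_1 mpoly) x"
  using meval_add[of p "- q" x] by (simp add: meval_uminus)

lemma meval_sum: "meval (sum f I) x = (\<Sum>i\<in>I. meval (f i) x)"
  by (induction I rule: infinite_finite_induct) (simp_all add: meval_add)

lemma meval_single [simp]: "meval (msingle m a) x = a * monomial m x"
  by (simp add: meval_superset[of "{m}"])

lemma sum_monomials: "p = (\<Sum>m\<in>mkeys p. msingle m (mlookup p m))"
  by (rule poly_mapping_eqI)
    (simp add: lookup_sum lookup_single when_def in_keys_iff)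

lemma mult_sum_monomials:
  "p * q = (\<Sum>m\<in>mkeys p. \<Sum>m'\<in>mkeys q. msingle (m + m') (mlookup p m * mlookup q m'))"
  for p q :: "'a::comm_semiring_1 mpoly"
proof -
  have "p * q = (\<Sum>m\<in>mkeys p. msingle m (mlookup p m)) * (\<Sum>m\<in>mkeys q. msingle m (mlookup q m))"
    using sum_monomials[of p] sum_monomials[of q] by simp
  then show ?thesis by (simp add: sum_product mult_single)
qed

lemma meval_mult: "meval (p * q) x = meval p x * meval q x"
  unfolding mult_sum_monomials[of p q]
  by (simp add: meval_sum monomial_add meval_superset[of "mkeys p" p] meval_superset[of "mkeys q" q] sum_product mult_ac)

lemma meval_1 [simp]: "meval 1 x = 1"
  by (simp flip: single_one)

lemma meval_power: "meval (p ^ k) x = meval p x ^ k"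
  by (induction k) (simp_all add: meval_mult)

lemma meval_prod: "meval (prod f I) x = (\<Prod>i\<in>I. meval (f i) x)"
  by (induction I rule: infinite_finite_induct) (simp_all add: meval_mult)

context
  fixes A :: "'a::field set"
  assumes A: "is_subfield A"
begin

lemma mpolys_0 [simp]: "0 \<in> mpolys n A"
  using A by (simp add: mpolys_def)

lemma mpolys_single: "a \<in> A \<Longrightarrow> mkeys m \<subseteq> {..<n} \<Longrightarrow> msingle m a \<in> mpolys n A"
  using A by (auto simp: mpolys_def lookup_single when_def)

lemma mpolys_const: "a \<in> A \<Longrightarrow> msingle 0 a \<in> mpolys n A"
  by (rule mpolys_single) simp_all

lemma mpolys_var: "i < n \<Longrightarrow> msingle (msingle i 1) 1 \<in> mpolys n A"
  using A by (intro mpolys_single) simp_all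

lemma mpolys_1 [simp]: "1 \<in> mpolys n A"
  using mpolys_const[of 1] A by simp

lemma mpolys_add: "p \<in> mpolys n A \<Longrightarrow> q \<in> mpolys n A \<Longrightarrow> p + q \<in> mpolys n A"
  using A Poly_Mapping.keys_add[of p q] by (fastforce simp: mpolys_def lookup_add intro: sf_add)

lemma mpolys_uminus: "p \<in> mpolys n A \<Longrightarrow> - p \<in> mpolys n A"
  using A by (auto simp: mpolys_def intro: sf_uminus)

lemma mpolys_diff: "p \<in> mpolys n A \<Longrightarrow> q \<in> mpolys n A \<Longrightarrow> p - q \<in> mpolys n A"
  using mpolys_add[of p n "- q"] mpolys_uminus[of q n] by simp

lemma mpolys_sum: "(\<And>i. i \<in> I \<Longrightarrow> f i \<in> mpolys n A) \<Longrightarrow> sum f I \<in> mpolys n A"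
  by (induction I rule: infinite_finite_induct) (auto intro: mpolys_add)

lemma mpolys_mult:
  assumes "p \<in> mpolys n A" "q \<in> mpolys n A" shows "p * q \<in> mpolys n A"
  unfolding mult_sum_monomials[of p q]
proof (intro mpolys_sum mpolys_single)
  fix m m' assume "m \<in> mkeys p" "m' \<in> mkeys q"
  then show "mkeys (m + m') \<subseteq> {..<n}" using assms by (intro keys_add_subset) (auto simp: mpolys_def)
qed (use assms A in \<open>auto simp: mpolys_def intro: sf_mult\<close>)

lemma mpolys_power: "p \<in> mpolys n A \<Longrightarrow> p ^ k \<in> mpolys n A"
  by (induction k) (auto intro: mpolys_mult)

lemma mpolys_prod: "(\<And>i. i \<in> I \<Longrightarrow> f i \<in> mpolys n A) \<Longrightarrow> prod f I \<in> mpolys n A"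
  by (induction I rule: infinite_finite_induct) (auto intro: mpolys_mult)

end

lemma mpolys_mono: "A \<subseteq> B \<Longrightarrow> n \<le> n' \<Longrightarrow> p \<in> mpolys n A \<Longrightarrow> p \<in> mpolys n' B"
  by (fastforce simp: mpolys_def)

lemma meval_cong:
  assumes "p \<in> mpolys n A" "\<And>i. i < n \<Longrightarrow> x i = y i" shows "meval p x = meval p y"
proof -
  have "monomial m x = monomial m y" if "m \<in> mkeys p" for m
    unfolding monomial_def using assms that by (intro prod.cong) (auto simp: mpolys_def subset_iff)
  then show ?thesis by (simp add: meval_superset[of "mkeys p"])
qed

text \<open>In a finite field, 1 plus the product of all \<open>X - a\<close> has no root.\<close>

lemma infinite_alg_closed: "infinite (UNIV :: 'a::alg_closed_field set)"
proof
  assume fin: "finite (UNIV :: 'a set)"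
  let ?f = "(\<Prod>a\<in>UNIV. [:-a, 1:]) + 1 :: 'a poly"
  have val: "poly ?f x = 1" for x using fin by (auto simp: poly_prod)
  have "Polynomial.degree (\<Prod>a\<in>(UNIV::'a set). [:-a, 1:]) = (\<Sum>a\<in>(UNIV::'a set). Polynomial.degree [:-a, 1:])"
    by (rule degree_prod_eq_sum_degree) simp
  also have "\<dots> > 0" using fin by (simp add: finite_UNIV_card_ge_0)
  finally have "Polynomial.degree ?f > 0" by (subst degree_add_eq_left) simp_all
  then obtain x where "poly ?f x = 0" using alg_closed_imp_poly_has_root by blast
  then show False using val by simp
qed

lemma digits_unique:
  fixes a b :: "nat \<Rightarrow> nat"
  assumes "\<forall>i<N. a i < B \<and> b i < B" "(\<Sum>i<N. a i * B ^ i) = (\<Sum>i<N. b i * B ^ i)"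
  shows "\<forall>i<N. a i = b i"
  using assms
proof (induction N)
  case (Suc N)
  have bound: "(\<Sum>i<N. c i * B ^ i) < B ^ N" if "\<forall>i<N. c i < B" for c :: "nat \<Rightarrow> nat" and N
    using that
  proof (induction N)
    case (Suc N)
    then have "(\<Sum>i<Suc N. c i * B ^ i) < B ^ N + c N * B ^ N" by simp
    also have "\<dots> = (c N + 1) * B ^ N" by simp
    also have "\<dots> \<le> B * B ^ N" using Suc.prems by (intro mult_right_mono) (auto simp: Suc_le_eq)
    finally show ?case by simp
  qed simp
  have lt: "(\<Sum>i<N. a i * B ^ i) < B ^ N" "(\<Sum>i<N. b i * B ^ i) < B ^ N" using Suc.prems by (auto intro!: bound)
  then have pos: "B ^ N > 0" by linarith
  have eq: "(\<Sum>i<N. a i * B ^ i) + a N * B ^ N = (\<Sum>i<N. b i * B ^ i) + b N * B ^ N" using Suc.prems by simp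
  have top: "a N = b N"
    using arg_cong[OF eq, of "\<lambda>x. x div B ^ N"] lt pos by simp
  then have "\<forall>i<N. a i = b i" using Suc.prems eq by (intro Suc.IH) auto
  then show ?case using top less_Suc_eq by auto
qed simp

text \<open>Kronecker substitution \<open>X\<^sub>i \<mapsto> T\<^bsup>B^i\<^esup>\<close> separates the monomials of a polynomial of degree less than \<open>B\<close>.\<close>

lemma mpoly_eq_0I:
  fixes p :: "'a::alg_closed_field mpoly"
  assumes "\<And>x. meval p x = 0" shows "p = 0"
proof (rule poly_mapping_eqI)
  fix m0
  \<comment> \<open>\<open>m0\<close> is included although it need not occur in \<open>p\<close>:
    its digits must be below \<open>B\<close> and its variables below \<open>N\<close> for the codes
    to be comparable.\<close>
  define N where "N = Suc (Max (insert 0 (\<Union>m\<in>insert m0 (mkeys p). mkeys m)))"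
  define B where "B = Suc (Max (insert 0 (\<Union>m\<in>insert m0 (mkeys p). mlookup m ` mkeys m)))"
  have N: "mkeys m \<subseteq> {..<N}" if "m \<in> insert m0 (mkeys p)" for m
    using that unfolding N_def by (auto simp: less_Suc_eq_le intro!: Max_ge)
  have B: "mlookup m i < B" if "m \<in> insert m0 (mkeys p)" for m i
  proof (cases "i \<in> mkeys m")
    case True
    then show ?thesis using that unfolding B_def by (auto simp: less_Suc_eq_le intro!: Max_ge)
  qed (simp add: B_def in_keys_iff)
  define code where "code m = (\<Sum>i<N. mlookup m i * B ^ i)" for m
  have inj: "m = m0" if "m \<in> mkeys p" "code m = code m0" for m
  proof (rule poly_mapping_eqI)
    fix i
    have "\<forall>i<N. mlookup m i = mlookup m0 i" using that B unfolding code_def by (intro digits_unique[of N _ B]) auto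
    moreover have "mlookup m i = 0 \<and> mlookup m0 i = 0" if "\<not> i < N"
      using N[of m] N[of m0] \<open>m \<in> mkeys p\<close> that by (auto simp: in_keys_iff subset_iff)
    ultimately show "mlookup m i = mlookup m0 i" by metis
  qed
  define P where "P = (\<Sum>m\<in>mkeys p. Polynomial.monom (mlookup p m) (code m))"
  have "poly P t = 0" for t
  proof -
    have "monomial m (\<lambda>i. t ^ (B ^ i)) = t ^ code m" if "m \<in> mkeys p" for m
      using N[of m] that by (simp add: monomial_superset[of "{..<N}"] code_def power_sum power_mult mult.commute)
        (simp add: mult.commute flip: power_mult)
    then have "poly P t = meval p (\<lambda>i. t ^ (B ^ i))"
      by (simp add: P_def poly_sum poly_monom meval_superset[of "mkeys p"])
    then show ?thesis using assms by simp
  qed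
  then have "{t. poly P t = 0} = UNIV" by simp
  then have "P = 0" using poly_roots_finite[of P] infinite_alg_closed by auto
  then have "0 = poly.coeff P (code m0)" by simp
  also have "\<dots> = (\<Sum>m\<in>mkeys p. if m = m0 then mlookup p m else 0)"
    unfolding P_def coeff_sum by (rule sum.cong) (use inj in auto)
  also have "\<dots> = mlookup p m0" by (simp add: in_keys_iff)
  finally show "mlookup p m0 = mlookup 0 m0" by simp
qed

text \<open>\<open>Q * p\<close> vanishes everywhere, and there are no zero divisors. Identities of
  functions on a principal open set thereby become identities of polynomials.\<close>

lemma mpoly_eq_0I_on:
  fixes p Q :: "'a::alg_closed_field mpoly"
  assumes "Q \<noteq> 0" "\<And>x. meval Q x \<noteq> 0 \<Longrightarrow> meval p x = 0" shows "p = 0"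
proof -
  have "Q * p = 0" by (rule mpoly_eq_0I) (use assms in \<open>auto simp: meval_mult\<close>)
  then show ?thesis using assms(1) by simp
qed

subsection \<open>Action on coefficients\<close>

abbreviation cmap :: "('a::zero \<Rightarrow> 'b::zero) \<Rightarrow> 'a mpoly \<Rightarrow> 'b mpoly" where
  "cmap \<equiv> Poly_Mapping.map"

lemma lookup_cmap: "\<delta> 0 = 0 \<Longrightarrow> mlookup (cmap \<delta> p) m = \<delta> (mlookup p m)"
  by transfer (simp add: when_def)

lemma keys_cmap: "mkeys (cmap \<delta> p) \<subseteq> mkeys p"
  unfolding subset_iff in_keys_iff by transfer (simp add: when_def)

context
  fixes K E :: "'a::alg_closed_field set" and \<delta>
  assumes E: "is_subfield E" and \<delta>: "embedding K E \<delta>"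
begin

lemma lookup_cmap_emb: "mlookup (cmap \<delta> p) m = \<delta> (mlookup p m)"
  by (rule lookup_cmap) (rule emb_0[OF E \<delta>])

lemma cmap_add: "p \<in> mpolys n E \<Longrightarrow> q \<in> mpolys n E \<Longrightarrow> cmap \<delta> (p + q) = cmap \<delta> p + cmap \<delta> q"
  by (rule poly_mapping_eqI) (simp add: lookup_cmap_emb lookup_add mpolys_def emb_add[OF E \<delta>])

lemma cmap_0 [simp]: "cmap \<delta> 0 = 0"
  by (rule poly_mapping_eqI) (simp add: lookup_cmap_emb emb_0[OF E \<delta>])

lemma cmap_sum: "(\<And>i. i \<in> I \<Longrightarrow> f i \<in> mpolys n E) \<Longrightarrow> cmap \<delta> (sum f I) = (\<Sum>i\<in>I. cmap \<delta> (f i))"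
proof (induction I rule: infinite_finite_induct)
  case (insert i I)
  then have "cmap \<delta> (f i + sum f I) = cmap \<delta> (f i) + cmap \<delta> (sum f I)"
    by (intro cmap_add[of _ n] mpolys_sum[OF E]) auto
  then show ?case using insert by simp
qed simp_all

lemma cmap_single: "cmap \<delta> (msingle m a) = msingle m (\<delta> a)"
  by (rule poly_mapping_eqI) (simp add: lookup_cmap_emb lookup_single when_def emb_0[OF E \<delta>])

lemma cmap_mult:
  assumes "p \<in> mpolys n E" "q \<in> mpolys n E"
  shows "cmap \<delta> (p * q) = cmap \<delta> p * cmap \<delta> q"
proof -
  have mem: "msingle (m + m') (mlookup p m * mlookup q m') \<in> mpolys n E" if "m \<in> mkeys p" "m' \<in> mkeys q" for m m'
    using that assms E
    by (intro mpolys_single keys_add_subset) (auto simp: mpolys_def intro: sf_mult)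
  have e: "\<delta> (mlookup p m * mlookup q m') = \<delta> (mlookup p m) * \<delta> (mlookup q m')" for m m'
    using assms by (intro emb_mult[OF E \<delta>]) (auto simp: mpolys_def)
  have s: "cmap \<delta> r = (\<Sum>m\<in>mkeys r. msingle m (\<delta> (mlookup r m)))" for r
  proof (rule poly_mapping_eqI)
    fix k
    show "mlookup (cmap \<delta> r) k = mlookup (\<Sum>m\<in>mkeys r. msingle m (\<delta> (mlookup r m))) k"
      by (simp add: lookup_cmap_emb lookup_sum lookup_single when_def in_keys_iff emb_0[OF E \<delta>])
  qed
  have "cmap \<delta> (p * q) = (\<Sum>m\<in>mkeys p. \<Sum>m'\<in>mkeys q. msingle (m + m') (\<delta> (mlookup p m) * \<delta> (mlookup q m')))"
    unfolding mult_sum_monomials[of p q]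
    by (subst cmap_sum[of _ _ n], (intro mpolys_sum[OF E] mem; simp),
        rule sum.cong[OF refl], subst cmap_sum[of _ _ n], (intro mem; simp), simp add: cmap_single e)
  also have "\<dots> = cmap \<delta> p * cmap \<delta> q" unfolding s by (simp add: sum_product mult_single)
  finally show ?thesis .
qed

lemma cmap_prod: "(\<And>i. i \<in> I \<Longrightarrow> f i \<in> mpolys n E) \<Longrightarrow> cmap \<delta> (prod f I) = (\<Prod>i\<in>I. cmap \<delta> (f i))"
proof (induction I rule: infinite_finite_induct)
  case (insert i I)
  then have "cmap \<delta> (f i * prod f I) = cmap \<delta> (f i) * cmap \<delta> (prod f I)"
    by (intro cmap_mult[of _ n] mpolys_prod[OF E]) auto
  then show ?case using insert by simp
qed (simp_all add: cmap_single emb_1[OF E \<delta>] flip: single_one)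

lemma cmap_fix: "p \<in> mpolys n K \<Longrightarrow> cmap \<delta> p = p"
  by (rule poly_mapping_eqI) (simp add: lookup_cmap_emb mpolys_def emb_fix[OF E \<delta>])

lemma cmap_mpolys: "p \<in> mpolys n E \<Longrightarrow> (\<And>x. x \<in> E \<Longrightarrow> \<delta> x \<in> E') \<Longrightarrow> cmap \<delta> p \<in> mpolys n E'"
  using keys_cmap[of \<delta> p] by (auto simp: mpolys_def lookup_cmap_emb)

lemma cmap_eq_0: "p \<in> mpolys n E \<Longrightarrow> cmap \<delta> p = 0 \<Longrightarrow> p = 0"
  by (rule poly_mapping_eqI) (metis (no_types, lifting) lookup_cmap_emb emb_eq_0[OF E \<delta>] lookup_zero mem_Collect_eq mpolys_def)

end

lemma alg_independent_mono: "alg_independent K' r t \<Longrightarrow> K \<subseteq> K' \<Longrightarrow> alg_independent K r t"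
  unfolding alg_independent_def using mpolys_mono[of K K' r r] by blast

text \<open>The norm of a relation over \<open>K'\<close>, the product of its conjugates, is a relation over \<open>K\<close>.\<close>

lemma alg_independent_galois_ext:
  assumes gal: "galois_ext K K'" and t: "alg_independent K r t"
  shows "alg_independent K' r t"
  unfolding alg_independent_def
proof (intro ballI impI)
  note D = galois_extD[OF gal]
  let ?G = "galois_group K K'"
  fix p assume p: "p \<in> mpolys r K'" and pt: "meval p t = 0"
  have emb: "embedding K K' \<tau>" if "\<tau> \<in> ?G" for \<tau> using that by (rule galois_group_embedding)
  have im: "\<tau> x \<in> K'" if "\<tau> \<in> ?G" "x \<in> K'" for \<tau> x using galois_embedding_image[OF gal emb[OF that(1)] that(2)] .
  have id: "(\<lambda>x. x) \<in> ?G" by (simp add: galois_group_iff[OF gal] embedding_id)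
  define C where "C = mlookup p ` mkeys p"
  have CK: "C \<subseteq> K'" using p by (auto simp: C_def mpolys_def)
  \<comment> \<open>Some finite set containing all conjugates of \<open>c\<close>. Since
    \<open>p\<close> has finitely many coefficients, its orbit is finite even if the Galois group is
    not.\<close>
  define conj where "conj c = (SOME B. finite B \<and> (\<forall>\<tau>\<in>?G. \<tau> c \<in> B))" for c
  have conj: "finite (conj c) \<and> (\<forall>\<tau>\<in>?G. \<tau> c \<in> conj c)" if c: "c \<in> C" for c
    unfolding conj_def
  proof (rule someI_ex)
    have cK: "c \<in> K'" using c CK by blast
    obtain m where m: "is_minpoly K c m" using minpoly_exists[OF D(1) D(5)[OF cK]] by blast
    have "\<forall>\<tau>\<in>?G. \<tau> c \<in> {y. poly m y = 0}"
      using emb_root[OF D(2) emb _ D(3) cK] m by (auto simp: is_minpoly_def)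
    then show "\<exists>B. finite B \<and> (\<forall>\<tau>\<in>?G. \<tau> c \<in> B)" using poly_roots_finite[OF is_minpoly_nz[OF m]] by blast
  qed
  define Orb where "Orb = (\<lambda>\<tau>. cmap \<tau> p) ` ?G"
  have "finite ((\<lambda>\<tau>. restrict \<tau> C) ` ?G)"
  proof (rule finite_subset)
    show "(\<lambda>\<tau>. restrict \<tau> C) ` ?G \<subseteq> Pi\<^sub>E C conj" using conj by fastforce
    show "finite (Pi\<^sub>E C conj)" using conj by (intro finite_PiE) (auto simp: C_def)
  qed
  \<comment> \<open>\<open>restrict\<close> gives an unspecified value outside the nonzero
    coefficients, so the value 0 at 0 is put in by hand.\<close>
  moreover have "Orb \<subseteq> (\<lambda>\<rho>. cmap (\<lambda>c. if c = 0 then 0 else \<rho> c) p) ` ((\<lambda>\<tau>. restrict \<tau> C) ` ?G)"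
  proof
    fix q assume "q \<in> Orb"
    then obtain \<tau> where \<tau>: "\<tau> \<in> ?G" "q = cmap \<tau> p" by (auto simp: Orb_def)
    have "q = cmap (\<lambda>c. if c = 0 then 0 else restrict \<tau> C c) p"
    proof (rule poly_mapping_eqI)
      fix m
      show "mlookup q m = mlookup (cmap (\<lambda>c. if c = 0 then 0 else restrict \<tau> C c) p) m"
        using \<tau> emb_0[OF D(2) emb[OF \<tau>(1)]] by (auto simp: lookup_cmap C_def in_keys_iff)
    qed
    then show "q \<in> (\<lambda>\<rho>. cmap (\<lambda>c. if c = 0 then 0 else \<rho> c) p) ` ((\<lambda>\<tau>. restrict \<tau> C) ` ?G)" using \<tau> by blast
  qed
  ultimately have finO: "finite Orb" by (meson finite_imageI finite_subset)
  have OK: "Orb \<subseteq> mpolys r K'" using cmap_mpolys[OF D(2) emb p] im unfolding Orb_def by blast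
  have pO: "p \<in> Orb"
  proof -
    have "cmap (\<lambda>x. x) p = p" by (rule poly_mapping_eqI) (simp add: lookup_cmap)
    then show ?thesis using id unfolding Orb_def by force
  qed
  define N where "N = (\<Prod>q\<in>Orb. q)"
  have NK: "N \<in> mpolys r K'" unfolding N_def using OK by (intro mpolys_prod[OF D(2)]) auto
  have fixN: "cmap \<tau> N = N" if \<tau>: "\<tau> \<in> ?G" for \<tau>
  proof -
    note e = emb[OF \<tau>]
    have "cmap \<tau> ` Orb \<subseteq> Orb"
    proof
      fix q assume "q \<in> cmap \<tau> ` Orb"
      then obtain \<rho> where \<rho>: "\<rho> \<in> ?G" "q = cmap \<tau> (cmap \<rho> p)" by (auto simp: Orb_def)
      have "(\<lambda>x. \<tau> (\<rho> x)) \<in> ?G" using embedding_comp[OF emb[OF \<rho>(1)] e] im[OF \<rho>(1)] by (simp add: galois_group_iff[OF gal])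
      moreover have "q = cmap (\<lambda>x. \<tau> (\<rho> x)) p"
        by (rule poly_mapping_eqI) (simp add: \<rho> lookup_cmap emb_0[OF D(2) e] emb_0[OF D(2) emb[OF \<rho>(1)]])
      ultimately show "q \<in> Orb" by (auto simp: Orb_def)
    qed
    moreover have inj: "inj_on (cmap \<tau>) Orb"
    proof (rule inj_onI)
      fix q q' assume "q \<in> Orb" "q' \<in> Orb" "cmap \<tau> q = cmap \<tau> q'"
      then have "\<tau> (mlookup q m) = \<tau> (mlookup q' m)" "mlookup q m \<in> K'" "mlookup q' m \<in> K'" for m
        using OK by (auto simp: mpolys_def simp flip: lookup_cmap_emb[OF D(2) e])
      then show "q = q'" by (intro poly_mapping_eqI) (use emb_inj[OF D(2) e] in blast)
    qed
    ultimately have img: "cmap \<tau> ` Orb = Orb" using finO by (simp add: endo_inj_surj)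
    have "cmap \<tau> N = (\<Prod>q\<in>Orb. cmap \<tau> q)" unfolding N_def using OK by (intro cmap_prod[OF D(2) e, of _ _ r]) auto
    also have "\<dots> = (\<Prod>q\<in>cmap \<tau> ` Orb. q)" using inj by (simp add: prod.reindex)
    finally show ?thesis by (simp add: img N_def)
  qed
  have "mlookup N m \<in> K" for m
  proof (rule ccontr)
    assume "mlookup N m \<notin> K"
    moreover have "mlookup N m \<in> K'" using NK by (simp add: mpolys_def)
    ultimately obtain \<tau> where "\<tau> \<in> ?G" "\<tau> (mlookup N m) \<noteq> mlookup N m"
      using galois_fixed[OF gal D(1) subset_refl D(3)] by blast
    then show False using fixN[of \<tau>] lookup_cmap_emb[OF D(2) emb[of \<tau>], of N m] by simp
  qed
  then have "N \<in> mpolys r K" using NK by (simp add: mpolys_def)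
  moreover have "meval N t = 0" unfolding N_def meval_prod using pO pt finO by (intro prod_zero) auto
  ultimately have "N = 0" using t by (auto simp: alg_independent_def)
  then obtain q where "q \<in> Orb" "q = 0" unfolding N_def using finO by auto
  then obtain \<tau> where "\<tau> \<in> ?G" "cmap \<tau> p = 0" by (auto simp: Orb_def)
  then show "p = 0" using cmap_eq_0[OF D(2) emb p] by blast
qed

subsection \<open>Regular functions on a principal open subset of affine space\<close>

lemma monomial_single [simp]: "monomial (msingle i k) x = x i ^ k"
  by (simp add: monomial_superset[of "{i}"])

lemma lookup_const_mult: "mlookup (msingle 0 a * p) m = a * mlookup p m" for a :: "'a::comm_semiring_1" and p :: "'a mpoly"
proof -
  have "msingle 0 a * p = cmap ((*) a) p" by (simp add: mult_map_scale_conv_mult)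
  then show ?thesis by (simp add: lookup_cmap)
qed

text \<open>
  \<open>f\<close> is a function \<open>P / Q\<^sup>k\<close> on \<open>{Q \<noteq> 0}\<close> with \<open>P\<close> over \<open>E\<close>, and \<open>f'\<close> arises from it by applying
  \<open>\<delta>\<close> to the coefficients of \<open>P\<close>.
\<close>

definition regular_pair :: "nat \<Rightarrow> 'a::alg_closed_field set \<Rightarrow> ('a \<Rightarrow> 'a) \<Rightarrow> 'a mpoly \<Rightarrow>
    ((nat \<Rightarrow> 'a) \<Rightarrow> 'a) \<Rightarrow> ((nat \<Rightarrow> 'a) \<Rightarrow> 'a) \<Rightarrow> bool" where
  "regular_pair r E \<delta> Q f f' \<longleftrightarrow> (\<exists>P\<in>mpolys r E. \<exists>k. \<forall>s. meval Q s \<noteq> 0 \<longrightarrow>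
     f s * meval Q s ^ k = meval P s \<and> f' s * meval Q s ^ k = meval (cmap \<delta> P) s)"

lemma regular_pair_cong:
  assumes "regular_pair r E \<delta> Q f f'" "\<And>s. meval Q s \<noteq> 0 \<Longrightarrow> f s = g s" "\<And>s. meval Q s \<noteq> 0 \<Longrightarrow> f' s = g' s"
  shows "regular_pair r E \<delta> Q g g'"
  using assms unfolding regular_pair_def by metis

context
  fixes K E :: "'a::alg_closed_field set" and \<delta> and r :: nat and Q :: "'a mpoly"
  assumes K: "is_subfield K" "K \<subseteq> E" and E: "is_subfield E" and \<delta>: "embedding K E \<delta>" and Q: "Q \<in> mpolys r K"
begin

lemma QE: "Q \<in> mpolys r E"
  using mpolys_mono[OF K(2) order_refl Q] .

lemma cmap_Q_power: "cmap \<delta> (Q ^ k) = Q ^ k"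
  by (rule cmap_fix[OF E \<delta>]) (rule mpolys_power[OF K(1) Q])

lemma cmap_mult_Q: "P \<in> mpolys r E \<Longrightarrow> cmap \<delta> (P * Q ^ k) = cmap \<delta> P * Q ^ k"
  using cmap_mult[OF E \<delta> _ mpolys_power[OF E QE], of P k] by (simp add: cmap_Q_power)

lemma regular_const: "a \<in> E \<Longrightarrow> regular_pair r E \<delta> Q (\<lambda>_. a) (\<lambda>_. \<delta> a)"
  unfolding regular_pair_def
  by (intro bexI[of _ "msingle 0 a"] exI[of _ 0]) (simp_all add: cmap_single[OF E \<delta>] mpolys_const[OF E])

lemma regular_var: "i < r \<Longrightarrow> regular_pair r E \<delta> Q (\<lambda>s. s i) (\<lambda>s. s i)"
  unfolding regular_pair_def
  by (intro bexI[of _ "msingle (msingle i 1) 1"] exI[of _ 0])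
    (use E in \<open>simp_all add: cmap_single[OF E \<delta>] mpolys_single emb_1[OF E \<delta>]\<close>)

lemma regular_add:
  assumes "regular_pair r E \<delta> Q f f'" "regular_pair r E \<delta> Q g g'"
  shows "regular_pair r E \<delta> Q (\<lambda>s. f s + g s) (\<lambda>s. f' s + g' s)"
proof -
  obtain P k where P: "P \<in> mpolys r E" "\<And>s. meval Q s \<noteq> 0 \<Longrightarrow> f s * meval Q s ^ k = meval P s"
    "\<And>s. meval Q s \<noteq> 0 \<Longrightarrow> f' s * meval Q s ^ k = meval (cmap \<delta> P) s"
    using assms(1) unfolding regular_pair_def by blast
  obtain R l where R: "R \<in> mpolys r E" "\<And>s. meval Q s \<noteq> 0 \<Longrightarrow> g s * meval Q s ^ l = meval R s"
    "\<And>s. meval Q s \<noteq> 0 \<Longrightarrow> g' s * meval Q s ^ l = meval (cmap \<delta> R) s"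
    using assms(2) unfolding regular_pair_def by blast
  note QE' = mpolys_power[OF E QE]
  have mem: "P * Q ^ l \<in> mpolys r E" "R * Q ^ k \<in> mpolys r E" using P R QE' by (auto intro: mpolys_mult[OF E])
  have c: "cmap \<delta> (P * Q ^ l + R * Q ^ k) = cmap \<delta> P * Q ^ l + cmap \<delta> R * Q ^ k"
    using cmap_add[OF E \<delta> mem] P(1) R(1) by (simp add: cmap_mult_Q)
  have "(f s + g s) * meval Q s ^ (k + l) = meval (P * Q ^ l + R * Q ^ k) s" if "meval Q s \<noteq> 0" for s
    using P(2)[OF that] R(2)[OF that] by (simp add: meval_add meval_mult meval_power power_add distrib_right flip: P(2)[OF that] R(2)[OF that])
  moreover have "(f' s + g' s) * meval Q s ^ (k + l) = meval (cmap \<delta> (P * Q ^ l + R * Q ^ k)) s" if "meval Q s \<noteq> 0" for s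
    unfolding c by (simp add: meval_add meval_mult meval_power power_add distrib_right flip: P(3)[OF that] R(3)[OF that])
  ultimately show ?thesis unfolding regular_pair_def
    using mpolys_add[OF E mem] by (intro bexI[of _ "P * Q ^ l + R * Q ^ k"] exI[of _ "k + l"]) auto
qed

lemma regular_mult:
  assumes "regular_pair r E \<delta> Q f f'" "regular_pair r E \<delta> Q g g'"
  shows "regular_pair r E \<delta> Q (\<lambda>s. f s * g s) (\<lambda>s. f' s * g' s)"
proof -
  obtain P k where P: "P \<in> mpolys r E" "\<And>s. meval Q s \<noteq> 0 \<Longrightarrow> f s * meval Q s ^ k = meval P s"
    "\<And>s. meval Q s \<noteq> 0 \<Longrightarrow> f' s * meval Q s ^ k = meval (cmap \<delta> P) s"
    using assms(1) unfolding regular_pair_def by blast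
  obtain R l where R: "R \<in> mpolys r E" "\<And>s. meval Q s \<noteq> 0 \<Longrightarrow> g s * meval Q s ^ l = meval R s"
    "\<And>s. meval Q s \<noteq> 0 \<Longrightarrow> g' s * meval Q s ^ l = meval (cmap \<delta> R) s"
    using assms(2) unfolding regular_pair_def by blast
  have "(f s * g s) * meval Q s ^ (k + l) = meval (P * R) s" if "meval Q s \<noteq> 0" for s
    by (simp add: meval_mult power_add mult_ac flip: P(2)[OF that] R(2)[OF that])
  moreover have "(f' s * g' s) * meval Q s ^ (k + l) = meval (cmap \<delta> (P * R)) s" if "meval Q s \<noteq> 0" for s
    unfolding cmap_mult[OF E \<delta> P(1) R(1)] by (simp add: meval_mult power_add mult_ac flip: P(3)[OF that] R(3)[OF that])
  ultimately show ?thesis unfolding regular_pair_def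
    using mpolys_mult[OF E P(1) R(1)] by (intro bexI[of _ "P * R"] exI[of _ "k + l"]) auto
qed

lemma regular_sum:
  "(\<And>i. i \<in> I \<Longrightarrow> regular_pair r E \<delta> Q (f i) (f' i)) \<Longrightarrow> regular_pair r E \<delta> Q (\<lambda>s. \<Sum>i\<in>I. f i s) (\<lambda>s. \<Sum>i\<in>I. f' i s)"
  using regular_const[of 0] E emb_0[OF E \<delta>]
  by (induction I rule: infinite_finite_induct) (auto intro: regular_add)

lemma regular_prod:
  "(\<And>i. i \<in> I \<Longrightarrow> regular_pair r E \<delta> Q (f i) (f' i)) \<Longrightarrow> regular_pair r E \<delta> Q (\<lambda>s. \<Prod>i\<in>I. f i s) (\<lambda>s. \<Prod>i\<in>I. f' i s)"
  using regular_const[of 1] E emb_1[OF E \<delta>]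
  by (induction I rule: infinite_finite_induct) (auto intro: regular_mult)

lemma regular_power:
  "regular_pair r E \<delta> Q f f' \<Longrightarrow> regular_pair r E \<delta> Q (\<lambda>s. f s ^ k) (\<lambda>s. f' s ^ k)"
  using regular_prod[of "{..<k}" "\<lambda>_. f" "\<lambda>_. f'"] by simp

lemma regular_div_Q:
  assumes "regular_pair r E \<delta> Q f f'"
  shows "regular_pair r E \<delta> Q (\<lambda>s. f s / meval Q s) (\<lambda>s. f' s / meval Q s)"
proof -
  obtain P k where "P \<in> mpolys r E" "\<forall>s. meval Q s \<noteq> 0 \<longrightarrow> f s * meval Q s ^ k = meval P s \<and> f' s * meval Q s ^ k = meval (cmap \<delta> P) s"
    using assms unfolding regular_pair_def by blast
  then show ?thesis unfolding regular_pair_def by (intro bexI[of _ P] exI[of _ "Suc k"]) auto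
qed

lemma regular_meval:
  assumes p: "p \<in> mpolys N E" and \<phi>: "\<And>i. i < N \<Longrightarrow> regular_pair r E \<delta> Q (\<phi> i) (\<phi>' i)"
  shows "regular_pair r E \<delta> Q (\<lambda>s. meval p (\<lambda>i. \<phi> i s)) (\<lambda>s. meval (cmap \<delta> p) (\<lambda>i. \<phi>' i s))"
proof -
  have "regular_pair r E \<delta> Q (\<lambda>s. \<Sum>m\<in>mkeys p. mlookup p m * (\<Prod>i\<in>mkeys m. \<phi> i s ^ mlookup m i))
     (\<lambda>s. \<Sum>m\<in>mkeys p. \<delta> (mlookup p m) * (\<Prod>i\<in>mkeys m. \<phi>' i s ^ mlookup m i))"
    using p by (intro regular_sum regular_mult regular_const regular_prod regular_power \<phi>) (auto simp: mpolys_def)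
  then show ?thesis
    by (simp add: meval_superset[of "mkeys p"] keys_cmap monomial_def lookup_cmap_emb[OF E \<delta>])
qed

text \<open>A numerator vanishing on \<open>{Q \<noteq> 0}\<close> is the zero polynomial, and so is
  its image under \<open>\<delta>\<close>. Equations satisfied by a parametrization pass in this way
  to its conjugates.\<close>

lemma regular_zero_transfer:
  assumes "regular_pair r E \<delta> Q f f'" "Q \<noteq> 0" "\<And>s. meval Q s \<noteq> 0 \<Longrightarrow> f s = 0" "meval Q s \<noteq> 0"
  shows "f' s = 0"
proof -
  obtain P k where P: "P \<in> mpolys r E" "\<And>s. meval Q s \<noteq> 0 \<Longrightarrow> f s * meval Q s ^ k = meval P s"
    "\<And>s. meval Q s \<noteq> 0 \<Longrightarrow> f' s * meval Q s ^ k = meval (cmap \<delta> P) s"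
    using assms(1) unfolding regular_pair_def by blast
  have "meval P s = 0" if "meval Q s \<noteq> 0" for s using P(2)[OF that] assms(3)[OF that] by simp
  then have "P = 0" by (rule mpoly_eq_0I_on[OF assms(2)])
  then show ?thesis using P(3)[OF assms(4)] assms(4) by (simp add: cmap_0[OF E \<delta>])
qed

text \<open>A point algebraically independent over \<open>E\<close> is generic: a numerator over
  \<open>E\<close> that vanishes there is 0.\<close>

lemma regular_zero_generic:
  assumes "regular_pair r E \<delta> Q f f'" "alg_independent E r s0" "meval Q s0 \<noteq> 0" "f s0 = 0" "meval Q s \<noteq> 0"
  shows "f s = 0"
proof -
  obtain P k where P: "P \<in> mpolys r E" "\<And>s. meval Q s \<noteq> 0 \<Longrightarrow> f s * meval Q s ^ k = meval P s"
    using assms(1) unfolding regular_pair_def by blast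
  have "meval P s0 = 0" using P(2)[OF assms(3)] assms(4) by simp
  then have "P = 0" using assms(2) P(1) by (auto simp: alg_independent_def)
  then show ?thesis using P(2)[OF assms(5)] assms(5) by simp
qed

text \<open>Polynomials form an integral domain. This is the irreducibility of affine space, from
  which parametrized varieties inherit absolute irreducibility.\<close>

lemma regular_mult_eq_0:
  assumes f: "regular_pair r E \<delta> Q f f'" and g: "regular_pair r E \<delta> Q g g'" and Q0: "Q \<noteq> 0"
    and fg: "\<And>s. meval Q s \<noteq> 0 \<Longrightarrow> f s * g s = 0"
  shows "(\<forall>s. meval Q s \<noteq> 0 \<longrightarrow> f s = 0) \<or> (\<forall>s. meval Q s \<noteq> 0 \<longrightarrow> g s = 0)"
proof -
  obtain P k where P: "\<And>s. meval Q s \<noteq> 0 \<Longrightarrow> f s * meval Q s ^ k = meval P s"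
    using f unfolding regular_pair_def by blast
  obtain R l where R: "\<And>s. meval Q s \<noteq> 0 \<Longrightarrow> g s * meval Q s ^ l = meval R s"
    using g unfolding regular_pair_def by blast
  have "meval (P * R) s = 0" if "meval Q s \<noteq> 0" for s
    using fg[OF that] by (auto simp: meval_mult simp flip: P[OF that] R[OF that])
  then have "P * R = 0" by (rule mpoly_eq_0I_on[OF Q0])
  then have "P = 0 \<or> R = 0" by simp
  then show ?thesis
  proof
    assume "P = 0"
    then have "f s = 0" if "meval Q s \<noteq> 0" for s using P[OF that] that by simp
    then show ?thesis by blast
  next
    assume "R = 0"
    then have "g s = 0" if "meval Q s \<noteq> 0" for s using R[OF that] that by simp
    then show ?thesis by blast
  qed
qed

text \<open>Linear disjointness of \<open>E[X]\<close> and the ambient field over \<open>E\<close>: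
  with the common denominator \<open>Q ^ k0\<close>, the relation is compared monomial by monomial,
  and \<open>ind\<close> applies to the coefficients.\<close>

lemma regular_independent:
  fixes \<gamma> :: "nat \<Rightarrow> 'a"
  assumes f: "\<And>j. j < n \<Longrightarrow> regular_pair r E \<delta> Q (f j) (f' j)" and Q0: "Q \<noteq> 0"
    and ind: "\<And>c. (\<forall>j<n. c j \<in> E) \<Longrightarrow> (\<Sum>j<n. c j * \<gamma> j) = 0 \<Longrightarrow> (\<forall>j<n. c j = 0)"
    and zero: "\<And>s. meval Q s \<noteq> 0 \<Longrightarrow> (\<Sum>j<n. \<gamma> j * f j s) = 0"
    and j: "j < n" and s: "meval Q s \<noteq> 0"
  shows "f j s = 0"
proof -
  have "\<forall>j. \<exists>P k. j < n \<longrightarrow> P \<in> mpolys r E \<and> (\<forall>s. meval Q s \<noteq> 0 \<longrightarrow> f j s * meval Q s ^ k = meval P s)"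
    using f unfolding regular_pair_def by blast
  then obtain P k where P: "\<And>j. j < n \<Longrightarrow> P j \<in> mpolys r E"
    "\<And>j s. j < n \<Longrightarrow> meval Q s \<noteq> 0 \<Longrightarrow> f j s * meval Q s ^ k j = meval (P j) s" by metis
  define k0 where "k0 = (\<Sum>j<n. k j)"
  have k0: "k j \<le> k0" if "j < n" for j unfolding k0_def using that by (intro member_le_sum) auto
  define R where "R j = P j * Q ^ (k0 - k j)" for j
  have RE: "R j \<in> mpolys r E" if "j < n" for j
    unfolding R_def using P(1)[OF that] mpolys_power[OF E QE] by (rule mpolys_mult[OF E])
  have R: "meval (R j) s = f j s * meval Q s ^ k0" if "j < n" "meval Q s \<noteq> 0" for j s
    using k0[OF that(1)] by (simp add: R_def meval_mult meval_power mult.assoc flip: P(2)[OF that] power_add)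
  have "meval (\<Sum>j<n. msingle 0 (\<gamma> j) * R j) s = 0" if "meval Q s \<noteq> 0" for s
  proof -
    have "meval (\<Sum>j<n. msingle 0 (\<gamma> j) * R j) s = (\<Sum>j<n. \<gamma> j * f j s) * meval Q s ^ k0"
      using that by (simp add: meval_sum meval_mult R sum_distrib_right mult.assoc)
    then show ?thesis using zero[OF that] by simp
  qed
  then have sum0: "(\<Sum>j<n. msingle 0 (\<gamma> j) * R j) = 0" by (rule mpoly_eq_0I_on[OF Q0])
  have "mlookup (R j) m = 0" for m
  proof -
    have "(\<Sum>j<n. mlookup (R j) m * \<gamma> j) = mlookup (\<Sum>j<n. msingle 0 (\<gamma> j) * R j) m"
      by (simp add: lookup_sum lookup_const_mult) (simp add: mult.commute)
    then have "(\<Sum>j<n. mlookup (R j) m * \<gamma> j) = 0" by (simp add: sum0)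
    moreover have "\<forall>j<n. mlookup (R j) m \<in> E" using RE by (simp add: mpolys_def)
    ultimately have "\<forall>j<n. mlookup (R j) m = 0" by (rule_tac ind)
    then show ?thesis using j by simp
  qed
  then have "R j = 0" by (intro poly_mapping_eqI) simp
  then have "f j s * meval Q s ^ k0 = 0" using R[OF j s] by simp
  then show ?thesis using s by simp
qed

end

text \<open>The coefficients of \<open>p\<close> are expanded along a family independent over
  \<open>E\<close>. With \<open>regular_independent\<close>, questions about ideals over the ambient
  field reduce to polynomials over \<open>E\<close>.\<close>

lemma mpoly_decompose:
  assumes E: "is_subfield E" and p: "p \<in> mpolys N UNIV"
  shows "\<exists>(n::nat) \<gamma> q. (\<forall>c. (\<forall>j<n. c j \<in> E) \<and> (\<Sum>j<n. c j * \<gamma> j) = 0 \<longrightarrow> (\<forall>j<n. c j = 0)) \<and>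
     (\<forall>j<n. q j \<in> mpolys N E) \<and> p = (\<Sum>j<n. msingle 0 (\<gamma> j) * q j)"
proof -
  from independent_representation[OF E finite_imageI[OF finite_keys], of "mlookup p" p] obtain n :: nat and \<gamma> where
    ng: "(\<forall>f. (\<forall>t<n. f t \<in> E) \<and> (\<Sum>t<n. f t * \<gamma> t) = 0 \<longrightarrow> (\<forall>t<n. f t = 0)) \<and>
      (\<forall>x\<in>mlookup p ` mkeys p. \<exists>f. (\<forall>t<n. f t \<in> E) \<and> x = (\<Sum>t<n. f t * \<gamma> t))"
    by (elim exE)
  have "\<forall>m. \<exists>f. m \<in> mkeys p \<longrightarrow> (\<forall>t<n. f t \<in> E) \<and> mlookup p m = (\<Sum>t<n. f t * \<gamma> t)"
    using conjunct2[OF ng] by simp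
  from choice[OF this] obtain f where f: "\<And>m. m \<in> mkeys p \<Longrightarrow> (\<forall>t<n. f m t \<in> E) \<and> mlookup p m = (\<Sum>t<n. f m t * \<gamma> t)" by blast
  define q where "q j = (\<Sum>m\<in>mkeys p. msingle m (f m j))" for j
  have lq: "mlookup (q j) m = (if m \<in> mkeys p then f m j else 0)" for j m
    by (simp add: q_def lookup_sum lookup_single when_def)
  have "q j \<in> mpolys N E" if "j < n" for j
    unfolding q_def using f that p by (intro mpolys_sum[OF E] mpolys_single[OF E]) (auto simp: mpolys_def)
  moreover have "p = (\<Sum>j<n. msingle 0 (\<gamma> j) * q j)"
  proof (rule poly_mapping_eqI)
    fix m
    show "mlookup p m = mlookup (\<Sum>j<n. msingle 0 (\<gamma> j) * q j) m"
    proof (cases "m \<in> mkeys p")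
      case True
      then show ?thesis using f[OF True] by (simp add: lookup_sum lookup_const_mult lq) (simp add: mult.commute)
    next
      case False
      then show ?thesis by (simp add: lookup_sum lookup_const_mult lq in_keys_iff)
    qed
  qed
  ultimately have "(\<forall>j<n. q j \<in> mpolys N E) \<and> p = (\<Sum>j<n. msingle 0 (\<gamma> j) * q j)" by blast
  with conjunct1[OF ng] show ?thesis by (intro exI[of _ n] exI[of _ \<gamma>] exI[of _ q] conjI) (elim conjE; assumption)+
qed

text \<open>Galois descent, by induction on the number of monomials.\<close>

lemma galois_descent:
  assumes gal: "galois_ext K K'"
    and W_add: "\<And>p q. p \<in> W \<Longrightarrow> q \<in> W \<Longrightarrow> p - q \<in> W"
    and W_scale: "\<And>a p. a \<in> K' \<Longrightarrow> p \<in> W \<Longrightarrow> msingle 0 a * p \<in> W"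
    and W_cmap: "\<And>\<tau> p. \<tau> \<in> galois_group K K' \<Longrightarrow> p \<in> W \<Longrightarrow> cmap \<tau> p \<in> W"
    and W: "W \<subseteq> mpolys N K'"
    and J: "W \<inter> mpolys N K \<subseteq> J"
    and J_add: "\<And>p q. p \<in> J \<Longrightarrow> q \<in> J \<Longrightarrow> p + q \<in> J"
    and J_scale: "\<And>a p. a \<in> K' \<Longrightarrow> p \<in> J \<Longrightarrow> msingle 0 a * p \<in> J"
    and p: "p \<in> W"
  shows "p \<in> J"
  using p
proof (induction "card (mkeys p)" arbitrary: p rule: less_induct)
  case less
  note D = galois_extD[OF gal]
  have pK': "mlookup p m \<in> K'" for m using less.prems W by (auto simp: mpolys_def)
  show ?case
  proof (cases "p = 0")
    case True
    then show ?thesis using less.prems J D(1) by (auto simp: mpolys_def)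
  next
    case False
    then obtain m0 where m0: "m0 \<in> mkeys p" by (metis keys_eq_empty all_not_in_conv)
    define a0 where "a0 = mlookup p m0"
    have a0: "a0 \<noteq> 0" "a0 \<in> K'" using m0 pK' by (auto simp: a0_def in_keys_iff)
    \<comment> \<open>With one coefficient normalised to 1, that monomial disappears from the
      difference \<open>q\<close> with a conjugate.\<close>
    define p1 where "p1 = msingle 0 (inverse a0) * p"
    have p1: "p1 \<in> W" unfolding p1_def using a0(2) less.prems by (intro W_scale sf_inverse[OF D(2)])
    have lp1: "mlookup p1 m = inverse a0 * mlookup p m" for m by (simp add: p1_def lookup_const_mult)
    have p_p1: "p = msingle 0 a0 * p1" by (rule poly_mapping_eqI) (simp add: lookup_const_mult lp1 a0)
    have k1: "mkeys p1 = mkeys p" using a0 by (auto simp: in_keys_iff lp1)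
    have "p1 \<in> J"
    proof (cases "\<forall>m. mlookup p1 m \<in> K")
      case True
      moreover have "p1 \<in> mpolys N K'" using p1 W by blast
      ultimately have "p1 \<in> mpolys N K" by (simp add: mpolys_def)
      then show ?thesis using p1 J by blast
    next
      case False
      then obtain m1 where m1: "mlookup p1 m1 \<notin> K" by blast
      define a where "a = mlookup p1 m1"
      have aK: "a \<in> K'" using p1 W by (auto simp: a_def mpolys_def)
      then obtain \<tau> where \<tau>: "\<tau> \<in> galois_group K K'" "\<tau> a \<noteq> a"
        using galois_fixed[OF gal D(1) subset_refl D(3)] m1 by (metis a_def)
      have e: "embedding K K' \<tau>" using \<tau>(1) by (rule galois_group_embedding)
      define q where "q = cmap \<tau> p1 - p1"
      have q: "q \<in> W" unfolding q_def using \<tau> p1 by (intro W_add W_cmap)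
      have lq: "mlookup q m = \<tau> (mlookup p1 m) - mlookup p1 m" for m
        by (simp add: q_def lookup_minus lookup_cmap_emb[OF D(2) e])
      have "mlookup q m0 = 0" unfolding lq lp1 using a0 emb_1[OF D(2) e] by (simp flip: a0_def)
      moreover have "mlookup q m = 0" if "m \<notin> mkeys p" for m
        using that unfolding k1[symmetric] by (simp add: lq in_keys_iff emb_0[OF D(2) e])
      ultimately have "mkeys q \<subseteq> mkeys p - {m0}" by (auto simp: in_keys_iff)
      then have "card (mkeys q) < card (mkeys p)" using m0 by (intro psubset_card_mono) auto
      then have qJ: "q \<in> J" using less.hyps q by blast
      \<comment> \<open>The multiple of \<open>q\<close> that cancels the coefficient
        \<open>a\<close> of \<open>m1\<close>; the coefficient of \<open>q\<close> there is
        \<open>\<tau> a - a\<close>, which is nonzero.\<close>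
      define c where "c = a / (\<tau> a - a)"
      have "\<tau> a \<in> K'" by (rule galois_embedding_image[OF gal e aK])
      then have cK: "c \<in> K'" unfolding c_def using aK by (intro sf_divide[OF D(2)] sf_diff[OF D(2)])
      define p2 where "p2 = p1 - msingle 0 c * q"
      have p2: "p2 \<in> W" unfolding p2_def using p1 q cK by (intro W_add W_scale)
      have lp2: "mlookup p2 m = mlookup p1 m - c * mlookup q m" for m
        by (simp add: p2_def lookup_minus lookup_const_mult)
      have "mlookup p2 m1 = 0" unfolding lp2 lq a_def[symmetric] using \<tau>(2) by (simp add: c_def)
      moreover have "mlookup p2 m = 0" if "m \<notin> mkeys p" for m
        using that \<open>mkeys q \<subseteq> mkeys p - {m0}\<close> unfolding lp2 by (metis Diff_iff k1 mult_zero_right not_in_keys_iff_lookup_eq_zero subsetD diff_zero)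
      moreover have "m1 \<in> mkeys p" using m1 D(1) unfolding k1[symmetric] in_keys_iff by auto
      ultimately have "card (mkeys p2) < card (mkeys p)"
        by (intro psubset_card_mono) (auto simp: in_keys_iff)
      then have p2J: "p2 \<in> J" using less.hyps p2 by blast
      have "p1 = p2 + msingle 0 c * q" by (simp add: p2_def)
      then show ?thesis using J_add[OF p2J J_scale[OF cK qJ]] by simp
    qed
    then show ?thesis using J_scale[OF a0(2), of p1] by (simp add: p_p1[symmetric])
  qed
qed

subsection \<open>PAC extensions and parametrized varieties\<close>

lemma mpoly_ring_simps:
  "monoid.mult (ring_of_type_algebra\<lparr>carrier := C\<rparr>) x y = x * y"
  "ring.add (ring_of_type_algebra\<lparr>carrier := C\<rparr>) x y = x + y"
  "monoid.one (ring_of_type_algebra\<lparr>carrier := C\<rparr>) = 1"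
  "ring.zero (ring_of_type_algebra\<lparr>carrier := C\<rparr>) = 0"
  "carrier (ring_of_type_algebra\<lparr>carrier := C\<rparr>) = C"
  "monoid.mult ring_of_type_algebra x y = x * y"
  "ring.add ring_of_type_algebra x y = x + y"
  "monoid.one ring_of_type_algebra = 1"
  "ring.zero ring_of_type_algebra = 0"
  by (simp_all add: ring_of_type_algebra_def)

lemma ring_mpolys:
  assumes A: "is_subfield (A :: 'a::alg_closed_field set)"
  shows "ring (ring_of_type_algebra\<lparr>carrier := mpolys n A\<rparr>)"
proof (rule ringI)
  show "abelian_group (ring_of_type_algebra\<lparr>carrier := mpolys n A\<rparr>)"
  proof (rule abelian_groupI, unfold mpoly_ring_simps)
    fix x assume "x \<in> mpolys n A"
    then show "\<exists>y\<in>mpolys n A. y + x = 0" using mpolys_uminus[OF A] by (intro bexI[of _ "- x"]) simp_all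
  qed (use A in \<open>auto simp: add_ac intro: mpolys_add\<close>)
  show "Group.monoid (ring_of_type_algebra\<lparr>carrier := mpolys n A\<rparr>)"
    by (rule monoidI, unfold mpoly_ring_simps) (use A in \<open>auto simp: mult_ac intro: mpolys_mult\<close>)
qed (unfold mpoly_ring_simps, simp_all add: distrib_left distrib_right)

lemma galois_ext_refl: "is_subfield K \<Longrightarrow> galois_ext K K"
  using galois_extI[of K "{}"] by (simp add: adjoin_empty)

text \<open>Applies the PAC property to the closure \<open>V\<close> of the image of
  \<open>\<phi>\<close> on \<open>{Q \<noteq> 0}\<close>, with the first \<open>r\<close>
  coordinates as rational map. By \<open>twist\<close> every conjugate parametrization reaches all
  points of the image, which makes \<open>V\<close> defined over \<open>K\<close> although
  \<open>\<phi>\<close> is only defined over \<open>K'\<close>. The conclusion hands over all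
  equations with coefficients in \<open>K'\<close> that hold on the image.\<close>

lemma PAC_parametrization:
  fixes K0 K K' :: "'a::alg_closed_field set" and \<phi> :: "nat \<Rightarrow> (nat \<Rightarrow> 'a) \<Rightarrow> 'a"
  assumes PAC: "PAC_extension K0 K" and gal: "galois_ext K K'" and Q: "Q \<in> mpolys r K" "Q \<noteq> 0"
    and r: "1 \<le> r" "r \<le> N" and s0: "alg_independent K' r s0"
    and twist: "\<And>\<tau>. \<tau> \<in> galois_group K K' \<Longrightarrow> \<exists>\<phi>'. (\<forall>i<N. regular_pair r K' \<tau> Q (\<phi> i) (\<phi>' i)) \<and>
      (\<forall>s. meval Q s \<noteq> 0 \<longrightarrow> (\<exists>s'. meval Q s' \<noteq> 0 \<and> (\<forall>i<N. \<phi>' i s' = \<phi> i s)))"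
    and indep: "alg_independent K' r (\<lambda>i. \<phi> i s0)"
    and sep: "\<And>j. j < N \<Longrightarrow> separable_over (adjoin K ((\<lambda>i. \<phi> i s0) ` {..<r})) (\<phi> j s0)"
  shows "\<exists>a. (\<forall>i<N. a i \<in> K) \<and> (\<forall>i<r. a i \<in> K0) \<and>
    (\<forall>p\<in>mpolys N K'. (\<forall>s. meval Q s \<noteq> 0 \<longrightarrow> meval p (\<lambda>i. \<phi> i s) = 0) \<longrightarrow> meval p a = 0)"
proof -
  note D = galois_extD[OF gal]
  have U: "is_subfield (UNIV :: 'a set)" by (rule is_subfieldI) auto
  have QK': "Q \<in> mpolys r K'" by (rule mpolys_mono[OF D(3) order_refl Q(1)])
  have Qs0: "meval Q s0 \<noteq> 0" using s0 QK' Q(2) unfolding alg_independent_def by blast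
  have idG: "(\<lambda>x. x) \<in> galois_group K K'" by (simp add: galois_group_iff[OF gal] embedding_id)
  have cmap_id: "cmap (\<lambda>x. x) P = P" for P :: "'a mpoly" by (rule poly_mapping_eqI) (simp add: lookup_cmap)
  have reg: "regular_pair r K' (\<lambda>x. x) Q (\<phi> i) (\<phi> i)" if i: "i < N" for i
  proof -
    obtain \<phi>' where "regular_pair r K' (\<lambda>x. x) Q (\<phi> i) (\<phi>' i)" using twist[OF idG] i by blast
    then show ?thesis unfolding regular_pair_def cmap_id by blast
  qed
  have regU: "regular_pair r UNIV (\<lambda>x. x) Q (\<phi> i) (\<phi> i)" if i: "i < N" for i
    using reg[OF i] mpolys_mono[OF subset_UNIV order_refl] unfolding regular_pair_def by blast
  define pt where "pt s = restrict (\<lambda>i. \<phi> i s) {..<N}" for s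
  define x where "x = pt s0"
  define S where "S = pt ` {s. meval Q s \<noteq> 0}"
  have pt_aff: "pt s \<in> affine_space N UNIV" for s by (simp add: pt_def affine_space_def)
  have meval_pt: "meval p (pt s) = meval p (\<lambda>i. \<phi> i s)" if "p \<in> mpolys N A" for p A s
    using that by (rule meval_cong) (simp add: pt_def)
  have evreg: "regular_pair r K' (\<lambda>x. x) Q (\<lambda>s. meval p (pt s)) (\<lambda>s. meval p (pt s))" if p: "p \<in> mpolys N K'" for p
    using regular_meval[OF D(1,3,2) embedding_id Q(1) p reg] by (simp add: cmap_id meval_pt[OF p])
  have evregU: "regular_pair r UNIV (\<lambda>x. x) Q (\<lambda>s. meval p (pt s)) (\<lambda>s. meval p (pt s))" if p: "p \<in> mpolys N UNIV" for p
    using regular_meval[OF D(1) subset_UNIV U embedding_id Q(1) p regU] by (simp add: cmap_id meval_pt[OF p])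
  have generic: "meval p (pt s) = 0" if "p \<in> mpolys N K'" "meval p x = 0" "meval Q s \<noteq> 0" for p s
    using regular_zero_generic[OF D(1,3,2) embedding_id Q(1) evreg[OF that(1)] s0 Qs0 _ that(3)] that(2)
    by (simp add: x_def)

  \<comment> \<open>The closure of the image and its absolute irreducibility\<close>
  define IV where "IV = {p \<in> mpolys N UNIV. \<forall>s. meval Q s \<noteq> 0 \<longrightarrow> meval p (pt s) = 0}"
  define V where "V = zero_locus N IV"
  have SV: "pt s \<in> V" if "meval Q s \<noteq> 0" for s
    using that pt_aff by (auto simp: V_def zero_locus_def IV_def)
  have xV: "x \<in> V" unfolding x_def by (rule SV[OF Qs0])
  have van: "vanishing_ideal N V = IV"
    using SV by (auto simp: vanishing_ideal_def V_def zero_locus_def IV_def)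
  have IV_V: "meval p y = 0" if "p \<in> IV" "y \<in> V" for p y
    using that by (auto simp: V_def zero_locus_def)
  have closed: "zariski_closed N V" unfolding zariski_closed_def V_def
    by (rule exI[of _ IV]) (simp add: IV_def Collect_mono_iff)

  have irr: "abs_irreducible N V"
    unfolding abs_irreducible_def
  proof (intro conjI allI impI)
    show "V \<noteq> {}" using xV by blast
    fix A B assume AB: "zariski_closed N A \<and> zariski_closed N B \<and> V = A \<union> B"
    have sepp: "\<exists>p\<in>mpolys N UNIV. (\<forall>y\<in>C. meval p y = 0) \<and> p \<notin> IV"
      if C: "zariski_closed N C" "C \<subseteq> V" "V \<noteq> C" for C
    proof -
      obtain T where T: "T \<subseteq> mpolys N UNIV" "C = zero_locus N T" using C(1) by (auto simp: zariski_closed_def)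
      obtain y where y: "y \<in> V" "y \<notin> C" using C by blast
      then have "y \<in> affine_space N UNIV" by (simp add: V_def zero_locus_def)
      then obtain p where p: "p \<in> T" "meval p y \<noteq> 0" using y T by (auto simp: zero_locus_def)
      then have "p \<notin> IV" using IV_V y by blast
      then show ?thesis using p T by (auto simp: zero_locus_def)
    qed
    show "V = A \<or> V = B"
    proof (rule ccontr)
      assume "\<not> (V = A \<or> V = B)"
      then obtain p q where p: "p \<in> mpolys N UNIV" "\<forall>y\<in>A. meval p y = 0" "p \<notin> IV"
        and q: "q \<in> mpolys N UNIV" "\<forall>y\<in>B. meval q y = 0" "q \<notin> IV"
        using sepp[of A] sepp[of B] AB by blast
      have "meval p (pt s) * meval q (pt s) = 0" if "meval Q s \<noteq> 0" for s
        using SV[OF that] AB p q by auto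
      then have "(\<forall>s. meval Q s \<noteq> 0 \<longrightarrow> meval p (pt s) = 0) \<or> (\<forall>s. meval Q s \<noteq> 0 \<longrightarrow> meval q (pt s) = 0)"
        by (rule regular_mult_eq_0[OF D(1) subset_UNIV U embedding_id Q(1) evregU[OF p(1)] evregU[OF q(1)] Q(2)])
      then show False using p q by (auto simp: IV_def)
    qed
  qed

  \<comment> \<open>Descent of the vanishing ideal to \<open>K\<close>\<close>
  let ?R = "ring_of_type_algebra\<lparr>carrier := mpolys N (UNIV :: 'a set)\<rparr>"
  interpret R: ring ?R by (rule ring_mpolys[OF U])
  have R_inv: "a_inv ?R p = - p" if "p \<in> mpolys N UNIV" for p
    using that mpolys_uminus[OF U that] by (intro R.minus_equality) (simp_all add: mpoly_ring_simps)
  have IVR: "IV \<subseteq> mpolys N UNIV" by (auto simp: IV_def)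
  have ideal_IV: "ideal IV ?R"
  proof (rule idealI)
    show "ring ?R" by (rule R.ring_axioms)
    show "subgroup IV (add_monoid ?R)"
      by (rule R.add.subgroupI)
        (use IVR R_inv U in \<open>auto simp: mpoly_ring_simps IV_def meval_add meval_uminus mpolys_add mpolys_uminus
          simp flip: a_inv_def intro!: exI[of _ 0]\<close>)
  qed (use U in \<open>auto simp: mpoly_ring_simps IV_def meval_mult mpolys_mult\<close>)
  define J where "J = genideal ?R (IV \<inter> mpolys N K)"
  have genR: "IV \<inter> mpolys N K \<subseteq> carrier ?R" using IVR by (simp add: mpoly_ring_simps le_infI1)
  have ideal_J: "ideal J ?R" unfolding J_def by (rule R.genideal_ideal[OF genR])
  have J_gen: "IV \<inter> mpolys N K \<subseteq> J" unfolding J_def by (rule R.genideal_self[OF genR])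
  have J_add: "p + q \<in> J" if "p \<in> J" "q \<in> J" for p q
    using additive_subgroup.a_closed[OF ideal.axioms(1)[OF ideal_J] that] by (simp add: mpoly_ring_simps)
  have J_scale: "msingle 0 a * p \<in> J" if "p \<in> J" for a p
    using ideal.I_l_closed[OF ideal_J that, of "msingle 0 a"] mpolys_const[OF U, of a] by (simp add: mpoly_ring_simps)
  have J0: "0 \<in> J" using additive_subgroup.zero_closed[OF ideal.axioms(1)[OF ideal_J]] by (simp add: mpoly_ring_simps)
  \<comment> \<open>First the polynomials over \<open>K'\<close>: they are stable under the Galois
    group because each conjugate parametrization reaches every point of the image.\<close>
  have "IV \<inter> mpolys N K' \<subseteq> J"
  proof
    fix p assume p: "p \<in> IV \<inter> mpolys N K'"
    show "p \<in> J"
    proof (rule galois_descent[OF gal, of "IV \<inter> mpolys N K'" N J])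
      show "p \<in> IV \<inter> mpolys N K'" by (rule p)
    next
      fix p q assume "p \<in> IV \<inter> mpolys N K'" "q \<in> IV \<inter> mpolys N K'"
      then show "p - q \<in> IV \<inter> mpolys N K'"
        using U D(2) by (auto simp: IV_def meval_diff intro: mpolys_diff)
    next
      fix a p assume "a \<in> K'" "p \<in> IV \<inter> mpolys N K'"
      then show "msingle 0 a * p \<in> IV \<inter> mpolys N K'"
        using U D(2) by (auto simp: IV_def meval_mult intro: mpolys_mult mpolys_const)
    next
      fix \<tau> p assume \<tau>: "\<tau> \<in> galois_group K K'" and p: "p \<in> IV \<inter> mpolys N K'"
      have e: "embedding K K' \<tau>" using \<tau> by (rule galois_group_embedding)
      obtain \<phi>' where \<phi>': "\<And>i. i < N \<Longrightarrow> regular_pair r K' \<tau> Q (\<phi> i) (\<phi>' i)"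
        "\<And>s. meval Q s \<noteq> 0 \<Longrightarrow> \<exists>s'. meval Q s' \<noteq> 0 \<and> (\<forall>i<N. \<phi>' i s' = \<phi> i s)"
        using twist[OF \<tau>] by blast
      have pK': "p \<in> mpolys N K'" using p by blast
      have cp: "cmap \<tau> p \<in> mpolys N K'" by (rule cmap_mpolys[OF D(2) e pK']) (rule galois_embedding_image[OF gal e])
      have zero: "meval p (\<lambda>i. \<phi> i s) = 0" if "meval Q s \<noteq> 0" for s
        using p that meval_pt[OF pK'] by (auto simp: IV_def)
      have "meval (cmap \<tau> p) (pt s) = 0" if "meval Q s \<noteq> 0" for s
      proof -
        obtain s' where s': "meval Q s' \<noteq> 0" "\<forall>i<N. \<phi>' i s' = \<phi> i s" using \<phi>'(2)[OF \<open>meval Q s \<noteq> 0\<close>] by blast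
        have "meval (cmap \<tau> p) (\<lambda>i. \<phi>' i s') = 0"
          by (rule regular_zero_transfer[OF D(1,3,2) e Q(1) regular_meval[OF D(1,3,2) e Q(1) pK' \<phi>'(1)] Q(2) zero s'(1)])
        also have "meval (cmap \<tau> p) (\<lambda>i. \<phi>' i s') = meval (cmap \<tau> p) (pt s)"
          using cp by (rule meval_cong) (use s' in \<open>simp add: pt_def\<close>)
        finally show ?thesis .
      qed
      then show "cmap \<tau> p \<in> IV \<inter> mpolys N K'" using cp mpolys_mono[OF subset_UNIV order_refl cp] by (simp add: IV_def)
    qed (use J_gen D(3) mpolys_mono[OF D(3) order_refl] J_add J_scale in auto)
  qed
  \<comment> \<open>From \<open>K'\<close> to the ambient field: the components of \<open>p\<close>
    along a family independent over \<open>K'\<close> vanish on the image separately.\<close>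
  have "IV \<subseteq> J"
  proof
    fix p assume p: "p \<in> IV"
    then have pU: "p \<in> mpolys N UNIV" using IVR by blast
    obtain n :: nat and \<gamma> q where
      ind: "\<forall>c. (\<forall>j<n. c j \<in> K') \<and> (\<Sum>j<n. c j * \<gamma> j) = 0 \<longrightarrow> (\<forall>j<n. c j = 0)" and
      q: "\<forall>j<n. q j \<in> mpolys N K'" and pq: "p = (\<Sum>j<n. msingle 0 (\<gamma> j) * q j)"
      using mpoly_decompose[OF D(2) pU] by (elim exE conjE)
    have zero: "(\<Sum>j<n. \<gamma> j * meval (q j) (pt s)) = 0" if "meval Q s \<noteq> 0" for s
      using p that by (simp add: IV_def pq meval_sum meval_mult)
    have "q j \<in> J" if j: "j < n" for j
    proof -
      have qj: "q j \<in> mpolys N K'" using q j by simp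
      have "meval (q j) (pt s) = 0" if "meval Q s \<noteq> 0" for s
      proof (rule regular_independent[OF D(1,3,2) embedding_id Q(1) evreg Q(2) _ zero j that])
        show "q j \<in> mpolys N K'" if "j < n" for j using q that by simp
        show "\<forall>j<n. c j = 0" if "\<forall>j<n. c j \<in> K'" "(\<Sum>j<n. c j * \<gamma> j) = 0" for c
          using spec[OF ind, of c] conjI[OF that] by (rule mp)
      qed
      then have "q j \<in> IV \<inter> mpolys N K'" using qj mpolys_mono[OF subset_UNIV order_refl qj] by (simp add: IV_def)
      then show ?thesis using \<open>IV \<inter> mpolys N K' \<subseteq> J\<close> by blast
    qed
    then have terms: "msingle 0 (\<gamma> j) * q j \<in> J" if "j < n" for j using J_scale that by blast
    have "(\<Sum>j\<in>I. msingle 0 (\<gamma> j) * q j) \<in> J" if "I \<subseteq> {..<n}" for I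
      using that by (induction I rule: infinite_finite_induct) (auto intro: J0 J_add terms)
    then show "p \<in> J" unfolding pq by blast
  qed
  moreover have "J \<subseteq> IV" unfolding J_def by (rule R.genideal_minimal[OF ideal_IV]) simp
  ultimately have "defined_over K N V" unfolding defined_over_def van J_def by blast
  then have variety: "abs_irreducible_variety K N V" using closed irr by (simp add: abs_irreducible_variety_def)

  \<comment> \<open>Generic point, dimension and separability\<close>
  have gen: "generic_point K N V x"
    unfolding generic_point_def
  proof (intro conjI ballI impI xV)
    fix p y assume p: "p \<in> mpolys N K" "meval p x = 0" and y: "y \<in> V"
    have "p \<in> mpolys N K'" by (rule mpolys_mono[OF D(3) order_refl p(1)])
    then have "p \<in> IV" using generic p(2) mpolys_mono[OF subset_UNIV order_refl p(1)] by (auto simp: IV_def)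
    then show "meval p y = 0" using IV_V y by blast
  qed

  have x_i: "x i = \<phi> i s0" if "i < N" for i using that by (simp add: x_def pt_def)
  have imr: "(\<lambda>i. \<phi> i s0) ` {..<r} = x ` {..<r}" using x_i r by (intro image_cong) auto
  define F where "F = adjoin K (x ` {..<r})"
  have F: "is_subfield F" "K \<subseteq> F" by (simp_all add: F_def adjoin_base)
  have KF: "function_field K N x \<subseteq> adjoin F (x ` {..<N})"
    unfolding function_field_def using F by (intro adjoin_mono) auto
  have sepF: "separable_over F y" if "y \<in> function_field K N x" for y
  proof (rule separable_over_adjoin[OF F(1)])
    show "y \<in> adjoin F (x ` {..<N})" using that KF by blast
    show "separable_over F z" if "z \<in> x ` {..<N}" for z
      using that sep x_i by (auto simp: F_def imr)
  qed
  have x_ff: "x i \<in> function_field K N x" if "i < N" for i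
    unfolding function_field_def using adjoin_gen[of "x ` {..<N}" K] that by auto
  have indepK': "alg_independent K' r x"
    unfolding alg_independent_def
  proof (intro ballI impI)
    fix p assume p: "p \<in> mpolys r K'" "meval p x = 0"
    have "meval p (\<lambda>i. \<phi> i s0) = meval p x" using p(1) by (rule meval_cong) (use x_i r in auto)
    then show "p = 0" using indep p by (auto simp: alg_independent_def)
  qed
  have trdeg: "has_trdeg K (function_field K N x) r"
    unfolding has_trdeg_def
  proof (intro exI[of _ x] conjI)
    show "x ` {..<r} \<subseteq> function_field K N x" using x_ff r by auto
    show "alg_independent K r x" by (rule alg_independent_mono[OF indepK' D(3)])
    show "algebraic_ext (adjoin K (x ` {..<r})) (function_field K N x)"
      using separable_imp_algebraic[OF sepF] unfolding algebraic_ext_def algebraic_over_def F_def by blast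
  qed
  define \<nu> where "\<nu> = restrict x {..<r}"
  have \<nu>: "\<nu> \<in> affine_space r (function_field K N x)" using x_ff r by (auto simp: \<nu>_def affine_space_def)
  have im\<nu>: "\<nu> ` {..<r} = x ` {..<r}" by (intro image_cong) (auto simp: \<nu>_def)
  have sepm: "separable_map K N r x \<nu>"
    unfolding separable_map_def im\<nu> using sepF separable_algebraic_ext_iff[OF F(1)] by (simp add: F_def)

  \<comment> \<open>Dominance of the projection\<close>
  have dom: "dominating K N r V x \<nu>"
    unfolding dominating_def zariski_dense_def
  proof (intro conjI allI impI)
    let ?Im = "{b \<in> affine_space r UNIV. \<exists>a\<in>V. rational_map_value K N r x \<nu> a b}"
    show "?Im \<subseteq> affine_space r UNIV" by blast
    fix Z assume Z: "zariski_closed r Z \<and> ?Im \<subseteq> Z"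
    then obtain T where T: "T \<subseteq> mpolys r UNIV" "Z = zero_locus r T" by (auto simp: zariski_closed_def)
    have "g = 0" if g: "g \<in> T" for g
    proof -
      have gU: "g \<in> mpolys r UNIV" using g T by blast
      have val: "meval g (pt s) = 0" if s: "meval Q s \<noteq> 0" for s
      proof -
        let ?b = "restrict (pt s) {..<r}"
        have "rational_map_value K N r x \<nu> (pt s) ?b"
          unfolding rational_map_value_def
        proof (intro allI impI)
          fix i assume i: "i < r"
          let ?p = "msingle (msingle i 1) 1 :: 'a mpoly"
          have "?p \<in> mpolys N K" using i r by (intro mpolys_var[OF D(1)]) simp
          then show "\<exists>p\<in>mpolys N K. \<exists>q\<in>mpolys N K. meval q (pt s) \<noteq> 0 \<and> \<nu> i = meval p x / meval q x \<and>
              ?b i = meval p (pt s) / meval q (pt s)"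
            using i D(1) by (intro bexI[of _ ?p] bexI[of _ 1]) (simp_all add: \<nu>_def)
        qed
        moreover have "?b \<in> affine_space r UNIV" by (simp add: affine_space_def)
        ultimately have "?b \<in> Z" using Z SV[OF s] by blast
        then have "meval g ?b = 0" using T g by (auto simp: zero_locus_def)
        also have "meval g ?b = meval g (pt s)" using gU by (rule meval_cong) simp
        finally show ?thesis .
      qed
      obtain n :: nat and \<gamma> q where
        ind: "\<forall>c. (\<forall>j<n. c j \<in> K') \<and> (\<Sum>j<n. c j * \<gamma> j) = 0 \<longrightarrow> (\<forall>j<n. c j = 0)" and
        q: "\<forall>j<n. q j \<in> mpolys r K'" and gq: "g = (\<Sum>j<n. msingle 0 (\<gamma> j) * q j)"
        using mpoly_decompose[OF D(2) gU] by (elim exE conjE)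
      have zero: "(\<Sum>j<n. \<gamma> j * meval (q j) (pt s)) = 0" if "meval Q s \<noteq> 0" for s
        using val[OF that] by (simp add: gq meval_sum meval_mult)
      have qN: "q j \<in> mpolys N K'" if "j < n" for j using q that mpolys_mono[OF subset_refl r(2)] by blast
      \<comment> \<open>The components of an equation for the projected image vanish at
        \<open>pt s0\<close>, whose first \<open>r\<close> coordinates are independent over
        \<open>K'\<close>; so only the zero equation remains.\<close>
      have "q j = 0" if j: "j < n" for j
      proof -
        have "meval (q j) (pt s0) = 0"
        proof (rule regular_independent[OF D(1,3,2) embedding_id Q(1) evreg Q(2) _ zero j Qs0])
          show "q j \<in> mpolys N K'" if "j < n" for j using qN that .
          show "\<forall>j<n. c j = 0" if "\<forall>j<n. c j \<in> K'" "(\<Sum>j<n. c j * \<gamma> j) = 0" for c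
            using spec[OF ind, of c] conjI[OF that] by (rule mp)
        qed
        then show ?thesis using indepK' q j unfolding alg_independent_def x_def by blast
      qed
      then show "g = 0" by (simp add: gq)
    qed
    then have "T \<subseteq> {0}" by blast
    then show "Z = affine_space r UNIV" unfolding T(2) zero_locus_def by auto
  qed

  \<comment> \<open>The rational point\<close>
  obtain a b where a: "a \<in> V" "a \<in> affine_space N K" and b: "b \<in> affine_space r K0"
    and rmv: "rational_map_value K N r x \<nu> a b"
    using PAC r(1) variety gen trdeg \<nu> dom sepm unfolding PAC_extension_def by blast
  have aK: "a i \<in> K" if "i < N" for i using a(2) that by (auto simp: affine_space_def)
  \<comment> \<open>The value \<open>b i\<close> may come from any fraction \<open>p / q\<close>
    representing the coordinate \<open>x i\<close>. The relation \<open>X_i q - p\<close> vanishes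
    at the generic point, hence at \<open>a\<close>, so \<open>b i = a i\<close>.\<close>
  have "a i \<in> K0" if i: "i < r" for i
  proof -
    obtain p q where pq: "p \<in> mpolys N K" "q \<in> mpolys N K" "meval q a \<noteq> 0" "\<nu> i = meval p x / meval q x"
      "b i = meval p a / meval q a"
      using rmv i unfolding rational_map_value_def by blast
    have gen': "meval p' a = 0" if "p' \<in> mpolys N K" "meval p' x = 0" for p'
      using gen a(1) that unfolding generic_point_def by blast
    have "meval q x \<noteq> 0" using gen'[OF pq(2)] pq(3) by blast
    let ?v = "msingle (msingle i 1) 1 :: 'a mpoly"
    have v: "?v \<in> mpolys N K" using i r by (intro mpolys_var[OF D(1)]) simp
    have "meval (?v * q - p) a = 0"
    proof (rule gen')
      show "?v * q - p \<in> mpolys N K" using v pq by (intro mpolys_diff[OF D(1)] mpolys_mult[OF D(1)])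
      show "meval (?v * q - p) x = 0"
        using pq(4) \<open>meval q x \<noteq> 0\<close> i by (simp add: meval_diff meval_mult \<nu>_def)
    qed
    then have "a i * meval q a = meval p a" by (simp add: meval_diff meval_mult)
    then have "b i = a i * meval q a / meval q a" using pq(5) by simp
    then have "b i = a i" using pq(3) by simp
    moreover have "b i \<in> K0" using b i by (auto simp: affine_space_def)
    ultimately show ?thesis by simp
  qed
  then have aK0: "\<forall>i<r. a i \<in> K0" by blast
  have "meval p a = 0" if p: "p \<in> mpolys N K'" "\<forall>s. meval Q s \<noteq> 0 \<longrightarrow> meval p (\<lambda>i. \<phi> i s) = 0" for p
  proof -
    have "p \<in> IV" using p meval_pt[OF p(1)] mpolys_mono[OF subset_UNIV order_refl p(1)] by (simp add: IV_def)
    then show ?thesis using IV_V a(1) by blast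
  qed
  then have "\<forall>p\<in>mpolys N K'. (\<forall>s. meval Q s \<noteq> 0 \<longrightarrow> meval p (\<lambda>i. \<phi> i s) = 0) \<longrightarrow> meval p a = 0" by simp
  moreover have "\<forall>i<N. a i \<in> K" using aK by simp
  ultimately show ?thesis using aK0 by (intro exI[of _ a] conjI)
qed

subsection \<open>Cyclic extensions of degree a power of the characteristic\<close>

text \<open>The derivative of \<open>X^p - X - c\<close> is the constant -1.\<close>

lemma separable_artin_schreier:
  fixes F :: "'a::alg_closed_field set"
  assumes F: "is_subfield F" and p: "CHAR('a) > 0" and y: "y ^ CHAR('a) - y \<in> F"
  shows "separable_over F y"
proof -
  let ?p = "CHAR('a)"
  let ?f = "Polynomial.monom 1 ?p - [:y ^ ?p - y, 1:]"
  have "?f \<in> polys_over F" using F y by (intro polys_over_diff polys_over_monom polys_over_pCons) auto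
  moreover have "poly ?f y = 0" by (simp add: poly_monom)
  moreover have "poly (pderiv ?f) y \<noteq> 0" by (simp add: pderiv_diff pderiv_monom pderiv_pCons)
  ultimately show ?thesis unfolding separable_over_def by blast
qed

lemma separable_artin_schreier_tower:
  fixes F :: "'a::alg_closed_field set" and z :: "nat \<Rightarrow> 'a"
  assumes F: "is_subfield F" and p: "CHAR('a) > 0"
    and z: "\<And>n. 1 \<le> n \<Longrightarrow> n \<le> r \<Longrightarrow> z n ^ CHAR('a) - z n \<in> adjoin F (z ` {1..<n})"
    and n: "1 \<le> n" "n \<le> r"
  shows "separable_over F (z n)"
  using n
proof (induction n rule: less_induct)
  case (less n)
  have "separable_over (adjoin F (z ` {1..<n})) (z n)"
    using z[OF less.prems] by (intro separable_artin_schreier p) simp_all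
  moreover have "separable_over F y" if "y \<in> adjoin F (z ` {1..<n})" for y
    using less by (intro separable_over_adjoin[OF F _ that]) auto
  ultimately show ?case by (rule separable_over_trans[OF F])
qed

text \<open>The \<open>p\<close> distinct elements 0, ..., p - 1 already exhaust the roots of
  \<open>X^p - X\<close>.\<close>

lemma prime_field_CHAR:
  fixes x :: "'a::alg_closed_field"
  assumes p: "CHAR('a) > 0" and x: "x ^ CHAR('a) = x"
  shows "\<exists>i. x = of_nat i"
proof -
  let ?p = "CHAR('a)"
  have prime: "prime ?p" by (rule prime_CHAR_semidom[OF p])
  then have p2: "?p \<ge> 2" by (rule prime_ge_2_nat)
  let ?f = "Polynomial.monom 1 ?p - [:0, 1::'a:]"
  have "poly.coeff ?f ?p = 1" using p2 by (simp add: coeff_pCons split: nat.splits)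
  then have f0: "?f \<noteq> 0" by (metis coeff_0 zero_neq_one)
  have deg: "Polynomial.degree ?f \<le> ?p"
    by (rule degree_le) (use p2 in \<open>auto simp: coeff_pCons split: nat.splits\<close>)
  have roots: "{x. poly ?f x = 0} = {x. x ^ ?p = x}" by (simp add: poly_monom)
  have fin: "finite {x::'a. x ^ ?p = x}" and card: "card {x::'a. x ^ ?p = x} \<le> ?p"
    using poly_roots_finite[OF f0] card_poly_roots_bound[OF f0] deg unfolding roots by auto
  have frob: "(of_nat i :: 'a) ^ ?p = of_nat i" for i
    using p by (induction i) (simp_all add: freshmans_dream[OF prime refl])
  have "inj_on (of_nat :: nat \<Rightarrow> 'a) {..<?p}"
  proof (rule inj_onI)
    fix i j assume ij: "i \<in> {..<?p}" "j \<in> {..<?p}" "(of_nat i :: 'a) = of_nat j"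
    have False if "m < k" "k < ?p" "(of_nat m :: 'a) = of_nat k" for m k
    proof -
      have "(of_nat (k - m) :: 'a) = 0" using that by (simp add: of_nat_diff)
      then have "?p dvd k - m" by (simp add: of_nat_eq_0_iff_char_dvd)
      then show False using that dvd_imp_le[of ?p "k - m"] by simp
    qed
    from this[of i j] this[of j i] show "i = j" using ij by (cases i j rule: linorder_cases) auto
  qed
  then have "card ((of_nat :: nat \<Rightarrow> 'a) ` {..<?p}) = ?p" by (simp add: card_image)
  moreover have "(of_nat :: nat \<Rightarrow> 'a) ` {..<?p} \<subseteq> {x. x ^ ?p = x}" using frob by auto
  ultimately have "(of_nat :: nat \<Rightarrow> 'a) ` {..<?p} = {x. x ^ ?p = x}"
    using fin card by (intro card_seteq) auto
  then show ?thesis using x by blast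
qed

text \<open>In characteristic \<open>p\<close>, Frobenius on the coefficients only. The variable
  \<open>T\<close> stays fixed, so this is not the \<open>p\<close>-th power, and
  \<open>1 + T\<close> is invariant.\<close>

definition frob :: "'a::alg_closed_field fps \<Rightarrow> 'a fps" where
  "frob f = Abs_fps (\<lambda>n. fps_nth f n ^ CHAR('a))"

lemma frob_nth [simp]: "fps_nth (frob (f :: 'a::alg_closed_field fps)) n = fps_nth f n ^ CHAR('a)"
  by (simp add: frob_def)

lemma frob_mult: "CHAR('a::alg_closed_field) > 0 \<Longrightarrow> frob (f * g) = frob f * frob (g :: 'a fps)"
  by (rule fps_ext) (simp add: fps_mult_nth freshmans_dream_sum[OF prime_CHAR_semidom refl] power_mult_distrib)

lemma fps_mult_cong_upto:
  assumes "\<And>n. n \<le> r \<Longrightarrow> fps_nth f n = fps_nth f' n" "\<And>n. n \<le> r \<Longrightarrow> fps_nth g n = fps_nth g' n" "n \<le> r"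
  shows "fps_nth (f * g) n = fps_nth (f' * g' :: 'a::comm_semiring_1 fps) n"
  unfolding fps_mult_nth using assms by (intro sum.cong) auto

text \<open>Agreement of the coefficients up to \<open>r\<close> is congruence modulo
  \<open>T^(r+1)\<close>; a series with nonzero constant term is a unit there.\<close>

lemma fps_cancel_upto:
  fixes f g h :: "'a::field fps"
  assumes "\<And>n. n \<le> r \<Longrightarrow> fps_nth (f * h) n = fps_nth (g * h) n" "fps_nth h 0 \<noteq> 0" "n \<le> r"
  shows "fps_nth f n = fps_nth g n"
proof -
  have "fps_nth (f * h * inverse h) n = fps_nth (g * h * inverse h) n"
    by (rule fps_mult_cong_upto[of r]) (use assms in auto)
  then show ?thesis using inverse_mult_eq_1'[OF assms(2)] by (simp add: mult.assoc)
qed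

lemma fps_mult_nth_first: "fps_nth (f * g) n = fps_nth f 0 * fps_nth g n + (\<Sum>i=1..n. fps_nth f i * fps_nth g (n - i))"
  for f g :: "'a::comm_semiring_1 fps"
  unfolding fps_mult_nth by (simp add: sum.atLeast_Suc_atMost)

lemma fps_mult_nth_last: "fps_nth (f * g) n = fps_nth f n * fps_nth g 0 + (\<Sum>i<n. fps_nth f i * fps_nth g (n - i))"
  for f g :: "'a::comm_semiring_1 fps"
proof -
  have "{0..n} = insert n {..<n}" by auto
  then show ?thesis unfolding fps_mult_nth by simp
qed

text \<open>
  The solutions of \<open>frob z = b z\<close> among the truncated power series with constant term 1
  form a torsor under a group of power series over the prime field.
\<close>

lemma abelian_ext_frob_equation:
  fixes K0 :: "'a::alg_closed_field set"
  assumes K0: "is_subfield K0" and p: "CHAR('a) > 0"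
    and b: "\<And>n. n \<le> r \<Longrightarrow> fps_nth b n \<in> K0" "fps_nth b 0 = 1" and z0: "fps_nth z 0 = 1"
    and eq: "\<And>n. n \<le> r \<Longrightarrow> fps_nth (frob z) n = fps_nth (b * z) n"
  shows "abelian_ext K0 (adjoin K0 (fps_nth z ` {1..r}))"
proof -
  let ?Z = "fps_nth z ` {1..r}"
  let ?E = "adjoin K0 ?Z"
  have E: "is_subfield ?E" "K0 \<subseteq> ?E" "?Z \<subseteq> ?E" by (simp_all add: adjoin_base adjoin_gen)
  have zE: "fps_nth z n \<in> ?E" if "n \<le> r" for n
    using that E z0 by (cases "n = 0") (auto intro: subsetD[OF E(3)])
  have twist: "\<exists>c. (\<forall>n\<le>r. fps_nth c n \<in> range of_nat) \<and> (\<forall>n\<le>r. \<tau> (fps_nth z n) = fps_nth (c * z) n)"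
    if \<tau>: "embedding K0 ?E \<tau>" for \<tau>
  proof -
    define z' where "z' = Abs_fps (\<lambda>n. \<tau> (fps_nth z n))"
    have z'0: "fps_nth z' 0 = 1" using emb_1[OF E(1) \<tau>] by (simp add: z'_def z0)
    have eq': "fps_nth (frob z') n = fps_nth (b * z') n" if n: "n \<le> r" for n
    proof -
      have "fps_nth (frob z') n = \<tau> (fps_nth (frob z) n)"
        using zE[OF n] emb_power[OF E(1) \<tau>] by (simp add: z'_def)
      also have "\<dots> = \<tau> (\<Sum>i=0..n. fps_nth b i * fps_nth z (n - i))" using eq[OF n] by (simp only: fps_mult_nth)
      also have "\<dots> = (\<Sum>i=0..n. \<tau> (fps_nth b i * fps_nth z (n - i)))"
        using n b(1) E zE by (intro emb_sum[OF E(1) \<tau>] sf_mult[OF E(1)]) auto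
      also have "\<dots> = (\<Sum>i=0..n. fps_nth b i * \<tau> (fps_nth z (n - i)))"
      proof (rule sum.cong[OF refl])
        fix i assume i: "i \<in> {0..n}"
        then have "fps_nth b i \<in> K0" using b n by auto
        then show "\<tau> (fps_nth b i * fps_nth z (n - i)) = fps_nth b i * \<tau> (fps_nth z (n - i))"
          using emb_mult[OF E(1) \<tau>, of "fps_nth b i" "fps_nth z (n - i)"] E zE[of "n - i"] n emb_fix[OF E(1) \<tau>] by auto
      qed
      finally show ?thesis by (simp add: fps_mult_nth z'_def)
    qed
    \<comment> \<open>The quotient of two solutions is fixed by \<open>frob\<close> up to order
      \<open>r\<close>, so its coefficients up to \<open>r\<close> lie in the prime field.\<close>
    define c where "c = z' * inverse z"
    have c0: "fps_nth c 0 = 1" by (simp add: c_def z'0 z0)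
    have cz: "c * z = z'" using inverse_mult_eq_1[of z] z0 by (simp add: c_def mult.assoc)
    have "fps_nth (frob c) n = fps_nth c n" if "n \<le> r" for n
    proof (rule fps_cancel_upto[OF _ _ that, of _ "frob z"])
      show "fps_nth (frob z) 0 \<noteq> 0" by (simp add: z0)
      fix n assume n: "n \<le> r"
      have "fps_nth (frob c * frob z) n = fps_nth (frob z') n" using frob_mult[OF p, of c z] by (simp add: cz)
      also have "\<dots> = fps_nth (b * z') n" by (rule eq'[OF n])
      also have "b * z' = c * (b * z)" by (simp add: mult_ac flip: cz)
      also have "fps_nth (c * (b * z)) n = fps_nth (c * frob z) n"
        using eq n by (intro fps_mult_cong_upto[of r]) auto
      finally show "fps_nth (frob c * frob z) n = fps_nth (c * frob z) n" .
    qed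
    then have "\<forall>n\<le>r. fps_nth c n \<in> range of_nat" using prime_field_CHAR[OF p] by fastforce
    then show ?thesis by (intro exI[of _ c]) (simp add: cz, simp add: z'_def)
  qed
  have range: "x \<in> K0" if "x \<in> range of_nat" for x using that sf_of_nat[OF K0] by auto
  show ?thesis
  proof (rule abelian_extI[OF K0])
    fix x assume "x \<in> ?Z"
    then obtain n where n: "x = fps_nth z n" "1 \<le> n" "n \<le> r" by auto
    have "separable_over K0 (fps_nth z n)"
    proof (rule separable_artin_schreier_tower[OF K0 p _ n(2,3)])
      fix n assume n: "1 \<le> n" "n \<le> r"
      let ?G = "adjoin K0 (fps_nth z ` {1..<n})"
      \<comment> \<open>Coefficient \<open>n\<close> of the equation, with both constant terms equal
        to 1: an Artin-Schreier equation over the earlier coefficients.\<close>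
      have "fps_nth z n ^ CHAR('a) - fps_nth z n = (\<Sum>i=1..n. fps_nth b i * fps_nth z (n - i))"
        using eq[OF n(2)] by (simp add: fps_mult_nth_first b(2))
      also have "\<dots> \<in> ?G"
      proof (intro sf_sum sf_mult is_subfield_adjoin)
        fix i assume i: "i \<in> {1..n}"
        show "fps_nth b i \<in> ?G" using b(1)[of i] i n adjoin_base[of K0 "fps_nth z ` {1..<n}"] by auto
        show "fps_nth z (n - i) \<in> ?G"
          using i z0 adjoin_gen[of "fps_nth z ` {1..<n}" K0] by (cases "n - i = 0") auto
      qed
      finally show "fps_nth z n ^ CHAR('a) - fps_nth z n \<in> ?G" .
    qed
    then show "separable_over K0 x" using n by simp
  next
    fix \<tau> x assume \<tau>: "embedding K0 ?E \<tau>" and "x \<in> ?Z"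
    then obtain n where n: "x = fps_nth z n" "1 \<le> n" "n \<le> r" by auto
    obtain c where c: "\<forall>n\<le>r. fps_nth c n \<in> range of_nat" "\<forall>n\<le>r. \<tau> (fps_nth z n) = fps_nth (c * z) n"
      using twist[OF \<tau>] by blast
    have "fps_nth (c * z) n \<in> ?E"
      unfolding fps_mult_nth using c(1) range E zE n by (intro sf_sum[OF E(1)] sf_mult[OF E(1)]) auto
    then show "\<tau> x \<in> ?E" using c n by simp
  next
    fix \<sigma> \<tau> x assume \<sigma>: "embedding K0 ?E \<sigma>" and \<tau>: "embedding K0 ?E \<tau>" and "x \<in> ?Z"
    then obtain n where n: "x = fps_nth z n" "1 \<le> n" "n \<le> r" by auto
    \<comment> \<open>\<open>\<sigma>\<close> fixes the relevant coefficients of \<open>c\<close>,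
      so composing multiplies \<open>z\<close> by \<open>c * d\<close>, which is symmetric in the
      two embeddings.\<close>
    have comp: "\<sigma> (\<tau> (fps_nth z n)) = fps_nth (c * d * z) n"
      if \<sigma>: "embedding K0 ?E \<sigma>" and c: "\<forall>n\<le>r. fps_nth c n \<in> range of_nat" "\<forall>n\<le>r. \<tau> (fps_nth z n) = fps_nth (c * z) n"
        and d: "\<forall>n\<le>r. \<sigma> (fps_nth z n) = fps_nth (d * z) n" for c d \<sigma> \<tau>
    proof -
      have "\<sigma> (\<tau> (fps_nth z n)) = \<sigma> (\<Sum>i=0..n. fps_nth c i * fps_nth z (n - i))"
        using c(2) n by (simp add: fps_mult_nth)
      also have "\<dots> = (\<Sum>i=0..n. \<sigma> (fps_nth c i * fps_nth z (n - i)))"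
        using n c(1) range E zE by (intro emb_sum[OF E(1) \<sigma>] sf_mult[OF E(1)]) auto
      also have "\<dots> = (\<Sum>i=0..n. fps_nth c i * fps_nth (d * z) (n - i))"
      proof (rule sum.cong[OF refl])
        fix i assume i: "i \<in> {0..n}"
        then have "fps_nth c i \<in> K0" using c range n by auto
        then show "\<sigma> (fps_nth c i * fps_nth z (n - i)) = fps_nth c i * fps_nth (d * z) (n - i)"
          using emb_mult[OF E(1) \<sigma>, of "fps_nth c i" "fps_nth z (n - i)"] E zE[of "n - i"] n d emb_fix[OF E(1) \<sigma>] by auto
      qed
      also have "\<dots> = fps_nth (c * (d * z)) n" by (simp only: fps_mult_nth[of c])
      finally show ?thesis by (simp add: mult.assoc)
    qed
    obtain c where c: "\<forall>n\<le>r. fps_nth c n \<in> range of_nat" "\<forall>n\<le>r. \<tau> (fps_nth z n) = fps_nth (c * z) n"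
      using twist[OF \<tau>] by blast
    obtain d where d: "\<forall>n\<le>r. fps_nth d n \<in> range of_nat" "\<forall>n\<le>r. \<sigma> (fps_nth z n) = fps_nth (d * z) n"
      using twist[OF \<sigma>] by blast
    show "\<sigma> (\<tau> x) = \<tau> (\<sigma> x)"
      using comp[OF \<sigma> c d(2)] comp[OF \<tau> d c(2)] n by (simp add: mult.commute)
  qed
qed

text \<open>Division by a series with constant term 1, coefficient by coefficient.\<close>

lemma fps_unique_factor_mem:
  assumes E: "is_subfield E" and y: "\<And>n. n \<le> r \<Longrightarrow> fps_nth y n \<in> E" "fps_nth y 0 = 1"
    and uy: "\<And>n. n \<le> r \<Longrightarrow> fps_nth (u * y) n \<in> E" and n: "n \<le> r"
  shows "fps_nth u n \<in> E"
  using n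
proof (induction n rule: less_induct)
  case (less n)
  have "fps_nth u n = fps_nth (u * y) n - (\<Sum>i<n. fps_nth u i * fps_nth y (n - i))"
    by (simp add: fps_mult_nth_last y(2))
  also have "\<dots> \<in> E" using less uy y(1) by (intro sf_diff[OF E] sf_sum[OF E] sf_mult[OF E]) auto
  finally show ?case .
qed

text \<open>
  The map \<open>y \<mapsto> w frob(y) / y\<close> on truncated power series is triangular with separable steps
  \<open>y\<^sub>n\<^sup>p - y\<^sub>n + \<dots>\<close>, so the PAC property applies to it.
\<close>

lemma PAC_frob_equation:
  fixes K0 K :: "'a::alg_closed_field set"
  assumes univ: "universal_domain_over K" and PAC: "PAC_extension K0 K" and p: "CHAR('a) > 0" and r: "1 \<le> r"
    and w: "\<And>n. n \<le> r \<Longrightarrow> fps_nth w n \<in> K" "fps_nth w 0 = 1"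
  shows "\<exists>y b. (\<forall>n\<le>r. fps_nth y n \<in> K \<and> fps_nth b n \<in> K0) \<and> fps_nth y 0 = 1 \<and> fps_nth b 0 = 1 \<and>
    (\<forall>n\<le>r. fps_nth (w * frob y) n = fps_nth (b * y) n)"
proof -
  let ?p = "CHAR('a)"
  have K: "is_subfield K" and K0: "is_subfield K0" using PAC by (auto simp: PAC_extension_def subfield_ambient_iff)
  note gal = galois_ext_refl[OF K]
  obtain s0 where s0: "alg_independent K r s0" using univ by (auto simp: universal_domain_over_def)
  \<comment> \<open>The constant term 1 is not a parameter, hence the shift: parameter
    \<open>n - 1\<close> is coefficient \<open>n\<close>.\<close>
  define Y where "Y s = Abs_fps (\<lambda>n. if n = 0 then 1 else s (n - 1))" for s :: "nat \<Rightarrow> 'a"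
  define B where "B s = w * frob (Y s) * inverse (Y s)" for s
  have Y: "fps_nth (Y s) 0 = 1" "n > 0 \<Longrightarrow> fps_nth (Y s) n = s (n - 1)" for s n by (simp_all add: Y_def)
  have BY: "B s * Y s = w * frob (Y s)" for s
    using inverse_mult_eq_1[of "Y s"] Y(1) by (simp add: B_def mult.assoc)
  have B0: "fps_nth (B s) 0 = 1" for s by (simp add: B_def Y(1) w(2))
  have Brec: "fps_nth (B s) n = (\<Sum>i=0..n. fps_nth w i * fps_nth (Y s) (n - i) ^ ?p) - (\<Sum>i<n. fps_nth (B s) i * fps_nth (Y s) (n - i))" for s n
    using fps_mult_nth_last[of "B s" "Y s" n] Y(1) by (simp add: BY fps_mult_nth)
  \<comment> \<open>As \<open>Y s\<close> has constant term 1, the coefficients of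
    \<open>B s\<close> are polynomials in the parameters; the parameter space is the whole affine
    space.\<close>
  define Q where "Q = (1 :: 'a mpoly)"
  have Q: "Q \<in> mpolys r K" "Q \<noteq> 0" "\<And>s. meval Q s = 1" using K by (simp_all add: Q_def)
  have regY: "regular_pair r K \<tau> Q (\<lambda>s. fps_nth (Y s) n) (\<lambda>s. fps_nth (Y s) n)"
    if \<tau>: "embedding K K \<tau>" and n: "n \<le> r" for \<tau> n
  proof (cases "n = 0")
    case True
    then show ?thesis using regular_const[OF K subset_refl K \<tau> Q(1), of 1] K by (simp add: Y(1) emb_1[OF K \<tau>])
  next
    case False
    then show ?thesis using regular_var[OF K subset_refl K \<tau> Q(1), of "n - 1"] n by (simp add: Y(2))
  qed
  have regB: "regular_pair r K \<tau> Q (\<lambda>s. fps_nth (B s) n) (\<lambda>s. fps_nth (B s) n)"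
    if \<tau>: "embedding K K \<tau>" and n: "n \<le> r" for \<tau> n
    using n
  proof (induction n rule: less_induct)
    case (less n)
    note R = K subset_refl K \<tau> Q(1)
    have c: "regular_pair r K \<tau> Q (\<lambda>s. a) (\<lambda>s. a)" if "a \<in> K" for a
      using regular_const[OF R that] emb_fix[OF K \<tau> that] by simp
    have "regular_pair r K \<tau> Q
      (\<lambda>s. (\<Sum>i=0..n. fps_nth w i * fps_nth (Y s) (n - i) ^ ?p) + (- 1) * (\<Sum>i<n. fps_nth (B s) i * fps_nth (Y s) (n - i)))
      (\<lambda>s. (\<Sum>i=0..n. fps_nth w i * fps_nth (Y s) (n - i) ^ ?p) + (- 1) * (\<Sum>i<n. fps_nth (B s) i * fps_nth (Y s) (n - i)))"
      using less w K
      by (intro regular_add[OF R] regular_sum[OF R] regular_mult[OF R] regular_power[OF R] regY[OF \<tau>] c sf_uminus[OF K]) auto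
    then show ?case by (rule regular_pair_cong) (simp_all add: Brec[of _ n])
  qed
  \<comment> \<open>Coordinates below \<open>r\<close> are the base point, coefficients 1 to
    \<open>r\<close> of \<open>B s\<close>; the remaining \<open>r\<close> are the parameters,
    coefficients 1 to \<open>r\<close> of \<open>Y s\<close>.\<close>
  define \<phi> where "\<phi> i s = (if i < r then fps_nth (B s) (Suc i) else s (i - r))" for i and s :: "nat \<Rightarrow> 'a"
  have reg: "regular_pair r K \<tau> Q (\<phi> i) (\<phi> i)" if "embedding K K \<tau>" "i < 2 * r" for \<tau> i
    using regB[OF that(1), of "Suc i"] regular_var[OF K subset_refl K that(1) Q(1), of "i - r"] that(2)
    by (cases "i < r") (simp_all add: \<phi>_def[abs_def])

  \<comment> \<open>Over an algebraically closed field every base point is hit: the next coefficient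
    \<open>t\<close> of \<open>y\<close> solves \<open>t^p - t + c = 0\<close>, where
    \<open>c\<close> collects the coefficients already chosen. The independence of the base
    coordinates follows from this.\<close>
  have surj: "\<exists>s. \<forall>i<r. fps_nth (B s) (Suc i) = b i" for b :: "nat \<Rightarrow> 'a"
  proof -
    define bf where "bf = Abs_fps (\<lambda>n. if n = 0 then 1 else b (n - 1))"
    have bf0: "fps_nth bf 0 = 1" by (simp add: bf_def)
    have "\<exists>y. fps_nth y 0 = 1 \<and> (\<forall>m\<le>n. fps_nth (w * frob y) m = fps_nth (bf * y) m)" for n
    proof (induction n)
      case 0
      show ?case by (intro exI[of _ 1]) (simp add: w(2) bf0)
    next
      case (Suc n)
      then obtain y where y: "fps_nth y 0 = 1" "\<forall>m\<le>n. fps_nth (w * frob y) m = fps_nth (bf * y) m" by blast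
      define c where "c = (\<Sum>i=1..Suc n. fps_nth w i * fps_nth (frob y) (Suc n - i)) - (\<Sum>i=1..Suc n. fps_nth bf i * fps_nth y (Suc n - i))"
      have p2: "?p \<ge> 2" using prime_ge_2_nat[OF prime_CHAR_semidom[OF p]] .
      have "poly.coeff (Polynomial.monom 1 ?p + [:c, -1:]) ?p \<noteq> 0" using p2 by (simp add: coeff_pCons split: nat.splits)
      then have "?p \<le> Polynomial.degree (Polynomial.monom 1 ?p + [:c, -1:])" by (rule le_degree)
      then obtain t where "poly (Polynomial.monom 1 ?p + [:c, -1:]) t = 0"
        using alg_closed_imp_poly_has_root p2 by (metis less_le_trans pos2)
      then have t: "t ^ ?p + c - t = 0" by (simp add: poly_monom algebra_simps)
      define y' where "y' = Abs_fps (\<lambda>m. if m = Suc n then t else fps_nth y m)"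
      have y': "fps_nth y' m = fps_nth y m" if "m \<le> n" for m using that by (simp add: y'_def)
      have "fps_nth (w * frob y') m = fps_nth (bf * y') m" if m: "m \<le> Suc n" for m
      proof (cases "m = Suc n")
        case True
        have y'': "fps_nth y' (Suc n - i) = fps_nth y (Suc n - i)" if "Suc 0 \<le> i" for i
          using that by (intro y') auto
        have "(\<Sum>i=1..Suc n. fps_nth w i * fps_nth (frob y') (Suc n - i)) = (\<Sum>i=1..Suc n. fps_nth w i * fps_nth (frob y) (Suc n - i))"
          "(\<Sum>i=1..Suc n. fps_nth bf i * fps_nth y' (Suc n - i)) = (\<Sum>i=1..Suc n. fps_nth bf i * fps_nth y (Suc n - i))"
          by (auto intro!: sum.cong simp: y'')
        then have "fps_nth (w * frob y') m - fps_nth (bf * y') m = t ^ ?p + c - t"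
          unfolding True fps_mult_nth_first w(2) bf0 c_def by (simp add: y'_def)
        then show ?thesis using t by simp
      next
        case False
        then have "m \<le> n" using m by simp
        have "fps_nth (w * frob y') m = fps_nth (w * frob y) m" "fps_nth (bf * y') m = fps_nth (bf * y) m"
          using y' \<open>m \<le> n\<close> by (auto intro!: fps_mult_cong_upto[of n])
        then show ?thesis using y(2) \<open>m \<le> n\<close> by simp
      qed
      then show ?case using y y' by (intro exI[of _ y']) auto
    qed
    then obtain y where y: "fps_nth y 0 = 1" "\<forall>m\<le>r. fps_nth (w * frob y) m = fps_nth (bf * y) m" by blast
    define s where "s = (\<lambda>i. fps_nth y (Suc i))"
    have Ys: "Y s = y" by (rule fps_ext) (simp add: Y_def s_def y(1))
    have "fps_nth (B s * y) n = fps_nth (bf * y) n" if "n \<le> r" for n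
      using BY[of s] y(2) that unfolding Ys by simp
    then have "fps_nth (B s) n = fps_nth bf n" if "n \<le> r" for n
      by (rule fps_cancel_upto[of r]) (simp_all add: y(1) that)
    then have "\<forall>i<r. fps_nth (B s) (Suc i) = b i" by (simp add: bf_def)
    then show ?thesis by blast
  qed

  have "\<exists>a. (\<forall>i<2 * r. a i \<in> K) \<and> (\<forall>i<r. a i \<in> K0) \<and>
    (\<forall>q\<in>mpolys (2 * r) K. (\<forall>s. meval Q s \<noteq> 0 \<longrightarrow> meval q (\<lambda>i. \<phi> i s) = 0) \<longrightarrow> meval q a = 0)"
  proof (rule PAC_parametrization[OF PAC gal Q(1,2) r _ s0])
    show "r \<le> 2 * r" by simp
  next
    fix \<tau> assume "\<tau> \<in> galois_group K K"
    then have "embedding K K \<tau>" by (rule galois_group_embedding)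
    then show "\<exists>\<phi>'. (\<forall>i<2 * r. regular_pair r K \<tau> Q (\<phi> i) (\<phi>' i)) \<and>
      (\<forall>s. meval Q s \<noteq> 0 \<longrightarrow> (\<exists>s'. meval Q s' \<noteq> 0 \<and> (\<forall>i<2 * r. \<phi>' i s' = \<phi> i s)))"
      using reg by (intro exI[of _ \<phi>]) blast
  next
    show "alg_independent K r (\<lambda>i. \<phi> i s0)"
      unfolding alg_independent_def
    proof (intro ballI impI)
      fix q assume q: "q \<in> mpolys r K" "meval q (\<lambda>i. \<phi> i s0) = 0"
      have regq: "regular_pair r K (\<lambda>x. x) Q (\<lambda>s. meval q (\<lambda>i. \<phi> i s)) (\<lambda>s. meval (cmap (\<lambda>x. x) q) (\<lambda>i. \<phi> i s))"
        using reg[OF embedding_id] by (intro regular_meval[OF K subset_refl K embedding_id Q(1) q(1)]) simp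
      have zero: "meval q (\<lambda>i. \<phi> i s) = 0" for s
        using regular_zero_generic[OF K subset_refl K embedding_id Q(1) regq s0 _ q(2), of s] Q(3) by simp
      show "q = 0"
      proof (rule mpoly_eq_0I)
        fix b
        obtain s where s: "\<forall>i<r. fps_nth (B s) (Suc i) = b i" using surj by blast
        have "meval q b = meval q (\<lambda>i. \<phi> i s)" using q(1) by (rule meval_cong) (use s in \<open>simp add: \<phi>_def\<close>)
        then show "meval q b = 0" using zero by simp
      qed
    qed
  next
    fix j assume j: "j < 2 * r"
    let ?F = "adjoin K ((\<lambda>i. \<phi> i s0) ` {..<r})"
    have BF: "fps_nth (B s0) n \<in> ?F" if "n \<le> r" for n
    proof (cases n)
      case (Suc m)
      then show ?thesis using that adjoin_gen[of "(\<lambda>i. \<phi> i s0) ` {..<r}" K] by (force simp: \<phi>_def)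
    qed (simp add: B0)
    have wF: "fps_nth w n \<in> ?F" if "n \<le> r" for n using w(1)[OF that] adjoin_base by blast
    have ysep: "separable_over ?F (fps_nth (Y s0) n)" if n: "1 \<le> n" "n \<le> r" for n
    proof (rule separable_artin_schreier_tower[OF is_subfield_adjoin p _ n])
      fix n assume n: "1 \<le> n" "n \<le> r"
      let ?S = "fps_nth (Y s0) ` {1..<n}"
      let ?G = "adjoin ?F ?S"
      have FG: "x \<in> ?F \<Longrightarrow> x \<in> ?G" for x using adjoin_base by blast
      have YG: "fps_nth (Y s0) m \<in> ?G" if "m < n" for m
        using that Y(1) adjoin_gen[of ?S ?F] by (cases "m = 0") auto
      have "fps_nth (w * frob (Y s0)) n = fps_nth (B s0 * Y s0) n" by (simp only: BY)
      then have "fps_nth (Y s0) n ^ ?p - fps_nth (Y s0) n =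
        (\<Sum>i=1..n. fps_nth (B s0) i * fps_nth (Y s0) (n - i)) - (\<Sum>i=1..n. fps_nth w i * fps_nth (Y s0) (n - i) ^ ?p)"
        unfolding fps_mult_nth_first w(2) B0 by (simp add: algebra_simps)
      also have "\<dots> \<in> ?G"
        using n by (intro sf_diff sf_sum sf_mult sf_power is_subfield_adjoin FG[OF BF] FG[OF wF] YG) auto
      finally show "fps_nth (Y s0) n ^ ?p - fps_nth (Y s0) n \<in> ?G" .
    qed
    show "separable_over ?F (\<phi> j s0)"
    proof (cases "j < r")
      case True
      then show ?thesis using adjoin_gen[of "(\<lambda>i. \<phi> i s0) ` {..<r}" K] by (intro separable_over_self) auto
    next
      case False
      then show ?thesis using ysep[of "Suc (j - r)"] j Y(2)[of "Suc (j - r)" s0] by (simp add: \<phi>_def)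
    qed
  qed
  then obtain a where a: "\<forall>i<2 * r. a i \<in> K" "\<forall>i<r. a i \<in> K0"
    "\<forall>q\<in>mpolys (2 * r) K. (\<forall>s. meval Q s \<noteq> 0 \<longrightarrow> meval q (\<lambda>i. \<phi> i s) = 0) \<longrightarrow> meval q a = 0"
    by (elim exE conjE)
  define y where "y = Abs_fps (\<lambda>n. if n = 0 then 1 else a (r + n - 1))"
  define b where "b = Abs_fps (\<lambda>n. if n = 0 then 1 else a (n - 1))"
  have "fps_nth (w * frob y) n = fps_nth (b * y) n" if n: "n \<le> r" for n
  proof -
    define vy where "vy m = (if m = 0 then 1 else msingle (msingle (r + m - 1) 1) 1 :: 'a mpoly)" for m
    define vb where "vb m = (if m = 0 then 1 else msingle (msingle (m - 1) 1) 1 :: 'a mpoly)" for m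
    have vy: "vy m \<in> mpolys (2 * r) K" and vb: "vb m \<in> mpolys (2 * r) K" if "m \<le> r" for m
      using that K by (simp_all add: vy_def vb_def mpolys_single)
    define q where "q = (\<Sum>i=0..n. msingle 0 (fps_nth w i) * vy (n - i) ^ ?p) - (\<Sum>i=0..n. vb i * vy (n - i))"
    have "q \<in> mpolys (2 * r) K" unfolding q_def using n w(1) vy vb
      by (intro mpolys_diff[OF K] mpolys_sum[OF K] mpolys_mult[OF K] mpolys_power[OF K] mpolys_const[OF K]) auto
    moreover have "meval q (\<lambda>i. \<phi> i s) = 0" for s
    proof -
      have 1: "meval (vy m) (\<lambda>i. \<phi> i s) = fps_nth (Y s) m" "meval (vb m) (\<lambda>i. \<phi> i s) = fps_nth (B s) m" if "m \<le> r" for m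
        using that r by (auto simp: vy_def vb_def \<phi>_def Y B0)
      have "meval q (\<lambda>i. \<phi> i s) = fps_nth (w * frob (Y s)) n - fps_nth (B s * Y s) n"
        using n by (simp add: q_def meval_diff meval_sum meval_mult meval_power 1 fps_mult_nth)
      then show ?thesis by (simp add: BY)
    qed
    ultimately have "meval q a = 0" using a(3) by blast
    moreover have "meval (vy m) a = fps_nth y m" "meval (vb m) a = fps_nth b m" for m
      by (simp_all add: vy_def vb_def y_def b_def)
    ultimately show ?thesis by (simp add: q_def meval_diff meval_sum meval_mult meval_power fps_mult_nth)
  qed
  moreover have "fps_nth y n \<in> K \<and> fps_nth b n \<in> K0" if "n \<le> r" for n
    using that a(1,2) K K0 by (auto simp: y_def b_def)
  ultimately show ?thesis by (intro exI[of _ y] exI[of _ b]) (simp add: y_def b_def)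
qed

text \<open>In characteristic \<open>p\<close> the polynomial \<open>(1 + X)^(p^k)\<close> equals
  \<open>1 + X^(p^k)\<close>; coefficients are compared.\<close>

lemma binomial_CHAR_power:
  assumes p: "CHAR('a::alg_closed_field) > 0" and i: "0 < i" "i < CHAR('a) ^ k"
  shows "(of_nat (CHAR('a) ^ k choose i) :: 'a) = 0"
proof -
  let ?q = "CHAR('a) ^ k"
  have prime: "prime CHAR('a poly)" using prime_CHAR_semidom[OF p] by simp
  have "(of_nat (?q choose i) :: 'a) = poly.coeff ([:1, 1:] ^ ?q) i"
    using i by (simp add: coeff_linear_poly_power)
  also have "[:1, 1::'a:] = 1 + Polynomial.monom 1 1" by (simp add: monom_altdef one_pCons)
  also have "(1 + Polynomial.monom 1 1 :: 'a poly) ^ ?q = 1 ^ ?q + Polynomial.monom 1 1 ^ ?q"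
    by (rule freshmans_dream'[OF prime]) simp
  also have "poly.coeff \<dots> i = 0" using i by (simp add: monom_power coeff_1)
  finally show ?thesis .
qed

text \<open>
  The series \<open>u = \<Sum> u\<^sub>i T\<^sup>i\<close> built from the \<open>(\<sigma> - 1)\<^sup>j \<theta>\<close> satisfies \<open>\<sigma> u = (1 + T) u\<close>, so \<open>w = frob(u) / u\<close> is
  defined over \<open>K\<close>.
\<close>

lemma wild_case:
  fixes K0 K L :: "'a::alg_closed_field set"
  assumes univ: "universal_domain_over K" and PAC: "PAC_extension K0 K" and L: "abelian_ext K L"
    and p: "CHAR('a) > 0" and \<sigma>: "\<sigma> \<in> galois_group K L" and \<theta>: "\<theta> \<in> L"
    and period: "(\<sigma> ^^ (CHAR('a) ^ k)) \<theta> = \<theta>"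
    and cyclic: "\<forall>\<tau>\<in>galois_group K L. \<exists>i. \<tau> \<theta> = (\<sigma> ^^ i) \<theta>"
  shows "\<theta> \<in> adjoin (max_abelian_ext K0) K"
proof -
  let ?p = "CHAR('a)" and ?G = "galois_group K L"
  let ?\<Omega> = "adjoin (max_abelian_ext K0) K"
  have K: "is_subfield K" and K0: "is_subfield K0" using PAC by (auto simp: PAC_extension_def subfield_ambient_iff)
  have \<Omega>: "is_subfield ?\<Omega>" "K \<subseteq> ?\<Omega>" "max_abelian_ext K0 \<subseteq> ?\<Omega>" by (simp_all add: adjoin_base adjoin_gen)
  have gal: "galois_ext K L" using L by (simp add: abelian_ext_def)
  note D = galois_extD[OF gal]
  have emb: "embedding K L \<tau>" if "\<tau> \<in> ?G" for \<tau> using that by (rule galois_group_embedding)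
  have im: "\<tau> x \<in> L" if "\<tau> \<in> ?G" "x \<in> L" for \<tau> x using galois_embedding_image[OF gal emb[OF that(1)] that(2)] .
  have comm: "\<sigma>' (\<tau> x) = \<tau> (\<sigma>' x)" if "\<sigma>' \<in> ?G" "\<tau> \<in> ?G" "x \<in> L" for \<sigma>' \<tau> x
    using L that by (simp add: abelian_ext_def)
  have pow: "embedding K L (\<sigma> ^^ i) \<and> (\<forall>x\<in>L. (\<sigma> ^^ i) x \<in> L)" for i
  proof (induction i)
    case 0 show ?case by (simp add: embedding_def)
  next
    case (Suc i)
    then show ?case using embedding_comp[of K L "\<sigma> ^^ i" L \<sigma>] emb[OF \<sigma>] im[OF \<sigma>] by (simp add: comp_def)
  qed
  have powG: "\<sigma> ^^ i \<in> ?G" for i using pow by (simp add: galois_group_iff[OF gal])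
  \<comment> \<open>In characteristic \<open>p\<close> the operator \<open>\<Delta>\<close> raised
    to the power \<open>p^k\<close> is the \<open>p^k\<close>-th iterate of \<open>\<sigma>\<close>
    minus the identity, which kills \<open>\<theta>\<close>; so \<open>\<Delta>\<close> acts
    nilpotently on \<open>\<theta>\<close>.\<close>
  define \<Delta> where "\<Delta> x = \<sigma> x - x" for x
  have \<Delta>L: "(\<Delta> ^^ i) x \<in> L" if "x \<in> L" for i x
    using that im[OF \<sigma>] D(2) by (induction i) (auto simp: \<Delta>_def intro: sf_diff)
  have \<Delta>comm: "\<tau> ((\<Delta> ^^ i) x) = (\<Delta> ^^ i) (\<tau> x)" if "\<tau> \<in> ?G" "x \<in> L" for \<tau> i x
  proof (induction i)
    case (Suc i)
    have "\<tau> (\<Delta> ((\<Delta> ^^ i) x)) = \<Delta> (\<tau> ((\<Delta> ^^ i) x))"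
      using emb_diff[OF D(2) emb[OF that(1)]] \<Delta>L[OF that(2)] im[OF \<sigma>] comm[OF \<sigma> that(1)] by (simp add: \<Delta>_def)
    then show ?case using Suc by simp
  qed simp
  have binom: "(\<sigma> ^^ n) x = (\<Sum>i\<le>n. of_nat (n choose i) * (\<Delta> ^^ i) x)" if x: "x \<in> L" for n x
  proof (induction n)
    case (Suc n)
    let ?d = "\<lambda>i. (\<Delta> ^^ i) x"
    have s: "\<sigma> (?d i) = ?d i + ?d (Suc i)" for i by (simp add: \<Delta>_def)
    have nat: "of_nat m \<in> L" for m by (rule sf_of_nat[OF D(2)])
    have "(\<sigma> ^^ Suc n) x = \<sigma> (\<Sum>i\<le>n. of_nat (n choose i) * ?d i)" using Suc by simp
    also have "\<dots> = (\<Sum>i\<le>n. of_nat (n choose i) * (?d i + ?d (Suc i)))"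
      using \<Delta>L[OF x] nat D(2)
      by (subst emb_sum[OF D(2) emb[OF \<sigma>]]) (simp_all add: sf_mult emb_mult[OF D(2) emb[OF \<sigma>]] emb_of_nat[OF D(2) emb[OF \<sigma>]] s del: funpow.simps)
    also have "\<dots> = (\<Sum>i\<le>n. of_nat (n choose i) * ?d i) + (\<Sum>i\<le>n. of_nat (n choose i) * ?d (Suc i))"
      by (simp only: distrib_left sum.distrib)
    also have "(\<Sum>i\<le>n. of_nat (n choose i) * ?d i) = (\<Sum>i\<le>Suc n. of_nat (n choose i) * ?d i)"
      by (simp add: binomial_eq_0)
    also have "\<dots> = ?d 0 + (\<Sum>i\<le>n. of_nat (n choose Suc i) * ?d (Suc i))"
      by (subst sum.atMost_Suc_shift) (simp del: funpow.simps(2))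
    also have "\<dots> + (\<Sum>i\<le>n. of_nat (n choose i) * ?d (Suc i)) =
        ?d 0 + (\<Sum>i\<le>n. of_nat (Suc n choose Suc i) * ?d (Suc i))"
      by (simp only: binomial_Suc_Suc of_nat_add distrib_right sum.distrib add_ac)
    also have "\<dots> = (\<Sum>i\<le>Suc n. of_nat (Suc n choose i) * ?d i)"
      by (subst sum.atMost_Suc_shift) (simp only: binomial_n_0 of_nat_1 mult_1_left)
    finally show ?case .
  qed simp
  let ?q = "?p ^ k"
  have q: "?q > 0" using p by simp
  have "(\<Delta> ^^ ?q) \<theta> = 0"
  proof -
    have "\<theta> = (\<Sum>i\<le>?q. of_nat (?q choose i) * (\<Delta> ^^ i) \<theta>)" using binom[OF \<theta>, of ?q] period by simp
    also have "\<dots> = (\<Sum>i\<in>{0, ?q}. of_nat (?q choose i) * (\<Delta> ^^ i) \<theta>)"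
      by (rule sum.mono_neutral_right) (auto simp: binomial_CHAR_power[OF p])
    also have "\<dots> = \<theta> + (\<Delta> ^^ ?q) \<theta>" using q by simp
    finally show ?thesis by simp
  qed
  define m where "m = (LEAST m. (\<Delta> ^^ m) \<theta> = 0)"
  have m: "(\<Delta> ^^ m) \<theta> = 0" unfolding m_def by (rule LeastI) fact
  have least: "(\<Delta> ^^ i) \<theta> \<noteq> 0" if "i < m" for i using that not_less_Least unfolding m_def by blast
  show ?thesis
  proof (cases m)
    case 0
    then show ?thesis using m \<Omega> by simp
  next
    case (Suc r)
    \<comment> \<open>The last nonzero iterate. It is fixed by \<open>\<sigma>\<close>, hence by the
      whole group, which acts on \<open>\<theta>\<close> through powers of \<open>\<sigma>\<close>;
      so it lies in \<open>K\<close> and can be used for normalising.\<close>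
    define c where "c = (\<Delta> ^^ r) \<theta>"
    have c0: "c \<noteq> 0" using least[of r] Suc by (simp add: c_def)
    have cL: "c \<in> L" unfolding c_def by (rule \<Delta>L[OF \<theta>])
    have "\<sigma> c = c" using m Suc by (simp add: c_def \<Delta>_def)
    then have \<sigma>c: "(\<sigma> ^^ i) c = c" for i by (induction i) auto
    have cK: "c \<in> K"
    proof (rule ccontr)
      assume "c \<notin> K"
      then obtain \<tau> where \<tau>: "\<tau> \<in> ?G" "\<tau> c \<noteq> c" using galois_fixed[OF gal D(1) subset_refl D(3) cL] by blast
      obtain i where i: "\<tau> \<theta> = (\<sigma> ^^ i) \<theta>" using cyclic \<tau>(1) by blast
      have "\<tau> c = (\<sigma> ^^ i) c" unfolding c_def using \<Delta>comm[OF \<tau>(1) \<theta>] \<Delta>comm[OF powG \<theta>] i by simp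
      then show False using \<tau>(2) \<sigma>c by simp
    qed
    show ?thesis
    proof (cases "r = 0")
      case True
      then show ?thesis using cK \<Omega> by (auto simp: c_def)
    next
      case False
      then have r: "1 \<le> r" by simp
      \<comment> \<open>The iterates in reverse order, divided by \<open>c\<close>: the constant
        term becomes 1, and \<open>\<theta> / c\<close> is the coefficient of \<open>T^r\<close>.
        The identity \<open>\<sigma> = 1 + \<Delta>\<close> turns into multiplication by
        \<open>1 + T\<close> modulo \<open>T^(r+1)\<close>.\<close>
      define u where "u = Abs_fps (\<lambda>i. if i \<le> r then (\<Delta> ^^ (r - i)) \<theta> / c else 0)"
      have u: "fps_nth u i = (\<Delta> ^^ (r - i)) \<theta> / c" if "i \<le> r" for i using that by (simp add: u_def)
      have u0: "fps_nth u 0 = 1" using c0 by (simp add: u c_def)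
      have uL: "fps_nth u i \<in> L" for i using \<Delta>L[OF \<theta>] cL D(2) by (auto simp: u_def intro: sf_divide)
      have \<sigma>u: "\<sigma> (fps_nth u (Suc i)) = fps_nth u (Suc i) + fps_nth u i" if "Suc i \<le> r" for i
      proof -
        have "\<sigma> (fps_nth u (Suc i)) = \<sigma> ((\<Delta> ^^ (r - Suc i)) \<theta>) / c"
          using emb_divide[OF D(2) emb[OF \<sigma>] \<Delta>L[OF \<theta>] cL] \<open>\<sigma> c = c\<close> that by (simp add: u)
        also have "\<sigma> ((\<Delta> ^^ (r - Suc i)) \<theta>) = (\<Delta> ^^ (r - Suc i)) \<theta> + (\<Delta> ^^ (Suc (r - Suc i))) \<theta>" by (simp add: \<Delta>_def)
        also have "Suc (r - Suc i) = r - i" using that by simp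
        finally show ?thesis using that by (simp add: u add_divide_distrib)
      qed
      define w where "w = frob u * inverse u"
      have wu: "w * u = frob u" using inverse_mult_eq_1[of u] u0 by (simp add: w_def mult.assoc)
      have w0: "fps_nth w 0 = 1" by (simp add: w_def u0)
      have wrec: "fps_nth w n = fps_nth u n ^ ?p - (\<Sum>i<n. fps_nth w i * fps_nth u (n - i))" for n
        using fps_mult_nth_last[of w u n] by (simp add: wu u0)
      have wA: "fps_nth w n \<in> adjoin K (range (fps_nth u))" for n
      proof (induction n rule: less_induct)
        case (less n)
        have "fps_nth u i \<in> adjoin K (range (fps_nth u))" for i using adjoin_gen[of "range (fps_nth u)" K] by blast
        then show ?case by (subst wrec) (intro sf_diff sf_sum sf_mult sf_power is_subfield_adjoin less; simp)
      qed
      have AL: "adjoin K (range (fps_nth u)) \<subseteq> L" using uL D(3) by (rule_tac adjoin_minimal[OF D(2)]) auto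
      have wL: "fps_nth w n \<in> L" for n using wA AL by blast
      \<comment> \<open>\<open>frob\<close> fixes \<open>1 + T\<close>, so numerator and denominator
        of \<open>w\<close> acquire the same factor; the induction carries this out
        coefficientwise.\<close>
      have \<sigma>w: "\<sigma> (fps_nth w n) = fps_nth w n" if "n \<le> r" for n
        using that
      proof (induction n rule: less_induct)
        case (less n)
        note e = emb[OF \<sigma>]
        show ?case
        proof (cases n)
          case 0
          then show ?thesis using emb_1[OF D(2) e] by (simp add: w0)
        next
          case (Suc n')
          have "\<sigma> (fps_nth w n) = \<sigma> (fps_nth u n) ^ ?p - (\<Sum>i<n. \<sigma> (fps_nth w i) * \<sigma> (fps_nth u (n - i)))"
            using uL wL D(2)
            by (subst wrec) (simp add: emb_diff[OF D(2) e] emb_power[OF D(2) e] emb_sum[OF D(2) e] emb_mult[OF D(2) e] sf_power sf_sum sf_mult)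
          also have "(\<Sum>i<n. \<sigma> (fps_nth w i) * \<sigma> (fps_nth u (n - i))) = (\<Sum>i<n. fps_nth w i * (fps_nth u (n - i) + fps_nth u (n' - i)))"
          proof (rule sum.cong[OF refl])
            fix i assume i: "i \<in> {..<n}"
            then have "n - i = Suc (n' - i)" using Suc by auto
            then show "\<sigma> (fps_nth w i) * \<sigma> (fps_nth u (n - i)) = fps_nth w i * (fps_nth u (n - i) + fps_nth u (n' - i))"
              using less i \<sigma>u[of "n' - i"] Suc by simp
          qed
          also have "\<dots> = (\<Sum>i<n. fps_nth w i * fps_nth u (n - i)) + fps_nth (w * u) n'"
          proof -
            have "{..<n} = {0..n'}" using Suc by auto
            then show ?thesis by (simp add: distrib_left sum.distrib fps_mult_nth)
          qed
          also have "\<sigma> (fps_nth u n) ^ ?p = fps_nth u n ^ ?p + fps_nth u n' ^ ?p"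
            using \<sigma>u[of n'] Suc less.prems by (simp add: freshmans_dream[OF prime_CHAR_semidom[OF p] refl])
          finally show ?thesis using wrec[of n] by (simp add: wu)
        qed
      qed
      have wK: "fps_nth w n \<in> K" if n: "n \<le> r" for n
      proof (rule ccontr)
        assume "fps_nth w n \<notin> K"
        then obtain \<tau> where \<tau>: "\<tau> \<in> ?G" "\<tau> (fps_nth w n) \<noteq> fps_nth w n" using galois_fixed[OF gal D(1) subset_refl D(3) wL] by blast
        obtain i where i: "\<tau> \<theta> = (\<sigma> ^^ i) \<theta>" using cyclic \<tau>(1) by blast
        have agree: "\<tau> ((\<Delta> ^^ j) \<theta>) = (\<sigma> ^^ i) ((\<Delta> ^^ j) \<theta>)" for j using \<Delta>comm[OF \<tau>(1) \<theta>] \<Delta>comm[OF powG \<theta>] i by simp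
        have \<tau>u: "\<tau> (fps_nth u j) = (\<sigma> ^^ i) (fps_nth u j)" for j
          using agree[of "r - j"] emb_divide[OF D(2) emb[OF \<tau>(1)] \<Delta>L[OF \<theta>] cL] emb_divide[OF D(2) emb[OF powG] \<Delta>L[OF \<theta>] cL]
            emb_fix[OF D(2) emb[OF \<tau>(1)] cK] \<sigma>c emb_0[OF D(2) emb[OF \<tau>(1)]] emb_0[OF D(2) emb[OF powG]] by (simp add: u_def)
        have "\<tau> (fps_nth w n) = (\<sigma> ^^ i) (fps_nth w n)"
        proof (rule embeddings_agree_adjoin[OF D(2) emb[OF \<tau>(1)] emb[OF powG] AL _ _ wA])
          show "\<tau> x = (\<sigma> ^^ i) x" if "x \<in> K" for x
            using emb_fix[OF D(2) emb[OF \<tau>(1)] that] emb_fix[OF D(2) emb[OF powG] that] by simp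
          show "\<tau> x = (\<sigma> ^^ i) x" if "x \<in> range (fps_nth u)" for x using that \<tau>u by auto
        qed
        moreover have "(\<sigma> ^^ i) (fps_nth w n) = fps_nth w n" using \<sigma>w[OF n] by (induction i) auto
        ultimately show False using \<tau>(2) by simp
      qed
      obtain y b where yb: "\<forall>n\<le>r. fps_nth y n \<in> K \<and> fps_nth b n \<in> K0" "fps_nth y 0 = 1" "fps_nth b 0 = 1"
        "\<forall>n\<le>r. fps_nth (w * frob y) n = fps_nth (b * y) n"
        using PAC_frob_equation[OF univ PAC p r wK w0] by blast
      \<comment> \<open>Up to order \<open>r\<close>, \<open>frob z = b * z\<close>: the factor
        \<open>w\<close> of \<open>frob u\<close> is absorbed by the equation for \<open>y\<close>.
        So \<open>z\<close> generates an abelian extension of \<open>K0\<close>, and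
        \<open>u\<close> is regained as \<open>z / y\<close>.\<close>
      define z where "z = u * y"
      have z0: "fps_nth z 0 = 1" by (simp add: z_def u0 yb)
      have "fps_nth (frob z) n = fps_nth (b * z) n" if n: "n \<le> r" for n
      proof -
        have "frob z = u * (w * frob y)" by (simp add: z_def frob_mult[OF p] mult_ac flip: wu)
        then have "fps_nth (frob z) n = fps_nth (u * (w * frob y)) n" by simp
        also have "\<dots> = fps_nth (u * (b * y)) n" by (rule fps_mult_cong_upto[of r]) (use yb(4) n in auto)
        finally show ?thesis by (simp add: z_def mult_ac)
      qed
      then have "abelian_ext K0 (adjoin K0 (fps_nth z ` {1..r}))"
        using yb by (intro abelian_ext_frob_equation[OF K0 p _ _ z0, of r b]) auto
      then have "fps_nth z ` {1..r} \<subseteq> ?\<Omega>"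
        using abelian_ext_subset_max adjoin_gen[of "fps_nth z ` {1..r}" K0] \<Omega>(3) by blast
      then have z\<Omega>: "fps_nth z n \<in> ?\<Omega>" if "n \<le> r" for n
        using that z0 \<Omega>(1) by (cases "n = 0") auto
      have "fps_nth u r \<in> ?\<Omega>"
      proof (rule fps_unique_factor_mem[OF \<Omega>(1) _ yb(2) _ order_refl])
        show "fps_nth y n \<in> ?\<Omega>" if "n \<le> r" for n using yb(1) that \<Omega>(2) by blast
        show "fps_nth (u * y) n \<in> ?\<Omega>" if "n \<le> r" for n using z\<Omega>[OF that] by (simp add: z_def)
      qed
      then have "\<theta> / c \<in> ?\<Omega>" by (simp add: u)
      then have "\<theta> / c * c \<in> ?\<Omega>" using cK \<Omega> by (intro sf_mult) auto
      then show ?thesis using c0 by simp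
    qed
  qed
qed

subsection \<open>Cyclic extensions of degree prime to the characteristic\<close>

lemma exponent_exists:
  fixes x :: "'b::monoid_mult"
  assumes "m > 0" "x ^ m = 1"
  shows "\<exists>d>0. \<forall>i. x ^ i = 1 \<longleftrightarrow> d dvd i"
proof -
  define d where "d = (LEAST d. d > 0 \<and> x ^ d = 1)"
  have d: "d > 0 \<and> x ^ d = 1" unfolding d_def by (rule LeastI[of _ m]) (use assms in simp)
  have "d dvd i" if "x ^ i = 1" for i
  proof -
    have "x ^ i = (x ^ d) ^ (i div d) * x ^ (i mod d)"
      by (simp flip: power_mult power_add)
    then have "x ^ (i mod d) = 1" using that d by simp
    then have "\<not> i mod d > 0" using Least_le[of "\<lambda>d. d > 0 \<and> x ^ d = 1" "i mod d"] mod_less_divisor[of d i] d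
      unfolding d_def by linarith
    then show ?thesis by auto
  qed
  moreover have "x ^ i = 1" if "d dvd i" for i using that d by (auto simp: power_mult)
  ultimately show ?thesis using d by blast
qed

text \<open>For \<open>a > 0\<close>, a root \<open>w\<close> of
  \<open>1 + X + ... + X^(l-1)\<close> is an \<open>l\<close>-th root of unity, and \<open>w\<close>
  is not 1 because \<open>l\<close> is nonzero in the field. Extracting a root of exponent
  \<open>l^(a-1)\<close> gives exact order \<open>l^a\<close>, since proper divisors of
  \<open>l^a\<close> divide \<open>l^(a-1)\<close>.\<close>

lemma primitive_root_exists:
  assumes l: "prime (l::nat)" and nz: "of_nat l \<noteq> (0 :: 'a::alg_closed_field)"
  shows "\<exists>\<zeta>::'a. \<forall>i. \<zeta> ^ i = 1 \<longleftrightarrow> l ^ a dvd i"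
proof (cases a)
  case 0
  then show ?thesis by (intro exI[of _ 1]) simp
next
  case (Suc a')
  have l2: "l \<ge> 2" using l by (rule prime_ge_2_nat)
  define f where "f = (\<Sum>i<l. Polynomial.monom (1::'a) i)"
  have "poly.coeff f (l - 1) = 1" using l2 by (simp add: f_def coeff_sum)
  then have "l - 1 \<le> Polynomial.degree f" by (intro le_degree) simp
  then have "Polynomial.degree f > 0" using l2 by linarith
  then obtain w where "poly f w = 0" using alg_closed_imp_poly_has_root by blast
  then have w: "(\<Sum>i<l. w ^ i) = 0" by (simp add: f_def poly_sum poly_monom)
  have w1: "w \<noteq> 1" using w nz by auto
  have wl: "w ^ l = 1" using geometric_sum[OF w1, of l] w w1 by simp
  obtain \<zeta> where \<zeta>: "\<zeta> ^ (l ^ a') = w" using nth_root_exists[of "l ^ a'" w] l2 by auto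
  have "\<zeta> ^ (l ^ a) = 1" using \<zeta> wl by (simp add: Suc mult.commute[of l] power_mult)
  moreover have "l ^ a > 0" using l2 by simp
  ultimately obtain d where d: "d > 0" "\<And>i. \<zeta> ^ i = 1 \<longleftrightarrow> d dvd i" using exponent_exists[of "l ^ a" \<zeta>] by blast
  have "d dvd l ^ a" using d(2) \<open>\<zeta> ^ (l ^ a) = 1\<close> by blast
  then obtain b where b: "b \<le> a" "d = l ^ b" using divides_primepow_nat[OF l, of d a] by blast
  have "b = a"
  proof (rule ccontr)
    assume "b \<noteq> a"
    then have "d dvd l ^ a'" using b Suc by (simp add: le_imp_power_dvd)
    then show False using d(2) \<zeta> w1 by metis
  qed
  then show ?thesis using d b by auto
qed

text \<open>\<open>\<zeta>\<close> has exact order \<open>n\<close>, and \<open>e\<close> picks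
  inverses modulo \<open>n\<close>; its values at non-units never enter.\<close>

locale root_of_unity =
  fixes \<zeta> :: "'a::alg_closed_field" and n :: nat and e :: "nat \<Rightarrow> nat"
  assumes n2: "2 \<le> n" and \<zeta>_iff: "\<And>i. \<zeta> ^ i = 1 \<longleftrightarrow> n dvd i" and n_nz: "of_nat n \<noteq> (0::'a)"
    and e: "\<And>k. k < n \<Longrightarrow> coprime k n \<Longrightarrow> e k < n \<and> coprime (e k) n \<and> k * e k mod n = 1"
begin

definition "units = {k. k < n \<and> coprime k n}"

lemma finite_units [simp]: "finite units"
  by (simp add: units_def)

lemma one_units [simp]: "1 \<in> units" "Suc 0 \<in> units"
  using n2 by (auto simp: units_def)

lemma e_unique: "k \<in> units \<Longrightarrow> m < n \<Longrightarrow> k * m mod n = 1 \<Longrightarrow> m = e k"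
proof -
  assume k: "k \<in> units" and m: "m < n" "k * m mod n = 1"
  have "[k * m = k * e k] (mod n)" using m e[of k] k by (simp add: cong_def units_def)
  then have "[m = e k] (mod n)" using k by (simp add: units_def cong_mult_lcancel_nat)
  then show ?thesis using m e[of k] k by (simp add: cong_def units_def)
qed

lemma e_1 [simp]: "e 1 = 1" "e (Suc 0) = Suc 0"
  using e_unique[of 1 1] n2 by simp_all

lemma mult_units: "coprime d n \<Longrightarrow> k \<in> units \<Longrightarrow> d * k mod n \<in> units"
  using n2 by (auto simp: units_def coprime_mod_left_iff)

text \<open>Modulo \<open>n\<close> this is \<open>d (d k)^(-1) = k^(-1)\<close>, between reduced
  representatives.\<close>

lemma e_mult: "coprime d n \<Longrightarrow> k \<in> units \<Longrightarrow> d * e (d * k mod n) mod n = e k"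
proof (rule e_unique)
  assume d: "coprime d n" and k: "k \<in> units"
  let ?j = "d * k mod n"
  have j: "?j < n" "coprime ?j n" using mult_units[OF d k] unfolding units_def by blast+
  have "k * (d * e ?j mod n) mod n = (d * k mod n) * e ?j mod n" by (simp add: mod_mult_right_eq mod_mult_left_eq mult_ac)
  also have "\<dots> = 1" using conjunct2[OF conjunct2[OF e[OF j]]] .
  finally show "k * (d * e ?j mod n) mod n = 1" .
  show "d * e ?j mod n < n" using n2 by simp
qed

lemma bij_mult: "coprime d n \<Longrightarrow> bij_betw (\<lambda>k. d * k mod n) {..<n} {..<n}"
proof -
  assume d: "coprime d n"
  have inj: "inj_on (\<lambda>k. d * k mod n) {..<n}"
  proof (rule inj_onI)
    fix x y assume xy: "x \<in> {..<n}" "y \<in> {..<n}" "d * x mod n = d * y mod n"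
    then have "[x = y] (mod n)" using d by (simp add: cong_mult_lcancel_nat flip: cong_def)
    then show "x = y" using xy by (simp add: cong_def)
  qed
  moreover have "(\<lambda>k. d * k mod n) ` {..<n} \<subseteq> {..<n}" using n2 by auto
  ultimately show ?thesis by (simp add: bij_betw_def endo_inj_surj)
qed

lemma bij_mult_units: "coprime d n \<Longrightarrow> bij_betw (\<lambda>k. d * k mod n) units units"
proof -
  assume d: "coprime d n"
  have "inj_on (\<lambda>k. d * k mod n) units"
    using bij_mult[OF d] by (auto simp: bij_betw_def units_def intro: inj_on_subset)
  moreover have "(\<lambda>k. d * k mod n) ` units \<subseteq> units" using mult_units[OF d] by auto
  ultimately show ?thesis by (simp add: bij_betw_def endo_inj_surj)
qed

lemma \<zeta>_nz [simp]: "\<zeta> \<noteq> 0"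
  using \<zeta>_iff[of n] n2 by (auto simp: power_0_left)

lemma \<zeta>_n [simp]: "\<zeta> ^ n = 1"
  by (simp add: \<zeta>_iff)

lemma \<zeta>_power_n [simp]: "(\<zeta> ^ i) ^ n = 1"
  by (metis mult.commute power_mult power_one \<zeta>_n)

lemma \<zeta>_mod: "\<zeta> ^ (i mod n) = \<zeta> ^ i"
proof -
  have "\<zeta> ^ i = (\<zeta> ^ n) ^ (i div n) * \<zeta> ^ (i mod n)" by (simp del: \<zeta>_n flip: power_mult power_add)
  then show ?thesis by simp
qed

lemma \<zeta>_mod_cong: "i mod n = j mod n \<Longrightarrow> \<zeta> ^ i = \<zeta> ^ j"
  by (metis \<zeta>_mod)

lemma \<zeta>_power_inj:
  assumes "i < n" "j < n" "\<zeta> ^ i = \<zeta> ^ j" shows "i = j"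
proof -
  have False if mk: "m < k" "k < n" "\<zeta> ^ m = \<zeta> ^ k" for m k
  proof -
    have "\<zeta> ^ k = \<zeta> ^ m * \<zeta> ^ (k - m)" using mk(1) by (simp flip: power_add)
    then have "\<zeta> ^ m * \<zeta> ^ (k - m) = \<zeta> ^ m * 1" using mk(3) by simp
    then have "\<zeta> ^ (k - m) = 1" using \<zeta>_nz by (metis mult_left_cancel power_not_zero)
    then have "n dvd k - m" by (simp add: \<zeta>_iff)
    then show False using mk dvd_imp_le[of n "k - m"] by simp
  qed
  from this[of i j] this[of j i] show "i = j" using assms by (cases i j rule: linorder_cases) auto
qed

lemma roots_of_unity:
  assumes "x ^ n = 1" shows "\<exists>i<n. x = \<zeta> ^ i"
proof -
  let ?f = "Polynomial.monom 1 n - [:1::'a:]"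
  have "poly.coeff ?f n = 1" using n2 by (cases n) auto
  then have f0: "?f \<noteq> 0" by (metis coeff_0 zero_neq_one)
  have deg: "Polynomial.degree ?f \<le> n"
    by (rule degree_le) (auto simp: coeff_pCons split: nat.splits)
  have roots: "{x. poly ?f x = 0} = {x. x ^ n = 1}" by (simp add: poly_monom)
  have fin: "finite {x::'a. x ^ n = 1}" and card: "card {x::'a. x ^ n = 1} \<le> n"
    using poly_roots_finite[OF f0] card_poly_roots_bound[OF f0] deg unfolding roots by auto
  have "inj_on (\<lambda>i. \<zeta> ^ i) {..<n}"
  proof (rule inj_onI)
    fix i j assume ij: "i \<in> {..<n}" "j \<in> {..<n}" "\<zeta> ^ i = \<zeta> ^ j"
    then show "i = j" by (simp add: \<zeta>_power_inj)
  qed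
  then have "card ((\<lambda>i. \<zeta> ^ i) ` {..<n}) = n" by (simp add: card_image)
  moreover have "(\<lambda>i. \<zeta> ^ i) ` {..<n} \<subseteq> {x. x ^ n = 1}" by auto
  ultimately have "(\<lambda>i. \<zeta> ^ i) ` {..<n} = {x. x ^ n = 1}"
    using fin card by (intro card_seteq) auto
  then show ?thesis using assms by blast
qed

lemma same_power:
  assumes "x ^ n = y ^ n" shows "\<exists>j. x = \<zeta> ^ j * y"
proof (cases "y = 0")
  case True
  then have "x ^ n = 0" using assms n2 by (simp add: power_0_left)
  then show ?thesis using True by simp
next
  case False
  then have "(x / y) ^ n = 1" using assms by (simp add: power_divide)
  then obtain j where "x / y = \<zeta> ^ j" using roots_of_unity by blast
  then show ?thesis using False by (auto simp: field_simps)
qed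

lemma orthogonality:
  assumes "i < n" "j < n"
  shows "(\<Sum>g<n. \<zeta> ^ (g * i) * inverse \<zeta> ^ (g * j)) = (if i = j then of_nat n else 0)"
proof -
  define x where "x = \<zeta> ^ i * inverse \<zeta> ^ j"
  have "(\<Sum>g<n. \<zeta> ^ (g * i) * inverse \<zeta> ^ (g * j)) = (\<Sum>g<n. x ^ g)"
    by (simp add: x_def power_mult_distrib mult.commute flip: power_mult)
  also have "\<dots> = (if i = j then of_nat n else 0)"
  proof (cases "i = j")
    case True
    then have "x = 1" by (simp add: x_def power_inverse)
    then show ?thesis using True by simp
  next
    case False
    have "x \<noteq> 1"
    proof
      assume "x = 1"
      then have eq: "\<zeta> ^ i = \<zeta> ^ j" by (simp add: x_def power_inverse field_simps)
      then show False using assms False by (simp add: \<zeta>_power_inj)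
    qed
    moreover have "x ^ n = 1" by (simp add: x_def power_mult_distrib power_inverse)
    ultimately show ?thesis using False sum_powers_root_of_unity[of x n] by simp
  qed
  finally show ?thesis .
qed

text \<open>Passes between the components \<open>b g\<close>, which automorphisms permute, and
  Fourier coefficients, which can be defined over the base field.\<close>

lemma fourier_inverse:
  assumes "g < n"
  shows "(\<Sum>i<n. (1 / of_nat n * (\<Sum>h<n. b h * inverse \<zeta> ^ (h * i))) * \<zeta> ^ (g * i)) = b g"
proof -
  have "(\<Sum>i<n. (1 / of_nat n * (\<Sum>h<n. b h * inverse \<zeta> ^ (h * i))) * \<zeta> ^ (g * i)) =
    1 / of_nat n * (\<Sum>h<n. b h * (\<Sum>i<n. \<zeta> ^ (i * g) * inverse \<zeta> ^ (i * h)))"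
    unfolding sum_distrib_left sum_distrib_right by (subst sum.swap) (simp add: mult_ac)
  also have "\<dots> = 1 / of_nat n * (\<Sum>h<n. if g = h then b h * of_nat n else 0)"
    using assms by (intro arg_cong2[where f = "(*)"] sum.cong) (auto simp: orthogonality)
  also have "\<dots> = b g" using assms n_nz by simp
  finally show ?thesis .
qed

lemma fourier_inverse':
  assumes "i < n"
  shows "1 / of_nat n * (\<Sum>h<n. (\<Sum>j<n. \<beta> j * \<zeta> ^ (h * j)) * inverse \<zeta> ^ (h * i)) = \<beta> i"
proof -
  have "(\<Sum>h<n. (\<Sum>j<n. \<beta> j * \<zeta> ^ (h * j)) * inverse \<zeta> ^ (h * i)) =
    (\<Sum>j<n. \<beta> j * (\<Sum>h<n. \<zeta> ^ (h * j) * inverse \<zeta> ^ (h * i)))"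
    unfolding sum_distrib_left sum_distrib_right by (subst sum.swap) (simp add: mult_ac)
  also have "\<dots> = (\<Sum>j<n. if i = j then \<beta> j * of_nat n else 0)"
    using assms by (intro sum.cong) (auto simp: orthogonality)
  also have "\<dots> = \<beta> i * of_nat n" using assms by simp
  finally show ?thesis using n_nz by simp
qed

text \<open>
  If \<open>z\<^sup>n = \<Prod> b\<^sub>k\<^bsup>e(k)\<^esup>\<close>, then \<open>cocycle z b g\<close> is the \<open>n\<close>-th root \<open>z\<^sup>g \<Prod> b\<^sub>k\<^bsup>-\<lfloor>g e(k)/n\<rfloor>\<^esup>\<close> of
  \<open>\<Prod> b\<^sub>k\<^bsup>g e(k) mod n\<^esup> = \<Prod> b\<^bsub>gk\<^esub>\<^bsup>e(k)\<^esup>\<close>.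
\<close>

definition cocycle :: "'a \<Rightarrow> (nat \<Rightarrow> 'a) \<Rightarrow> nat \<Rightarrow> 'a" where
  "cocycle z b g = z ^ g * (\<Prod>k\<in>units. inverse (b k) ^ (g * e k div n))"

text \<open>The group ring element with coefficient \<open>k^(-1)\<close> at each unit
  \<open>k\<close>, applied to \<open>b\<close>. It produces radicands on which
  \<open>\<zeta> \<mapsto> \<zeta>^d\<close> acts as the \<open>d\<close>-th power modulo
  \<open>n\<close>-th powers.\<close>

definition "norm_form b = (\<Prod>k\<in>units. b k ^ e k)"

context
  fixes b :: "nat \<Rightarrow> 'a" and z
  assumes b: "\<And>k. k \<in> units \<Longrightarrow> b k \<noteq> 0" and z: "z ^ n = norm_form b"
begin

lemma cocycle_power: "cocycle z b g ^ n = (\<Prod>k\<in>units. b k ^ (g * e k mod n))"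
proof -
  have "cocycle z b g ^ n = (z ^ n) ^ g * (\<Prod>k\<in>units. inverse (b k) ^ (n * (g * e k div n)))"
    by (simp add: cocycle_def power_mult_distrib prod_power_distrib mult.commute flip: power_mult)
  also have "\<dots> = (\<Prod>k\<in>units. b k ^ (e k * g) * inverse (b k) ^ (n * (g * e k div n)))"
    unfolding z norm_form_def by (simp add: prod_power_distrib prod.distrib flip: power_mult)
  also have "\<dots> = (\<Prod>k\<in>units. b k ^ (g * e k mod n))"
  proof (rule prod.cong[OF refl])
    fix k assume k: "k \<in> units"
    have "e k * g = g * e k mod n + n * (g * e k div n)" by (simp add: mult.commute)
    then have "b k ^ (e k * g) = b k ^ (g * e k mod n) * b k ^ (n * (g * e k div n))" by (metis power_add)
    then show "b k ^ (e k * g) * inverse (b k) ^ (n * (g * e k div n)) = b k ^ (g * e k mod n)"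
      using b[OF k] by (simp add: power_inverse)
  qed
  finally show ?thesis .
qed

text \<open>Reindexing by \<open>k \<mapsto> d k\<close> replaces the exponent \<open>e k\<close> by
  \<open>d * e k mod n\<close>.\<close>

lemma norm_form_mult:
  assumes "coprime d n" shows "cocycle z b d ^ n = norm_form (\<lambda>k. b (d * k mod n))"
proof -
  have "norm_form (\<lambda>k. b (d * k mod n)) = (\<Prod>k\<in>units. b (d * k mod n) ^ (d * e (d * k mod n) mod n))"
    unfolding norm_form_def using e_mult[OF assms] by (intro prod.cong) auto
  also have "\<dots> = (\<Prod>k\<in>units. b k ^ (d * e k mod n))"
    by (rule prod.reindex_bij_betw[OF bij_mult_units[OF assms]])
  finally show ?thesis by (simp add: cocycle_power)
qed

text \<open>The exponents match by \<open>g (x div n) + g (x mod n) div n = g x div n\<close>. This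
  relation governs the composition of automorphisms.\<close>

lemma cocycle_mult:
  assumes "coprime d n"
  shows "cocycle (cocycle z b d) (\<lambda>k. b (d * k mod n)) g = cocycle z b (d * g)"
proof -
  have "(\<Prod>k\<in>units. inverse (b (d * k mod n)) ^ (g * e k div n)) =
    (\<Prod>k\<in>units. inverse (b (d * k mod n)) ^ (g * (d * e (d * k mod n) mod n) div n))"
    using e_mult[OF assms] by (intro prod.cong) auto
  also have "\<dots> = (\<Prod>k\<in>units. inverse (b k) ^ (g * (d * e k mod n) div n))"
    by (rule prod.reindex_bij_betw[OF bij_mult_units[OF assms]])
  finally have "cocycle (cocycle z b d) (\<lambda>k. b (d * k mod n)) g =
      z ^ (d * g) * (\<Prod>k\<in>units. inverse (b k) ^ (g * (d * e k div n) + g * (d * e k mod n) div n))"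
    by (simp add: cocycle_def power_mult_distrib prod_power_distrib power_add prod.distrib mult_ac flip: power_mult)
  also have "\<dots> = cocycle z b (d * g)"
  proof -
    have "g * (x div n) + g * (x mod n) div n = g * x div n" for x
    proof -
      have "g * x = g * (x mod n) + n * (g * (x div n))"
        by (metis add.commute distrib_left mult.left_commute mult_div_mod_eq)
      then show ?thesis using n2 by simp
    qed
    then show ?thesis by (simp add: cocycle_def mult_ac)
  qed
  finally show ?thesis .
qed

text \<open>Adding \<open>n t\<close> to \<open>g\<close> multiplies the power of \<open>z\<close>
  by \<open>norm_form b ^ t\<close> and the product of inverses by the inverse of that.\<close>

lemma cocycle_mod: "cocycle z b (g mod n) = cocycle z b g"
proof -
  have gd: "g = g mod n + n * (g div n)" by simp
  have "g * e k div n = g mod n * e k div n + e k * (g div n)" for k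
  proof -
    have "g * e k = g mod n * e k + n * (e k * (g div n))"
    proof -
      have "(r + n * q) * c = r * c + n * (c * q)" for r q c :: nat by (simp add: algebra_simps)
      from this[of "g mod n" "g div n" "e k"] show ?thesis by simp
    qed
    then show ?thesis using n2 by simp
  qed
  moreover have "(\<Prod>k\<in>units. inverse (b k) ^ (e k * t)) = inverse (norm_form b) ^ t" for t
  proof -
    have "(\<Prod>k\<in>units. inverse (b k) ^ (e k * t)) = (\<Prod>k\<in>units. inverse (b k ^ e k)) ^ t"
      by (simp only: prod_power_distrib power_mult power_inverse)
    also have "(\<Prod>k\<in>units. inverse (b k ^ e k)) = inverse (norm_form b)"
      unfolding norm_form_def using prod_inversef[of "\<lambda>k. b k ^ e k" units] by (simp add: comp_def)
    finally show ?thesis .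
  qed
  ultimately have "(\<Prod>k\<in>units. inverse (b k) ^ (g * e k div n)) =
      (\<Prod>k\<in>units. inverse (b k) ^ (g mod n * e k div n)) * inverse (norm_form b) ^ (g div n)"
    by (simp add: power_add prod.distrib)
  moreover have "z ^ g = z ^ (g mod n) * norm_form b ^ (g div n)"
    by (subst gd) (simp only: power_add power_mult z)
  moreover have "norm_form b \<noteq> 0" using b by (simp add: norm_form_def)
  ultimately show ?thesis by (simp add: cocycle_def power_inverse)
qed

end

lemma cocycle_scale: "cocycle (c * z) b g = c ^ g * cocycle z b g"
  by (simp add: cocycle_def power_mult_distrib mult_ac)

lemma cocycle_mem: "is_subfield E \<Longrightarrow> z \<in> E \<Longrightarrow> (\<And>k. k \<in> units \<Longrightarrow> b k \<in> E) \<Longrightarrow> cocycle z b g \<in> E"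
  unfolding cocycle_def by (intro sf_mult sf_power sf_prod sf_inverse)

text \<open>The image of \<open>\<zeta>\<close> is some \<open>\<zeta>^d\<close>. With
  \<open>h = gcd d n\<close>, the power of \<open>\<zeta>\<close> with exponent
  \<open>n div h\<close> is sent to 1, so it is 1 by injectivity, and \<open>n\<close> divides
  \<open>n div h\<close>.\<close>

lemma embedding_\<zeta>:
  assumes E: "is_subfield E" and \<tau>: "embedding K E \<tau>" and \<zeta>E: "\<zeta> \<in> E"
  shows "\<exists>d. coprime d n \<and> \<tau> \<zeta> = \<zeta> ^ d"
proof -
  have "\<tau> \<zeta> ^ n = 1" using emb_power[OF E \<tau> \<zeta>E, of n] emb_1[OF E \<tau>] by simp
  then obtain d where d: "\<tau> \<zeta> = \<zeta> ^ d" using roots_of_unity by blast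
  let ?h = "gcd d n"
  have "\<tau> (\<zeta> ^ (n div ?h)) = \<zeta> ^ (d * (n div ?h))" using emb_power[OF E \<tau> \<zeta>E] d by (simp add: power_mult)
  also have "\<dots> = 1" unfolding \<zeta>_iff by (metis dvd_triv_right gcd_dvd1 gcd_dvd2 dvd_mult_div_cancel dvdE mult.assoc mult.commute div_mult_swap)
  finally have "\<zeta> ^ (n div ?h) = 1"
    using emb_inj[OF E \<tau>, of "\<zeta> ^ (n div ?h)" 1] E \<zeta>E emb_1[OF E \<tau>] by (simp add: sf_power)
  then have "n dvd n div ?h" by (simp add: \<zeta>_iff)
  moreover have "n div ?h > 0" using n2 by (simp add: div_greater_zero_iff gcd_le2_nat)
  ultimately have "n \<le> n div ?h" by (rule dvd_imp_le)
  have "?h = 1"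
  proof (rule ccontr)
    assume "?h \<noteq> 1"
    moreover have "?h > 0" using n2 by (simp add: gcd_pos_nat)
    ultimately have "?h > 1" by linarith
    then have "n div ?h < n" using n2 by (intro div_less_dividend) auto
    then show False using \<open>n \<le> n div ?h\<close> by simp
  qed
  then show ?thesis using d coprime_iff_gcd_eq_1 by blast
qed

lemma separable_\<zeta>: "is_subfield F \<Longrightarrow> separable_over F \<zeta>"
  by (rule separable_root[of F n]) (simp_all add: n_nz)

text \<open>An embedding is recorded by a pair \<open>(d, j)\<close>: it sends
  \<open>\<zeta>\<close> to \<open>\<zeta>^d\<close> and \<open>z\<close> to
  \<open>\<zeta>^j\<close> times \<open>cocycle z b d\<close>. A composite has the pair
  \<open>(d' d, d' j + d j')\<close>, which is symmetric, so embeddings commute.\<close>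

lemma abelian_ext_kummer:
  fixes K0 :: "'a set" and \<beta> :: "nat \<Rightarrow> 'a"
  assumes K0: "is_subfield K0" and \<beta>: "\<And>i. i < n \<Longrightarrow> \<beta> i \<in> K0"
    and b_def: "b = (\<lambda>g. \<Sum>i<n. \<beta> i * \<zeta> ^ (g * i))"
    and b: "\<And>k. k \<in> units \<Longrightarrow> b k \<noteq> 0" and z: "z ^ n = norm_form b"
  shows "abelian_ext K0 (adjoin K0 {\<zeta>, z})"
proof -
  let ?E = "adjoin K0 {\<zeta>, z}"
  have E: "is_subfield ?E" "K0 \<subseteq> ?E" "\<zeta> \<in> ?E" "z \<in> ?E"
    using adjoin_gen[of "{\<zeta>, z}" K0] by (simp_all add: adjoin_base)
  have bmem: "b g \<in> G" if "is_subfield G" "K0 \<subseteq> G" "\<zeta> \<in> G" for g G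
    unfolding b_def using that \<beta> by (intro sf_sum sf_mult sf_power) auto
  have emb_b: "\<tau> (b k) = b (d * k mod n)" if \<tau>: "embedding K0 ?E \<tau>" "\<tau> \<zeta> = \<zeta> ^ d" for \<tau> d k
  proof -
    have "\<tau> (b k) = (\<Sum>i<n. \<tau> (\<beta> i * \<zeta> ^ (k * i)))"
      unfolding b_def using E \<beta> by (intro emb_sum[OF E(1) \<tau>(1)] sf_mult sf_power) auto
    also have "\<dots> = (\<Sum>i<n. \<beta> i * \<zeta> ^ (d * k mod n * i))"
    proof (rule sum.cong[OF refl])
      fix i assume "i \<in> {..<n}"
      then have \<beta>i: "\<beta> i \<in> K0" using \<beta> by simp
      have "\<tau> (\<beta> i * \<zeta> ^ (k * i)) = \<beta> i * (\<zeta> ^ d) ^ (k * i)"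
        using emb_mult[OF E(1) \<tau>(1), of "\<beta> i" "\<zeta> ^ (k * i)"] E \<beta>i emb_fix[OF E(1) \<tau>(1) \<beta>i] emb_power[OF E(1) \<tau>(1) E(3)] \<tau>(2)
        by (auto simp: sf_power)
      also have "(\<zeta> ^ d) ^ (k * i) = \<zeta> ^ (d * k mod n * i)"
        unfolding power_mult[symmetric] by (rule \<zeta>_mod_cong) (simp add: mod_mult_left_eq mult.assoc)
      finally show "\<tau> (\<beta> i * \<zeta> ^ (k * i)) = \<beta> i * \<zeta> ^ (d * k mod n * i)" .
    qed
    finally show ?thesis by (simp add: b_def)
  qed
  have emb_z: "\<exists>d j. coprime d n \<and> \<tau> \<zeta> = \<zeta> ^ d \<and> \<tau> z = \<zeta> ^ j * cocycle z b d" if \<tau>: "embedding K0 ?E \<tau>" for \<tau>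
  proof -
    obtain d where d: "coprime d n" "\<tau> \<zeta> = \<zeta> ^ d" using embedding_\<zeta>[OF E(1) \<tau> E(3)] by blast
    have "\<tau> z ^ n = \<tau> (norm_form b)" using emb_power[OF E(1) \<tau> E(4), of n] by (simp add: z)
    also have "\<dots> = norm_form (\<lambda>k. b (d * k mod n))"
      unfolding norm_form_def using bmem[OF E(1,2,3)] E(1)
      by (simp add: emb_prod[OF E(1) \<tau>] emb_power[OF E(1) \<tau>] emb_b[OF \<tau> d(2)] sf_power)
    also have "\<dots> = cocycle z b d ^ n" using norm_form_mult[OF b z d(1)] by simp
    finally obtain j where "\<tau> z = \<zeta> ^ j * cocycle z b d" using same_power by blast
    then show ?thesis using d by blast
  qed
  have emb_cocycle: "\<tau> (cocycle z b g) = cocycle (\<tau> z) (\<lambda>k. b (d * k mod n)) g"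
    if \<tau>: "embedding K0 ?E \<tau>" "\<tau> \<zeta> = \<zeta> ^ d" for \<tau> d g
    unfolding cocycle_def using bmem[OF E(1,2,3)] E
    by (simp add: emb_mult[OF E(1) \<tau>(1)] emb_prod[OF E(1) \<tau>(1)] emb_power[OF E(1) \<tau>(1)] emb_inverse[OF E(1) \<tau>(1)]
        emb_b[OF \<tau>] sf_power sf_prod sf_inverse)
  have comp: "\<sigma> (\<tau> z) = \<zeta> ^ (d' * j + d * j') * cocycle z b (d' * d)"
    if \<sigma>: "embedding K0 ?E \<sigma>" "coprime d' n" "\<sigma> \<zeta> = \<zeta> ^ d'" "\<sigma> z = \<zeta> ^ j' * cocycle z b d'"
      and \<tau>: "\<tau> z = \<zeta> ^ j * cocycle z b d" for \<sigma> \<tau> d d' j j'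
  proof -
    have cE: "cocycle z b d \<in> ?E" using bmem[OF E(1,2,3)] E by (intro cocycle_mem) auto
    have "\<sigma> (\<tau> z) = \<sigma> \<zeta> ^ j * \<sigma> (cocycle z b d)"
      using \<tau> E cE by (simp add: emb_mult[OF E(1) \<sigma>(1)] emb_power[OF E(1) \<sigma>(1)] sf_power)
    also have "\<sigma> (cocycle z b d) = cocycle (\<zeta> ^ j' * cocycle z b d') (\<lambda>k. b (d' * k mod n)) d"
      using emb_cocycle[OF \<sigma>(1,3), of d] \<sigma>(4) by simp
    also have "\<dots> = (\<zeta> ^ j') ^ d * cocycle z b (d' * d)"
      by (simp add: cocycle_scale cocycle_mult[OF b z \<sigma>(2)])
    also have "\<sigma> \<zeta> ^ j * ((\<zeta> ^ j') ^ d * cocycle z b (d' * d)) = \<zeta> ^ (d' * j + d * j') * cocycle z b (d' * d)"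
      by (simp add: \<sigma>(3) power_add mult_ac flip: power_mult)
    finally show ?thesis .
  qed
  show ?thesis
  proof (rule abelian_extI[OF K0])
    fix x assume "x \<in> {\<zeta>, z}"
    moreover have "separable_over K0 z"
    proof (rule separable_over_trans[OF K0])
      let ?G = "adjoin K0 {\<zeta>}"
      have G: "is_subfield ?G" "K0 \<subseteq> ?G" "\<zeta> \<in> ?G" using adjoin_gen[of "{\<zeta>}" K0] by (simp_all add: adjoin_base)
      show "separable_over ?G z"
        by (rule separable_root[OF G(1) n_nz]) (unfold z norm_form_def, intro sf_prod[OF G(1)] sf_power[OF G(1)] bmem[OF G])
      show "separable_over K0 y" if "y \<in> ?G" for y
        using separable_over_adjoin[OF K0 _ that] separable_\<zeta>[OF K0] by simp
    qed
    ultimately show "separable_over K0 x" using separable_\<zeta>[OF K0] by blast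
  next
    fix \<tau> x assume \<tau>: "embedding K0 ?E \<tau>" and x: "x \<in> {\<zeta>, z}"
    obtain d j where dj: "\<tau> \<zeta> = \<zeta> ^ d" "\<tau> z = \<zeta> ^ j * cocycle z b d" using emb_z[OF \<tau>] by blast
    have "cocycle z b d \<in> ?E" using bmem[OF E(1,2,3)] E by (intro cocycle_mem) auto
    then show "\<tau> x \<in> ?E" using x dj E by (auto intro!: sf_power[OF E(1)] sf_mult[OF E(1)])
  next
    fix \<sigma> \<tau> x assume \<sigma>: "embedding K0 ?E \<sigma>" and \<tau>: "embedding K0 ?E \<tau>" and x: "x \<in> {\<zeta>, z}"
    obtain d j where t: "coprime d n" "\<tau> \<zeta> = \<zeta> ^ d" "\<tau> z = \<zeta> ^ j * cocycle z b d" using emb_z[OF \<tau>] by blast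
    obtain d' j' where s: "coprime d' n" "\<sigma> \<zeta> = \<zeta> ^ d'" "\<sigma> z = \<zeta> ^ j' * cocycle z b d'" using emb_z[OF \<sigma>] by blast
    have "\<sigma> (\<tau> \<zeta>) = \<tau> (\<sigma> \<zeta>)"
      using emb_power[OF E(1) \<sigma> E(3)] emb_power[OF E(1) \<tau> E(3)] s t by (simp add: mult.commute flip: power_mult)
    moreover have "\<sigma> (\<tau> z) = \<tau> (\<sigma> z)"
      using comp[of \<sigma> d' j' \<tau> j d, OF \<sigma> s t(3)] comp[of \<tau> d j \<sigma> j' d', OF \<tau> t s(3)] by (simp add: mult.commute add.commute)
    ultimately show "\<sigma> (\<tau> x) = \<tau> (\<sigma> x)" using x by blast
  qed
qed

end

lemma sum_periodic_shift:
  fixes h :: "nat \<Rightarrow> 'b::comm_monoid_add"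
  assumes "\<And>i. h (i + n) = h i" shows "(\<Sum>i<n. h (i + c)) = (\<Sum>i<n. h i)"
proof (induction c)
  case (Suc c)
  have "(\<Sum>i<n. h (i + Suc c)) = (\<Sum>i<n. h (Suc i + c))" by simp
  also have "\<dots> = (\<Sum>i<n. h (i + c))"
    by (rule sum_cyclic_shift[of "\<lambda>i. h (i + c)"]) (metis assms add.commute add_0)
  finally show ?case using Suc by simp
qed simp

context root_of_unity
begin

lemma inverse_\<zeta>_mod_cong: "i mod n = j mod n \<Longrightarrow> inverse \<zeta> ^ i = inverse \<zeta> ^ j"
  using \<zeta>_mod_cong[of i j] by (simp add: power_inverse)

lemma cocycle_1 [simp]: "cocycle z b 1 = z" "cocycle z b (Suc 0) = z"
  using e by (simp_all add: cocycle_def units_def)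

lemma norm_form_split: "norm_form b = b 1 * (\<Prod>k\<in>units - {1}. b k ^ e k)"
  unfolding norm_form_def by (subst prod.remove[of units 1]) simp_all

text \<open>
  Since \<open>e 1 = 1\<close>, the equation \<open>z\<^sup>n = \<Prod> b\<^sub>k\<^bsup>e(k)\<^esup>\<close> can be solved for \<open>b\<^sub>1\<close>: the variety of the pairs \<open>(b, z)\<close> is
  parametrized by \<open>s\<close> with \<open>s\<^sub>1 = z\<close> and \<open>s\<^sub>k = b\<^sub>k\<close> for \<open>k \<noteq> 1\<close>.
\<close>

definition base_coord :: "(nat \<Rightarrow> 'a) \<Rightarrow> nat \<Rightarrow> 'a" where
  "base_coord s g = (if g = 1 then s 1 ^ n * (\<Prod>k\<in>units - {1}. inverse (s k) ^ e k) else s g)"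

text \<open>For a unit \<open>g\<close>, the \<open>n\<close>-th root belonging to the permuted
  tuple with entries \<open>b_(g k)\<close>; for \<open>g = 1\<close> it is \<open>s 1\<close>
  itself.\<close>

definition "root_coord s g = cocycle (s 1) (base_coord s) g"

context
  fixes s :: "nat \<Rightarrow> 'a"
  assumes s: "\<And>i. i < n \<Longrightarrow> s i \<noteq> 0"
begin

lemma base_coord_nz: "g < n \<Longrightarrow> base_coord s g \<noteq> 0"
  using s n2 by (auto simp: base_coord_def units_def)

lemma base_coord_units_nz: "g \<in> units \<Longrightarrow> base_coord s g \<noteq> 0"
  using base_coord_nz by (simp add: units_def)

lemma base_coord_norm: "s 1 ^ n = norm_form (base_coord s)"
proof -
  have "(\<Prod>k\<in>units - {1}. base_coord s k ^ e k) = (\<Prod>k\<in>units - {1}. s k ^ e k)"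
    by (rule prod.cong) (auto simp: base_coord_def)
  moreover have "(\<Prod>k\<in>units - {1}. inverse (s k) ^ e k) * (\<Prod>k\<in>units - {1}. s k ^ e k) = 1"
    unfolding prod.distrib[symmetric] using s by (intro prod.neutral) (auto simp: units_def power_inverse)
  ultimately show ?thesis unfolding norm_form_split by (simp add: base_coord_def mult.assoc)
qed

lemma root_coord_mod: "root_coord s (g mod n) = root_coord s g"
  unfolding root_coord_def by (rule cocycle_mod[OF base_coord_units_nz base_coord_norm])

lemma root_coord_nz: "root_coord s g \<noteq> 0"
  unfolding root_coord_def cocycle_def using base_coord_units_nz s[of 1] n2 by auto

text \<open>The change of parameters that will undo an automorphism of the coefficients: indices are
  multiplied by \<open>d\<close>, and the root goes to its \<open>d\<close>-th conjugate up to a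
  root of unity. The new tuple satisfies the defining equation by \<open>norm_form_mult\<close>; the
  effect on all roots comes from \<open>cocycle_mult\<close>.\<close>

lemma twisted_coords:
  assumes d: "coprime d n" and s': "s' = (\<lambda>g. if g = 1 then inverse \<zeta> ^ c * root_coord s d else base_coord s (d * g mod n))"
  shows "\<And>g. g < n \<Longrightarrow> s' g \<noteq> 0"
    and "\<And>g. base_coord s' g = base_coord s (d * g mod n)"
    and "\<And>g. root_coord s' g = inverse \<zeta> ^ (c * g) * root_coord s (d * g)"
proof -
  show "\<And>g. g < n \<Longrightarrow> s' g \<noteq> 0" using root_coord_nz base_coord_nz n2 by (auto simp: s')
  show bc: "base_coord s' g = base_coord s (d * g mod n)" for g
  proof (cases "g = 1")
    case True
    let ?b = "\<lambda>k. base_coord s (d * k mod n)"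
    have "s' 1 ^ n = root_coord s d ^ n" by (simp add: s' power_mult_distrib power_inverse)
    also have "\<dots> = ?b 1 * (\<Prod>k\<in>units - {1}. ?b k ^ e k)"
      unfolding root_coord_def norm_form_split[of ?b, symmetric]
      by (rule norm_form_mult[OF base_coord_units_nz base_coord_norm d])
    finally have "base_coord s' 1 = ?b 1 * ((\<Prod>k\<in>units - {1}. ?b k ^ e k) * (\<Prod>k\<in>units - {1}. inverse (s' k) ^ e k))"
      unfolding base_coord_def[of s'] by (simp add: mult.assoc)
    also have "(\<Prod>k\<in>units - {1}. ?b k ^ e k) * (\<Prod>k\<in>units - {1}. inverse (s' k) ^ e k) = 1"
      unfolding prod.distrib[symmetric] using mult_units[OF d] base_coord_units_nz
      by (intro prod.neutral) (auto simp: s' power_inverse)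
    finally show ?thesis using True by simp
  next
    case False
    then have "base_coord s' g = s' g" by (simp add: base_coord_def)
    also have "\<dots> = base_coord s (d * g mod n)" using False by (simp add: s')
    finally show ?thesis .
  qed
  show "root_coord s' g = inverse \<zeta> ^ (c * g) * root_coord s (d * g)" for g
  proof -
    have "root_coord s' g = cocycle (inverse \<zeta> ^ c * root_coord s d) (\<lambda>k. base_coord s (d * k mod n)) g"
      unfolding root_coord_def[of s'] bc by (simp add: s')
    then show ?thesis
      using cocycle_mult[OF base_coord_units_nz base_coord_norm d] by (simp add: cocycle_scale root_coord_def power_mult)
  qed
qed

end

text \<open>
  The proof applies the PAC property to the variety \<open>y\<^sup>n = U(1)\<^sup>n \<Prod> b\<^sub>k\<^bsup>e(k)\<^esup>\<close> with \<open>y = U(1) z\<close>. Its functions \<open>\<phi>\<^sub>i\<close>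
  are defined over \<open>K\<close>: the Fourier coefficients of \<open>b\<close>, those of the conjugates of \<open>y\<close>, and
  \<open>1 / \<Prod> b\<^sub>k\<close>, which keeps the point obtained away from \<open>b\<^sub>k = 0\<close>.
\<close>

lemma tame_resolvent:
  fixes K0 K L :: "'a set"
  assumes univ: "universal_domain_over K" and PAC: "PAC_extension K0 K" and L: "abelian_ext K L"
    and \<sigma>: "\<sigma> \<in> galois_group K L" and \<theta>: "\<theta> \<in> L" and period: "(\<sigma> ^^ n) \<theta> = \<theta>"
    and cyclic: "\<forall>\<tau>\<in>galois_group K L. \<exists>i. \<tau> \<theta> = (\<sigma> ^^ i) \<theta>"
  shows "(\<Sum>i<n. (\<sigma> ^^ i) \<theta> * inverse \<zeta> ^ (f * i)) \<in> adjoin (max_abelian_ext K0) K"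
proof -
  let ?\<Omega> = "adjoin (max_abelian_ext K0) K"
  have K: "is_subfield K" and K0: "is_subfield K0" using PAC by (auto simp: PAC_extension_def subfield_ambient_iff)
  have \<Omega>: "is_subfield ?\<Omega>" "K \<subseteq> ?\<Omega>" "max_abelian_ext K0 \<subseteq> ?\<Omega>" by (simp_all add: adjoin_base adjoin_gen)
  have galL: "galois_ext K L" using L by (simp add: abelian_ext_def)
  note DL = galois_extD[OF galL]
  have comm: "\<sigma>' (\<tau> x) = \<tau> (\<sigma>' x)" if "\<sigma>' \<in> galois_group K L" "\<tau> \<in> galois_group K L" "x \<in> L" for \<sigma>' \<tau> x
    using L that by (simp add: abelian_ext_def)
  have pow: "embedding K L (\<sigma> ^^ i) \<and> (\<forall>x\<in>L. (\<sigma> ^^ i) x \<in> L)" for i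
  proof (induction i)
    case 0 show ?case by (simp add: embedding_def)
  next
    case (Suc i)
    then show ?case using embedding_comp[of K L "\<sigma> ^^ i" L \<sigma>] galois_group_embedding[OF \<sigma>]
        galois_embedding_image[OF galL galois_group_embedding[OF \<sigma>]] by (simp add: comp_def)
  qed
  have powG: "\<sigma> ^^ i \<in> galois_group K L" for i using pow by (simp add: galois_group_iff[OF galL])
  define t where "t i = (\<sigma> ^^ i) \<theta>" for i
  have tL: "t i \<in> L" for i using pow \<theta> by (simp add: t_def)
  have tper: "t (i + n) = t i" for i by (simp add: t_def funpow_add period)
  have tmult: "t (i + m * n) = t i" for i m by (induction m) (simp_all add: tper add.assoc[symmetric] add.commute[of n])
  have tmod: "t (i mod n) = t i" for i using tmult[of "i mod n" "i div n"] by (simp add: mult.commute)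
  define R where "R = t ` {..<n}"
  have tR: "t i \<in> R" for i using tmod[of i, symmetric] n2 by (simp add: R_def)
  \<comment> \<open>The coefficients of the parametrization involve \<open>\<zeta>\<close>, which
    \<open>L\<close> may lack, and the conjugates of \<open>\<theta>\<close>.\<close>
  define K' where "K' = adjoin K (insert \<zeta> R)"
  have gens: "insert \<zeta> R \<subseteq> K'" unfolding K'_def by (rule adjoin_gen)
  have tK': "t i \<in> K'" for i using gens tR by blast
  have "is_subfield K'" "K \<subseteq> K'" by (simp_all add: K'_def adjoin_base)
  note K' = this insertI1[THEN subsetD[OF gens]] tK'
  have "R \<subseteq> L" using tL by (auto simp: R_def)
  then have "adjoin K R \<subseteq> L" by (rule adjoin_minimal[OF DL(2,3)])
  moreover have "adjoin K R \<subseteq> K'" unfolding K'_def by (rule adjoin_mono) auto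
  ultimately have KR: "adjoin K R \<subseteq> L" "adjoin K R \<subseteq> K'" .
  \<comment> \<open>Every embedding shifts the conjugates of \<open>\<theta>\<close>: on
    \<open>adjoin K R\<close> it agrees with an automorphism of \<open>L\<close>, which commutes
    with \<open>\<sigma>\<close> and moves \<open>\<theta>\<close> by a power of
    \<open>\<sigma>\<close>.\<close>
  have emb_t: "\<exists>c. \<forall>i. \<delta> (t i) = t (i + c)" if \<delta>: "embedding K K' \<delta>" for \<delta>
  proof -
    have "\<And>x. x \<in> L \<Longrightarrow> algebraic_over (adjoin K R) x" using algebraic_over_mono[OF DL(5) adjoin_base] .
    then obtain \<tau> where \<tau>: "embedding K L \<tau>" "\<forall>x\<in>adjoin K R. \<tau> x = \<delta> x"
      using embedding_extend[OF is_subfield_adjoin DL(2) KR(1) _ embedding_mono[OF \<delta> subset_refl KR(2)] adjoin_base] by blast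
    then have \<tau>G: "\<tau> \<in> galois_group K L" by (simp add: galois_group_iff[OF galL])
    then obtain c where c: "\<tau> \<theta> = (\<sigma> ^^ c) \<theta>" using cyclic by blast
    have "\<delta> (t i) = t (i + c)" for i
    proof -
      have "\<delta> (t i) = \<tau> (t i)" using \<tau>(2) tR[of i] adjoin_gen[of R K] by auto
      also have "\<dots> = (\<sigma> ^^ i) (\<tau> \<theta>)" unfolding t_def using comm[OF \<tau>G powG \<theta>] .
      finally show ?thesis by (simp add: c t_def funpow_add)
    qed
    then show ?thesis by blast
  qed
  have gal: "galois_ext K K'"
    unfolding K'_def
  proof (rule galois_extI[OF K])
    fix z assume "z \<in> insert \<zeta> R"
    then show "separable_over K z" using separable_\<zeta>[OF K] DL(4) tL by (auto simp: R_def)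
  next
    fix \<delta> z assume "embedding K (adjoin K (insert \<zeta> R)) \<delta>" "z \<in> insert \<zeta> R"
    then have \<delta>: "embedding K K' \<delta>" and z: "z \<in> insert \<zeta> R" by (simp_all add: K'_def)
    obtain d where "\<delta> \<zeta> = \<zeta> ^ d" using embedding_\<zeta>[OF K'(1) \<delta> K'(3)] by blast
    moreover obtain c where "\<And>i. \<delta> (t i) = t (i + c)" using emb_t[OF \<delta>] by blast
    ultimately have "\<delta> z \<in> K'" using z K' by (auto simp: R_def intro: sf_power[OF K'(1)])
    then show "\<delta> z \<in> adjoin K (insert \<zeta> R)" by (simp add: K'_def)
  qed
  \<comment> \<open>Lagrange resolvents for the characters
    \<open>i \<mapsto> \<zeta>^(-f g i)\<close>; \<open>U 1\<close> is the one in the claim, and the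
    others enter when \<open>\<zeta>\<close> is conjugated.\<close>
  define U where "U g = (\<Sum>i<n. t i * inverse \<zeta> ^ (f * g * i))" for g
  have UK': "U g \<in> K'" for g unfolding U_def using K' by (intro sf_sum sf_mult sf_power sf_inverse) auto
  have Umod: "U (g mod n) = U g" for g
    unfolding U_def
    by (intro sum.cong refl arg_cong2[where f = "(*)"] inverse_\<zeta>_mod_cong) (metis mod_mult_left_eq mod_mult_right_eq)

  \<comment> \<open>Regular functions on the torus \<open>{Q \<noteq> 0}\<close>\<close>
  define Q where "Q = (\<Prod>i<n. msingle (msingle i 1) 1 :: 'a mpoly)"
  have Qval: "meval Q s = (\<Prod>i<n. s i)" for s by (simp add: Q_def meval_prod)
  have QK: "Q \<in> mpolys n K" unfolding Q_def using K by (intro mpolys_prod[OF K] mpolys_single[OF K]) auto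
  have Qnz: "meval Q s \<noteq> 0 \<longleftrightarrow> (\<forall>i<n. s i \<noteq> 0)" for s by (auto simp: Qval)
  have "meval Q (\<lambda>_. 1) \<noteq> 0" by (simp add: Qval)
  then have Q0: "Q \<noteq> 0" by auto
  obtain s0 where "alg_independent K n s0" using univ by (auto simp: universal_domain_over_def)
  then have s0: "alg_independent K' n s0" by (rule alg_independent_galois_ext[OF gal])
  have "Q \<in> mpolys n K'" by (rule mpolys_mono[OF K'(2) order_refl QK])
  then have Qs0: "meval Q s0 \<noteq> 0" using s0 Q0 unfolding alg_independent_def by blast

  \<comment> \<open>Fourier sums rather than the \<open>b g\<close> are taken as coordinates, since
    a sum over all indices is unchanged when \<open>\<zeta> \<mapsto> \<zeta>^d\<close> is
    compensated by permuting the indices.\<close>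
  define \<phi> where "\<phi> i s = (if i < n then 1 / of_nat n * (\<Sum>g<n. base_coord s g * inverse \<zeta> ^ (g * i))
      else if i < 2 * n then (\<Sum>g\<in>units. root_coord s g * U g * \<zeta> ^ (g * (i - n)))
      else (\<Prod>g\<in>units. inverse (base_coord s g)))" for i s
  define N where "N = 2 * n + 1"
  have regc: "regular_pair n K' \<delta> Q (\<lambda>_. a) (\<lambda>_. a')" if "embedding K K' \<delta>" "a \<in> K'" "\<delta> a = a'" for \<delta> a a'
    using regular_const[OF K K'(2,1) that(1) QK that(2)] that(3) by simp
  have reg_inv: "regular_pair n K' \<delta> Q (\<lambda>s. inverse (s k)) (\<lambda>s. inverse (s k))"
    if \<delta>: "embedding K K' \<delta>" and k: "k < n" for \<delta> k
  proof -
    have "regular_pair n K' \<delta> Q (\<lambda>s. (\<Prod>i\<in>{..<n} - {k}. s i) / meval Q s) (\<lambda>s. (\<Prod>i\<in>{..<n} - {k}. s i) / meval Q s)"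
      by (intro regular_div_Q[OF K K'(2,1) \<delta> QK] regular_prod[OF K K'(2,1) \<delta> QK] regular_var[OF K K'(2,1) \<delta> QK]) auto
    note quotient = this
    have "(\<Prod>i\<in>{..<n} - {k}. s i) / meval Q s = inverse (s k)" if "meval Q s \<noteq> 0" for s
    proof -
      have "meval Q s = s k * (\<Prod>i\<in>{..<n} - {k}. s i)" unfolding Qval using k by (subst prod.remove[of _ k]) auto
      then show ?thesis using that by (simp add: field_simps)
    qed
    then show ?thesis by (intro regular_pair_cong[OF quotient])
  qed
  have reg_base: "regular_pair n K' \<delta> Q (\<lambda>s. base_coord s g) (\<lambda>s. base_coord s g)"
    if \<delta>: "embedding K K' \<delta>" and g: "g < n" for \<delta> g
  proof (cases "g = 1")
    case True
    have "regular_pair n K' \<delta> Q (\<lambda>s. s 1 ^ n * (\<Prod>k\<in>units - {1}. inverse (s k) ^ e k)) (\<lambda>s. s 1 ^ n * (\<Prod>k\<in>units - {1}. inverse (s k) ^ e k))"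
      using n2 by (intro regular_mult[OF K K'(2,1) \<delta> QK] regular_power[OF K K'(2,1) \<delta> QK] regular_prod[OF K K'(2,1) \<delta> QK]
          regular_var[OF K K'(2,1) \<delta> QK] reg_inv[OF \<delta>]) (auto simp: units_def)
    then show ?thesis using True by (simp add: base_coord_def)
  next
    case False
    then show ?thesis using regular_var[OF K K'(2,1) \<delta> QK g] by (simp add: base_coord_def)
  qed
  have reg_ibase: "regular_pair n K' \<delta> Q (\<lambda>s. inverse (base_coord s g)) (\<lambda>s. inverse (base_coord s g))"
    if \<delta>: "embedding K K' \<delta>" and g: "g < n" for \<delta> g
  proof (cases "g = 1")
    case True
    have "regular_pair n K' \<delta> Q (\<lambda>s. inverse (s 1) ^ n * (\<Prod>k\<in>units - {1}. s k ^ e k)) (\<lambda>s. inverse (s 1) ^ n * (\<Prod>k\<in>units - {1}. s k ^ e k))"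
      using n2 by (intro regular_mult[OF K K'(2,1) \<delta> QK] regular_power[OF K K'(2,1) \<delta> QK] regular_prod[OF K K'(2,1) \<delta> QK]
          regular_var[OF K K'(2,1) \<delta> QK] reg_inv[OF \<delta>]) (auto simp: units_def)
    moreover have "inverse (s 1) ^ n * (\<Prod>k\<in>units - {1}. s k ^ e k) = inverse (base_coord s 1)" for s
      using prod_inversef[of "\<lambda>k. s k ^ e k" "units - {1}"] by (simp add: base_coord_def power_inverse comp_def)
    ultimately show ?thesis using True by simp
  next
    case False
    then show ?thesis using reg_inv[OF \<delta> g] by (simp add: base_coord_def)
  qed
  have reg_root: "regular_pair n K' \<delta> Q (\<lambda>s. root_coord s g) (\<lambda>s. root_coord s g)"
    if \<delta>: "embedding K K' \<delta>" for \<delta> g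
    unfolding root_coord_def cocycle_def using n2
    by (intro regular_mult[OF K K'(2,1) \<delta> QK] regular_power[OF K K'(2,1) \<delta> QK] regular_prod[OF K K'(2,1) \<delta> QK]
          regular_var[OF K K'(2,1) \<delta> QK] reg_ibase[OF \<delta>]) (auto simp: units_def)

  \<comment> \<open>Conjugates of the parametrization\<close>
  have twist: "\<exists>\<phi>'. (\<forall>i<N. regular_pair n K' \<delta> Q (\<phi> i) (\<phi>' i)) \<and>
      (\<forall>s. meval Q s \<noteq> 0 \<longrightarrow> (\<exists>s'. meval Q s' \<noteq> 0 \<and> (\<forall>i<N. \<phi>' i s' = \<phi> i s)))"
    if \<delta>G: "\<delta> \<in> galois_group K K'" for \<delta>
  proof -
    have \<delta>: "embedding K K' \<delta>" using \<delta>G by (rule galois_group_embedding)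
    note R = K K'(2,1) \<delta> QK
    obtain d where d: "coprime d n" "\<delta> \<zeta> = \<zeta> ^ d" using embedding_\<zeta>[OF K'(1) \<delta> K'(3)] by blast
    obtain c where c: "\<And>i. \<delta> (t i) = t (i + c)" using emb_t[OF \<delta>] by blast
    have \<delta>\<zeta>: "\<delta> (\<zeta> ^ m) = \<zeta> ^ (d * m)" for m using emb_power[OF K'(1) \<delta> K'(3)] d by (simp add: power_mult)
    have \<delta>i\<zeta>: "\<delta> (inverse \<zeta> ^ m) = inverse \<zeta> ^ (d * m)" for m
      using emb_inverse[OF K'(1) \<delta>, of "\<zeta> ^ m"] \<delta>\<zeta> K' by (simp add: power_inverse sf_power)
    \<comment> \<open>\<open>\<delta>\<close> shifts the conjugates of \<open>\<theta>\<close> by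
      \<open>c\<close>; undoing the shift in the resolvent costs the factor
      \<open>\<zeta> ^ (d * f * g * c)\<close>.\<close>
    have \<delta>U: "\<delta> (U g) = \<zeta> ^ (d * f * g * c) * U (d * g)" for g
    proof -
      let ?h = "\<lambda>i. t i * inverse \<zeta> ^ (f * (d * g) * i)"
      have per: "?h (i + n) = ?h i" for i
        by (intro arg_cong2[where f = "(*)"] tper inverse_\<zeta>_mod_cong) (simp add: distrib_left)
      have "\<delta> (U g) = (\<Sum>i<n. \<delta> (t i) * \<delta> (inverse \<zeta> ^ (f * g * i)))"
        unfolding U_def using K' by (subst emb_sum[OF K'(1) \<delta>]) (auto simp: emb_mult[OF K'(1) \<delta>] sf_mult sf_power sf_inverse)
      also have "\<dots> = (\<Sum>i<n. \<zeta> ^ (d * f * g * c) * ?h (i + c))"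
      proof (rule sum.cong[OF refl])
        fix i
        have "inverse \<zeta> ^ (d * (f * g * i)) = \<zeta> ^ (d * f * g * c) * inverse \<zeta> ^ (f * (d * g) * (i + c))"
          by (simp add: distrib_left power_add power_inverse mult_ac)
        then show "\<delta> (t i) * \<delta> (inverse \<zeta> ^ (f * g * i)) = \<zeta> ^ (d * f * g * c) * ?h (i + c)"
          by (simp add: c \<delta>i\<zeta>)
      qed
      also have "\<dots> = \<zeta> ^ (d * f * g * c) * (\<Sum>i<n. ?h i)"
        unfolding sum_distrib_left[symmetric] using sum_periodic_shift[of ?h n c, OF per] by (simp only:)
      finally show ?thesis by (simp add: U_def)
    qed
    define \<phi>' where "\<phi>' i s = (if i < n then 1 / of_nat n * (\<Sum>g<n. base_coord s g * inverse \<zeta> ^ (d * (g * i)))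
      else if i < 2 * n then (\<Sum>g\<in>units. root_coord s g * \<delta> (U g) * \<zeta> ^ (d * (g * (i - n))))
      else (\<Prod>g\<in>units. inverse (base_coord s g)))" for i s
    have nK: "1 / of_nat n \<in> K'" using K'(1) by (intro sf_divide sf_1 sf_of_nat)
    have \<delta>n: "\<delta> (1 / of_nat n) = 1 / of_nat n"
      using emb_divide[OF K'(1) \<delta>, of 1 "of_nat n"] K'(1) emb_1[OF K'(1) \<delta>] emb_of_nat[OF K'(1) \<delta>] by (simp add: sf_of_nat)
    have "regular_pair n K' \<delta> Q (\<phi> i) (\<phi>' i)" if "i < N" for i
    proof -
      consider "i < n" | "n \<le> i" "i < 2 * n" | "2 * n \<le> i" by linarith
      then show ?thesis
      proof cases
        case 1
        have "regular_pair n K' \<delta> Q (\<lambda>s. 1 / of_nat n * (\<Sum>g<n. base_coord s g * inverse \<zeta> ^ (g * i)))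
          (\<lambda>s. 1 / of_nat n * (\<Sum>g<n. base_coord s g * inverse \<zeta> ^ (d * (g * i))))"
          using K' by (intro regular_mult[OF R] regular_sum[OF R] reg_base[OF \<delta>] regc[OF \<delta>] nK \<delta>n \<delta>i\<zeta> sf_power[OF K'(1)] sf_inverse[OF K'(1)]) auto
        then show ?thesis using 1 by (simp add: \<phi>_def[abs_def] \<phi>'_def[abs_def])
      next
        case 2
        have "regular_pair n K' \<delta> Q (\<lambda>s. \<Sum>g\<in>units. root_coord s g * U g * \<zeta> ^ (g * (i - n)))
          (\<lambda>s. \<Sum>g\<in>units. root_coord s g * \<delta> (U g) * \<zeta> ^ (d * (g * (i - n))))"
          using K' by (intro regular_mult[OF R] regular_sum[OF R] reg_root[OF \<delta>] regc[OF \<delta>] UK' \<delta>\<zeta> refl sf_power[OF K'(1)]) auto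
        then show ?thesis using 2 by (simp add: \<phi>_def[abs_def] \<phi>'_def[abs_def])
      next
        case 3
        have "regular_pair n K' \<delta> Q (\<lambda>s. \<Prod>g\<in>units. inverse (base_coord s g)) (\<lambda>s. \<Prod>g\<in>units. inverse (base_coord s g))"
          by (intro regular_prod[OF R] reg_ibase[OF \<delta>]) (simp add: units_def)
        then show ?thesis using 3 n2 by (simp add: \<phi>_def[abs_def] \<phi>'_def[abs_def])
      qed
    qed
    moreover have "\<exists>s'. meval Q s' \<noteq> 0 \<and> (\<forall>i<N. \<phi>' i s' = \<phi> i s)" if "meval Q s \<noteq> 0" for s
    proof -
      have s: "\<And>i. i < n \<Longrightarrow> s i \<noteq> 0" using that Qnz by blast
      \<comment> \<open>The exponent \<open>d * f * c\<close> cancels the root of unity that appears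
        in \<open>\<delta> (U g)\<close>.\<close>
      define s' where "s' = (\<lambda>g. if g = 1 then inverse \<zeta> ^ (d * f * c) * root_coord s d else base_coord s (d * g mod n))"
      have T: "\<And>g. g < n \<Longrightarrow> s' g \<noteq> 0" "\<And>g. base_coord s' g = base_coord s (d * g mod n)"
        "\<And>g. root_coord s' g = inverse \<zeta> ^ (d * f * c * g) * root_coord s (d * g)"
        using twisted_coords[of s d s' "d * f * c", OF s d(1) s'_def] by blast+
      have "\<phi>' i s' = \<phi> i s" if "i < N" for i
      proof -
        consider "i < n" | "n \<le> i" "i < 2 * n" | "2 * n \<le> i" by linarith
        then show ?thesis
        proof cases
          case 1
          have "(\<Sum>g<n. base_coord s' g * inverse \<zeta> ^ (d * (g * i))) =
            (\<Sum>g<n. base_coord s (d * g mod n) * inverse \<zeta> ^ (d * g mod n * i))"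
            unfolding T by (intro sum.cong refl arg_cong2[where f = "(*)"] inverse_\<zeta>_mod_cong) (simp add: mod_mult_left_eq mult.assoc)
          also have "\<dots> = (\<Sum>g<n. base_coord s g * inverse \<zeta> ^ (g * i))"
            by (rule sum.reindex_bij_betw[OF bij_mult[OF d(1)]])
          finally show ?thesis using 1 by (simp add: \<phi>_def \<phi>'_def)
        next
          case 2
          have "root_coord s' g * \<delta> (U g) * \<zeta> ^ (d * (g * (i - n))) =
              root_coord s (d * g mod n) * U (d * g mod n) * \<zeta> ^ (d * g mod n * (i - n))" for g
          proof -
            have "root_coord s' g * \<delta> (U g) = root_coord s (d * g) * U (d * g)"
              unfolding T \<delta>U by (simp add: power_inverse mult_ac)
            moreover have "\<zeta> ^ (d * (g * (i - n))) = \<zeta> ^ (d * g mod n * (i - n))"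
              by (rule \<zeta>_mod_cong) (simp add: mod_mult_left_eq mult.assoc)
            ultimately show ?thesis by (simp add: root_coord_mod[OF s] Umod)
          qed
          then have "(\<Sum>g\<in>units. root_coord s' g * \<delta> (U g) * \<zeta> ^ (d * (g * (i - n)))) =
            (\<Sum>g\<in>units. root_coord s (d * g mod n) * U (d * g mod n) * \<zeta> ^ (d * g mod n * (i - n)))" by simp
          also have "\<dots> = (\<Sum>g\<in>units. root_coord s g * U g * \<zeta> ^ (g * (i - n)))"
            by (rule sum.reindex_bij_betw[OF bij_mult_units[OF d(1)]])
          finally show ?thesis using 2 by (simp add: \<phi>_def \<phi>'_def)
        next
          case 3
          have "(\<Prod>g\<in>units. inverse (base_coord s' g)) = (\<Prod>g\<in>units. inverse (base_coord s g))"
            unfolding T by (rule prod.reindex_bij_betw[OF bij_mult_units[OF d(1)]])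
          then show ?thesis using 3 n2 by (simp add: \<phi>_def \<phi>'_def)
        qed
      qed
      then show ?thesis using T(1) Qnz by blast
    qed
    ultimately show ?thesis by blast
  qed

  have \<phi>_inv: "(\<Sum>i<n. \<phi> i s * \<zeta> ^ (g * i)) = base_coord s g" if "g < n" for s g
    using fourier_inverse[OF that, of "base_coord s"] by (simp add: \<phi>_def)

  \<comment> \<open>Independence of the base coordinates\<close>
  have indep: "alg_independent K' n (\<lambda>i. \<phi> i s0)"
    unfolding alg_independent_def
  proof (intro ballI impI)
    fix q assume q: "q \<in> mpolys n K'" "meval q (\<lambda>i. \<phi> i s0) = 0"
    have idG: "(\<lambda>x. x) \<in> galois_group K K'" by (simp add: galois_group_iff[OF gal] embedding_id)
    obtain \<phi>' where "\<forall>i<N. regular_pair n K' (\<lambda>x. x) Q (\<phi> i) (\<phi>' i)" using twist[OF idG] by blast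
    then have "regular_pair n K' (\<lambda>x. x) Q (\<lambda>s. meval q (\<lambda>i. \<phi> i s)) (\<lambda>s. meval (cmap (\<lambda>x. x) q) (\<lambda>i. \<phi>' i s))"
      by (intro regular_meval[OF K K'(2,1) embedding_id QK q(1)]) (simp add: N_def)
    note zero = regular_zero_generic[OF K K'(2,1) embedding_id QK this s0 Qs0 q(2)]
    \<comment> \<open>\<open>B\<close> is nonzero at \<open>\<beta>\<close> if and only if all the
      \<open>b g\<close> are nonzero. Over such a tuple an \<open>n\<close>-th root \<open>z\<close>
      exists, so the first \<open>n\<close> coordinates take every such value
      \<open>\<beta>\<close>.\<close>
    define B where "B = (\<Prod>g<n. \<Sum>i<n. msingle (msingle i 1) (\<zeta> ^ (g * i)) :: 'a mpoly)"
    have Bval: "meval B \<beta> = (\<Prod>g<n. \<Sum>i<n. \<beta> i * \<zeta> ^ (g * i))" for \<beta>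
      by (simp add: B_def meval_prod meval_sum mult.commute)
    have "(\<Sum>i<n. (if i = 0 then 1 else 0) * \<zeta> ^ (g * i)) = 1" for g
      using n2 by (simp add: if_distrib[of "\<lambda>x. x * _"] cong: if_cong)
    then have "meval B (\<lambda>i. if i = 0 then 1 else 0) \<noteq> 0" by (simp add: Bval)
    then have "B \<noteq> 0" by auto
    then show "q = 0"
    proof (rule mpoly_eq_0I_on)
      fix \<beta> assume "meval B \<beta> \<noteq> 0"
      define b where "b g = (\<Sum>i<n. \<beta> i * \<zeta> ^ (g * i))" for g
      have bnz: "b g \<noteq> 0" if "g < n" for g using \<open>meval B \<beta> \<noteq> 0\<close> that by (auto simp: Bval b_def)
      obtain z where z: "z ^ n = norm_form b" using nth_root_exists[of n "norm_form b"] n2 by auto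
      have "norm_form b \<noteq> 0" using bnz by (auto simp: norm_form_def units_def)
      then have "z \<noteq> 0" using z n2 by (auto simp: power_0_left)
      define s where "s g = (if g = 1 then z else b g)" for g
      have bs: "base_coord s g = b g" if "g < n" for g
      proof (cases "g = 1")
        case True
        have "(\<Prod>k\<in>units - {1}. b k ^ e k) * (\<Prod>k\<in>units - {1}. inverse (s k) ^ e k) = 1"
          unfolding prod.distrib[symmetric] using bnz by (intro prod.neutral) (auto simp: s_def units_def power_inverse)
        then have "base_coord s 1 = b 1"
          using z unfolding norm_form_split base_coord_def by (simp add: s_def[of 1] s_def[of "Suc 0"] mult.assoc)
        then show ?thesis using True by simp
      next
        case False
        then show ?thesis by (simp add: base_coord_def s_def)
      qed
      have "meval Q s \<noteq> 0" unfolding Qnz using bnz \<open>z \<noteq> 0\<close> by (simp add: s_def)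
      moreover have "\<phi> i s = \<beta> i" if "i < n" for i
        using fourier_inverse'[OF that, of \<beta>] that bs by (simp add: \<phi>_def b_def)
      then have "meval q \<beta> = meval q (\<lambda>i. \<phi> i s)" using q(1) by (intro meval_cong) auto
      ultimately show "meval q \<beta> = 0" using zero by simp
    qed
  qed

  \<comment> \<open>Separability over the base\<close>
  let ?F = "adjoin K ((\<lambda>i. \<phi> i s0) ` {..<n})"
  have F: "is_subfield ?F" "K \<subseteq> ?F" by (simp_all add: adjoin_base)
  \<comment> \<open>As separable elements form a field, only the ingredients need checking;
    \<open>s0 1\<close> is an \<open>n\<close>-th root of an element of \<open>H\<close>, and
    \<open>n\<close> is nonzero in the field.\<close>
  define H where "H = {x. separable_over ?F x}"
  have H: "is_subfield H" unfolding H_def by (rule is_subfield_separable[OF F(1)])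
  have FH: "x \<in> H" if "x \<in> ?F" for x unfolding H_def using separable_over_self[OF F(1) that] by simp
  have \<zeta>H: "\<zeta> \<in> H" unfolding H_def using separable_\<zeta>[OF F(1)] by simp
  have tH: "t i \<in> H" for i unfolding H_def using separable_over_mono[OF DL(4)[OF tL] F(2)] by simp
  have bH: "base_coord s0 g \<in> H" if "g < n" for g
  proof -
    have "\<phi> i s0 \<in> H" if "i < n" for i using that adjoin_gen[of "(\<lambda>i. \<phi> i s0) ` {..<n}" K] by (intro FH) auto
    then show ?thesis unfolding \<phi>_inv[OF that, symmetric] using H \<zeta>H by (intro sf_sum sf_mult sf_power) auto
  qed
  have s0nz: "\<And>i. i < n \<Longrightarrow> s0 i \<noteq> 0" using Qs0 Qnz by blast
  have zH: "s0 1 \<in> H"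
  proof -
    have "norm_form (base_coord s0) \<in> H" unfolding norm_form_def
      by (intro sf_prod[OF H] sf_power[OF H] bH) (simp add: units_def)
    then have "s0 1 ^ n \<in> H" using base_coord_norm[of s0, OF s0nz] by (simp only:)
    then have "separable_over H (s0 1)" by (rule separable_root[OF H n_nz])
    then have "separable_over ?F (s0 1)" by (rule separable_over_trans[OF F(1)]) (simp add: H_def)
    then show ?thesis by (simp add: H_def)
  qed
  have sep: "separable_over ?F (\<phi> j s0)" for j
  proof -
    have "root_coord s0 g \<in> H" for g
      unfolding root_coord_def using bH zH by (intro cocycle_mem[OF H]) (auto simp: units_def)
    moreover have "U g \<in> H" for g unfolding U_def using H \<zeta>H tH by (intro sf_sum sf_mult sf_power sf_inverse) auto
    moreover have "of_nat n \<in> H" by (rule sf_of_nat[OF H])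
    ultimately have "\<phi> j s0 \<in> H" unfolding \<phi>_def using bH \<zeta>H
      by (auto simp: units_def intro!: sf_sum[OF H] sf_mult[OF H] sf_power[OF H] sf_inverse[OF H] sf_divide[OF H] sf_prod[OF H] sf_1[OF H])
    then show ?thesis by (simp add: H_def)
  qed

  have "\<exists>a. (\<forall>i<N. a i \<in> K) \<and> (\<forall>i<n. a i \<in> K0) \<and>
    (\<forall>p\<in>mpolys N K'. (\<forall>s. meval Q s \<noteq> 0 \<longrightarrow> meval p (\<lambda>i. \<phi> i s) = 0) \<longrightarrow> meval p a = 0)"
    by (rule PAC_parametrization[OF PAC gal QK Q0 _ _ s0 twist indep sep]) (use n2 in \<open>auto simp: N_def\<close>)
  then obtain a where a: "\<forall>i<N. a i \<in> K" "\<forall>i<n. a i \<in> K0"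
    "\<And>p. p \<in> mpolys N K' \<Longrightarrow> (\<And>s. meval Q s \<noteq> 0 \<Longrightarrow> meval p (\<lambda>i. \<phi> i s) = 0) \<Longrightarrow> meval p a = 0"
    by (elim exE conjE) blast

  \<comment> \<open>The equations at the rational point\<close>
  define b where "b = (\<lambda>g. \<Sum>i<n. a i * \<zeta> ^ (g * i))"
  \<comment> \<open>Fourier inversion at index 1 extracts the product of \<open>U 1\<close> and the
    root from the middle block of coordinates.\<close>
  define y where "y = (\<Sum>i<n. a (n + i) * (inverse \<zeta> ^ i / of_nat n))"
  define pb where "pb g = (\<Sum>i<n. msingle (msingle i 1) (\<zeta> ^ (g * i)) :: 'a mpoly)" for g
  define py where "py = (\<Sum>i<n. msingle (msingle (n + i) 1) (inverse \<zeta> ^ i / of_nat n) :: 'a mpoly)"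
  have pbN: "pb g \<in> mpolys N K'" for g
    unfolding pb_def using K' by (intro mpolys_sum[OF K'(1)] mpolys_single[OF K'(1)] sf_power[OF K'(1)]) (auto simp: N_def)
  have pyN: "py \<in> mpolys N K'"
    unfolding py_def using K'
    by (intro mpolys_sum[OF K'(1)] mpolys_single[OF K'(1)] sf_divide[OF K'(1)] sf_power[OF K'(1)] sf_inverse[OF K'(1)] sf_of_nat[OF K'(1)])
      (auto simp: N_def)
  have pb_a: "meval (pb g) a = b g" for g by (simp add: pb_def b_def meval_sum mult.commute)
  have py_a: "meval py a = y" by (simp add: py_def y_def meval_sum mult.commute)
  have pb_\<phi>: "meval (pb g) (\<lambda>i. \<phi> i s) = base_coord s g" if "g < n" for g s
    using \<phi>_inv[OF that, of s] by (simp add: pb_def meval_sum mult.commute)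
  have py_\<phi>: "meval py (\<lambda>i. \<phi> i s) = s 1 * U 1" for s
  proof -
    let ?\<beta> = "\<lambda>j. if j \<in> units then root_coord s j * U j else 0"
    have "(\<Sum>j<n. ?\<beta> j * \<zeta> ^ (h * j)) = (\<Sum>g\<in>units. root_coord s g * U g * \<zeta> ^ (g * h))" for h
    proof -
      have "(\<Sum>j<n. ?\<beta> j * \<zeta> ^ (h * j)) = (\<Sum>j\<in>units. ?\<beta> j * \<zeta> ^ (h * j))"
        by (rule sum.mono_neutral_right) (auto simp: units_def)
      then show ?thesis by (simp add: mult.commute[of h])
    qed
    then have "meval py (\<lambda>i. \<phi> i s) = 1 / of_nat n * (\<Sum>h<n. (\<Sum>j<n. ?\<beta> j * \<zeta> ^ (h * j)) * inverse \<zeta> ^ (h * 1))"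
      by (simp add: py_def meval_sum \<phi>_def sum_distrib_left mult_ac divide_simps)
    also have "\<dots> = ?\<beta> 1" using n2 by (intro fourier_inverse') simp
    finally show ?thesis by (simp add: root_coord_def)
  qed
  \<comment> \<open>This equation forces the specialized \<open>b g\<close>, \<open>g\<close> a
    unit, to be nonzero, as \<open>abelian_ext_kummer\<close> requires.\<close>
  have "meval (msingle (msingle (2 * n) 1) 1 * (\<Prod>g\<in>units. pb g) - 1) a = 0"
  proof (rule a(3))
    show "msingle (msingle (2 * n) 1) 1 * (\<Prod>g\<in>units. pb g) - 1 \<in> mpolys N K'"
      using K'(1) by (intro mpolys_diff[OF K'(1)] mpolys_mult[OF K'(1)] mpolys_single[OF K'(1)] mpolys_prod[OF K'(1)] pbN mpolys_1[OF K'(1)])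
        (auto simp: N_def)
    fix s assume "meval Q s \<noteq> 0"
    then have "base_coord s g \<noteq> 0" if "g \<in> units" for g using base_coord_units_nz[OF _ that] Qnz by blast
    then have "(\<Prod>g\<in>units. inverse (base_coord s g)) * (\<Prod>g\<in>units. base_coord s g) = 1"
      unfolding prod.distrib[symmetric] by (intro prod.neutral) simp
    moreover have "(\<Prod>g\<in>units. meval (pb g) (\<lambda>i. \<phi> i s)) = (\<Prod>g\<in>units. base_coord s g)"
      by (rule prod.cong) (simp_all add: pb_\<phi> units_def)
    moreover have "\<phi> (2 * n) s = (\<Prod>g\<in>units. inverse (base_coord s g))" using n2 by (simp add: \<phi>_def)
    ultimately show "meval (msingle (msingle (2 * n) 1) 1 * (\<Prod>g\<in>units. pb g) - 1) (\<lambda>i. \<phi> i s) = 0"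
      by (simp add: meval_diff meval_mult meval_prod)
  qed
  then have "a (2 * n) * (\<Prod>g\<in>units. b g) = 1" by (simp add: meval_diff meval_mult meval_prod pb_a)
  then have "(\<Prod>g\<in>units. b g) \<noteq> 0" by (metis mult_zero_right zero_neq_one)
  then have bnz: "b g \<noteq> 0" if "g \<in> units" for g using that by auto
  have "meval (py ^ n - msingle 0 (U 1 ^ n) * (\<Prod>k\<in>units. pb k ^ e k)) a = 0"
  proof (rule a(3))
    show "py ^ n - msingle 0 (U 1 ^ n) * (\<Prod>k\<in>units. pb k ^ e k) \<in> mpolys N K'"
      by (intro mpolys_diff[OF K'(1)] mpolys_mult[OF K'(1)] mpolys_const[OF K'(1)] mpolys_prod[OF K'(1)] mpolys_power[OF K'(1)]
          pbN pyN sf_power[OF K'(1)] UK')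
    fix s assume "meval Q s \<noteq> 0"
    then have s: "\<And>i. i < n \<Longrightarrow> s i \<noteq> 0" using Qnz by blast
    have "(\<Prod>k\<in>units. meval (pb k) (\<lambda>i. \<phi> i s) ^ e k) = norm_form (base_coord s)"
      unfolding norm_form_def by (rule prod.cong) (simp_all add: pb_\<phi> units_def)
    then show "meval (py ^ n - msingle 0 (U 1 ^ n) * (\<Prod>k\<in>units. pb k ^ e k)) (\<lambda>i. \<phi> i s) = 0"
      using base_coord_norm[of s, OF s] by (simp add: meval_diff meval_mult meval_prod meval_power py_\<phi> power_mult_distrib mult.commute)
  qed
  then have yn: "y ^ n = U 1 ^ n * norm_form b"
    by (simp add: meval_diff meval_mult meval_prod meval_power py_a pb_a norm_form_def)
  obtain z where z: "z ^ n = norm_form b" using nth_root_exists[of n "norm_form b"] n2 by auto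
  have "norm_form b \<noteq> 0" using bnz by (simp add: norm_form_def)
  then have z0: "z \<noteq> 0" using z n2 by (auto simp: power_0_left)
  have "(U 1 * z) ^ n = y ^ n" using yn z by (simp add: power_mult_distrib)
  \<comment> \<open>\<open>y\<close> is built from elements of \<open>K\<close> and
    \<open>\<zeta>\<close>, while \<open>\<zeta>\<close> and \<open>z\<close> lie in an abelian
    extension of \<open>K0\<close>; solving for \<open>U 1\<close> puts the resolvent into the
    compositum.\<close>
  then obtain j where "U 1 * z = \<zeta> ^ j * y" using same_power by blast
  then have U1: "U 1 = \<zeta> ^ j * y / z" using z0 by (simp add: field_simps)
  have "abelian_ext K0 (adjoin K0 {\<zeta>, z})"
    using a(2) by (intro abelian_ext_kummer[OF K0 _ b_def bnz z]) auto
  then have "{\<zeta>, z} \<subseteq> ?\<Omega>" using abelian_ext_subset_max adjoin_gen[of "{\<zeta>, z}" K0] \<Omega>(3) by blast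
  then have \<zeta>z: "\<zeta> \<in> ?\<Omega>" "z \<in> ?\<Omega>" by auto
  have "a (n + i) \<in> ?\<Omega>" if "i < n" for i using a(1) that \<Omega>(2) by (auto simp: N_def)
  then have "y \<in> ?\<Omega>" unfolding y_def using \<zeta>z
    by (intro sf_sum[OF \<Omega>(1)] sf_mult[OF \<Omega>(1)] sf_divide[OF \<Omega>(1)] sf_power[OF \<Omega>(1)] sf_inverse[OF \<Omega>(1)] sf_of_nat[OF \<Omega>(1)]) auto
  then have "U 1 \<in> ?\<Omega>" unfolding U1 using \<zeta>z by (intro sf_divide[OF \<Omega>(1)] sf_mult[OF \<Omega>(1)] sf_power[OF \<Omega>(1)])
  then show ?thesis by (simp add: U_def t_def)
qed

end

text \<open>The resolvents for all \<open>f < n\<close> add up to \<open>n \<theta>\<close>, and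
  \<open>n\<close> is invertible. For \<open>a = 0\<close> the locale assumption
  \<open>2 \<le> n\<close> fails; there \<open>\<theta>\<close> is fixed by the whole group and lies
  in \<open>K\<close>.\<close>

lemma tame_case:
  fixes K0 K L :: "'a::alg_closed_field set"
  assumes univ: "universal_domain_over K" and PAC: "PAC_extension K0 K" and L: "abelian_ext K L"
    and l: "prime (l::nat)" and nz: "of_nat l \<noteq> (0::'a)"
    and \<sigma>: "\<sigma> \<in> galois_group K L" and \<theta>: "\<theta> \<in> L" and period: "(\<sigma> ^^ (l ^ a)) \<theta> = \<theta>"
    and cyclic: "\<forall>\<tau>\<in>galois_group K L. \<exists>i. \<tau> \<theta> = (\<sigma> ^^ i) \<theta>"
  shows "\<theta> \<in> adjoin (max_abelian_ext K0) K"
proof (cases "a = 0")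
  case True
  have gal: "galois_ext K L" using L by (simp add: abelian_ext_def)
  note D = galois_extD[OF gal]
  have "\<sigma> \<theta> = \<theta>" using period True by simp
  then have "(\<sigma> ^^ i) \<theta> = \<theta>" for i by (induction i) auto
  then have "\<tau> \<theta> = \<theta>" if "\<tau> \<in> galois_group K L" for \<tau> using cyclic that by metis
  then have "\<theta> \<in> K" using galois_fixed[OF gal D(1) subset_refl D(3) \<theta>] by blast
  then show ?thesis using adjoin_gen[of K "max_abelian_ext K0"] by blast
next
  case False
  let ?\<Omega> = "adjoin (max_abelian_ext K0) K"
  have \<Omega>: "is_subfield ?\<Omega>" by simp
  define n where "n = l ^ a"
  have l2: "l \<ge> 2" using l by (rule prime_ge_2_nat)
  then have n2: "2 \<le> n" using False unfolding n_def by (metis le_trans power_increasing power_one_right Suc_leI neq0_conv One_nat_def le_trans one_le_numeral)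
  have n_nz: "of_nat n \<noteq> (0::'a)" using nz by (simp add: n_def)
  obtain \<zeta> :: 'a where \<zeta>: "\<And>i. \<zeta> ^ i = 1 \<longleftrightarrow> n dvd i" using primitive_root_exists[OF l nz, of a] unfolding n_def by blast
  have "\<exists>m. k < n \<longrightarrow> coprime k n \<longrightarrow> m < n \<and> coprime m n \<and> k * m mod n = 1" for k
  proof (cases "coprime k n")
    case True
    then obtain m where m: "[k * m = 1] (mod n)" using cong_solve_coprime_nat[of k n] by auto
    then have "k * (m mod n) mod n = 1" using n2 by (simp add: cong_def mod_mult_right_eq)
    moreover have "coprime (m mod n) n"
    proof -
      have "coprime m n" using m n2 by (metis cong_imp_coprime cong_sym coprime_1_left coprime_mult_left_iff)
      then show ?thesis using n2 by (simp add: coprime_mod_left_iff)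
    qed
    ultimately show ?thesis using n2 by (intro exI[of _ "m mod n"]) simp
  next
    case False
    then show ?thesis by simp
  qed
  then obtain e where e: "\<And>k. k < n \<Longrightarrow> coprime k n \<Longrightarrow> e k < n \<and> coprime (e k) n \<and> k * e k mod n = 1" by metis
  interpret root_of_unity \<zeta> n e by unfold_locales (fact n2, fact \<zeta>, fact n_nz, fact e)
  have res: "(\<Sum>i<n. (\<sigma> ^^ i) \<theta> * inverse \<zeta> ^ (f * i)) \<in> ?\<Omega>" for f
    using tame_resolvent[OF univ PAC L \<sigma> \<theta> _ cyclic] period by (simp add: n_def)
  have "(\<Sum>f<n. \<Sum>i<n. (\<sigma> ^^ i) \<theta> * inverse \<zeta> ^ (f * i)) = (\<Sum>i<n. (\<sigma> ^^ i) \<theta> * (\<Sum>f<n. \<zeta> ^ (f * 0) * inverse \<zeta> ^ (f * i)))"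
    unfolding sum_distrib_left by (subst sum.swap) simp
  also have "\<dots> = (\<Sum>i<n. if i = 0 then (\<sigma> ^^ i) \<theta> * of_nat n else 0)"
  proof (rule sum.cong[OF refl])
    fix i assume "i \<in> {..<n}"
    then have "(\<Sum>f<n. \<zeta> ^ (f * 0) * inverse \<zeta> ^ (f * i)) = (if 0 = i then of_nat n else 0)"
      using n2 by (intro orthogonality) auto
    then show "(\<sigma> ^^ i) \<theta> * (\<Sum>f<n. \<zeta> ^ (f * 0) * inverse \<zeta> ^ (f * i)) = (if i = 0 then (\<sigma> ^^ i) \<theta> * of_nat n else 0)"
      by (simp only:) simp
  qed
  also have "\<dots> = \<theta> * of_nat n" using n2 by simp
  finally have "\<theta> = (\<Sum>f<n. \<Sum>i<n. (\<sigma> ^^ i) \<theta> * inverse \<zeta> ^ (f * i)) / of_nat n" using n_nz by simp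
  also have "\<dots> \<in> ?\<Omega>" by (rule sf_divide[OF \<Omega> sf_sum[OF \<Omega> res] sf_of_nat[OF \<Omega>]])
  finally show ?thesis .
qed

theorem corollary6p2:
  fixes K0 K :: "'a::alg_closed_field set"
  assumes "universal_domain_over K"
    and "PAC_extension K0 K"
  shows "max_abelian_ext K = adjoin (max_abelian_ext K0) K"
proof
  let ?\<Omega> = "adjoin (max_abelian_ext K0) K"
  have K: "is_subfield K" "K0 \<subseteq> K" using assms(2) by (auto simp: PAC_extension_def subfield_ambient_iff)
  show "?\<Omega> \<subseteq> max_abelian_ext K" by (rule adjoin_max_abelian_ext_subset[OF K])
  have K\<Omega>: "K \<subseteq> ?\<Omega>" by (rule adjoin_gen)
  have "L \<subseteq> ?\<Omega>" if L: "abelian_ext K L" for L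
  proof (rule abelian_reduction[OF L is_subfield_adjoin K\<Omega>])
    fix \<sigma> and l :: nat and a x
    assume l: "prime l" and cyc: "\<sigma> \<in> galois_group K L" "x \<in> L" "(\<sigma> ^^ (l ^ a)) x = x"
      "\<forall>\<tau>\<in>galois_group K L. \<exists>i. \<tau> x = (\<sigma> ^^ i) x"
    show "x \<in> ?\<Omega>"
    \<comment> \<open>A prime \<open>l\<close> vanishes in the field exactly if it is the
      characteristic; this decides between the two constructions.\<close>
    proof (cases "of_nat l = (0::'a)")
      case True
      then have "CHAR('a) dvd l" by (simp add: of_nat_eq_0_iff_char_dvd)
      then have char: "CHAR('a) = l" using l by (metis CHAR_not_1' One_nat_def prime_nat_iff)
      then have "CHAR('a) > 0" using l by (simp add: prime_gt_0_nat)
      then show ?thesis using wild_case[OF assms L _ cyc(1,2) _ cyc(4)] cyc(3) by (simp add: char)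
    next
      case False
      then show ?thesis using tame_case[OF assms L l _ cyc] by blast
    qed
  qed
  then show "max_abelian_ext K \<subseteq> ?\<Omega>"
    unfolding max_abelian_ext_def[of K] using K\<Omega> by (rule_tac adjoin_minimal[OF is_subfield_adjoin]) auto
qed

end
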